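(* Let $\Omega\subseteq\mathbb{R}^N$, $N\ge 2$, be a bounded domain with Lipschitz boundary, let $p,q\in C_+(\overline\Omega)$ with $p(x)\le q(x)$ for all $x\in\overline\Omega$, and let $0\le\mu\in L^1(\Omega)$. Let $A:W^{1,\mathcal{H}_{\log}}_0(\Omega)\to[W^{1,\mathcal{H}_{\log}}_0(\Omega)]^*$ be given by $$\langle A(u),v\rangle=\int_\Omega|\nabla u|^{p(x)-2}\nabla u\cdot\nabla v\,dx+\int_\Omega\mu(x)\Big[\log(e+|\nabla u|)+\frac{|\nabla u|}{q(x)(e+|\nabla u|)}\Big]|\nabla u|^{q(x)-2}\nabla u\cdot\nabla v\,dx.$$ Then $A$ is bounded, continuous and strictly monotone. If in addition $q(x)<p^*(x)$ for all $x\in\overline\Omega$ and $\mu\in L^\infty(\Omega)$, then $A$ is also of type (S$_+$), coercive and a homeomorphism.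
   Context: $C_+(\overline\Omega)$ is the set of $r\in C(\overline\Omega)$ with $\min_{\overline\Omega}r>1$. $p^*(x)=\frac{Np(x)}{N-p(x)}$ if $p(x)<N$ and $p^*(x)=+\infty$ otherwise. $|\xi|^{r-2}\xi$ is read as $0$ at $\xi=0$. Let $\mathcal{H}_{\log}(x,t)=t^{p(x)}+\mu(x)t^{q(x)}\log(e+t)$ for $x\in\overline\Omega$, $t\ge0$. For measurable $u$ set $\varrho_{\mathcal{H}_{\log}}(u)=\int_\Omega\mathcal{H}_{\log}(x,|u|)\,dx$; $L^{\mathcal{H}_{\log}}(\Omega)$ is the space of measurable $u:\Omega\to\mathbb{R}$ with $\varrho_{\mathcal{H}_{\log}}(u)<\infty$. $W^{1,\mathcal{H}_{\log}}(\Omega)=\{u\in L^{\mathcal{H}_{\log}}(\Omega): |\nabla u|\in L^{\mathcal{H}_{\log}}(\Omega)\}$ with norm $\|u\|_{1,\mathcal{H}_{\log}}=\inf\{\lambda>0:\varrho_{\mathcal{H}_{\log}}(u/\lambda)+\varrho_{\mathcal{H}_{\log}}(|\nabla u|/\lambda)\le1\}$, and $W^{1,\mathcal{H}_{\log}}_0(\Omega)$ is the closure of $C_0^\infty(\Omega)$ in it. For an operator $A:X\to X^*$ on a Banach space $X$: bounded means it maps bounded sets to bounded sets; strictly monotone means $\langle A(u)-A(v),u-v\rangle>0$ for $u\ne v$; coercive means $\langle A(u),u\rangle/\|u\|\to+\infty$ as $\|u\|\to\infty$; type (S$_+$) means that $u_n\rightharpoonup u$ in $X$ and $\limsup_{n\to\infty}\langle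 A(u_n),u_n-u\rangle\le0$ imply $u_n\to u$ in $X$. *)

theory Defs
  imports "HOL-Analysis.Analysis"
begin

definition ae_equal :: "('a::euclidean_space \<Rightarrow> real) \<Rightarrow> ('a \<Rightarrow> real) \<Rightarrow> bool" where
  "ae_equal f g \<longleftrightarrow> f \<in> borel_measurable lebesgue \<and> g \<in> borel_measurable lebesgue \<and>
     (AE x in lebesgue. f x = g x)"

quotient_type (overloaded) 'a L0 = "'a::euclidean_space \<Rightarrow> real" / partial: ae_equal
proof (rule part_equivpI)
  show "\<exists>x::'a \<Rightarrow> real. ae_equal x x"
    by (rule exI[of _ "\<lambda>_. 0"]) (simp add: ae_equal_def)
  show "symp (ae_equal :: ('a \<Rightarrow> real) \<Rightarrow> _)"
    by (auto simp: symp_def ae_equal_def eq_commute)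
  show "transp (ae_equal :: ('a \<Rightarrow> real) \<Rightarrow> _)"
    by (auto simp: transp_def ae_equal_def elim: eventually_elim2)
qed

instantiation L0 :: (euclidean_space) real_vector
begin

lift_definition zero_L0 :: "'a L0" is "\<lambda>_. 0"
  by (simp add: ae_equal_def)

lift_definition plus_L0 :: "'a L0 \<Rightarrow> 'a L0 \<Rightarrow> 'a L0" is "\<lambda>f g x. f x + g x"
  by (auto simp: ae_equal_def elim: eventually_elim2)

lift_definition uminus_L0 :: "'a L0 \<Rightarrow> 'a L0" is "\<lambda>f x. - f x"
  by (auto simp: ae_equal_def)

lift_definition minus_L0 :: "'a L0 \<Rightarrow> 'a L0 \<Rightarrow> 'a L0" is "\<lambda>f g x. f x - g x"
  by (auto simp: ae_equal_def elim: eventually_elim2)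

lift_definition scaleR_L0 :: "real \<Rightarrow> 'a L0 \<Rightarrow> 'a L0" is "\<lambda>c f x. c * f x"
  by (auto simp: ae_equal_def elim: eventually_mono)

instance
  by standard (transfer; auto simp: ae_equal_def algebra_simps)+

end

text \<open>Near every boundary point, \<open>\<Omega>\<close> is the strict epigraph, in the direction of a unit vector \<open>n\<close>,
  of a Lipschitz function \<open>\<gamma>\<close> on the hyperplane orthogonal to \<open>n\<close>.\<close>

definition lipschitz_boundary :: "'a::euclidean_space set \<Rightarrow> bool" where
  "lipschitz_boundary \<Omega> \<longleftrightarrow>
     (\<forall>z\<in>frontier \<Omega>. \<exists>r>0. \<exists>n \<gamma> L. norm n = 1 \<and> L-lipschitz_on {y. y \<bullet> n = 0} \<gamma> \<and>
        \<Omega> \<inter> ball z r = {x \<in> ball z r. \<gamma> (x - (x \<bullet> n) *\<^sub>R n) < x \<bullet> n})"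

text \<open>For a bounded nonempty set \<open>\<Omega>\<close> the infimum below is the minimum over the compact set
  \<open>closure \<Omega>\<close>.\<close>

definition C_plus :: "'a::euclidean_space set \<Rightarrow> ('a \<Rightarrow> real) set" where
  "C_plus \<Omega> = {r. continuous_on (closure \<Omega>) r \<and> 1 < (INF x\<in>closure \<Omega>. r x)}"

definition critical_exponent :: "('a::euclidean_space \<Rightarrow> real) \<Rightarrow> 'a \<Rightarrow> ereal" where
  "critical_exponent p x =
     (if p x < real DIM('a) then ereal (real DIM('a) * p x / (real DIM('a) - p x)) else \<infinity>)"

primrec C_k :: "nat \<Rightarrow> ('a::euclidean_space \<Rightarrow> real) \<Rightarrow> bool" where
  "C_k 0 f \<longleftrightarrow> continuous_on UNIV f"
| "C_k (Suc k) f \<longleftrightarrow> (\<forall>x. f differentiable (at x)) \<and>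
     (\<forall>i\<in>Basis. C_k k (\<lambda>x. frechet_derivative f (at x) i))"

definition test_functions :: "'a::euclidean_space set \<Rightarrow> ('a \<Rightarrow> real) set" where
  "test_functions \<Omega> = {\<phi>. (\<forall>k. C_k k \<phi>) \<and>
     compact (closure {x. \<phi> x \<noteq> 0}) \<and> closure {x. \<phi> x \<noteq> 0} \<subseteq> \<Omega>}"

definition has_weak_gradient ::
    "'a::euclidean_space set \<Rightarrow> ('a \<Rightarrow> real) \<Rightarrow> ('a \<Rightarrow> 'a) \<Rightarrow> bool" where
  "has_weak_gradient \<Omega> u G \<longleftrightarrow>
     (\<forall>K. compact K \<and> K \<subseteq> \<Omega> \<longrightarrow> integrable (lebesgue_on K) u \<and> integrable (lebesgue_on K) G) \<and>
     (\<forall>\<phi>\<in>test_functions \<Omega>. \<forall>i\<in>Basis.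
        (LINT x|lebesgue_on \<Omega>. u x * frechet_derivative \<phi> (at x) i) =
        - (LINT x|lebesgue_on \<Omega>. (G x \<bullet> i) * \<phi> x))"

text \<open>The weak gradient is unique up to null sets; \<open>weak_gradient\<close> picks a representative.\<close>

definition weak_gradient :: "'a::euclidean_space set \<Rightarrow> 'a L0 \<Rightarrow> 'a \<Rightarrow> 'a" where
  "weak_gradient \<Omega> u = (SOME G. has_weak_gradient \<Omega> (rep_L0 u) G)"

definition Hlog :: "('a \<Rightarrow> real) \<Rightarrow> ('a \<Rightarrow> real) \<Rightarrow> ('a \<Rightarrow> real) \<Rightarrow> 'a \<Rightarrow> real \<Rightarrow> real" where
  "Hlog p q \<mu> x t = t powr p x + \<mu> x * (t powr q x) * ln (exp 1 + t)"

definition modular_Hlog :: "'a::euclidean_space set \<Rightarrow> ('a \<Rightarrow> real) \<Rightarrow> ('a \<Rightarrow> real) \<Rightarrow> ('a \<Rightarrow> real) \<Rightarrow>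
    ('a \<Rightarrow> real) \<Rightarrow> ennreal" where
  "modular_Hlog \<Omega> p q \<mu> u = (\<integral>\<^sup>+ x. ennreal (Hlog p q \<mu> x \<bar>u x\<bar>) \<partial>lebesgue_on \<Omega>)"

text \<open>A measurable function on \<open>\<Omega>\<close> is represented by its extension by zero to the whole space,
  so that two elements of the spaces below coincide iff they agree almost everywhere on \<open>\<Omega>\<close>.\<close>

definition L_Hlog :: "'a::euclidean_space set \<Rightarrow> ('a \<Rightarrow> real) \<Rightarrow> ('a \<Rightarrow> real) \<Rightarrow> ('a \<Rightarrow> real) \<Rightarrow>
    'a L0 set" where
  "L_Hlog \<Omega> p q \<mu> =
     {u. (AE x in lebesgue. x \<notin> \<Omega> \<longrightarrow> rep_L0 u x = 0) \<and> modular_Hlog \<Omega> p q \<mu> (rep_L0 u) < \<infinity>}"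

definition W1_Hlog :: "'a::euclidean_space set \<Rightarrow> ('a \<Rightarrow> real) \<Rightarrow> ('a \<Rightarrow> real) \<Rightarrow> ('a \<Rightarrow> real) \<Rightarrow>
    'a L0 set" where
  "W1_Hlog \<Omega> p q \<mu> =
     {u \<in> L_Hlog \<Omega> p q \<mu>. (\<exists>G. has_weak_gradient \<Omega> (rep_L0 u) G) \<and>
        modular_Hlog \<Omega> p q \<mu> (\<lambda>x. norm (weak_gradient \<Omega> u x)) < \<infinity>}"

definition norm_W1_Hlog :: "'a::euclidean_space set \<Rightarrow> ('a \<Rightarrow> real) \<Rightarrow> ('a \<Rightarrow> real) \<Rightarrow>
    ('a \<Rightarrow> real) \<Rightarrow> 'a L0 \<Rightarrow> real" where
  "norm_W1_Hlog \<Omega> p q \<mu> u = Inf {l. 0 < l \<and>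
     modular_Hlog \<Omega> p q \<mu> (\<lambda>x. rep_L0 u x / l) +
     modular_Hlog \<Omega> p q \<mu> (\<lambda>x. norm (weak_gradient \<Omega> u x) / l) \<le> 1}"

definition W10_Hlog :: "'a::euclidean_space set \<Rightarrow> ('a \<Rightarrow> real) \<Rightarrow> ('a \<Rightarrow> real) \<Rightarrow> ('a \<Rightarrow> real) \<Rightarrow>
    'a L0 set" where
  "W10_Hlog \<Omega> p q \<mu> = {u \<in> W1_Hlog \<Omega> p q \<mu>.
     \<forall>\<epsilon>>0. \<exists>\<phi>\<in>test_functions \<Omega>. norm_W1_Hlog \<Omega> p q \<mu> (u - abs_L0 \<phi>) < \<epsilon>}"

text \<open>A normed space is given by a linear subspace \<open>X\<close> of a real vector space together with a
  function \<open>N\<close> that is a norm on \<open>X\<close>; the values of \<open>N\<close> outside \<open>X\<close> are irrelevant. Functionals on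
  \<open>X\<close> are extended by zero outside \<open>X\<close> so that they are determined by their values on \<open>X\<close>.\<close>

definition dual_space :: "'v::real_vector set \<Rightarrow> ('v \<Rightarrow> real) \<Rightarrow> ('v \<Rightarrow> real) set" where
  "dual_space X N = {f. (\<forall>u. u \<notin> X \<longrightarrow> f u = 0) \<and>
     (\<forall>u\<in>X. \<forall>v\<in>X. f (u + v) = f u + f v) \<and>
     (\<forall>c. \<forall>u\<in>X. f (c *\<^sub>R u) = c * f u) \<and>
     (\<exists>C. \<forall>u\<in>X. \<bar>f u\<bar> \<le> C * N u)}"

definition dual_norm :: "'v::real_vector set \<Rightarrow> ('v \<Rightarrow> real) \<Rightarrow> ('v \<Rightarrow> real) \<Rightarrow> real" where
  "dual_norm X N f = (SUP v\<in>{v \<in> X. N v \<le> 1}. \<bar>f v\<bar>)"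

text \<open>The case distinction makes the distance nonnegative and symmetric on the whole type, as the
  locale \<open>Metric_space\<close> requires.\<close>

definition norm_topology :: "'v::minus set \<Rightarrow> ('v \<Rightarrow> real) \<Rightarrow> 'v topology" where
  "norm_topology X N =
     Metric_space.mtopology X (\<lambda>u v. if u \<in> X \<and> v \<in> X then N (u - v) else 0)"

definition dual_topology :: "'v::real_vector set \<Rightarrow> ('v \<Rightarrow> real) \<Rightarrow> ('v \<Rightarrow> real) topology" where
  "dual_topology X N = norm_topology (dual_space X N) (dual_norm X N)"

definition bounded_operator ::
    "'v::real_vector set \<Rightarrow> ('v \<Rightarrow> real) \<Rightarrow> ('v \<Rightarrow> 'v \<Rightarrow> real) \<Rightarrow> bool" where
  "bounded_operator X N A \<longleftrightarrow>
     (\<forall>B\<subseteq>X. (\<exists>M. \<forall>u\<in>B. N u \<le> M) \<longrightarrow> (\<exists>M. \<forall>u\<in>B. dual_norm X N (A u) \<le> M))"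

definition strictly_monotone_operator ::
    "'v::real_vector set \<Rightarrow> ('v \<Rightarrow> 'v \<Rightarrow> real) \<Rightarrow> bool" where
  "strictly_monotone_operator X A \<longleftrightarrow>
     (\<forall>u\<in>X. \<forall>v\<in>X. u \<noteq> v \<longrightarrow> (A u - A v) (u - v) > 0)"

definition coercive_operator ::
    "'v::real_vector set \<Rightarrow> ('v \<Rightarrow> real) \<Rightarrow> ('v \<Rightarrow> 'v \<Rightarrow> real) \<Rightarrow> bool" where
  "coercive_operator X N A \<longleftrightarrow>
     filterlim (\<lambda>u. A u u / N u) at_top (inf (filtercomap N at_top) (principal X))"

definition weakly_converges ::
    "'v::real_vector set \<Rightarrow> ('v \<Rightarrow> real) \<Rightarrow> (nat \<Rightarrow> 'v) \<Rightarrow> 'v \<Rightarrow> bool" where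
  "weakly_converges X N u w \<longleftrightarrow> range u \<subseteq> X \<and> w \<in> X \<and>
     (\<forall>f\<in>dual_space X N. (\<lambda>n. f (u n)) \<longlonglongrightarrow> f w)"

definition S_plus_operator ::
    "'v::real_vector set \<Rightarrow> ('v \<Rightarrow> real) \<Rightarrow> ('v \<Rightarrow> 'v \<Rightarrow> real) \<Rightarrow> bool" where
  "S_plus_operator X N A \<longleftrightarrow>
     (\<forall>u w. weakly_converges X N u w \<and> limsup (\<lambda>n. ereal (A (u n) (u n - w))) \<le> 0 \<longrightarrow>
        limitin (norm_topology X N) u w sequentially)"

text \<open>At \<open>\<xi> = 0\<close> the terms below vanish because the scaled vector \<open>\<xi>\<close> does.\<close>

definition p_integrand :: "'a::euclidean_space set \<Rightarrow> ('a \<Rightarrow> real) \<Rightarrow> 'a L0 \<Rightarrow> 'a L0 \<Rightarrow> 'a \<Rightarrow> real" where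
  "p_integrand \<Omega> p u v x =
     (let \<xi> = weak_gradient \<Omega> u x; \<eta> = weak_gradient \<Omega> v x
      in (norm \<xi> powr (p x - 2) *\<^sub>R \<xi>) \<bullet> \<eta>)"

definition q_integrand :: "'a::euclidean_space set \<Rightarrow> ('a \<Rightarrow> real) \<Rightarrow> ('a \<Rightarrow> real) \<Rightarrow>
    'a L0 \<Rightarrow> 'a L0 \<Rightarrow> 'a \<Rightarrow> real" where
  "q_integrand \<Omega> q \<mu> u v x =
     (let \<xi> = weak_gradient \<Omega> u x; \<eta> = weak_gradient \<Omega> v x
      in \<mu> x * (ln (exp 1 + norm \<xi>) + norm \<xi> / (q x * (exp 1 + norm \<xi>))) *
         ((norm \<xi> powr (q x - 2) *\<^sub>R \<xi>) \<bullet> \<eta>))"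

definition log_double_phase_op :: "'a::euclidean_space set \<Rightarrow> ('a \<Rightarrow> real) \<Rightarrow> ('a \<Rightarrow> real) \<Rightarrow>
    ('a \<Rightarrow> real) \<Rightarrow> 'a L0 \<Rightarrow> 'a L0 \<Rightarrow> real" where
  "log_double_phase_op \<Omega> p q \<mu> u v =
     (if v \<in> W10_Hlog \<Omega> p q \<mu>
      then (LINT x|lebesgue_on \<Omega>. p_integrand \<Omega> p u v x) +
           (LINT x|lebesgue_on \<Omega>. q_integrand \<Omega> q \<mu> u v x)
      else 0)"

end

theory Submission
  imports Defs "HOL-Analysis.Analysis"
begin

text \<open>
  For fixed \<open>x\<close> the integrand of the operator is the radial field \<open>a(\<xi>) = f(|\<xi>|) \<xi> / |\<xi>|\<close> with
  \<open>f(t) = t\<^sup>p\<^sup>-\<^sup>1 + \<mu> (log (e + t) + t / (q (e + t))) t\<^sup>q\<^sup>-\<^sup>1\<close>. The quantity \<open>F(t) = f(t) t\<close> is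
  comparable with the integrand \<open>H(t)\<close> of the modular, and scaling the argument by \<open>c \<le> 1\<close>
  multiplies \<open>f\<close> by a factor between \<open>c\<^sup>n\<close> and \<open>c\<^sup>\<alpha>\<close>, where \<open>\<alpha> = min p - 1 > 0\<close> and \<open>n \<ge> max q\<close>
  are the same for all \<open>x\<close> (\<open>power_growth_log_flux\<close>). Two pointwise inequalities follow from this
  growth alone, with constants that depend on \<open>\<epsilon>\<close>, \<open>\<alpha>\<close> and \<open>n\<close> only:

  \<^item> \<open>F(|\<xi> - \<eta>|) \<le> \<epsilon> F(|\<eta>|) + C (a(\<xi>) - a(\<eta>)) \<bullet> (\<xi> - \<eta>)\<close> (\<open>flux_monotone_modulus\<close>);
  \<^item> \<open>|a(\<xi>) - a(\<eta>)| z \<le> \<epsilon> (F(|\<xi>|) + F(|\<eta>|) + F(z)) + C F(|\<xi> - \<eta>|)\<close> (\<open>flux_modulus\<close>).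

  Integrated over the domain, the second one gives the continuity of \<open>A\<close>. By the first one, a
  small value of \<open>\<langle>A u - A w, u - w\<rangle>\<close> forces the modular of \<open>\<nabla>u - \<nabla>w\<close> to be small. This yields
  strict monotonicity, the property (S+) and the continuity of the inverse directly, without
  extracting almost everywhere convergent subsequences of gradients.

  Surjectivity comes from minimising \<open>J - g\<close>, where \<open>J\<close> is the convex energy with derivative \<open>A\<close>
  and \<open>g\<close> is a given functional. The convexity defect \<open>J(u) + J(v) - 2 J((u + v) / 2)\<close> dominates a
  monotonicity defect of \<open>A\<close> (\<open>midpoint_gap\<close>), so minimising sequences are Cauchy sequences, and
  completeness of the space takes the place of reflexivity and weak compactness.

  The norm contains both \<open>u\<close> and \<open>\<nabla>u\<close>, whereas the operator sees \<open>\<nabla>u\<close> only. Strict monotonicity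
  needs that \<open>\<nabla>u = 0\<close> implies \<open>u = 0\<close>, which follows from the Poincare inequality in \<open>L\<^sup>1\<close>.
  Coercivity needs that the modular of \<open>u\<close> is bounded as long as the modular of \<open>\<nabla>u\<close> is at most 1
  (\<open>W10_modular_poincare\<close>); here \<open>q < p\<^sup>*\<close> and the boundedness of \<open>\<mu>\<close> enter. On a small ball the
  exponents are almost constant, so that there a subcritical Sobolev inequality with constant
  exponents suffices (\<open>local_sobolev\<close>), and finitely many such balls cover the closure of the
  domain. The local inequality is obtained by bounding the deviation of a function from its mean
  over a ball by a weighted mean of \<open>|\<nabla>\<phi>|\<close> over segments.

  The functional analysis is carried out for an abstract operator on a space with a convex modular
  (locales \<open>modular_operator\<close> and \<open>coercive_modular_operator\<close>), of which the logarithmic double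
  phase operator is an instance.\<close>

section \<open>Radial fluxes of power growth\<close>

text \<open>Scaling bounds are required for factors \<open>c \<le> 1\<close> only; those for \<open>c \<ge> 1\<close> follow by rescaling
  (\<open>power_growth_scale_up\<close>). The lower exponent is a natural number so that Bernoulli's inequality
  applies to \<open>(1 - \<kappa>)\<^sup>n\<close>. Since \<open>0 powr \<alpha> = 0\<close>, the upper bound with \<open>c = 0\<close> forces \<open>f 0 = 0\<close>.\<close>

definition power_growth :: "real \<Rightarrow> nat \<Rightarrow> (real \<Rightarrow> real) \<Rightarrow> bool" where
  "power_growth \<alpha> n f \<longleftrightarrow> (\<forall>t\<ge>0. 0 \<le> f t) \<and>
     (\<forall>c t. 0 \<le> c \<longrightarrow> c \<le> 1 \<longrightarrow> 0 \<le> t \<longrightarrow> c ^ n * f t \<le> f (c * t) \<and> f (c * t) \<le> c powr \<alpha> * f t)"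

text \<open>The radial vector field with modulus \<open>f\<close>. It vanishes at the origin because \<open>\<xi> = 0\<close> there.\<close>

definition flux :: "(real \<Rightarrow> real) \<Rightarrow> 'a::real_inner \<Rightarrow> 'a" where
  "flux f \<xi> = (f (norm \<xi>) / norm \<xi>) *\<^sub>R \<xi>"

lemma power_growth_nonneg: "power_growth \<alpha> n f \<Longrightarrow> 0 \<le> t \<Longrightarrow> 0 \<le> f t"
  by (simp add: power_growth_def)

lemma power_growth_upper:
  "power_growth \<alpha> n f \<Longrightarrow> 0 \<le> c \<Longrightarrow> c \<le> 1 \<Longrightarrow> 0 \<le> t \<Longrightarrow> f (c * t) \<le> c powr \<alpha> * f t"
  by (simp add: power_growth_def)

lemma power_growth_lower:
  "power_growth \<alpha> n f \<Longrightarrow> 0 \<le> c \<Longrightarrow> c \<le> 1 \<Longrightarrow> 0 \<le> t \<Longrightarrow> c ^ n * f t \<le> f (c * t)"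
  by (simp add: power_growth_def)

lemma power_growth_zero: "power_growth \<alpha> n f \<Longrightarrow> f 0 = 0"
  using power_growth_upper[of \<alpha> n f 0 0] power_growth_nonneg[of \<alpha> n f 0] by simp

lemma power_growth_scale_up:
  assumes "power_growth \<alpha> n f" "1 \<le> c" "0 \<le> t"
  shows "f (c * t) \<le> c ^ n * f t"
proof -
  have "(1/c) ^ n * f (c * t) \<le> f (1/c * (c * t))"
    using assms by (intro power_growth_lower[of \<alpha>]) auto
  then show ?thesis using assms by (simp add: field_simps power_divide)
qed

lemma power_growth_mono:
  assumes g: "power_growth \<alpha> n f" and "0 \<le> \<alpha>" "0 \<le> s" "s \<le> t"
  shows "f s \<le> f t"
proof (cases "t = 0")
  case True then show ?thesis using assms by simp
next
  case False
  have "f (s / t * t) \<le> (s/t) powr \<alpha> * f t"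
    using assms False by (intro power_growth_upper[OF g]) auto
  also have "\<dots> \<le> 1 * f t"
    using assms False by (intro mult_right_mono powr_le1 power_growth_nonneg[OF g]) auto
  finally show ?thesis using False by simp
qed

lemma power_growth_strict:
  assumes g: "power_growth \<alpha> n f" and "0 \<le> \<alpha>" "0 \<le> \<theta>" "\<theta> \<le> 1" "0 \<le> s" "s \<le> \<theta> * t" "0 \<le> t"
  shows "f s \<le> \<theta> powr \<alpha> * f t"
  using power_growth_mono[OF g, of s "\<theta> * t"] power_growth_upper[OF g, of \<theta> t] assms by auto

lemma norm_flux: "f 0 = 0 \<Longrightarrow> 0 \<le> f (norm \<xi>) \<Longrightarrow> norm (flux f \<xi>) = f (norm \<xi>)"
  by (cases "\<xi> = 0") (auto simp: flux_def)

lemma flux_inner_self: "f 0 = 0 \<Longrightarrow> flux f \<xi> \<bullet> \<xi> = f (norm \<xi>) * norm \<xi>"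
  by (cases "\<xi> = 0") (auto simp: flux_def dot_square_norm power2_eq_square)

text \<open>The monotonicity product splits into a part that measures the difference of the moduli and a
  part that measures the difference of the directions. Both are nonnegative for monotone \<open>f\<close>, and
  at least one of them is large when \<open>\<xi>\<close> and \<open>\<eta>\<close> are far apart.\<close>

lemma flux_minus_inner_eq:
  assumes "f 0 = 0"
  shows "(flux f \<xi> - flux f \<eta>) \<bullet> (\<xi> - \<eta>) =
    (f (norm \<xi>) - f (norm \<eta>)) * (norm \<xi> - norm \<eta>) +
    (f (norm \<xi>) / norm \<xi> + f (norm \<eta>) / norm \<eta>) * (norm \<xi> * norm \<eta> - \<xi> \<bullet> \<eta>)"
proof (cases "\<xi> = 0 \<or> \<eta> = 0")
  case True
  then show ?thesis using assms
    by (auto simp: flux_def inner_diff_left inner_diff_right dot_square_norm power2_eq_square)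
next
  case False
  then have "norm \<xi> \<noteq> 0" "norm \<eta> \<noteq> 0" by auto
  then show ?thesis
    by (simp add: flux_def inner_diff_left inner_diff_right dot_square_norm power2_eq_square
        inner_commute field_simps)
qed

lemma flux_monotone:
  assumes g: "power_growth \<alpha> n f" and "0 \<le> \<alpha>"
  shows "0 \<le> (flux f \<xi> - flux f \<eta>) \<bullet> (\<xi> - \<eta>)"
proof -
  have 1: "0 \<le> (f (norm \<xi>) - f (norm \<eta>)) * (norm \<xi> - norm \<eta>)"
    using power_growth_mono[OF g, of "norm \<xi>" "norm \<eta>"]
      power_growth_mono[OF g, of "norm \<eta>" "norm \<xi>"] assms
    by (cases "norm \<xi> \<le> norm \<eta>") (auto simp: mult_nonpos_nonpos)
  have 2: "0 \<le> (f (norm \<xi>) / norm \<xi> + f (norm \<eta>) / norm \<eta>) * (norm \<xi> * norm \<eta> - \<xi> \<bullet> \<eta>)"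
    using power_growth_nonneg[OF g] norm_cauchy_schwarz[of \<xi> \<eta>] by (intro mult_nonneg_nonneg) auto
  show ?thesis using 1 2 by (simp add: flux_minus_inner_eq[of f] power_growth_zero[OF g])
qed

text \<open>The case in which \<open>|\<xi> - \<eta>|\<close> is comparable with the larger of \<open>|\<xi>|\<close> and \<open>|\<eta>|\<close>. By \<open>|\<xi> - \<eta>|\<^sup>2
  = (|\<xi>| - |\<eta>|)\<^sup>2 + 2 (|\<xi>| |\<eta>| - \<xi> \<bullet> \<eta>)\<close>, either the moduli or the directions account for a fixed
  fraction of the distance. In the first case \<open>|\<eta>| \<le> \<theta> |\<xi>|\<close> with \<open>\<theta> < 1\<close>, and the growth condition
  gives \<open>f(|\<xi>|) - f(|\<eta>|) \<ge> (1 - \<theta>\<^sup>\<alpha>) f(|\<xi>|)\<close>; in the second case the directional part alone is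
  large enough. The two summands of the constant belong to these cases.\<close>

lemma flux_monotone_modulus_aux:
  fixes \<xi> \<eta> :: "'a::real_inner"
  assumes g: "power_growth \<alpha> n f" and \<alpha>: "0 < \<alpha>" and K: "1 \<le> K"
    and st: "norm \<eta> \<le> norm \<xi>" and d: "norm \<xi> \<le> K * norm (\<xi> - \<eta>)"
  shows "f (norm (\<xi> - \<eta>)) * norm (\<xi> - \<eta>) \<le>
    (2 ^ (n+1) / (1 - (1 - 1/(2*K)) powr \<alpha>) + 2 ^ n * 8 * K / 3) * ((flux f \<xi> - flux f \<eta>) \<bullet> (\<xi> - \<eta>))"
    (is "?F \<le> (?C1 + ?C2) * ?D")
proof -
  define s t d where "s = norm \<xi>" and "t = norm \<eta>" and "d = norm (\<xi> - \<eta>)"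
  define \<theta> where "\<theta> = 1 - 1/(2*K)"
  have \<theta>: "0 < \<theta>" "\<theta> < 1" using K by (auto simp: \<theta>_def field_simps)
  have \<theta>1: "\<theta> powr \<alpha> < 1" using powr_less_mono2[of \<alpha> \<theta> 1] \<theta> \<alpha> by simp
  have nn: "0 \<le> t" "0 \<le> d" "t \<le> s" "s \<le> K * d" "0 \<le> s" using st assms by (auto simp: s_def t_def d_def)
  have ds: "d / 2 \<le> s" using norm_triangle_ineq4[of \<xi> \<eta>] st by (simp add: s_def t_def d_def)
  have D: "?D = (f s - f t) * (s - t) + (f s / s + f t / t) * (s * t - \<xi> \<bullet> \<eta>)"
    by (simp add: flux_minus_inner_eq[of f] power_growth_zero[OF g] s_def t_def)
  have fmono: "f t \<le> f s" using power_growth_mono[OF g, of t s] \<alpha> nn by simp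
  have f0: "0 \<le> f s" "0 \<le> f t" "0 \<le> f d" using power_growth_nonneg[OF g] nn by auto
  have cs: "0 \<le> s * t - \<xi> \<bullet> \<eta>" using norm_cauchy_schwarz[of \<xi> \<eta>] by (simp add: s_def t_def)
  have Dnn: "0 \<le> ?D" using flux_monotone[OF g] \<alpha> by simp
  have fd: "f d \<le> 2 ^ n * f s"
  proof -
    have "f d \<le> 2 ^ n * f (d/2)" using power_growth_scale_up[OF g, of 2 "d/2"] nn by simp
    also have "f (d/2) \<le> f s" using power_growth_mono[OF g, of "d/2" s] ds nn \<alpha> by simp
    finally show ?thesis by simp
  qed
  have dd: "d\<^sup>2 = (s - t)\<^sup>2 + 2 * (s * t - \<xi> \<bullet> \<eta>)"
    by (simp add: s_def t_def d_def power2_norm_eq_inner inner_diff_left inner_diff_right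
        inner_commute power2_diff)
  have C: "0 \<le> ?C1" "0 \<le> ?C2" using \<theta>1 K by (auto simp: \<theta>_def[symmetric])
  show ?thesis
  \<comment> \<open>First the difference of the moduli, then the difference of the directions.\<close>
  proof (cases "d / 2 \<le> s - t")
    case True
    have "t \<le> \<theta> * s"
    proof -
      have "t \<le> s - d / 2" using True by simp
      also have "\<dots> \<le> s - s / (2 * K)" using nn K by (simp add: field_simps)
      finally show ?thesis by (simp add: \<theta>_def algebra_simps)
    qed
    then have "f t \<le> \<theta> powr \<alpha> * f s"
      using power_growth_strict[OF g, of \<theta> t s] \<alpha> \<theta> nn by simp
    then have "(1 - \<theta> powr \<alpha>) * f s \<le> f s - f t" by (simp add: algebra_simps)
    then have "(1 - \<theta> powr \<alpha>) * f s * (d/2) \<le> (f s - f t) * (s - t)"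
      using True nn \<theta>1 f0 fmono by (intro mult_mono) auto
    also have "\<dots> \<le> ?D" unfolding D using cs f0 nn by (simp add: )
    finally have D1: "(1 - \<theta> powr \<alpha>) * f s * (d/2) \<le> ?D" .
    have "f d * d \<le> 2 ^ n * f s * d" using fd nn by (intro mult_right_mono) auto
    also have "\<dots> = ?C1 * ((1 - \<theta> powr \<alpha>) * f s * (d/2))"
      using \<theta>1 by (simp add: \<theta>_def[symmetric])
    also have "\<dots> \<le> ?C1 * ?D" using D1 C by (intro mult_left_mono) auto
    also have "\<dots> \<le> (?C1 + ?C2) * ?D" using C Dnn by (intro mult_right_mono) auto
    finally show ?thesis by (simp add: d_def)
  next
    case False
    then have "(s - t)\<^sup>2 \<le> (d/2)\<^sup>2" using nn by (intro power_mono) auto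
    then have q: "3/8 * d\<^sup>2 \<le> s * t - \<xi> \<bullet> \<eta>" using dd by (simp add: power_divide)
    show ?thesis
    proof (cases "d = 0")
      case True then show ?thesis using C Dnn by (simp add: d_def)
    next
      case False
      then have dp: "0 < d" using nn by simp
      then have sp: "0 < s" using ds by simp
      have "f d * d \<le> 2 ^ n * f s * d" using fd nn by (intro mult_right_mono) auto
      also have "\<dots> = 2 ^ n * 8 / 3 * (f s / s) * s / d * (3/8 * d\<^sup>2)" using sp dp
          by (simp add: power2_eq_square)
      also have "\<dots> \<le> 2 ^ n * 8 / 3 * (f s / s) * K * (3/8 * d\<^sup>2)"
      proof -
        have "s / d \<le> K" using nn dp by (simp add: field_simps)
        then have "2 ^ n * 8 / 3 * (f s / s) * (s / d) * (3/8 * d\<^sup>2) \<le> 2 ^ n * 8 / 3 * (f s / s) * K *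
            (3/8 * d\<^sup>2)"
          using nn f0 by (intro mult_right_mono mult_left_mono) auto
        then show ?thesis by simp
      qed
      also have "\<dots> = ?C2 * ((f s / s) * (3/8 * d\<^sup>2))" by simp
      also have "\<dots> \<le> ?C2 * ((f s / s + f t / t) * (s * t - \<xi> \<bullet> \<eta>))"
        using q C f0 nn by (intro mult_left_mono mult_mono) auto
      also have "\<dots> \<le> ?C2 * ?D" unfolding D using C fmono nn f0 by (intro mult_left_mono) auto
      also have "\<dots> \<le> (?C1 + ?C2) * ?D" using C Dnn by (intro mult_right_mono) auto
      finally show ?thesis by (simp add: d_def)
    qed
  qed
qed

text \<open>Quantitative strict monotonicity. If \<open>|\<xi> - \<eta>|\<close> is small compared with \<open>|\<eta>|\<close>, then the term
  with \<open>\<epsilon>\<close> absorbs the left-hand side; otherwise \<open>flux_monotone_modulus_aux\<close> applies. The constant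
  does not depend on \<open>f\<close>, which makes the inequality uniform in \<open>x\<close> when \<open>f\<close> depends on \<open>x\<close>.\<close>

lemma flux_monotone_modulus:
  assumes \<alpha>: "0 < \<alpha>" and \<epsilon>: "0 < \<epsilon>"
  shows "\<exists>C\<ge>0. \<forall>f. \<forall>\<xi> \<eta> :: 'a::real_inner. power_growth \<alpha> n f \<longrightarrow>
     f (norm (\<xi> - \<eta>)) * norm (\<xi> - \<eta>) \<le>
       \<epsilon> * (f (norm \<eta>) * norm \<eta>) + C * ((flux f \<xi> - flux f \<eta>) \<bullet> (\<xi> - \<eta>))"
proof -
  define \<kappa> where "\<kappa> = min \<epsilon> 1"
  define K where "K = 1 + 1 / \<kappa>"
  define C where "C = 2 ^ (n+1) / (1 - (1 - 1/(2*K)) powr \<alpha>) + 2 ^ n * 8 * K / 3"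
  have \<kappa>: "0 < \<kappa>" "\<kappa> \<le> 1" "\<kappa> \<le> \<epsilon>" using \<epsilon> by (auto simp: \<kappa>_def)
  have K: "1 \<le> K" using \<kappa> by (simp add: K_def)
  have "(1 - 1/(2*K)) powr \<alpha> < 1"
    using powr_less_mono2[of \<alpha> "1 - 1/(2*K)" 1] K \<alpha> by (simp add: field_simps)
  then have C0: "0 \<le> C" using K by (simp add: C_def)
  have "f (norm (\<xi> - \<eta>)) * norm (\<xi> - \<eta>) \<le>
       \<epsilon> * (f (norm \<eta>) * norm \<eta>) + C * ((flux f \<xi> - flux f \<eta>) \<bullet> (\<xi> - \<eta>))"
    if g: "power_growth \<alpha> n f" for f and \<xi> \<eta> :: 'a
  proof (cases "norm (\<xi> - \<eta>) \<le> \<kappa> * norm \<eta>")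
    case True
    have f0: "0 \<le> f (norm \<eta>)" using power_growth_nonneg[OF g] by simp
    have "f (norm (\<xi> - \<eta>)) * norm (\<xi> - \<eta>) \<le> f (norm \<eta>) * (\<kappa> * norm \<eta>)"
      using True \<kappa> \<alpha> f0 mult_right_mono[of \<kappa> 1 "norm \<eta>"] 
      by (intro mult_mono power_growth_mono[OF g]) auto
    also have "\<dots> \<le> \<epsilon> * (f (norm \<eta>) * norm \<eta>)"
      using \<kappa> f0 by (simp add: mult_right_mono mult.left_commute)
    finally show ?thesis using flux_monotone[OF g, of \<xi> \<eta>] C0 \<alpha> by (simp add: add_increasing2)
  next
    case False
    then have e: "norm \<eta> \<le> (1/\<kappa>) * norm (\<xi> - \<eta>)" using \<kappa> by (simp add: field_simps)
    have t: "norm \<xi> \<le> norm \<eta> + norm (\<xi> - \<eta>)"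
      using norm_triangle_ineq[of "\<xi> - \<eta>" \<eta>] by simp
    have nx: "norm \<xi> \<le> K * norm (\<xi> - \<eta>)" using e t by (simp add: K_def algebra_simps)
    have ne: "norm \<eta> \<le> K * norm (\<eta> - \<xi>)" using e add_increasing[of "norm (\<eta> - \<xi>)"]
        by (simp add: K_def ring_distribs norm_minus_commute)
    have "f (norm (\<xi> - \<eta>)) * norm (\<xi> - \<eta>) \<le> C * ((flux f \<xi> - flux f \<eta>) \<bullet> (\<xi> - \<eta>))"
    proof (cases "norm \<eta> \<le> norm \<xi>")
      case True
      show ?thesis unfolding C_def by (rule flux_monotone_modulus_aux[OF g \<alpha> K True nx])
    next
      case False
      have "(flux f \<xi> - flux f \<eta>) \<bullet> (\<xi> - \<eta>) = (flux f \<eta> - flux f \<xi>) \<bullet> (\<eta> - \<xi>)"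
        by (metis inner_minus_left inner_minus_right minus_diff_eq minus_minus)
      then show ?thesis unfolding C_def 
        using flux_monotone_modulus_aux[OF g \<alpha> K _ ne] False by (simp add: norm_minus_commute)
    qed
    then show ?thesis using power_growth_nonneg[OF g, of "norm \<eta>"] \<epsilon> by (simp add: add_increasing)
  qed
  then show ?thesis using C0 by blast
qed

text \<open>If \<open>|\<xi> - \<eta>| \<ge> \<kappa> |\<xi>|\<close>, then both fluxes are bounded by a multiple of \<open>f(|\<xi> - \<eta>|)\<close>, and the
  product with \<open>z\<close> is split according to whether \<open>|\<xi> - \<eta>| \<le> \<sigma> z\<close>. Otherwise \<open>\<xi>\<close> and \<open>\<eta>\<close> have
  comparable moduli, and the flux changes by at most a multiple of \<open>\<kappa> f(|\<xi>|)\<close>: by Bernoulli's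
  inequality for its modulus, and by an elementary estimate of \<open>\<xi> / |\<xi>| - \<eta> / |\<eta>|\<close> for its
  direction.\<close>

lemma flux_modulus_aux:
  fixes \<xi> \<eta> :: "'a::real_inner"
  assumes g: "power_growth \<alpha> n f" and \<alpha>: "0 < \<alpha>" and \<kappa>: "0 < \<kappa>" "\<kappa> \<le> 1/2"
    and \<sigma>: "0 < \<sigma>" "\<sigma> \<le> 1" and st: "norm \<eta> \<le> norm \<xi>" and z: "0 \<le> z"
  shows "norm (flux f \<xi> - flux f \<eta>) * z \<le>
    (real n + 2) * \<kappa> * (f (norm \<xi>) * norm \<xi> + f z * z) +
    2 * (1/\<kappa>) ^ n * (\<sigma> powr \<alpha> * (f z * z) + f (norm (\<xi> - \<eta>)) * norm (\<xi> - \<eta>) / \<sigma>)"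
proof -
  define s t d where "s = norm \<xi>" and "t = norm \<eta>" and "d = norm (\<xi> - \<eta>)"
  have nn: "0 \<le> t" "0 \<le> d" "t \<le> s" "0 \<le> s" using st by (auto simp: s_def t_def d_def)
  have fmono: "f x \<le> f y" if "0 \<le> x" "x \<le> y" for x y
    using power_growth_mono[OF g] \<alpha> that by simp
  have f0: "0 \<le> f x" if "0 \<le> x" for x using power_growth_nonneg[OF g] that by auto
  have mono: "f x * y \<le> f x * x + f y * y" if "0 \<le> x" "0 \<le> y" for x y
  proof (cases "x \<le> y")
    case True
    then have "f x * y \<le> f y * y" using that by (intro mult_right_mono fmono) auto
    then show ?thesis using f0[of x] that by (simp add: add_increasing)
  next
    case False
    then have "f x * y \<le> f x * x" using that f0[of x] by (intro mult_left_mono) auto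
    then show ?thesis using f0[of y] that by (simp add: add_increasing2)
  qed
  have nf: "norm (flux f \<xi>) = f s" "norm (flux f \<eta>) = f t"
    using norm_flux[of f] power_growth_zero[OF g] f0 by (auto simp: s_def t_def)
  have P1: "0 \<le> (real n + 2) * \<kappa> * (f s * s + f z * z)" using f0 nn z \<kappa> by simp
  have P2: "0 \<le> 2 * (1/\<kappa>) ^ n * (\<sigma> powr \<alpha> * (f z * z) + f d * d / \<sigma>)" using f0 nn z \<kappa> \<sigma> by simp
  have "norm (flux f \<xi> - flux f \<eta>) * z \<le> (real n + 2) * \<kappa> * (f s * s + f z * z) +
     2 * (1/\<kappa>) ^ n * (\<sigma> powr \<alpha> * (f z * z) + f d * d / \<sigma>)"
  proof (cases "\<kappa> * s \<le> d")
    case True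
    have "norm (flux f \<xi> - flux f \<eta>) \<le> f s + f t"
      using norm_triangle_ineq4[of "flux f \<xi>" "flux f \<eta>"] by (simp add: nf)
    also have "\<dots> \<le> 2 * f s" using fmono[of t s] nn by simp
    also have "f s \<le> f ((1/\<kappa>) * d)" using True \<kappa> nn by (intro fmono) (auto simp: field_simps)
    also have "\<dots> \<le> (1/\<kappa>) ^ n * f d" using \<kappa> nn by (intro power_growth_scale_up[OF g]) auto
    finally have "norm (flux f \<xi> - flux f \<eta>) * z \<le> 2 * ((1/\<kappa>) ^ n * f d) * z"
      using z by (intro mult_right_mono) auto
    also have "\<dots> = 2 * (1/\<kappa>) ^ n * (f d * z)" by simp
    also have "f d * z \<le> \<sigma> powr \<alpha> * (f z * z) + f d * d / \<sigma>"
    proof (cases "d \<le> \<sigma> * z")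
      case True
      have "f d \<le> \<sigma> powr \<alpha> * f z" using power_growth_strict[OF g, of \<sigma> d z] \<alpha> \<sigma> True nn z by simp
      then have "f d * z \<le> \<sigma> powr \<alpha> * (f z * z)" using z by (simp add: mult_right_mono flip: mult.assoc)
      then show ?thesis using f0[of d] nn \<sigma> by (simp add: add_increasing2)
    next
      case False
      then have "z \<le> d / \<sigma>" using \<sigma> by (simp add: field_simps)
      then have "f d * z \<le> f d * (d / \<sigma>)" using f0[of d] nn by (intro mult_left_mono) auto
      then show ?thesis using f0[of z] z by (simp add: add_increasing)
    qed
    finally show ?thesis using P1 \<kappa> by (auto intro: add_increasing simp: mult_left_mono)
  next
    case False
    then have ds: "d < \<kappa> * s" by simp
    then have sp: "0 < s" using nn \<kappa> by (cases "s = 0") auto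
    have tl: "(1 - \<kappa>) * s \<le> t"
      using norm_triangle_ineq[of "\<xi> - \<eta>" \<eta>] ds by (simp add: s_def t_def d_def algebra_simps)
    moreover have "0 < (1 - \<kappa>) * s" using \<kappa> sp by simp
    ultimately have tp: "0 < t" by linarith
    have ne: "\<xi> \<noteq> 0" "\<eta> \<noteq> 0" using sp tp by (auto simp: s_def t_def)
    have "1 - real n * \<kappa> \<le> (1 - \<kappa>) ^ n" using Bernoulli_inequality[of "-\<kappa>" n] \<kappa> by simp
    then have "(1 - real n * \<kappa>) * f s \<le> (1 - \<kappa>) ^ n * f s" using f0 nn by (intro mult_right_mono) auto
    also have "\<dots> \<le> f ((1 - \<kappa>) * s)" using \<kappa> nn by (intro power_growth_lower[OF g]) auto
    also have "\<dots> \<le> f t" using tl \<kappa> nn by (intro fmono) auto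
    finally have fd: "f s - f t \<le> real n * \<kappa> * f s" by (simp add: algebra_simps)
    \<comment> \<open>The first summand changes the modulus only, the other two the direction.\<close>
    have eq: "flux f \<xi> - flux f \<eta> = ((f s - f t) / s) *\<^sub>R \<xi> + (f t / s) *\<^sub>R (\<xi> - \<eta>) +
        (f t * (1/s - 1/t)) *\<^sub>R \<eta>"
    proof -
      have "((f s - f t) / s) *\<^sub>R \<xi> + (f t / s) *\<^sub>R (\<xi> - \<eta>) + (f t * (1/s - 1/t)) *\<^sub>R \<eta> =
        ((f s - f t) / s + f t / s) *\<^sub>R \<xi> + (f t * (1/s - 1/t) - f t / s) *\<^sub>R \<eta>"
        by (simp only: scaleR_add_left scaleR_diff_left scaleR_diff_right) simp
      also have "(f s - f t) / s + f t / s = f s / s" by (simp add: diff_divide_distrib)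
      also have "f t * (1/s - 1/t) - f t / s = - (f t / t)" by (simp add: algebra_simps)
      finally show ?thesis by (simp add: flux_def s_def t_def)
    qed
    have "norm (flux f \<xi> - flux f \<eta>) \<le> \<bar>(f s - f t) / s\<bar> * s + \<bar>f t / s\<bar> * d + \<bar>f t * (1/s - 1/t)\<bar> * t"
      unfolding eq
      by (intro order_trans[OF norm_triangle_ineq] add_mono)
        (simp_all add: s_def t_def d_def)
    also have "\<bar>(f s - f t) / s\<bar> * s = f s - f t" using fmono[of t s] nn sp by simp
    also have "\<bar>f t / s\<bar> * d \<le> f t * \<kappa>" 
    proof -
      have "d / s \<le> \<kappa>" using ds sp by (simp add: field_simps)
      then have "f t * (d / s) \<le> f t * \<kappa>" using f0[of t] nn by (intro mult_left_mono) auto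
      then show ?thesis using sp f0[of t] nn by simp
    qed
    also have "\<bar>f t * (1/s - 1/t)\<bar> * t = f t * ((s - t) / s)"
    proof -
      have "1/s - 1/t \<le> 0" using sp tp nn by (simp add: field_simps)
      then have "\<bar>f t * (1/s - 1/t)\<bar> = f t * (1/t - 1/s)" using f0[of t] nn by (simp add: abs_mult)
      then show ?thesis using sp tp by (simp add: field_simps)
    qed
    also have "\<dots> \<le> f t * \<kappa>"
    proof -
      have "(s - t) / s \<le> \<kappa>" using tl sp by (simp add: field_simps)
      then show ?thesis using f0[of t] nn by (intro mult_left_mono) auto
    qed
    finally have "norm (flux f \<xi> - flux f \<eta>) \<le> (real n * \<kappa>) * f s + 2 * \<kappa> * f t" using fd by simp
    also have "\<dots> \<le> (real n + 2) * \<kappa> * f s"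
      using fmono[of t s] nn \<kappa> by (simp add: algebra_simps mult_left_mono)
    finally have "norm (flux f \<xi> - flux f \<eta>) * z \<le> (real n + 2) * \<kappa> * f s * z"
      using z by (intro mult_right_mono) auto
    also have "\<dots> \<le> (real n + 2) * \<kappa> * (f s * s + f z * z)"
      using mono[of s z] nn z \<kappa> by (simp add: mult.assoc mult_left_mono)
    finally show ?thesis using P2 by simp
  qed
  then show ?thesis by (simp add: s_def t_def d_def)
qed

text \<open>Uniform continuity of the flux in the form that survives integration. The parameter \<open>\<kappa>\<close> is
  chosen first, to make the terms without \<open>|\<xi> - \<eta>|\<close> small; then \<open>\<sigma>\<close> compensates for the large
  factor \<open>(1 / \<kappa>)\<^sup>n\<close>.\<close>

lemma flux_modulus:
  assumes \<alpha>: "0 < \<alpha>" and \<epsilon>: "0 < \<epsilon>"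
  shows "\<exists>C\<ge>0. \<forall>f z. \<forall>\<xi> \<eta> :: 'a::real_inner. power_growth \<alpha> n f \<longrightarrow> 0 \<le> z \<longrightarrow>
     norm (flux f \<xi> - flux f \<eta>) * z \<le>
       \<epsilon> * (f (norm \<xi>) * norm \<xi> + f (norm \<eta>) * norm \<eta> + f z * z) +
       C * (f (norm (\<xi> - \<eta>)) * norm (\<xi> - \<eta>))"
proof -
  \<comment> \<open>This value makes \<open>(n + 2) \<kappa> \<le> \<epsilon> / 2\<close>.\<close>
  define \<kappa> where "\<kappa> = min (1/2) (\<epsilon> / (2 * (real n + 2)))"
  have \<kappa>: "0 < \<kappa>" "\<kappa> \<le> 1/2" "\<kappa> \<le> \<epsilon> / (2 * (real n + 2))"
    unfolding \<kappa>_def using \<epsilon> by (simp, linarith, linarith)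
  have \<kappa>2: "(real n + 2) * \<kappa> \<le> \<epsilon> / 2"
  proof -
    have "(real n + 2) * \<kappa> \<le> (real n + 2) * (\<epsilon> / (2 * (real n + 2)))" using \<kappa>
        by (intro mult_left_mono) auto
    also have "\<dots> = \<epsilon> / 2" by (simp add: field_simps)
    finally show ?thesis .
  qed
  define B where "B = 2 * (1/\<kappa>) ^ n"
  have B: "0 < B" using \<kappa> by (simp add: B_def)
  \<comment> \<open>This value makes \<open>B \<sigma>\<^sup>\<alpha> \<le> \<epsilon> / 2\<close>.\<close>
  define \<sigma> where "\<sigma> = min 1 ((\<epsilon> / (2 * B)) powr (1/\<alpha>))"
  have \<sigma>: "0 < \<sigma>" "\<sigma> \<le> 1" using \<epsilon> B by (auto simp: \<sigma>_def)
  have "\<sigma> powr \<alpha> \<le> ((\<epsilon> / (2 * B)) powr (1/\<alpha>)) powr \<alpha>" using \<alpha> \<sigma> by (intro powr_mono2) (auto simp: \<sigma>_def)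
  also have "\<dots> = \<epsilon> / (2 * B)" using \<alpha> \<epsilon> B by (simp add: powr_powr)
  finally have B\<sigma>: "B * \<sigma> powr \<alpha> \<le> \<epsilon> / 2" using B by (simp add: field_simps)
  have main: "norm (flux f \<xi> - flux f \<eta>) * z \<le>
       \<epsilon> * (f (norm \<xi>) * norm \<xi> + f (norm \<eta>) * norm \<eta> + f z * z) +
       B / \<sigma> * (f (norm (\<xi> - \<eta>)) * norm (\<xi> - \<eta>))"
    if g: "power_growth \<alpha> n f" and z: "0 \<le> z" and le: "norm \<eta> \<le> norm \<xi>" for f z and \<xi> \<eta> :: 'a
  proof -
    have nn: "0 \<le> f (norm \<xi>) * norm \<xi>" "0 \<le> f (norm \<eta>) * norm \<eta>" "0 \<le> f z * z"
      using power_growth_nonneg[OF g] z by auto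
    have "norm (flux f \<xi> - flux f \<eta>) * z \<le>
    (real n + 2) * \<kappa> * (f (norm \<xi>) * norm \<xi> + f z * z) +
    B * (\<sigma> powr \<alpha> * (f z * z) + f (norm (\<xi> - \<eta>)) * norm (\<xi> - \<eta>) / \<sigma>)"
      unfolding B_def by (rule flux_modulus_aux[OF g \<alpha> \<kappa>(1,2) \<sigma> le z])
    also have "\<dots> = (real n + 2) * \<kappa> * (f (norm \<xi>) * norm \<xi> + f z * z) + B * \<sigma> powr \<alpha> * (f z * z) +
        B / \<sigma> * (f (norm (\<xi> - \<eta>)) * norm (\<xi> - \<eta>))" by (simp add: algebra_simps)
    also have "\<dots> \<le> \<epsilon> / 2 * (f (norm \<xi>) * norm \<xi> + f z * z) + \<epsilon> / 2 * (f z * z) +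
        B / \<sigma> * (f (norm (\<xi> - \<eta>)) * norm (\<xi> - \<eta>))"
      using \<kappa>2 B\<sigma> nn by (intro add_mono mult_right_mono order_refl add_nonneg_nonneg) auto
    also have "\<dots> = \<epsilon> * (f (norm \<xi>) * norm \<xi> / 2 + f z * z) + B / \<sigma> * (f (norm (\<xi> - \<eta>)) * norm (\<xi> - \<eta>))"
      by (simp add: algebra_simps)
    also have "\<dots> \<le> \<epsilon> * (f (norm \<xi>) * norm \<xi> + f (norm \<eta>) * norm \<eta> + f z * z) +
        B / \<sigma> * (f (norm (\<xi> - \<eta>)) * norm (\<xi> - \<eta>))"
    proof -
      have "f (norm \<xi>) * norm \<xi> / 2 + f z * z \<le> f (norm \<xi>) * norm \<xi> + f (norm \<eta>) * norm \<eta> + f z * z"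
        using nn by linarith
      then show ?thesis using \<epsilon> by (intro add_right_mono mult_left_mono) auto
    qed
    finally show ?thesis .
  qed
  have "norm (flux f \<xi> - flux f \<eta>) * z \<le>
       \<epsilon> * (f (norm \<xi>) * norm \<xi> + f (norm \<eta>) * norm \<eta> + f z * z) +
       B / \<sigma> * (f (norm (\<xi> - \<eta>)) * norm (\<xi> - \<eta>))"
    if g: "power_growth \<alpha> n f" and z: "0 \<le> z" for f z and \<xi> \<eta> :: 'a
    using main[OF g z, of \<eta> \<xi>] main[OF g z, of \<xi> \<eta>]
    by (cases "norm \<eta> \<le> norm \<xi>") (simp_all add: norm_minus_commute add.commute)
  then show ?thesis using B \<sigma> by (intro exI[of _ "B / \<sigma>"]) auto
qed

section \<open>The logarithmic double phase integrand\<close>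

text \<open>The bracket of the operator. It makes \<open>t\<^sup>q\<^sup>-\<^sup>1\<close> times this function the derivative of \<open>t\<^sup>q
  log (e + t) / q\<close>.\<close>

definition log_bracket :: "real \<Rightarrow> real \<Rightarrow> real" where
  "log_bracket q t = ln (exp 1 + t) + t / (q * (exp 1 + t))"

definition log_phase :: "real \<Rightarrow> real \<Rightarrow> real \<Rightarrow> real \<Rightarrow> real" where
  "log_phase p q m t = t powr p + m * t powr q * ln (exp 1 + t)"

definition log_flux :: "real \<Rightarrow> real \<Rightarrow> real \<Rightarrow> real \<Rightarrow> real" where
  "log_flux p q m t = t powr (p - 1) + m * log_bracket q t * t powr (q - 1)"

text \<open>The primitive of \<open>log_flux\<close>.\<close>

definition log_energy :: "real \<Rightarrow> real \<Rightarrow> real \<Rightarrow> real \<Rightarrow> real" where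
  "log_energy p q m t = t powr p / p + m * (t powr q * ln (exp 1 + t) / q)"

lemma exp1_plus_pos: "0 \<le> t \<Longrightarrow> 0 < exp 1 + (t::real)"
  by (simp add: add_pos_nonneg)

lemma ln_exp1_plus_ge_1: "0 \<le> t \<Longrightarrow> 1 \<le> ln (exp 1 + (t::real))"
  using exp1_plus_pos[of t] by (subst ln_ge_iff) auto

text \<open>From \<open>e + t \<le> (e + c t) / c\<close> one gets \<open>log (e + t) \<le> log (e + c t) + (1 / c - 1)\<close>, and the
  last summand is at most \<open>(1 / c - 1) log (e + c t)\<close> because the logarithm is at least 1.\<close>

lemma ln_exp1_plus_scale:
  assumes "0 < c" "c \<le> 1" "0 \<le> (t::real)"
  shows "c * ln (exp 1 + t) \<le> ln (exp 1 + c * t)"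
proof -
  have e: "0 < exp 1 + t" "0 < exp 1 + c * t" using assms by (simp_all add: exp1_plus_pos)
  have "exp 1 + t \<le> (exp 1 + c * t) / c" using assms by (simp add: field_simps)
  then have "ln (exp 1 + t) \<le> ln ((exp 1 + c * t) / c)" using e assms by (intro ln_mono) auto
  also have "\<dots> = ln (exp 1 + c * t) + ln (1 / c)" using e assms by (simp add: ln_div)
  also have "ln (1 / c) \<le> 1 / c - 1" using assms by (intro ln_le_minus_one) auto
  also have "\<dots> \<le> (1 / c - 1) * ln (exp 1 + c * t)"
    using ln_exp1_plus_ge_1[of "c * t"] assms mult_left_mono[of 1 "ln (exp 1 + c * t)" "1 / c - 1"]
    by simp
  also have "ln (exp 1 + c * t) + (1 / c - 1) * ln (exp 1 + c * t) = ln (exp 1 + c * t) / c"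
    by (simp add: algebra_simps)
  finally show ?thesis using assms by (simp add: field_simps)
qed

lemma log_bracket_mono:
  assumes "0 < q" "0 \<le> s" "s \<le> t"
  shows "log_bracket q s \<le> log_bracket q t"
proof -
  have e: "0 < exp 1 + s" "0 < exp 1 + t" using assms by (simp_all add: exp1_plus_pos)
  have "s * (exp 1 + t) \<le> t * (exp 1 + s)" using assms by (simp add: algebra_simps)
  then have "s / (exp 1 + s) \<le> t / (exp 1 + t)" using e by (simp add: field_simps)
  then have "s / (exp 1 + s) / q \<le> t / (exp 1 + t) / q" using assms by (intro divide_right_mono) auto
  moreover have "ln (exp 1 + s) \<le> ln (exp 1 + t)" using e assms by (intro ln_mono) auto
  ultimately show ?thesis by (simp add: log_bracket_def mult.commute)
qed

lemma log_bracket_scale: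
  assumes "0 < q" "0 < c" "c \<le> 1" "0 \<le> t"
  shows "c * log_bracket q t \<le> log_bracket q (c * t)"
proof -
  have e: "0 < exp 1 + t" "0 < exp 1 + c * t" "exp 1 + c * t \<le> exp 1 + t"
    using assms by (simp_all add: exp1_plus_pos mult_left_le_one_le)
  have "t / (exp 1 + t) \<le> t / (exp 1 + c * t)" using e assms by (intro divide_left_mono) auto
  then have "c * (t / (exp 1 + t)) / q \<le> c * (t / (exp 1 + c * t)) / q"
    using assms by (intro divide_right_mono mult_left_mono) auto
  then show ?thesis using ln_exp1_plus_scale[of c t] assms
    by (simp add: log_bracket_def distrib_left mult.commute)
qed

lemma log_bracket_ge_1: "0 < q \<Longrightarrow> 0 \<le> t \<Longrightarrow> 1 \<le> log_bracket q t"
  using ln_exp1_plus_ge_1[of t] exp1_plus_pos[of t] unfolding log_bracket_def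
  by (intro order_trans[OF _ add_increasing2]) auto

lemma log_bracket_bounds:
  assumes "1 \<le> q" "0 \<le> t"
  shows "ln (exp 1 + t) \<le> log_bracket q t" "log_bracket q t \<le> 2 * ln (exp 1 + t)"
proof -
  have e: "0 < exp 1 + t" using assms by (simp add: exp1_plus_pos)
  show "ln (exp 1 + t) \<le> log_bracket q t" using e assms by (simp add: log_bracket_def)
  have "t \<le> q * (exp 1 + t)" using assms mult_mono[of 1 q t "exp 1 + t"] e by simp
  then have "t / (q * (exp 1 + t)) \<le> 1" using e assms by simp
  also have "\<dots> \<le> ln (exp 1 + t)" using ln_exp1_plus_ge_1 assms by simp
  finally show "log_bracket q t \<le> 2 * ln (exp 1 + t)" by (simp add: log_bracket_def)
qed

lemma powr_scale_between:
  assumes "0 \<le> c" "c \<le> 1" "0 \<le> t" "0 < a" "a \<le> b" "b \<le> real n"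
  shows "c ^ n * t powr b \<le> (c * t) powr b" "(c * t) powr b \<le> c powr a * t powr b"
proof -
  have "c ^ n \<le> c powr b"
  proof (cases "c = 0")
    case True then show ?thesis using assms by (cases n) auto
  next
    case False
    then have "c ^ n = c powr real n" using assms by (simp add: powr_realpow)
    also have "\<dots> \<le> c powr b" using assms False by (intro powr_mono') auto
    finally show ?thesis .
  qed
  then show "c ^ n * t powr b \<le> (c * t) powr b" using assms by (simp add: powr_mult mult_right_mono)
  have "c powr b \<le> c powr a" using assms by (cases "c = 0") (auto intro!: powr_mono')
  then show "(c * t) powr b \<le> c powr a * t powr b" using assms by (simp add: powr_mult mult_right_mono)
qed

lemma power_growth_add:
  assumes "power_growth a n f" "power_growth a n g"
  shows "power_growth a n (\<lambda>t. f t + g t)"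
  using assms unfolding power_growth_def by (simp add: distrib_left add_mono)

text \<open>A slowly growing weight \<open>w\<close>, such as a logarithm, costs at most one power of \<open>c\<close> in the
  lower bound and nothing in the upper bound.\<close>

lemma power_growth_log_term:
  assumes a: "0 < a" "a \<le> b" "b \<le> real n" and m: "0 \<le> m"
    and w0: "\<And>t. 0 \<le> t \<Longrightarrow> 0 \<le> w t"
    and wmono: "\<And>s t. 0 \<le> s \<Longrightarrow> s \<le> t \<Longrightarrow> w s \<le> w t"
    and wscale: "\<And>c t. 0 < c \<Longrightarrow> c \<le> 1 \<Longrightarrow> 0 \<le> t \<Longrightarrow> c * w t \<le> w (c * t)"
  shows "power_growth a (Suc n) (\<lambda>t. m * w t * t powr b)"
  unfolding power_growth_def
proof (intro conjI allI impI)
  fix t :: real assume "0 \<le> t" then show "0 \<le> m * w t * t powr b" using m w0 by simp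
next
  fix c t :: real assume c: "0 \<le> c" "c \<le> 1" and t: "0 \<le> t"
  show "c ^ Suc n * (m * w t * t powr b) \<le> m * w (c * t) * (c * t) powr b"
  proof (cases "c = 0")
    case False
    then have "(m * (c * w t)) * (c ^ n * t powr b) \<le> (m * w (c * t)) * (c * t) powr b"
      using c t a m w0 by (intro mult_mono mult_left_mono wscale powr_scale_between) auto
    then show ?thesis by (simp add: mult_ac)
  qed simp
  have "c * t \<le> t" using c t by (simp add: mult_left_le_one_le)
  then have "(m * w (c * t)) * (c * t) powr b \<le> (m * w t) * (c powr a * t powr b)"
    using c t a m w0 by (intro mult_mono mult_left_mono wmono powr_scale_between) auto
  then show "m * w (c * t) * (c * t) powr b \<le> c powr a * (m * w t * t powr b)" by (simp add: mult_ac)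
qed

lemma power_growth_powr:
  assumes "0 < a" "a \<le> b" "b \<le> real n"
  shows "power_growth a n (\<lambda>t. t powr b)"
  using assms powr_scale_between unfolding power_growth_def by auto

lemma power_growth_log_flux:
  assumes "1 < a" "a \<le> p" "p \<le> q" "q \<le> real n" "0 \<le> m"
  shows "power_growth (a - 1) n (log_flux p q m)"
proof -
  obtain k where n: "n = Suc k" using assms by (cases n) auto
  show ?thesis unfolding log_flux_def n
    using assms by (intro power_growth_add power_growth_powr power_growth_log_term)
      (auto simp: n intro: order_trans[OF _ log_bracket_ge_1] log_bracket_mono log_bracket_scale)
qed

lemma power_growth_log_phase:
  assumes "1 < a" "a \<le> p" "p \<le> q" "q \<le> real n" "0 \<le> m"
  shows "power_growth a (Suc n) (log_phase p q m)"
proof -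
  have "power_growth a (Suc n) (\<lambda>t. t powr p + m * ln (exp 1 + t) * t powr q)"
    using assms by (intro power_growth_add power_growth_powr power_growth_log_term)
      (auto intro: order_trans[OF _ ln_exp1_plus_ge_1] ln_exp1_plus_scale intro!: ln_mono exp1_plus_pos)
  then show ?thesis by (simp add: log_phase_def[abs_def] mult_ac)
qed

lemma log_flux_mult_self:
  assumes "0 \<le> t" 
  shows "log_flux p q m t * t = t powr p + m * log_bracket q t * t powr q"
proof (cases "t = 0")
  case False
  then have "t powr (p - 1) * t = t powr p" "t powr (q - 1) * t = t powr q"
    using assms by (simp_all add: powr_diff)
  then show ?thesis by (simp add: log_flux_def distrib_right mult.assoc)
qed simp

lemma log_phase_le_flux:
  assumes "0 \<le> t" "1 \<le> q" "0 \<le> m"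
  shows "log_phase p q m t \<le> log_flux p q m t * t" "log_flux p q m t * t \<le> 2 * log_phase p q m t"
proof -
  have "m * t powr q * ln (exp 1 + t) \<le> m * t powr q * log_bracket q t"
    using assms by (intro mult_left_mono log_bracket_bounds) auto
  then show "log_phase p q m t \<le> log_flux p q m t * t"
    unfolding log_flux_mult_self[OF assms(1)] log_phase_def by (simp add: mult_ac)
  have "m * t powr q * log_bracket q t \<le> m * t powr q * (2 * ln (exp 1 + t))"
    using assms by (intro mult_left_mono log_bracket_bounds) auto
  moreover have "t powr p \<le> 2 * t powr p" by simp
  ultimately show "log_flux p q m t * t \<le> 2 * log_phase p q m t"
    unfolding log_flux_mult_self[OF assms(1)] log_phase_def distrib_left
    by (intro add_mono) (simp_all add: mult_ac)
qed

text \<open>Convexity with the endpoint \<open>0\<close> included, where real powers with noninteger exponents need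
  not be differentiable from both sides: there the tangent inequality is checked by hand.\<close>

lemma above_tangent_of_mono_deriv:
  fixes F f :: "real \<Rightarrow> real"
  assumes der: "\<And>t. 0 < t \<Longrightarrow> (F has_real_derivative f t) (at t)"
    and mono: "\<And>s t. 0 < s \<Longrightarrow> s \<le> t \<Longrightarrow> f s \<le> f t"
    and F0: "F 0 = 0" "f 0 = 0" "\<And>t. 0 \<le> t \<Longrightarrow> 0 \<le> F t" "\<And>t. 0 \<le> t \<Longrightarrow> F t \<le> f t * t"
    and st: "0 \<le> s" "0 \<le> t"
  shows "F s + f s * (t - s) \<le> F t"
proof (cases "s = 0 \<or> t = 0")
  case True then show ?thesis
    by (elim disjE) (use F0(1,2) F0(3)[OF st(2)] F0(4)[OF st(1)] st in \<open>simp_all add: algebra_simps\<close>)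
next
  case False
  then have "0 < s" "0 < t" using st by auto
  have "convex_on {0<..} F"
    by (rule convex_on_realI[of _ _ f]) (auto intro: der mono)
  then have "f s * (t - s) \<le> F t - F s"
    using \<open>0 < s\<close> \<open>0 < t\<close>
    by (intro convex_on_imp_above_tangent[of "{0<..}"]) (auto intro!: has_field_derivative_at_within der
        simp: interior_open)
  then show ?thesis by simp
qed

lemma powr_above_tangent:
  assumes "1 \<le> b" "0 \<le> s" "0 \<le> (t::real)"
  shows "s powr b + (b * s powr (b - 1)) * (t - s) \<le> t powr b"
proof (cases "b = 1")
  case True then show ?thesis using assms by auto
next
  case False
  show ?thesis
  proof (rule above_tangent_of_mono_deriv[where F = "\<lambda>t. t powr b" and f = "\<lambda>t. b * t powr (b - 1)"])
    fix t :: real assume "0 < t"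
    then show "((\<lambda>t. t powr b) has_real_derivative b * t powr (b - 1)) (at t)"
      by (auto intro!: derivative_eq_intros)
  next
    fix t :: real assume t: "0 \<le> t"
    have "b * t powr (b - 1) * t = b * t powr b" using t by (cases "t = 0") (auto simp: powr_diff)
    moreover have "1 * t powr b \<le> b * t powr b" using assms by (intro mult_right_mono) auto
    ultimately show "t powr b \<le> b * t powr (b - 1) * t" by (simp only: mult_1)
  qed (use assms False in \<open>auto intro!: mult_left_mono powr_mono2\<close>)
qed

lemma powr_ln_above_tangent:
  assumes q: "1 < q" and st: "0 \<le> s" "0 \<le> (t::real)"
  shows "s powr q * ln (exp 1 + s) + (q * (log_bracket q s * s powr (q - 1))) * (t - s) \<le>
      t powr q * ln (exp 1 + t)"
proof (rule above_tangent_of_mono_deriv[where F = "\<lambda>t. t powr q * ln (exp 1 + t)"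
      and f = "\<lambda>t. q * (log_bracket q t * t powr (q - 1))"])
  fix t :: real assume t: "0 < t"
  then have e: "0 < exp 1 + t" by (simp add: exp1_plus_pos)
  have "((\<lambda>t. t powr q * ln (exp 1 + t)) has_real_derivative
      (q * t powr (q - 1)) * ln (exp 1 + t) + (1 / (exp 1 + t)) * t powr q) (at t)"
    using t e by (auto intro!: derivative_eq_intros)
  moreover have "(q * t powr (q - 1)) * ln (exp 1 + t) + (1 / (exp 1 + t)) * t powr q =
      q * (log_bracket q t * t powr (q - 1))"
  proof -
    have "q * (t / (q * (exp 1 + t)) * t powr (q - 1)) = (1 / (exp 1 + t)) * t powr q"
      using t q by (simp add: powr_diff)
    then show ?thesis by (simp add: log_bracket_def distrib_right distrib_left)
  qed
  ultimately show "((\<lambda>t. t powr q * ln (exp 1 + t)) has_real_derivative q * (log_bracket q t * t powr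
      (q - 1))) (at t)"
    by simp
next
  fix s t :: real assume "0 < s" "s \<le> t"
  then show "q * (log_bracket q s * s powr (q - 1)) \<le> q * (log_bracket q t * t powr (q - 1))"
    using q by (intro mult_left_mono mult_mono log_bracket_mono powr_mono2)
      (auto intro: order_trans[OF _ log_bracket_ge_1])
next
  fix t :: real assume t: "0 \<le> t"
  show "0 \<le> t powr q * ln (exp 1 + t)" using ln_exp1_plus_ge_1[OF t] by simp
  have "q * (log_bracket q t * t powr (q - 1)) * t = q * log_bracket q t * t powr q"
    using t by (cases "t = 0") (simp_all add: powr_diff)
  moreover have "1 * ln (exp 1 + t) \<le> q * log_bracket q t"
    using log_bracket_bounds(1)[of q t] ln_exp1_plus_ge_1[OF t] q t by (intro mult_mono) auto
  then have "1 * ln (exp 1 + t) * t powr q \<le> q * log_bracket q t * t powr q"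
    by (intro mult_right_mono) auto
  ultimately show "t powr q * ln (exp 1 + t) \<le> q * (log_bracket q t * t powr (q - 1)) * t"
    by (simp only: mult_1 mult.commute)
qed (use q st in auto)

text \<open>The pointwise source of the convexity of the energy functional: \<open>log_flux\<close> is a
  subgradient.\<close>

lemma log_energy_above_tangent:
  assumes "1 < p" "1 < q" "0 \<le> m" "0 \<le> s" "0 \<le> t"
  shows "log_energy p q m s + log_flux p q m s * (t - s) \<le> log_energy p q m t"
proof -
  have P: "(s powr p + (p * s powr (p - 1)) * (t - s)) / p \<le> t powr p / p"
    using powr_above_tangent[of p s t] assms by (intro divide_right_mono) auto
  have Q: "m * ((s powr q * ln (exp 1 + s) + (q * (log_bracket q s * s powr (q - 1))) * (t - s)) / q) \<le>
     m * (t powr q * ln (exp 1 + t) / q)"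
    using powr_ln_above_tangent[of q s t] assms by (intro mult_left_mono divide_right_mono) auto
  have P': "(s powr p + (p * s powr (p - 1)) * (t - s)) / p = s powr p / p + s powr (p - 1) * (t - s)"
    using assms by (simp add: add_divide_distrib)
  have Q': "(s powr q * ln (exp 1 + s) + (q * (log_bracket q s * s powr (q - 1))) * (t - s)) / q =
     s powr q * ln (exp 1 + s) / q + (log_bracket q s * s powr (q - 1)) * (t - s)"
    using assms by (simp add: add_divide_distrib)
  show ?thesis using P Q unfolding P' Q' log_energy_def log_flux_def
    by (simp add: algebra_simps)
qed

text \<open>Obtained from the tangent at the intermediate point rather than from second derivatives.\<close>

lemma log_phase_convex:
  assumes "1 < p" "1 < q" "0 \<le> m" "0 \<le> s" "0 \<le> t" "0 \<le> c" "c \<le> 1"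
  shows "log_phase p q m ((1 - c) * s + c * t) \<le> (1 - c) * log_phase p q m s + c * log_phase p q m t"
proof -
  define z where "z = (1 - c) * s + c * t"
  define D where "D = p * z powr (p - 1) + m * (q * (log_bracket q z * z powr (q - 1)))"
  have z: "0 \<le> z" using assms by (simp add: z_def)
  \<comment> \<open>The affine function on the left touches \<open>H\<close> at the intermediate point \<open>z\<close>.\<close>
  have T: "log_phase p q m z + D * (x - z) \<le> log_phase p q m x" if "0 \<le> x" for x
    using powr_above_tangent[of p z x]
      mult_left_mono[OF powr_ln_above_tangent[of q z x], of m] assms z that
    unfolding log_phase_def D_def by (simp add: algebra_simps)
  have "(1 - c) * (log_phase p q m z + D * (s - z)) + c * (log_phase p q m z + D * (t - z)) \<le>
      (1 - c) * log_phase p q m s + c * log_phase p q m t"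
    using T assms by (intro add_mono mult_left_mono) auto
  moreover have "(1 - c) * (log_phase p q m z + D * (s - z)) + c * (log_phase p q m z + D * (t - z)) =
     log_phase p q m z + D * (((1 - c) * s + c * t) - z)" by (simp add: algebra_simps)
  ultimately show ?thesis by (simp add: z_def)
qed

lemma le_1_plus_log_phase:
  assumes "1 \<le> p" "0 \<le> m" "0 \<le> t"
  shows "t \<le> 1 + log_phase p q m t"
proof -
  have "t \<le> 1 + t powr p"
    using powr_mono[of 1 p t] assms by (cases "t \<le> 1") (auto simp: add_increasing2)
  also have "\<dots> \<le> 1 + log_phase p q m t" 
    using assms ln_exp1_plus_ge_1[of t] by (simp add: log_phase_def)
  finally show ?thesis .
qed

lemma power_growth_add_le:
  assumes g: "power_growth a n f" and "0 \<le> a" "0 \<le> s" "0 \<le> t"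
  shows "f (s + t) \<le> 2 ^ n * (f s + f t)"
proof -
  have "f (s + t) \<le> f (2 * max s t)" using assms by (intro power_growth_mono[OF g]) auto
  also have "\<dots> \<le> 2 ^ n * f (max s t)" using assms by (intro power_growth_scale_up[OF g]) auto
  also have "f (max s t) \<le> f s + f t" using assms power_growth_nonneg[OF g] by (auto simp: max_def)
  finally show ?thesis by simp
qed

lemma Hlog_eq_log_phase: "Hlog p q \<mu> x t = log_phase (p x) (q x) (\<mu> x) t"
  by (simp add: Hlog_def log_phase_def)

section \<open>Normed subspaces, their duals and Luxemburg norms\<close>

text \<open>A linear subspace with a function that is a norm on it, in the form in which \<open>dual_space\<close>
  and \<open>norm_topology\<close> take their arguments.\<close>

locale normed_subspace =
  fixes X :: "'v::real_vector set" and N :: "'v \<Rightarrow> real"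
  assumes subspace: "subspace X"
    and N_nonneg: "u \<in> X \<Longrightarrow> 0 \<le> N u"
    and N_zero_imp: "u \<in> X \<Longrightarrow> N u = 0 \<Longrightarrow> u = 0"
    and N_scale: "u \<in> X \<Longrightarrow> N (c *\<^sub>R u) = \<bar>c\<bar> * N u"
    and N_triangle: "u \<in> X \<Longrightarrow> v \<in> X \<Longrightarrow> N (u + v) \<le> N u + N v"
begin

lemmas X_add = subspace_add[OF subspace]
  and X_diff = subspace_diff[OF subspace]
  and X_scale = subspace_scale[OF subspace]
  and X_zero = subspace_0[OF subspace]
  and X_neg = subspace_neg[OF subspace]

lemma N_0: "N 0 = 0"
  using N_scale[OF X_zero, of 0] by simp

lemma N_minus: "u \<in> X \<Longrightarrow> N (- u) = N u"
  using N_scale[of u "-1"] by simp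

lemma N_minus_commute: "u \<in> X \<Longrightarrow> v \<in> X \<Longrightarrow> N (u - v) = N (v - u)"
  using N_minus[of "u - v"] X_diff by simp

lemma N_triangle_diff: "u \<in> X \<Longrightarrow> v \<in> X \<Longrightarrow> w \<in> X \<Longrightarrow> N (u - w) \<le> N (u - v) + N (v - w)"
  using N_triangle[of "u - v" "v - w"] X_diff by simp

lemma N_le_add_diff: "u \<in> X \<Longrightarrow> v \<in> X \<Longrightarrow> N v \<le> N u + N (u - v)"
  using N_triangle[of u "v - u"] X_diff N_minus_commute[of u v] by simp

abbreviation "dist_N \<equiv> \<lambda>u v. if u \<in> X \<and> v \<in> X then N (u - v) else 0"

lemma Metric_space_norm: "Metric_space X dist_N"
proof
  fix x y z assume "x \<in> X" "y \<in> X" "z \<in> X"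
  then show "dist_N x z \<le> dist_N x y + dist_N y z" using N_triangle_diff by simp
next
  fix x y assume "x \<in> X" "y \<in> X"
  then show "(dist_N x y = 0) = (x = y)" using N_zero_imp[of "x - y"] X_diff N_0 by auto
qed (use N_nonneg X_diff N_minus_commute in auto)

lemma limitin_norm_topology:
  assumes "range u \<subseteq> X" "w \<in> X" and "\<And>e. 0 < e \<Longrightarrow> \<exists>n0. \<forall>n\<ge>n0. N (u n - w) < e"
  shows "limitin (norm_topology X N) u w sequentially"
proof -
  interpret M: Metric_space X dist_N by (rule Metric_space_norm)
  show ?thesis unfolding norm_topology_def M.limitin_metric eventually_sequentially
    using assms by (auto simp: image_subset_iff)
qed

text \<open>By homogeneity it suffices to bound a linear functional on the unit ball.\<close>

lemma dual_spaceI: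
  assumes "\<And>v. v \<notin> X \<Longrightarrow> f v = 0"
    and "\<And>u v. u \<in> X \<Longrightarrow> v \<in> X \<Longrightarrow> f (u + v) = f u + f v"
    and scale: "\<And>c u. u \<in> X \<Longrightarrow> f (c *\<^sub>R u) = c * f u"
    and bound: "\<And>v. v \<in> X \<Longrightarrow> N v \<le> 1 \<Longrightarrow> \<bar>f v\<bar> \<le> C"
  shows "f \<in> dual_space X N"
proof -
  have "\<bar>f v\<bar> \<le> C * N v" if v: "v \<in> X" for v
  proof (cases "N v = 0")
    case True
    then have "v = 0" using N_zero_imp v by blast
    then show ?thesis using scale[OF X_zero, of 0] True by simp
  next
    case False
    then have p: "0 < N v" using N_nonneg[OF v] by simp
    then have "N ((1 / N v) *\<^sub>R v) = 1" using N_scale[OF v] by simp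
    then have "\<bar>f ((1 / N v) *\<^sub>R v)\<bar> \<le> C" using bound X_scale[OF v] by simp
    then show ?thesis using scale[OF v, of "1 / N v"] p by (simp add: abs_mult field_simps)
  qed
  then show ?thesis using assms by (auto simp: dual_space_def)
qed

lemma dual_add: "f \<in> dual_space X N \<Longrightarrow> u \<in> X \<Longrightarrow> v \<in> X \<Longrightarrow> f (u + v) = f u + f v"
  and dual_scale: "f \<in> dual_space X N \<Longrightarrow> u \<in> X \<Longrightarrow> f (c *\<^sub>R u) = c * f u"
  and dual_outside: "f \<in> dual_space X N \<Longrightarrow> u \<notin> X \<Longrightarrow> f u = 0"
  by (auto simp: dual_space_def)

lemma dual_minus: "f \<in> dual_space X N \<Longrightarrow> u \<in> X \<Longrightarrow> f (- u) = - f u"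
  using dual_scale[of f u "-1"] by simp

lemma dual_diff: "f \<in> dual_space X N \<Longrightarrow> u \<in> X \<Longrightarrow> v \<in> X \<Longrightarrow> f (u - v) = f u - f v"
  using dual_add[of f u "- v"] dual_minus[of f v] X_neg by simp

lemma dual_bdd: "f \<in> dual_space X N \<Longrightarrow> bdd_above ((\<lambda>v. \<bar>f v\<bar>) ` {v \<in> X. N v \<le> 1})"
proof -
  assume "f \<in> dual_space X N"
  then obtain C where C: "\<forall>u\<in>X. \<bar>f u\<bar> \<le> C * N u" by (auto simp: dual_space_def)
  have "\<bar>f v\<bar> \<le> \<bar>C\<bar>" if "v \<in> X" "N v \<le> 1" for v
  proof -
    have "\<bar>f v\<bar> \<le> \<bar>C\<bar> * N v" using C that N_nonneg[of v]
        by (meson abs_ge_self mult_right_mono order_trans)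
    also have "\<dots> \<le> \<bar>C\<bar> * 1" using that by (intro mult_left_mono) auto
    finally show ?thesis by simp
  qed
  then show ?thesis by (auto simp: bdd_above_def)
qed

lemma dual_norm_upper: "f \<in> dual_space X N \<Longrightarrow> v \<in> X \<Longrightarrow> N v \<le> 1 \<Longrightarrow> \<bar>f v\<bar> \<le> dual_norm X N f"
  unfolding dual_norm_def by (rule cSUP_upper[OF _ dual_bdd]) auto

lemma dual_norm_least:
  assumes "\<And>v. v \<in> X \<Longrightarrow> N v \<le> 1 \<Longrightarrow> \<bar>f v\<bar> \<le> c"
  shows "dual_norm X N f \<le> c"
proof -
  have "{v \<in> X. N v \<le> 1} \<noteq> {}" using X_zero N_0
      by (metis (mono_tags, lifting) empty_Collect_eq zero_le_one)
  then show ?thesis unfolding dual_norm_def using assms by (intro cSUP_least) auto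
qed

lemma dual_norm_nonneg: "f \<in> dual_space X N \<Longrightarrow> 0 \<le> dual_norm X N f"
  using dual_norm_upper[of f 0] X_zero N_0 by force

lemma dual_norm_bound:
  assumes f: "f \<in> dual_space X N" and v: "v \<in> X"
  shows "\<bar>f v\<bar> \<le> dual_norm X N f * N v"
proof (cases "N v = 0")
  case True
  then have "v = 0" using N_zero_imp v by blast
  then show ?thesis using dual_scale[OF f X_zero, of 0] True by simp
next
  case False
  then have p: "0 < N v" using N_nonneg[OF v] by simp
  then have "N ((1 / N v) *\<^sub>R v) = 1" using N_scale[OF v] by simp
  then have "\<bar>f ((1 / N v) *\<^sub>R v)\<bar> \<le> dual_norm X N f" using dual_norm_upper[OF f X_scale[OF v]] by simp
  then show ?thesis using dual_scale[OF f v, of "1 / N v"] p by (simp add: abs_mult field_simps)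
qed

lemma dual_space_diff:
  assumes f: "f \<in> dual_space X N" and g: "g \<in> dual_space X N"
  shows "f - g \<in> dual_space X N"
proof (rule dual_spaceI)
  fix v assume "v \<in> X" "N v \<le> 1"
  then show "\<bar>(f - g) v\<bar> \<le> dual_norm X N f + dual_norm X N g"
    using dual_norm_upper[OF f, of v] dual_norm_upper[OF g, of v] by simp
qed (simp_all add: dual_add[OF f] dual_add[OF g] dual_scale[OF f] dual_scale[OF g]
    dual_outside[OF f] dual_outside[OF g] algebra_simps)

abbreviation "dual_dist \<equiv> \<lambda>f g. if f \<in> dual_space X N \<and> g \<in> dual_space X N then dual_norm X N (f - g)
    else 0"

lemma Metric_space_dual: "Metric_space (dual_space X N) dual_dist"
proof
  fix f g
  have "dual_norm X N (f - g) = dual_norm X N (g - f)"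
    unfolding dual_norm_def by (simp add: abs_minus_commute)
  then show "dual_dist f g = dual_dist g f" by simp
next
  fix f g assume f: "f \<in> dual_space X N" and g: "g \<in> dual_space X N"
  have "f v = g v" if 0: "dual_norm X N (f - g) = 0" for v
  proof (cases "v \<in> X")
    case True
    then show ?thesis using dual_norm_bound[OF dual_space_diff[OF f g] True] 0 by simp
  next
    case False then show ?thesis by (simp add: dual_outside[OF f] dual_outside[OF g])
  qed
  moreover have "dual_norm X N (f - f) = 0"
    using dual_norm_least[of "f - f" 0] dual_norm_nonneg[OF dual_space_diff[OF f f]] by simp
  ultimately show "(dual_dist f g = 0) = (f = g)" using f g by auto
next
  fix f g h assume f: "f \<in> dual_space X N" and g: "g \<in> dual_space X N" and h: "h \<in> dual_space X N"
  have "dual_norm X N (f - h) \<le> dual_norm X N (f - g) + dual_norm X N (g - h)"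
  proof (rule dual_norm_least)
    fix v assume v: "v \<in> X" "N v \<le> 1"
    show "\<bar>(f - h) v\<bar> \<le> dual_norm X N (f - g) + dual_norm X N (g - h)"
      using dual_norm_upper[OF dual_space_diff[OF f g] v] dual_norm_upper[OF dual_space_diff[OF g h] v]
      by simp
  qed
  then show "dual_dist f h \<le> dual_dist f g + dual_dist g h" using f g h by simp
qed (use dual_norm_nonneg dual_space_diff in auto)

lemma continuous_map_norm_dual:
  "continuous_map (norm_topology X N) (dual_topology X N) A \<longleftrightarrow>
    A ` X \<subseteq> dual_space X N \<and>
    (\<forall>u\<in>X. \<forall>e>0. \<exists>d>0. \<forall>w\<in>X. A ` X \<subseteq> dual_space X N \<longrightarrow> N (u - w) < d \<longrightarrow> dual_norm X N (A u - A w) < e)"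
proof -
  interpret M: Metric_space X dist_N by (rule Metric_space_norm)
  interpret D: Metric_space "dual_space X N" dual_dist by (rule Metric_space_dual)
  show ?thesis unfolding dual_topology_def norm_topology_def M.metric_continuous_map[OF
      Metric_space_dual]
    by (intro conj_cong refl ball_cong all_cong imp_cong ex_cong1) (auto simp: image_subset_iff)
qed

lemma continuous_map_dual_norm:
  "continuous_map (dual_topology X N) (norm_topology X N) B \<longleftrightarrow>
    B ` dual_space X N \<subseteq> X \<and>
    (\<forall>f\<in>dual_space X N. \<forall>e>0. \<exists>d>0. \<forall>g\<in>dual_space X N. B ` dual_space X N \<subseteq> X \<longrightarrow>
       dual_norm X N (f - g) < d \<longrightarrow> N (B f - B g) < e)"
proof -
  interpret M: Metric_space X dist_N by (rule Metric_space_norm)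
  interpret D: Metric_space "dual_space X N" dual_dist by (rule Metric_space_dual)
  show ?thesis unfolding dual_topology_def norm_topology_def D.metric_continuous_map[OF
      Metric_space_norm]
    by (intro conj_cong refl ball_cong all_cong imp_cong ex_cong1) (auto simp: image_subset_iff)
qed

lemma topspace_norm_topology: "topspace (norm_topology X N) = X"
proof -
  interpret M: Metric_space X dist_N by (rule Metric_space_norm)
  show ?thesis by (simp add: norm_topology_def)
qed

lemma topspace_dual_topology: "topspace (dual_topology X N) = dual_space X N"
proof -
  interpret D: Metric_space "dual_space X N" dual_dist by (rule Metric_space_dual)
  show ?thesis by (simp add: dual_topology_def norm_topology_def)
qed

end

text \<open>A convex modular \<open>R\<close> of at most polynomial growth and its Luxemburg norm \<open>N\<close>. The infimum is
  prescribed on \<open>X\<close> only, so that the locale applies to several subspaces with the same function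
  \<open>N\<close>.\<close>

locale luxemburg_norm =
  fixes X :: "'v::real_vector set" and R N :: "'v \<Rightarrow> real" and k :: nat
  assumes X_subspace: "subspace X"
    and R_nonneg: "u \<in> X \<Longrightarrow> 0 \<le> R u"
    and R_zero: "R 0 = 0"
    and R_zero_imp: "u \<in> X \<Longrightarrow> R u = 0 \<Longrightarrow> u = 0"
    and R_minus: "u \<in> X \<Longrightarrow> R (- u) = R u"
    and R_convex: "u \<in> X \<Longrightarrow> v \<in> X \<Longrightarrow> 0 \<le> c \<Longrightarrow> c \<le> 1 \<Longrightarrow>
      R ((1 - c) *\<^sub>R u + c *\<^sub>R v) \<le> (1 - c) * R u + c * R v"
    and R_scale: "u \<in> X \<Longrightarrow> 1 \<le> c \<Longrightarrow> R (c *\<^sub>R u) \<le> c ^ k * R u"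
    and N_eq: "u \<in> X \<Longrightarrow> N u = Inf {l. 0 < l \<and> R ((1 / l) *\<^sub>R u) \<le> 1}"
begin

lemmas scaleX = subspace_scale[OF X_subspace]

lemma R_contract:
  assumes "u \<in> X" "0 \<le> c" "c \<le> 1"
  shows "R (c *\<^sub>R u) \<le> c * R u"
  using R_convex[of 0 u c] assms subspace_0[OF X_subspace] by (simp add: R_zero)

lemma N_le:
  assumes "u \<in> X" "0 < l" "R ((1 / l) *\<^sub>R u) \<le> 1"
  shows "N u \<le> l"
  unfolding N_eq[OF assms(1)] using assms by (intro cInf_lower) (auto intro: bdd_belowI[of _ 0])

lemma N_set_nonempty: "u \<in> X \<Longrightarrow> {l. 0 < l \<and> R ((1 / l) *\<^sub>R u) \<le> 1} \<noteq> {}"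
proof -
  assume u: "u \<in> X"
  define l where "l = max 1 (R u)"
  have "R ((1 / l) *\<^sub>R u) \<le> 1 / l * R u" using R_contract[OF u, of "1/l"] by (simp add: l_def)
  also have "\<dots> \<le> 1" by (simp add: l_def divide_le_eq)
  finally have "l \<in> {l. 0 < l \<and> R ((1 / l) *\<^sub>R u) \<le> 1}" by (simp add: l_def)
  then show ?thesis by blast
qed

lemma nonneg: "u \<in> X \<Longrightarrow> 0 \<le> N u"
  unfolding N_eq using N_set_nonempty by (intro cInf_greatest) auto

text \<open>The infimum that defines the norm ranges over an upward closed set, because \<open>R\<close> is
  nonincreasing under contractions.\<close>

lemma N_less:
  assumes u: "u \<in> X" and l: "N u < l"
  shows "R ((1 / l) *\<^sub>R u) \<le> 1"
proof -
  obtain l' where l': "0 < l'" "R ((1 / l') *\<^sub>R u) \<le> 1" "l' < l"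
    using cInf_lessD[OF N_set_nonempty[OF u], of l] l unfolding N_eq[OF u] by auto
  have "R ((l' / l) *\<^sub>R ((1 / l') *\<^sub>R u)) \<le> l' / l * R ((1 / l') *\<^sub>R u)"
    using l' u by (intro R_contract scaleX) auto
  also have "\<dots> \<le> 1 * 1" using l' R_nonneg[OF scaleX[OF u]] by (intro mult_mono) auto
  finally show ?thesis using l' by simp
qed

lemma R_le_of_N_small:
  assumes u: "u \<in> X" and "N u < l" "l \<le> 1"
  shows "R u \<le> l"
proof -
  have l: "0 < l" using nonneg[OF u] assms by simp
  have "R (l *\<^sub>R ((1 / l) *\<^sub>R u)) \<le> l * R ((1 / l) *\<^sub>R u)"
    using l assms by (intro R_contract scaleX) auto
  also have "\<dots> \<le> l * 1" using N_less[OF assms(1,2)] l by (intro mult_left_mono) auto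
  finally show ?thesis using l by simp
qed

lemma R_le_of_N_bound:
  assumes u: "u \<in> X" and "N u < l" "1 \<le> l"
  shows "R u \<le> l ^ k"
proof -
  have "R (l *\<^sub>R ((1 / l) *\<^sub>R u)) \<le> l ^ k * R ((1 / l) *\<^sub>R u)"
    using assms by (intro R_scale scaleX) auto
  also have "\<dots> \<le> l ^ k * 1" using N_less[OF assms(1,2)] assms by (intro mult_left_mono) auto
  finally show ?thesis using assms by simp
qed

lemma N_scale_le:
  assumes u: "u \<in> X"
  shows "N (c *\<^sub>R u) \<le> \<bar>c\<bar> * N u"
proof (cases "c = 0")
  case True
  have "N 0 \<le> l" if "0 < l" for l using N_le[of 0 l] subspace_0[OF X_subspace] that
      by (simp add: R_zero)
  then have "N 0 \<le> 0" using field_le_epsilon[of "N 0" 0] by simp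
  then show ?thesis using True by simp
next
  case False
  show ?thesis
  proof (rule dense_ge)
    fix y assume y: "\<bar>c\<bar> * N u < y"
    define l where "l = y / \<bar>c\<bar>"
    have l: "N u < l" using y False by (simp add: l_def field_simps)
    then have l0: "0 < l" using nonneg[OF u] by simp
    have "(1 / y) *\<^sub>R (c *\<^sub>R u) = sgn c *\<^sub>R ((1 / l) *\<^sub>R u)"
      using False by (simp add: l_def sgn_if)
    then have "R ((1 / y) *\<^sub>R (c *\<^sub>R u)) = R ((1 / l) *\<^sub>R u)"
      using False R_minus[OF scaleX[OF u, of "1/l"]] by (auto simp: sgn_if)
    then show "N (c *\<^sub>R u) \<le> y"
      using N_less[OF u l] N_le[OF scaleX[OF u, of c], of y] l0 False
          by (simp add: l_def zero_less_divide_iff)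
  qed
qed

text \<open>For the triangle inequality, let \<open>R (u / a) \<le> 1\<close> and \<open>R (v / b) \<le> 1\<close>; then \<open>(u + v) / (a +
  b)\<close> is a convex combination of \<open>u / a\<close> and \<open>v / b\<close>.\<close>

lemma normed: "normed_subspace X N"
proof
  show "subspace X" by (rule X_subspace)
  fix u assume u: "u \<in> X"
  show "0 \<le> N u" by (rule nonneg[OF u])
  show "u = 0" if 0: "N u = 0"
  proof -
    have "R u \<le> 0"
    proof (rule dense_ge)
      fix y :: real assume "0 < y"
      then have "R u \<le> min y 1" using 0 by (intro R_le_of_N_small u) auto
      then show "R u \<le> y" by simp
    qed
    then show ?thesis using R_zero_imp R_nonneg u by force
  qed
  show "N (c *\<^sub>R u) = \<bar>c\<bar> * N u" for c
  proof (cases "c = 0")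
    case True
    then show ?thesis using N_scale_le[OF u, of 0] nonneg[of 0] subspace_0[OF X_subspace] by simp
  next
    case False
    have "N ((1/c) *\<^sub>R (c *\<^sub>R u)) \<le> \<bar>1/c\<bar> * N (c *\<^sub>R u)" by (intro N_scale_le scaleX u)
    then have "\<bar>c\<bar> * N u \<le> N (c *\<^sub>R u)" using False by (simp add: field_simps)
    then show ?thesis using N_scale_le[OF u, of c] by simp
  qed
  fix v assume v: "v \<in> X"
  show "N (u + v) \<le> N u + N v"
  proof (rule dense_ge)
    fix y assume y: "N u + N v < y"
    define e where "e = (y - (N u + N v)) / 2"
    have e: "0 < e" using y by (simp add: e_def)
    \<comment> \<open>Strict upper bounds for the two norms whose sum is exactly \<open>y\<close>.\<close>
    define a b where "a = N u + e" and "b = N v + e"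
    have ab: "N u < a" "N v < b" "a + b = y" using e by (auto simp: a_def b_def e_def field_simps)
    then have p: "0 < a" "0 < b" using nonneg[OF u] nonneg[OF v] by auto
    define c where "c = b / y"
    have c: "0 \<le> c" "c \<le> 1" "1 - c = a / y" using p ab by (auto simp: c_def field_simps)
    have "R ((1 - c) *\<^sub>R ((1 / a) *\<^sub>R u) + c *\<^sub>R ((1 / b) *\<^sub>R v)) \<le>
        (1 - c) * R ((1 / a) *\<^sub>R u) + c * R ((1 / b) *\<^sub>R v)"
      using c u v by (intro R_convex scaleX) auto
    also have "\<dots> \<le> (1 - c) * 1 + c * 1"
      using c N_less u v ab by (intro add_mono mult_left_mono) auto
    also have "(1 - c) *\<^sub>R ((1 / a) *\<^sub>R u) + c *\<^sub>R ((1 / b) *\<^sub>R v) = (1 / y) *\<^sub>R (u + v)"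
      unfolding c(3) using p by (simp add: c_def scaleR_add_right)
    finally show "N (u + v) \<le> y"
      using p ab by (intro N_le subspace_add[OF X_subspace] u v) auto
  qed
qed

end

sublocale luxemburg_norm \<subseteq> normed_subspace X N
  by (rule normed)

section \<open>Monotone operators controlled by a modular\<close>

text \<open>An operator whose continuity and monotonicity are controlled by a second modular \<open>G \<le> R\<close>. In
  the application, \<open>R u\<close> is the modular of \<open>u\<close> plus that of \<open>\<nabla>u\<close>, and \<open>G u\<close> is the modular of
  \<open>\<nabla>u\<close>. The assumptions \<open>A_modulus\<close> and \<open>A_monotone_modulus\<close> are the integrated forms of
  \<open>flux_modulus\<close> and \<open>flux_monotone_modulus\<close>; \<open>J_tangent\<close> says that \<open>A u\<close> is a subgradient of
  \<open>J\<close>.\<close>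

locale modular_operator = luxemburg_norm X R N k
  for X :: "'v::real_vector set" and R N :: "'v \<Rightarrow> real" and k :: nat +
  fixes G J :: "'v \<Rightarrow> real" and A :: "'v \<Rightarrow> 'v \<Rightarrow> real" and a c0 :: real
  assumes G_nonneg: "u \<in> X \<Longrightarrow> 0 \<le> G u"
    and G_le_R: "u \<in> X \<Longrightarrow> G u \<le> R u"
    and G_zero_imp: "u \<in> X \<Longrightarrow> G u = 0 \<Longrightarrow> u = 0"
    and a_gt_1: "1 < a"
    and G_superlinear: "u \<in> X \<Longrightarrow> 1 \<le> c \<Longrightarrow> c powr a * G u \<le> G (c *\<^sub>R u)"
    and G_scale: "u \<in> X \<Longrightarrow> 1 \<le> c \<Longrightarrow> G (c *\<^sub>R u) \<le> c ^ k * G u"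
    and A_outside: "v \<notin> X \<Longrightarrow> A u v = 0"
    and A_add: "u \<in> X \<Longrightarrow> v \<in> X \<Longrightarrow> w \<in> X \<Longrightarrow> A u (v + w) = A u v + A u w"
    and A_scale: "u \<in> X \<Longrightarrow> v \<in> X \<Longrightarrow> A u (c *\<^sub>R v) = c * A u v"
    and c0_nonneg: "0 \<le> c0"
    and A_bound: "u \<in> X \<Longrightarrow> v \<in> X \<Longrightarrow> \<bar>A u v\<bar> \<le> c0 * (G u + G v)"
    and A_modulus: "0 < \<epsilon> \<Longrightarrow> \<exists>C\<ge>0. \<forall>u\<in>X. \<forall>w\<in>X. \<forall>v\<in>X.
      \<bar>A u v - A w v\<bar> \<le> \<epsilon> * (G u + G w + G v) + C * G (u - w)"
    and A_monotone: "u \<in> X \<Longrightarrow> w \<in> X \<Longrightarrow> 0 \<le> A u (u - w) - A w (u - w)"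
    and A_monotone_modulus: "0 < \<epsilon> \<Longrightarrow> \<exists>C\<ge>0. \<forall>u\<in>X. \<forall>w\<in>X.
      G (u - w) \<le> \<epsilon> * G w + C * (A u (u - w) - A w (u - w))"
    and G_le_A: "u \<in> X \<Longrightarrow> G u \<le> A u u"
    and J_tangent: "u \<in> X \<Longrightarrow> w \<in> X \<Longrightarrow> J u + A u (w - u) \<le> J w"
begin

lemma G_bound_of_N: "u \<in> X \<Longrightarrow> N u < l \<Longrightarrow> 1 \<le> l \<Longrightarrow> G u \<le> l ^ k"
  using R_le_of_N_bound G_le_R order_trans by blast

lemma A_unit_ball_bound:
  assumes "u \<in> X" "v \<in> X" "N v \<le> 1"
  shows "\<bar>A u v\<bar> \<le> c0 * (G u + 2 ^ k)"
proof -
  have "G v \<le> 2 ^ k" using assms by (intro G_bound_of_N) auto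
  then have "c0 * (G u + G v) \<le> c0 * (G u + 2 ^ k)" using c0_nonneg by (intro mult_left_mono) auto
  then show ?thesis using A_bound[of u v] assms by simp
qed

lemma A_in_dual: "u \<in> X \<Longrightarrow> A u \<in> dual_space X N"
  by (rule dual_spaceI[of _ "c0 * (G u + 2 ^ k)"])
    (auto simp: A_outside A_add A_scale intro: A_unit_ball_bound)

lemmas A_diff = dual_diff[OF A_in_dual]
  and A_dual_minus = dual_minus[OF A_in_dual]

lemma A_bounded: "bounded_operator X N A"
  unfolding bounded_operator_def
proof (intro allI impI)
  fix B assume B: "B \<subseteq> X" "\<exists>M. \<forall>u\<in>B. N u \<le> M"
  then obtain M where M: "\<And>u. u \<in> B \<Longrightarrow> N u \<le> M" by blast
  define l where "l = max M 1 + 1"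
  have "dual_norm X N (A u) \<le> c0 * (l ^ k + 2 ^ k)" if u: "u \<in> B" for u
  proof (rule dual_norm_least)
    fix v assume v: "v \<in> X" "N v \<le> 1"
    have "G u \<le> l ^ k" using M[OF u] B u by (intro G_bound_of_N) (auto simp: l_def)
    then have "c0 * (G u + 2 ^ k) \<le> c0 * (l ^ k + 2 ^ k)" using c0_nonneg by (intro mult_left_mono) auto
    then show "\<bar>A u v\<bar> \<le> c0 * (l ^ k + 2 ^ k)" using A_unit_ball_bound[of u v] v u B by auto
  qed
  then show "\<exists>M. \<forall>u\<in>B. dual_norm X N (A u) \<le> M" by blast
qed

text \<open>On bounded sets \<open>A_modulus\<close> makes the terms with \<open>\<epsilon>\<close> uniformly small, and the last one is
  controlled by the norm of the difference.\<close>

lemma A_continuous_at: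
  assumes u: "u \<in> X" and e: "0 < e"
  shows "\<exists>d>0. \<forall>w\<in>X. N (u - w) < d \<longrightarrow> dual_norm X N (A u - A w) < e"
proof -
  define B where "B = (N u + 3) ^ k"
  have Nu: "0 \<le> N u" by (rule N_nonneg[OF u])
  have B: "0 \<le> B" using Nu by (simp add: B_def)
  define \<epsilon> where "\<epsilon> = e / (4 * (2 * B + 2 ^ k))"
  have den: "0 < 4 * (2 * B + 2 ^ k)" using B by (simp add: add_nonneg_pos)
  have \<epsilon>: "0 < \<epsilon>" using e den by (simp add: \<epsilon>_def)
  have \<epsilon>B: "\<epsilon> * (B + B + 2 ^ k) = e / 4"
  proof -
    have "\<epsilon> * (4 * (2 * B + 2 ^ k)) = e" using den by (simp add: \<epsilon>_def)
    then show ?thesis by (simp add: algebra_simps)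
  qed
  obtain C where C: "0 \<le> C" "\<And>u w v. u \<in> X \<Longrightarrow> w \<in> X \<Longrightarrow> v \<in> X \<Longrightarrow>
      \<bar>A u v - A w v\<bar> \<le> \<epsilon> * (G u + G w + G v) + C * G (u - w)" using A_modulus[OF \<epsilon>] by blast
  define d where "d = min 1 (e / (4 * (C + 1)))"
  have d: "0 < d" "d \<le> 1" "d \<le> e / (4 * (C + 1))" using e C unfolding d_def by (auto simp: min_def)
  have Cd: "C * d \<le> e / 4"
  proof -
    have "C * d \<le> (C + 1) * (e / (4 * (C + 1)))" using d C by (intro mult_mono) auto
    also have "\<dots> = e / 4" using C by (simp add: field_simps)
    finally show ?thesis .
  qed
  have "dual_norm X N (A u - A w) < e" if w: "w \<in> X" and uw: "N (u - w) < d" for w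
  proof -
    have "dual_norm X N (A u - A w) \<le> e / 2"
    proof (rule dual_norm_least)
      fix v assume v: "v \<in> X" "N v \<le> 1"
      have "N w < N u + 3" using N_le_add_diff[OF u w] uw d by simp
      then have "G u \<le> B" "G w \<le> B" "G v \<le> 2 ^ k"
        unfolding B_def using u w v Nu by (auto intro!: G_bound_of_N)
      then have "\<epsilon> * (G u + G w + G v) \<le> \<epsilon> * (B + B + 2 ^ k)" using \<epsilon>
          by (intro mult_left_mono add_mono) auto
      moreover have "G (u - w) \<le> d"
        using R_le_of_N_small[of "u - w" d] G_le_R[of "u - w"] u w uw d X_diff by simp
      then have "C * G (u - w) \<le> C * d" using C by (intro mult_left_mono) auto
      ultimately show "\<bar>(A u - A w) v\<bar> \<le> e / 2" using C(2)[OF u w v(1)] \<epsilon>B Cd by simp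
    qed
    then show ?thesis using e by simp
  qed
  then show ?thesis using d by blast
qed

lemma A_continuous: "continuous_map (norm_topology X N) (dual_topology X N) A"
  unfolding continuous_map_norm_dual
proof (intro conjI ballI allI impI)
  show "A ` X \<subseteq> dual_space X N" using A_in_dual by auto
  fix u and e :: real assume "u \<in> X" "0 < e"
  then show "\<exists>d>0. \<forall>w\<in>X. A ` X \<subseteq> dual_space X N \<longrightarrow> N (u - w) < d \<longrightarrow> dual_norm X N (A u - A w) < e"
    using A_continuous_at[of u e] by meson
qed

text \<open>If the monotonicity product vanished, \<open>A_monotone_modulus\<close> would give \<open>G (u - w) \<le> \<epsilon> G w\<close>
  for every \<open>\<epsilon>\<close>.\<close>

lemma A_strictly_monotone_pos:
  assumes u: "u \<in> X" and w: "w \<in> X" and ne: "u \<noteq> w"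
  shows "0 < A u (u - w) - A w (u - w)"
proof (rule ccontr)
  assume "\<not> ?thesis"
  then have z: "A u (u - w) - A w (u - w) = 0" using A_monotone[OF u w] by simp
  have "G (u - w) \<le> 0"
  proof (rule dense_ge)
    fix y :: real assume y: "0 < y"
    have Gw: "0 \<le> G w" by (rule G_nonneg[OF w])
    then have "0 < y / (G w + 1)" using y by simp
    then obtain C where "G (u - w) \<le> y / (G w + 1) * G w + C * (A u (u - w) - A w (u - w))"
      using A_monotone_modulus u w by blast
    also have "\<dots> = y * (G w / (G w + 1))" by (simp add: z)
    also have "\<dots> \<le> y * 1" using y Gw by (intro mult_left_mono) auto
    finally show "G (u - w) \<le> y" by simp
  qed
  then show False using G_zero_imp[of "u - w"] G_nonneg[of "u - w"] X_diff[OF u w] ne by simp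
qed

lemma A_strictly_monotone: "strictly_monotone_operator X A"
  unfolding strictly_monotone_operator_def using A_strictly_monotone_pos by simp

end

text \<open>The assumption \<open>poincare\<close> makes \<open>N\<close> equivalent to the Luxemburg norm of \<open>G\<close>.\<close>

locale coercive_modular_operator = modular_operator +
  fixes K :: real
  assumes poincare: "u \<in> X \<Longrightarrow> G u \<le> 1 \<Longrightarrow> R u \<le> K"
    and complete: "range s \<subseteq> X \<Longrightarrow> (\<And>e. 0 < e \<Longrightarrow> \<exists>M. \<forall>i\<ge>M. \<forall>j\<ge>M. N (s i - s j) < e) \<Longrightarrow>
      \<exists>w\<in>X. (\<lambda>i. N (s i - w)) \<longlonglongrightarrow> 0"
begin

definition "K1 = max K 1"

lemma K1: "1 \<le> K1" "K \<le> K1" "0 < K1" by (auto simp: K1_def)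

lemma N_le_K1: "u \<in> X \<Longrightarrow> G u \<le> 1 \<Longrightarrow> N u \<le> K1"
proof (rule N_le)
  assume u: "u \<in> X" and G: "G u \<le> 1"
  have "R ((1 / K1) *\<^sub>R u) \<le> 1 / K1 * R u" using K1 by (intro R_contract u) auto
  also have "\<dots> \<le> 1 / K1 * K1" using poincare[OF u G] K1 by (intro mult_left_mono) auto
  finally show "R ((1 / K1) *\<^sub>R u) \<le> 1" using K1 by simp
qed (use K1 in auto)

lemma N_small_of_G_small:
  assumes e: "0 < e"
  shows "\<exists>d>0. \<forall>u\<in>X. G u < d \<longrightarrow> N u < e"
proof -
  define l where "l = min 1 (e / (2 * K1))"
  have l: "0 < l" "l \<le> 1" "l \<le> e / (2 * K1)" using e K1 unfolding l_def by (auto simp: min_def)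
  have lK: "l * K1 < e"
  proof -
    have "l * K1 \<le> e / (2 * K1) * K1" using l K1 by (intro mult_right_mono) auto
    also have "\<dots> = e / 2" using K1 by simp
    finally show ?thesis using e by simp
  qed
  have "N u < e" if u: "u \<in> X" and G: "G u < l ^ k" for u
  proof -
    have "G ((1 / l) *\<^sub>R u) \<le> (1 / l) ^ k * G u" using l by (intro G_scale u) auto
    also have "\<dots> \<le> (1 / l) ^ k * l ^ k" using l G by (intro mult_left_mono) auto
    also have "\<dots> = 1" using l by (simp add: power_divide)
    finally have "N ((1 / l) *\<^sub>R u) \<le> K1" by (intro N_le_K1 X_scale u)
    then have "N u \<le> l * K1" using N_scale[OF u, of "1/l"] l by (simp add: field_simps)
    then show ?thesis using lK by simp
  qed
  then show ?thesis using l by (intro exI[of _ "l ^ k"]) auto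
qed

text \<open>The modular \<open>G\<close> grows faster than linearly: if \<open>N u > l K1\<close> with \<open>l \<ge> 1\<close>, then \<open>G (u / l) >
  1\<close>, whence \<open>G u \<ge> l\<^sup>a\<close> with \<open>a > 1\<close>.\<close>

lemma G_dominates_N: "\<exists>M>0. \<forall>u\<in>X. M \<le> N u \<longrightarrow> B * N u \<le> G u"
proof -
  define b where "b = max 1 ((2 * K1 * \<bar>B\<bar>) powr (1 / (a - 1)))"
  have b: "1 \<le> b" by (simp add: b_def)
  have "B * N u \<le> G u" if u: "u \<in> X" and M: "2 * K1 * b \<le> N u" for u
  proof -
    define l where "l = N u / (2 * K1)"
    have lb: "b \<le> l" using M K1 by (simp add: l_def field_simps)
    then have l: "1 \<le> l" using b by simp
    have Nl: "N u = 2 * K1 * l" using K1 by (simp add: l_def)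
    have "1 < G ((1 / l) *\<^sub>R u)"
    proof (rule ccontr)
      assume "\<not> ?thesis"
      then have "N ((1 / l) *\<^sub>R u) \<le> K1" by (intro N_le_K1 X_scale u) auto
      then have "N u / l \<le> K1" using N_scale[OF u, of "1/l"] l by simp
      then show False using l K1 by (simp add: Nl)
    qed
    then have "l powr a * 1 \<le> l powr a * G ((1 / l) *\<^sub>R u)" by (intro mult_left_mono) auto
    also have "\<dots> \<le> G (l *\<^sub>R ((1 / l) *\<^sub>R u))" using l by (intro G_superlinear X_scale u) auto
    finally have 1: "l powr a \<le> G u" using l by simp
    have "2 * K1 * \<bar>B\<bar> = ((2 * K1 * \<bar>B\<bar>) powr (1 / (a - 1))) powr (a - 1)"
      using a_gt_1 K1 by (simp add: powr_powr)
    also have "\<dots> \<le> l powr (a - 1)" using a_gt_1 lb by (intro powr_mono2) (auto simp: b_def)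
    finally have "2 * K1 * \<bar>B\<bar> * l \<le> l powr (a - 1) * l" using l by (intro mult_right_mono) auto
    also have "\<dots> = l powr a" using l by (simp add: powr_diff)
    finally have 2: "\<bar>B\<bar> * N u \<le> l powr a" by (simp add: Nl mult_ac)
    have "B * N u \<le> \<bar>B\<bar> * N u" using N_nonneg[OF u] by (intro mult_right_mono) auto
    then show ?thesis using 1 2 by simp
  qed
  then show ?thesis using K1 b by (intro exI[of _ "2 * K1 * b"]) auto
qed

text \<open>The main tool of the locale: on sets where \<open>G\<close> is bounded, a small monotonicity product
  forces proximity in norm.\<close>

lemma N_diff_small_of_monotone_small:
  assumes e: "0 < e" and B: "0 \<le> B"
  shows "\<exists>d>0. \<forall>u\<in>X. \<forall>w\<in>X. G w \<le> B \<longrightarrow> A u (u - w) - A w (u - w) < d \<longrightarrow> N (u - w) < e"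
proof -
  obtain d0 where d0: "0 < d0" "\<And>u. u \<in> X \<Longrightarrow> G u < d0 \<Longrightarrow> N u < e" using N_small_of_G_small[OF e] by blast
  define \<epsilon> where "\<epsilon> = d0 / (2 * (B + 1))"
  have \<epsilon>: "0 < \<epsilon>" using d0 B by (simp add: \<epsilon>_def)
  obtain C where C: "0 \<le> C" "\<And>u w. u \<in> X \<Longrightarrow> w \<in> X \<Longrightarrow>
      G (u - w) \<le> \<epsilon> * G w + C * (A u (u - w) - A w (u - w))" using A_monotone_modulus[OF \<epsilon>] by blast
  define d where "d = d0 / (2 * (C + 1))"
  have d: "0 < d" using d0 C by (simp add: d_def)
  have "N (u - w) < e" if u: "u \<in> X" and w: "w \<in> X" and G: "G w \<le> B"
      and D: "A u (u - w) - A w (u - w) < d" for u w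
  proof (rule d0(2)[OF X_diff[OF u w]])
    have "\<epsilon> * G w \<le> \<epsilon> * B" using G \<epsilon> by (intro mult_left_mono) auto
    also have "\<dots> < \<epsilon> * (B + 1)" using \<epsilon> by simp
    also have "\<dots> = d0 / 2"
    proof -
      have "\<epsilon> * (2 * (B + 1)) = d0" using B by (intro nonzero_eq_divide_eq[THEN iffD1, OF _ \<epsilon>_def]) simp
      then show ?thesis by (simp add: algebra_simps)
    qed
    finally have 1: "\<epsilon> * G w < d0 / 2" .
    have "C * (A u (u - w) - A w (u - w)) \<le> (C + 1) * d" using D C A_monotone[OF u w] d
        by (intro mult_mono) auto
    also have "\<dots> = d0 / 2"
    proof -
      have "d * (2 * (C + 1)) = d0" using C(1)
          by (intro nonzero_eq_divide_eq[THEN iffD1, OF _ d_def]) simp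
      then show ?thesis by (simp add: algebra_simps)
    qed
    finally show "G (u - w) < d0" using C(2)[OF u w] 1 by simp
  qed
  then show ?thesis using d by blast
qed

lemma A_coercive: "coercive_operator X N A"
  unfolding coercive_operator_def filterlim_at_top eventually_inf_principal eventually_filtercomap
proof
  fix Z
  obtain M where M: "0 < M" "\<And>u. u \<in> X \<Longrightarrow> M \<le> N u \<Longrightarrow> Z * N u \<le> G u" using G_dominates_N[of Z] by blast
  have "Z \<le> A u u / N u" if "u \<in> X" "M \<le> N u" for u
    using M that G_le_A[of u] order_trans[of "Z * N u" "G u" "A u u"] by (simp add: le_divide_eq)
  then show "\<exists>P. eventually P at_top \<and> (\<forall>x. P (N x) \<longrightarrow> x \<in> X \<longrightarrow> Z \<le> A x x / N x)"
    by (intro exI[of _ "\<lambda>y. M \<le> y"]) (auto simp: eventually_ge_at_top)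
qed

text \<open>Weak convergence is used only through the functional \<open>A w\<close>: it turns the hypothesis on \<open>A
  (u\<^sub>n)\<close> into smallness of the monotonicity product.\<close>

lemma A_S_plus: "S_plus_operator X N A"
  unfolding S_plus_operator_def
proof (intro allI impI)
  fix u w assume "weakly_converges X N u w \<and> limsup (\<lambda>n. ereal (A (u n) (u n - w))) \<le> 0"
  then have rX: "range u \<subseteq> X" and w: "w \<in> X" and weak: "\<And>f. f \<in> dual_space X N \<Longrightarrow> (\<lambda>n. f (u n)) \<longlonglongrightarrow> f w"
    and ls: "limsup (\<lambda>n. ereal (A (u n) (u n - w))) \<le> 0" by (auto simp: weakly_converges_def)
  have uX: "u n \<in> X" for n using rX by auto
  show "limitin (norm_topology X N) u w sequentially"
  proof (rule limitin_norm_topology[OF rX w])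
    fix e :: real assume e: "0 < e"
    obtain d where d: "0 < d" "\<And>u. u \<in> X \<Longrightarrow> A u (u - w) - A w (u - w) < d \<Longrightarrow> N (u - w) < e"
      using N_diff_small_of_monotone_small[OF e G_nonneg[OF w]] w by blast
    have "limsup (\<lambda>n. ereal (A (u n) (u n - w))) < ereal (d / 2)" using ls d
      by (metis half_gt_zero order_le_less_trans ereal_less(2))
    then have "eventually (\<lambda>n. ereal (A (u n) (u n - w)) < ereal (d / 2)) sequentially"
      by (rule Limsup_lessD)
    moreover have "eventually (\<lambda>n. \<bar>A w (u n) - A w w\<bar> < d / 2) sequentially"
      using weak[OF A_in_dual[OF w]] d unfolding tendsto_iff dist_real_def by (metis half_gt_zero)
    ultimately have "eventually (\<lambda>n. N (u n - w) < e) sequentially"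
    proof eventually_elim
      case (elim n)
      have "A w (u n - w) = A w (u n) - A w w" by (rule A_diff[OF w uX w])
      moreover have "A (u n) (u n - w) < d / 2" "- (d / 2) < A w (u n) - A w w"
        using elim by (simp_all only: ereal_less_eq less_ereal.simps abs_less_iff) linarith
      ultimately show ?case by (intro d(2) uX) linarith
    qed
    then show "\<exists>n0. \<forall>n\<ge>n0. N (u n - w) < e" by (simp add: eventually_sequentially)
  qed
qed

text \<open>Two tangent inequalities, at \<open>0\<close> and at \<open>u / 2\<close>, bound the energy from below by the modular
  of \<open>u / 2\<close>, up to a linear term.\<close>

lemma J_lower:
  assumes u: "u \<in> X"
  shows "J 0 - dual_norm X N (A 0) * N u + G ((1/2) *\<^sub>R u) \<le> J u"
proof -
  define m where "m = (1/2::real) *\<^sub>R u"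
  have m: "m \<in> X" using X_scale[OF u] by (simp add: m_def)
  have um: "u - m = m" using scaleR_add_left[of "1/2" "1/2" u] by (simp add: m_def algebra_simps)
  have "J m + A m m \<le> J u" using J_tangent[OF m u] um by simp
  moreover have "G m \<le> A m m" by (rule G_le_A[OF m])
  moreover have "J 0 + A 0 m \<le> J m" using J_tangent[OF X_zero m] by simp
  moreover have "\<bar>A 0 m\<bar> \<le> dual_norm X N (A 0) * N m"
      by (rule dual_norm_bound[OF A_in_dual[OF X_zero] m])
  moreover have "dual_norm X N (A 0) * N m \<le> dual_norm X N (A 0) * N u"
    using dual_norm_nonneg[OF A_in_dual[OF X_zero]] N_nonneg[OF u] N_scale[OF u, of "1/2"]
    by (intro mult_left_mono) (auto simp: m_def)
  ultimately show ?thesis unfolding m_def[symmetric] by linarith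
qed

text \<open>With \<open>m\<close> the midpoint of \<open>u\<close> and \<open>v\<close>, the tangent inequalities from \<open>m\<close> to \<open>m + h\<close>, from \<open>m
  + h\<close> to \<open>u\<close> and from \<open>m\<close> to \<open>v\<close> add up; here \<open>u = m + 2 h\<close> and \<open>v = m - 2 h\<close>. The convexity
  defect thus dominates a monotonicity product at the points \<open>m + h\<close> and \<open>m\<close>.\<close>

lemma midpoint_gap:
  assumes u: "u \<in> X" and v: "v \<in> X"
  defines "m \<equiv> (1/2) *\<^sub>R (u + v)" and "h \<equiv> (1/4) *\<^sub>R (u - v)"
  shows "A (m + h) h - A m h \<le> J u + J v - 2 * J m"
proof -
  have mX: "m \<in> X" and hX: "h \<in> X" using u v X_add X_diff X_scale by (auto simp: m_def h_def)
  have um: "u - (m + h) = h" "v - m = (-2) *\<^sub>R h" 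
    by (simp_all add: m_def h_def algebra_simps flip: scaleR_add_left scaleR_left_diff_distrib)
  have "J (m + h) + A (m + h) h \<le> J u" using J_tangent[OF X_add[OF mX hX] u] um by simp
  moreover have "J m + A m h \<le> J (m + h)" using J_tangent[OF mX X_add[OF mX hX]] by simp
  moreover have "J m + A m ((-2) *\<^sub>R h) \<le> J v" using J_tangent[OF mX v] um by simp
  then have "J m - 2 * A m h \<le> J v" using A_scale[OF mX hX, of "-2"] by simp
  ultimately show ?thesis by linarith
qed

lemma functional_coercive:
  assumes f: "f \<in> dual_space X N"
  obtains M where "0 < M" "\<And>u. u \<in> X \<Longrightarrow> M \<le> N u \<Longrightarrow> J 0 + N u \<le> J u - f u"
    "bdd_below ((\<lambda>u. J u - f u) ` X)"
proof -
  define L where "L = dual_norm X N (A 0) + dual_norm X N f"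
  have nn: "0 \<le> dual_norm X N (A 0)" "0 \<le> dual_norm X N f"
    using dual_norm_nonneg A_in_dual[OF X_zero] f by auto
  have low: "J 0 + G ((1/2) *\<^sub>R u) - L * N u \<le> J u - f u" if u: "u \<in> X" for u
    using J_lower[OF u] dual_norm_bound[OF f u] by (simp add: L_def algebra_simps)
  obtain M where M: "0 < M" "\<And>u. u \<in> X \<Longrightarrow> M \<le> N u \<Longrightarrow> (2 * L + 2) * N u \<le> G u"
    using G_dominates_N[of "2 * L + 2"] by blast
  have big: "J 0 + N u \<le> J u - f u" if u: "u \<in> X" "2 * M \<le> N u" for u
  proof -
    have "(2 * L + 2) * N ((1/2) *\<^sub>R u) \<le> G ((1/2) *\<^sub>R u)"
      using N_scale[OF u(1), of "1/2"] u by (intro M(2) X_scale) auto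
    then have "(L + 1) * N u \<le> G ((1/2) *\<^sub>R u)" using N_scale[OF u(1), of "1/2"]
        by (simp add: algebra_simps)
    then show ?thesis using low[OF u(1)] by (simp add: algebra_simps)
  qed
  have "min (J 0) (J 0 - L * (2 * M)) \<le> J u - f u" if u: "u \<in> X" for u
  proof (cases "2 * M \<le> N u")
    case True then show ?thesis using big[OF u] N_nonneg[OF u] by simp
  next
    case False
    then have "L * N u \<le> L * (2 * M)" using nn by (intro mult_left_mono) (auto simp: L_def)
    then show ?thesis using low[OF u] G_nonneg[OF X_scale[OF u, of "1/2"]] by simp
  qed
  then have "bdd_below ((\<lambda>u. J u - f u) ` X)" by (intro bdd_belowI2)
  then show ?thesis using that[of "2 * M"] big M by simp
qed

text \<open>The direct method without weak compactness. Along a minimising sequence the convexity defect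
  tends to zero, so by \<open>midpoint_gap\<close> and \<open>N_diff_small_of_monotone_small\<close> the sequence is Cauchy.
  At its limit the tangent inequality gives lower semicontinuity.\<close>

lemma minimizer_exists:
  assumes f: "f \<in> dual_space X N"
  shows "\<exists>w\<in>X. \<forall>u\<in>X. J w - f w \<le> J u - f u"
proof -
  define I where "I = (\<lambda>u. J u - f u)"
  obtain M where M: "0 < M" "\<And>u. u \<in> X \<Longrightarrow> M \<le> N u \<Longrightarrow> J 0 + N u \<le> I u" and bdd: "bdd_below (I ` X)"
    by (rule functional_coercive[OF f]) (rule that[unfolded I_def], assumption+)
  define i where "i = Inf (I ` X)"
  have i_le: "i \<le> I u" if "u \<in> X" for u unfolding i_def using bdd that by (intro cInf_lower) auto
  have "\<exists>u\<in>X. I u < i + 1 / real (Suc n)" for n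
  proof -
    have "Inf (I ` X) < i + 1 / real (Suc n)" by (simp add: i_def)
    then show ?thesis using cInf_lessD[of "I ` X"] X_zero by fast
  qed
  then obtain s where s: "\<And>n. s n \<in> X" "\<And>n. I (s n) < i + 1 / real (Suc n)" by metis
  \<comment> \<open>A common bound for the norms of the minimising sequence, by coercivity.\<close>
  define l where "l = max M (i + 1 - J 0) + 1"
  have l: "1 \<le> l" using M by (simp add: l_def)
  have sl: "N (s n) < l" for n
  proof (cases "M \<le> N (s n)")
    case True
    have "1 / real (Suc n) \<le> 1" by simp
    then have "N (s n) \<le> i + 1 - J 0" using M(2)[OF s(1) True] s(2)[of n] by linarith
    then show ?thesis by (simp add: l_def)
  qed (simp add: l_def)
  have cauchy: "\<exists>n0. \<forall>m\<ge>n0. \<forall>n\<ge>n0. N (s m - s n) < e" if e: "0 < e" for e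
  proof -
    obtain d where d: "0 < d" "\<And>u w. u \<in> X \<Longrightarrow> w \<in> X \<Longrightarrow> G w \<le> l ^ k \<Longrightarrow>
        A u (u - w) - A w (u - w) < d \<Longrightarrow> N (u - w) < e / 4"
      using N_diff_small_of_monotone_small[of "e / 4" "l ^ k"] e l by auto
    obtain n0 where n0: "1 / real (Suc n0) < d / 2" using d nat_approx_posE[of "d / 2"] by auto
    have "N (s m - s n) < e" if "m \<ge> n0" "n \<ge> n0" for m n
    proof -
      define z h where "z = (1/2) *\<^sub>R (s m + s n)" and "h = (1/4) *\<^sub>R (s m - s n)"
      have zh: "z \<in> X" "h \<in> X" using s X_add X_diff X_scale by (auto simp: z_def h_def)
      have "N z \<le> 1/2 * (N (s m) + N (s n))"
        using N_scale[OF X_add[OF s(1) s(1)], of "1/2" m n] N_triangle[OF s(1) s(1), of m n]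
            by (simp add: z_def)
      then have "N z < l" using sl[of m] sl[of n] by simp
      then have Gz: "G z \<le> l ^ k" using l zh by (intro G_bound_of_N) auto
      have small: "I (s j) < i + d / 2" if "j \<ge> n0" for j
      proof -
        have "1 / real (Suc j) \<le> 1 / real (Suc n0)" using that by (simp add: frac_le)
        then show ?thesis using s(2)[of j] n0 by linarith
      qed
      have fz: "f (s m) + f (s n) = 2 * f z"
        using dual_add[OF f s(1) s(1), of m n] dual_scale[OF f X_add[OF s(1) s(1)], of "1/2" m n]
            by (simp add: z_def)
      have "A (z + h) h - A z h \<le> J (s m) + J (s n) - 2 * J z"
        using midpoint_gap[OF s(1) s(1), of m n] by (simp add: z_def h_def)
      also have "\<dots> = I (s m) + I (s n) - 2 * I z" using fz by (simp add: I_def)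
      also have "\<dots> < d" using small[of m] small[of n] i_le[OF zh(1)] that by simp
      finally have "N h < e / 4" using d(2)[OF X_add[OF zh] zh(1) Gz] by simp
      then show ?thesis using N_scale[OF X_diff[OF s(1) s(1)], of "1/4" m n] by (simp add: h_def)
    qed
    then show ?thesis by blast
  qed
  obtain w where w: "w \<in> X" and lim: "(\<lambda>n. N (s n - w)) \<longlonglongrightarrow> 0"
    using complete[of s] s(1) cauchy by blast
  define c where "c = dual_norm X N (A w) + dual_norm X N f"
  have le: "I w \<le> i + 1 / real (Suc n) + c * N (s n - w)" for n
  proof -
    have "J w + A w (s n - w) \<le> J (s n)" by (rule J_tangent[OF w s(1)])
    moreover have "\<bar>A w (s n - w)\<bar> \<le> dual_norm X N (A w) * N (s n - w)"
      by (intro dual_norm_bound A_in_dual w X_diff s)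
    moreover have "\<bar>f (s n - w)\<bar> \<le> dual_norm X N f * N (s n - w)"
      by (intro dual_norm_bound f w X_diff s)
    moreover have "f (s n - w) = f (s n) - f w" by (rule dual_diff[OF f s(1) w])
    moreover have "c * N (s n - w) = dual_norm X N (A w) * N (s n - w) + dual_norm X N f * N (s n - w)"
      by (simp add: c_def distrib_right)
    ultimately show ?thesis using s(2)[of n] unfolding I_def by linarith
  qed
  have "(\<lambda>n. i + 1 / real (Suc n) + c * N (s n - w)) \<longlonglongrightarrow> i + 0 + c * 0"
    by (intro tendsto_intros lim LIMSEQ_Suc[OF lim_inverse_n'])
  then have "I w \<le> i" using le by (intro LIMSEQ_le_const[of _ "i"]) auto
  then have "\<forall>u\<in>X. J w - f w \<le> J u - f u" using i_le unfolding I_def by (meson order_trans)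
  then show ?thesis using w by blast
qed

text \<open>The Euler equation at a minimiser \<open>w\<close>. Instead of differentiating \<open>J\<close>, the tangent
  inequality at \<open>w + t v\<close> is used: together with minimality it gives \<open>f v \<le> A (w + t v) v\<close> for \<open>t
  > 0\<close>, and continuity of \<open>A\<close> allows \<open>t\<close> to tend to \<open>0\<close>. Applying this to \<open>v\<close> and \<open>- v\<close> gives
  equality.\<close>

lemma A_surj:
  assumes f: "f \<in> dual_space X N"
  shows "\<exists>w\<in>X. A w = f"
proof -
  obtain w where w: "w \<in> X" and min: "\<And>u. u \<in> X \<Longrightarrow> J w - f w \<le> J u - f u"
    using minimizer_exists[OF f] by blast
  have ge: "f v \<le> A w v" if v: "v \<in> X" for v
  proof (rule field_le_epsilon)
    fix e :: real assume e: "0 < e"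
    obtain d where d: "0 < d" "\<And>z. z \<in> X \<Longrightarrow> N (w - z) < d \<Longrightarrow> dual_norm X N (A w - A z) < e / (N v + 1)"
      using A_continuous_at[OF w, of "e / (N v + 1)"] e N_nonneg[OF v] by auto
    define t where "t = d / (N v + 1) / 2"
    have t: "0 < t" using d N_nonneg[OF v] by (simp add: t_def)
    define z where "z = w + t *\<^sub>R v"
    have z: "z \<in> X" using X_add[OF w X_scale[OF v]] by (simp add: z_def)
    have "N (w - z) = t * N v" using N_scale[OF v, of "-t"] t by (simp add: z_def)
    also have "\<dots> \<le> t * (N v + 1)" using t by simp
    also have "\<dots> = d / 2" 
    proof -
      have "N v + 1 \<noteq> 0" using N_nonneg[OF v] by simp
      then have "d / (N v + 1) * (N v + 1) = d" by (rule nonzero_eq_divide_eq[THEN iffD1, OF _ refl])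
      then show ?thesis by (simp only: t_def times_divide_eq_left)
    qed
    also have "\<dots> < d" using d by simp
    finally have dz: "dual_norm X N (A w - A z) < e / (N v + 1)" using d(2) z by simp
    have "J z + A z (w - z) \<le> J w" by (rule J_tangent[OF z w])
    moreover have "w - z = (- t) *\<^sub>R v" by (simp add: z_def)
    then have "A z (w - z) = - t * A z v" using A_scale[OF z v, of "- t"] by simp
    moreover have "f z = f w + t * f v"
      unfolding z_def using dual_add[OF f w X_scale[OF v]] dual_scale[OF f v] by simp
    ultimately have "t * f v \<le> t * A z v" using min[OF z] by simp
    then have "f v \<le> A z v" using t by simp
    moreover have "\<bar>(A w - A z) v\<bar> \<le> dual_norm X N (A w - A z) * N v"
      by (intro dual_norm_bound dual_space_diff A_in_dual w z v)
    moreover have "dual_norm X N (A w - A z) * N v \<le> e / (N v + 1) * (N v + 1)"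
      using dz N_nonneg[OF v] dual_norm_nonneg[OF dual_space_diff[OF A_in_dual[OF w] A_in_dual[OF z]]]
      by (intro mult_mono) auto
    moreover have "e / (N v + 1) * (N v + 1) = e" using N_nonneg[OF v] by simp
    ultimately show "f v \<le> A w v + e" by simp
  qed
  have "A w v = f v" for v
  proof (cases "v \<in> X")
    case True
    then show ?thesis using ge[OF True] ge[OF X_neg[OF True]] dual_minus[OF f True] A_dual_minus[OF w
        True] by simp
  next
    case False then show ?thesis using dual_outside[OF f] A_outside by simp
  qed
  then show ?thesis using w by blast
qed

lemma A_inj: "inj_on A X"
proof (rule inj_onI, rule ccontr)
  fix u w assume "u \<in> X" "w \<in> X" "A u = A w" "u \<noteq> w"
  then show False using A_strictly_monotone_pos[of u w] by simp
qed

text \<open>If \<open>A u\<close> is close to \<open>A w\<close>, the monotonicity product is at most a small multiple of \<open>N (u -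
  w)\<close>. Since \<open>G\<close> grows faster than linearly, this first bounds \<open>N (u - w)\<close>, and then makes the
  product small.\<close>

lemma A_inverse_continuous_at:
  assumes w: "w \<in> X" and e: "0 < e"
  shows "\<exists>d>0. \<forall>u\<in>X. dual_norm X N (A w - A u) < d \<longrightarrow> N (w - u) < e"
proof -
  obtain C where C: "0 \<le> C" "\<And>u. u \<in> X \<Longrightarrow> G (u - w) \<le> 1 * G w + C * (A u (u - w) - A w (u - w))"
    using A_monotone_modulus[of 1] w by auto
  obtain M where M: "0 < M" "\<And>u. u \<in> X \<Longrightarrow> M \<le> N u \<Longrightarrow> 2 * N u \<le> G u" using G_dominates_N[of 2] by blast
  obtain d0 where d0: "0 < d0" "\<And>u. u \<in> X \<Longrightarrow> A u (u - w) - A w (u - w) < d0 \<Longrightarrow> N (u - w) < e"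
    using N_diff_small_of_monotone_small[OF e G_nonneg[OF w]] w by blast
  define B where "B = max M (G w)"
  have B: "0 < B" using M by (simp add: B_def)
  define d where "d = min (1 / (C + 1)) (d0 / B)"
  have d: "0 < d" using C d0 B by (simp add: d_def)
  have "N (w - u) < e" if u: "u \<in> X" and uw: "dual_norm X N (A w - A u) < d" for u
  proof -
    define z where "z = u - w"
    have z: "z \<in> X" using X_diff[OF u w] by (simp add: z_def)
    have Nz: "0 \<le> N z" by (rule N_nonneg[OF z])
    have nn: "0 \<le> dual_norm X N (A w - A u)" by (intro dual_norm_nonneg dual_space_diff A_in_dual u w)
    have "\<bar>(A w - A u) z\<bar> \<le> dual_norm X N (A w - A u) * N z"
      by (intro dual_norm_bound dual_space_diff A_in_dual u w z)
    then have D: "A u z - A w z \<le> dual_norm X N (A w - A u) * N z" by simp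
    have NB: "N z \<le> B"
    proof (cases "M \<le> N z")
      case True
      have "C * (A u z - A w z) \<le> C * (dual_norm X N (A w - A u) * N z)" using D C
          by (intro mult_left_mono) auto
      also have "\<dots> \<le> C * (1 / (C + 1) * N z)" using uw C Nz
          by (intro mult_left_mono mult_right_mono) (auto simp: d_def)
      also have "\<dots> \<le> 1 * N z" using C Nz mult_right_mono[of "C / (C + 1)" 1 "N z"] by simp
      finally have "2 * N z \<le> G w + N z" using C(2)[OF u] M(2)[OF z True] by (simp add: z_def)
      then show ?thesis by (simp add: B_def)
    qed (simp add: B_def)
    have "dual_norm X N (A w - A u) * N z \<le> dual_norm X N (A w - A u) * B" using NB nn
        by (intro mult_left_mono)
    also have "\<dots> < d0 / B * B" using uw B by (intro mult_strict_right_mono) (auto simp: d_def)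
    also have "\<dots> = d0" using B by simp
    finally have "N (u - w) < e" using d0(2)[OF u] D by (simp add: z_def)
    then show ?thesis using N_minus_commute[OF u w] by simp
  qed
  then show ?thesis using d by blast
qed

lemma A_homeomorphic: "homeomorphic_map (norm_topology X N) (dual_topology X N) A"
proof -
  define B where "B = inv_into X A"
  have AB: "A (B f) = f" "B f \<in> X" if "f \<in> dual_space X N" for f
  proof -
    have "f \<in> A ` X" using A_surj[OF that] by blast
    then show "A (B f) = f" "B f \<in> X" unfolding B_def by (rule f_inv_into_f, rule inv_into_into)
  qed
  have BA: "B (A u) = u" if "u \<in> X" for u unfolding B_def using A_inj that by simp
  have "continuous_map (dual_topology X N) (norm_topology X N) B"
    unfolding continuous_map_dual_norm
  proof (intro conjI ballI allI impI)
    fix f and e :: real assume f: "f \<in> dual_space X N" and "0 < e"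
    then obtain d where "0 < d" "\<And>u. u \<in> X \<Longrightarrow> dual_norm X N (A (B f) - A u) < d \<Longrightarrow> N (B f - u) < e"
      using A_inverse_continuous_at[of "B f" e] AB by blast
    then show "\<exists>d>0. \<forall>g\<in>dual_space X N. B ` dual_space X N \<subseteq> X \<longrightarrow> dual_norm X N (f - g) < d \<longrightarrow>
        N (B f - B g) < e"
      using AB f by metis
  qed (use AB in auto)
  then have "homeomorphic_maps (norm_topology X N) (dual_topology X N) A B"
    unfolding homeomorphic_maps_def topspace_norm_topology topspace_dual_topology
    using A_continuous AB BA by auto
  then show ?thesis using homeomorphic_map_maps by blast
qed

end

section \<open>Smooth test functions\<close>

text \<open>Smoothness can be checked with any explicit formula for the derivative.\<close>

lemma C_k_SucI:
  assumes "\<And>x. (f has_derivative D x) (at x)" and "\<And>i. i \<in> Basis \<Longrightarrow> C_k k (\<lambda>x. D x i)"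
  shows "C_k (Suc k) f"
proof -
  have "frechet_derivative f (at x) = D x" for x
    using frechet_derivative_at[OF assms(1)] by metis
  then show ?thesis using assms by (auto simp: differentiable_def)
qed

lemma C_k_SucD:
  assumes "C_k (Suc k) f"
  shows "(f has_derivative frechet_derivative f (at x)) (at x)"
    and "i \<in> Basis \<Longrightarrow> C_k k (\<lambda>x. frechet_derivative f (at x) i)"
  using assms frechet_derivative_works by auto

lemma C_k_continuous: "C_k k f \<Longrightarrow> continuous_on UNIV f"
  by (cases k) (auto simp: differentiable_imp_continuous_within continuous_on_eq_continuous_within)

lemma C_k_lower: "C_k (Suc k) f \<Longrightarrow> C_k k f"
proof (induction k arbitrary: f)
  case 0 then show ?case using C_k_continuous[of "Suc 0" f] by simp
next
  case (Suc k) 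
  show ?case using C_k_SucD[OF Suc.prems] Suc.IH by (intro C_k_SucI) auto
qed

lemma C_k_const: "C_k k (\<lambda>x. c)"
  by (induction k arbitrary: c) (auto simp: continuous_on_const intro: C_k_SucI)

lemma C_k_add: "C_k k f \<Longrightarrow> C_k k g \<Longrightarrow> C_k k (\<lambda>x. f x + g x)"
proof (induction k arbitrary: f g)
  case 0 then show ?case by (simp add: continuous_on_add)
next
  case (Suc k)
  show ?case using C_k_SucD[OF Suc.prems(1)] C_k_SucD[OF Suc.prems(2)]
    by (intro C_k_SucI[where D = "\<lambda>x h. frechet_derivative f (at x) h + frechet_derivative g (at x) h"]
        Suc.IH)
      (auto intro: has_derivative_add)
qed

lemma C_k_mult: "C_k k f \<Longrightarrow> C_k k g \<Longrightarrow> C_k k (\<lambda>x. f x * g x)"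
proof (induction k arbitrary: f g)
  case 0 then show ?case by (simp add: continuous_on_mult)
next
  case (Suc k)
  show ?case 
    using C_k_SucD[OF Suc.prems(1)] C_k_SucD[OF Suc.prems(2)] C_k_lower[OF Suc.prems(1)] C_k_lower[OF
        Suc.prems(2)]
    by (intro C_k_SucI[where D = "\<lambda>x h. f x * frechet_derivative g (at x) h +
        frechet_derivative f (at x) h * g x"]
        C_k_add Suc.IH)
      (auto intro: has_derivative_mult)
qed

lemma C_k_prod: "finite I \<Longrightarrow> (\<And>i. i \<in> I \<Longrightarrow> C_k k (f i)) \<Longrightarrow> C_k k (\<lambda>x. \<Prod>i\<in>I. f i x)"
  by (induction I rule: finite_induct) (auto intro: C_k_const C_k_mult)

lemma test_functions_add: "\<phi> \<in> test_functions \<Omega> \<Longrightarrow> \<psi> \<in> test_functions \<Omega> \<Longrightarrow> (\<lambda>x. \<phi> x +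
    \<psi> x) \<in> test_functions \<Omega>"
proof -
  assume a: "\<phi> \<in> test_functions \<Omega>" "\<psi> \<in> test_functions \<Omega>"
  have sub: "{x. \<phi> x + \<psi> x \<noteq> 0} \<subseteq> {x. \<phi> x \<noteq> 0} \<union> {x. \<psi> x \<noteq> 0}" by auto
  then have "closure {x. \<phi> x + \<psi> x \<noteq> 0} \<subseteq> closure {x. \<phi> x \<noteq> 0} \<union> closure {x. \<psi> x \<noteq> 0}"
    using closure_mono[OF sub] by (simp add: closure_Un)
  moreover have "compact (closure {x. \<phi> x \<noteq> 0} \<union> closure {x. \<psi> x \<noteq> 0})"
    using a by (auto simp: test_functions_def)
  ultimately have "compact (closure {x. \<phi> x + \<psi> x \<noteq> 0})" "closure {x. \<phi> x + \<psi> x \<noteq> 0} \<subseteq> \<Omega>"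
    using a by (meson bounded_subset closed_closure compact_eq_bounded_closed)
      (use \<open>closure {x. \<phi> x + \<psi> x \<noteq> 0} \<subseteq> _\<close> a in \<open>auto simp: test_functions_def\<close>)
  then show ?thesis using a by (simp add: test_functions_def C_k_add)
qed

lemma test_functions_cmult: "\<phi> \<in> test_functions \<Omega> \<Longrightarrow> (\<lambda>x. c * \<phi> x) \<in> test_functions \<Omega>"
  by (cases "c = 0") (auto simp: test_functions_def C_k_const C_k_mult)

text \<open>The functions \<open>exp (- 1 / t) / t\<^sup>j\<close> on the positive half-line, extended by zero. Their span
  is closed under differentiation (\<open>flat_exp_has_derivative\<close>), which makes all of them smooth.\<close>

definition flat_exp :: "nat \<Rightarrow> real \<Rightarrow> real" where
  "flat_exp j t = (if 0 < t then exp (- (1 / t)) / t ^ j else 0)"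

lemma flat_exp_tendsto_0: "(flat_exp j \<longlongrightarrow> 0) (at 0)"
proof -
  have "((\<lambda>t. (inverse t) ^ j / exp (inverse t)) \<longlongrightarrow> (0::real)) (at_right 0)"
    by (rule filterlim_compose[OF tendsto_power_div_exp_0 filterlim_inverse_at_top_right])
  moreover have "\<forall>\<^sub>F t in at_right 0. (inverse t) ^ j / exp (inverse t) = flat_exp j t"
    by (auto simp: eventually_at_filter flat_exp_def exp_minus field_simps)
  ultimately have r: "(flat_exp j \<longlongrightarrow> 0) (at_right 0)" by (rule Lim_transform_eventually)
  have "\<forall>\<^sub>F t in at_left 0. 0 = flat_exp j t"
    by (auto simp: eventually_at_filter flat_exp_def)
  then have l: "(flat_exp j \<longlongrightarrow> 0) (at_left 0)" by (rule Lim_transform_eventually[OF tendsto_const])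
  show ?thesis using l r by (simp add: filterlim_split_at)
qed

lemma flat_exp_has_derivative:
  "(flat_exp j has_real_derivative (flat_exp (j + 2) t - real j * flat_exp (j + 1) t)) (at t)"
proof (cases "t = 0")
  case True
  have "(\<lambda>h. (flat_exp j (0 + h) - flat_exp j 0) / h) = flat_exp (Suc j)"
    by (auto simp: flat_exp_def fun_eq_iff)
  then have "(\<lambda>h. (flat_exp j (0 + h) - flat_exp j 0) / h) \<midarrow>0\<rightarrow> 0" using flat_exp_tendsto_0[of "Suc j"]
      by (simp only:)
  then have "(flat_exp j has_real_derivative 0) (at 0)" by (simp add: DERIV_def)
  then show ?thesis using True by (simp add: flat_exp_def)
next
  case False
  show ?thesis
  proof (cases "0 < t")
    case True
    have "((\<lambda>t. exp (- (1 / t)) / t ^ j) has_real_derivative (flat_exp (j + 2) t - real j * flat_exp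
        (j + 1) t)) (at t)"
    proof -
      have 1: "((\<lambda>t. 1 / t) has_real_derivative - (1 / t\<^sup>2)) (at t)"
        using True by (auto intro!: derivative_eq_intros simp: power2_eq_square)
      have 2: "((\<lambda>t. exp (- (1 / t))) has_real_derivative exp (- (1 / t)) * (1 / t\<^sup>2)) (at t)"
        using True by (auto intro!: derivative_eq_intros simp: power2_eq_square)
      have "((\<lambda>t. exp (- (1 / t)) * (1 / t) ^ j) has_real_derivative
          exp (- (1 / t)) * (1 / t\<^sup>2) * (1 / t) ^ j + real j * (- (1 / t\<^sup>2) * (1 / t) ^ (j - Suc 0)) *
              exp (- (1 / t))) (at t)"
        by (rule DERIV_mult[OF 2 DERIV_power[OF 1]])
      moreover have "exp (- (1 / t)) * (1 / t\<^sup>2) * (1 / t) ^ j +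
          real j * (- (1 / t\<^sup>2) * (1 / t) ^ (j - Suc 0)) * exp (- (1 / t))
          = flat_exp (j + 2) t - real j * flat_exp (j + 1) t"
        using True by (cases j) (simp_all add: flat_exp_def power_divide power2_eq_square mult_ac)
      ultimately show ?thesis by (simp add: power_divide)
    qed
    then show ?thesis
      by (rule has_field_derivative_transform_within_open[where S = "{0<..}"]) (use True in \<open>auto simp:
          flat_exp_def\<close>)
  next
    case False
    then have "t < 0" using \<open>t \<noteq> 0\<close> by simp
    have "((\<lambda>t. 0) has_real_derivative (flat_exp (j + 2) t - real j * flat_exp (j + 1) t)) (at t)"
      using False by (simp add: flat_exp_def)
    then show ?thesis
      by (rule has_field_derivative_transform_within_open[where S = "{..<0}"]) (use \<open>t < 0\<close> in \<open>auto
          simp: flat_exp_def\<close>)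
  qed
qed

lemma C_k_flat_exp: "C_k k (\<lambda>x::'a::euclidean_space. flat_exp j (c * (x \<bullet> b) + d))"
proof (induction k arbitrary: j)
  case 0
  have "continuous_on UNIV (flat_exp j)"
    using DERIV_isCont[OF flat_exp_has_derivative] by (simp add: continuous_on_eq_continuous_at)
  then have "continuous_on UNIV (flat_exp j \<circ> (\<lambda>x::'a. c * (x \<bullet> b) + d))"
    by (intro continuous_on_compose) (auto intro!: continuous_intros intro: continuous_on_subset)
  then show ?case by (simp add: o_def)
next
  case (Suc k)
  define e' where "e' y = flat_exp (j + 2) y + (- real j) * flat_exp (j + 1) y" for y
  have der: "((\<lambda>x. flat_exp j (c * (x \<bullet> b) + d)) has_derivative (\<lambda>h. e' (c * (x \<bullet> b) +
      d) * (c * (h \<bullet> b)))) (at x)" for x :: 'a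
  proof -
    have lin: "((\<lambda>x. c * (x \<bullet> b) + d) has_derivative (\<lambda>h. c * (h \<bullet> b))) (at x)"
      by (auto intro!: derivative_eq_intros)
    have "(flat_exp j has_derivative (*) (e' (c * (x \<bullet> b) + d))) (at (c * (x \<bullet> b) + d))"
      using flat_exp_has_derivative[of j "c * (x \<bullet> b) + d"]
          by (simp add: has_field_derivative_def e'_def)
    from has_derivative_compose[OF lin this] show ?thesis by simp
  qed
  show ?case unfolding e'_def
    by (rule C_k_SucI[OF der], unfold e'_def) (intro C_k_mult C_k_add C_k_const Suc.IH)
qed

text \<open>A smooth function that is positive exactly on the open box with corners \<open>a\<close> and \<open>b\<close>. As \<open>n\<close>
  grows, the factors \<open>exp (- 1 / (n y))\<close> tend to 1, and the function tends to the indicator of the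
  box.\<close>

definition box_bump :: "'a::euclidean_space \<Rightarrow> 'a \<Rightarrow> real \<Rightarrow> 'a \<Rightarrow> real" where
  "box_bump a b n x = (\<Prod>i\<in>Basis. flat_exp 0 (n * (x \<bullet> i) + - (n * (a \<bullet> i))) * flat_exp 0 (- n * (x \<bullet> i)
      + n * (b \<bullet> i)))"

lemma flat_exp_0_bounds: "0 \<le> flat_exp 0 t" "flat_exp 0 t \<le> 1"
  by (auto simp: flat_exp_def)

lemma box_bump_nonneg: "0 \<le> box_bump a b n x"
  unfolding box_bump_def by (intro prod_nonneg) (auto simp: flat_exp_0_bounds)

lemma box_bump_le_1: "box_bump a b n x \<le> 1"
  unfolding box_bump_def by (intro prod_le_1) (auto simp: flat_exp_0_bounds mult_le_one)

lemma box_bump_outside: "0 < n \<Longrightarrow> x \<notin> box a b \<Longrightarrow> box_bump a b n x = 0"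
proof -
  assume n: "0 < n" and "x \<notin> box a b"
  then obtain i where i: "i \<in> Basis" "x \<bullet> i \<le> a \<bullet> i \<or> b \<bullet> i \<le> x \<bullet> i"
    by (auto simp: mem_box not_less)
  then have "flat_exp 0 (n * (x \<bullet> i) + - (n * (a \<bullet> i))) * flat_exp 0 (- n * (x \<bullet> i) + n * (b \<bullet> i)) = 0"
    using n by (auto simp: flat_exp_def)
  then show ?thesis unfolding box_bump_def using i(1) by (intro prod_zero) auto
qed

lemma box_bump_test: "0 < n \<Longrightarrow> cbox a b \<subseteq> \<Omega> \<Longrightarrow> box_bump a b n \<in> test_functions \<Omega>"
proof -
  assume n: "0 < n" and sub: "cbox a b \<subseteq> \<Omega>"
  have "{x. box_bump a b n x \<noteq> 0} \<subseteq> cbox a b" using box_bump_outside[OF n] box_subset_cbox by blast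
  then have cl: "closure {x. box_bump a b n x \<noteq> 0} \<subseteq> cbox a b" by (intro closure_minimal) auto
  then have "compact (closure {x. box_bump a b n x \<noteq> 0})"
    by (meson bounded_cbox bounded_subset closed_closure compact_eq_bounded_closed)
  moreover have "C_k k (box_bump a b n)" for k unfolding box_bump_def[abs_def]
    by (intro C_k_prod C_k_mult C_k_flat_exp) auto
  ultimately show ?thesis using cl sub by (auto simp: test_functions_def)
qed

lemma box_bump_tendsto: "(\<lambda>n. box_bump a b (real (Suc n)) x) \<longlonglongrightarrow> indicator (box a b) x"
proof (cases "x \<in> box a b")
  case False
  then show ?thesis by (simp add: box_bump_outside)
next
  case True
  have lim: "(\<lambda>n. flat_exp 0 (real (Suc n) * y)) \<longlonglongrightarrow> 1" if "0 < y" for y :: real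
  proof -
    have "(\<lambda>n. exp (- (1 / y * (1 / real (Suc n))))) \<longlonglongrightarrow> exp (- (1 / y * 0))"
      by (intro tendsto_intros LIMSEQ_Suc[OF lim_inverse_n'])
    then show ?thesis using that by (simp add: flat_exp_def mult.commute)
  qed
  have "(\<lambda>n. box_bump a b (real (Suc n)) x) \<longlonglongrightarrow> (\<Prod>i\<in>(Basis::'a set). 1 * 1)"
    unfolding box_bump_def
  proof (intro tendsto_prod tendsto_mult)
    fix i :: 'a assume i: "i \<in> Basis"
    have "a \<bullet> i < x \<bullet> i" "x \<bullet> i < b \<bullet> i" using True i by (auto simp: mem_box)
    moreover have "real (Suc n) * (x \<bullet> i) + - (real (Suc n) * (a \<bullet> i)) = real (Suc n) * (x \<bullet> i - a \<bullet> i)"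
      "- real (Suc n) * (x \<bullet> i) + real (Suc n) * (b \<bullet> i) = real (Suc n) * (b \<bullet> i - x \<bullet> i)" for n
      by (simp_all add: algebra_simps)
    ultimately show "(\<lambda>n. flat_exp 0 (real (Suc n) * (x \<bullet> i) + - (real (Suc n) * (a \<bullet> i)))) \<longlonglongrightarrow> 1"
      "(\<lambda>n. flat_exp 0 (- real (Suc n) * (x \<bullet> i) + real (Suc n) * (b \<bullet> i))) \<longlonglongrightarrow> 1"
      using lim[of "x \<bullet> i - a \<bullet> i"] lim[of "b \<bullet> i - x \<bullet> i"] by simp_all
  qed
  then show ?thesis using True by simp
qed

definition grad :: "('a::euclidean_space \<Rightarrow> real) \<Rightarrow> 'a \<Rightarrow> 'a" where
  "grad \<phi> x = (\<Sum>i\<in>Basis. frechet_derivative \<phi> (at x) i *\<^sub>R i)"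

lemma grad_inner_Basis: "i \<in> Basis \<Longrightarrow> grad \<phi> x \<bullet> i = frechet_derivative \<phi> (at x) i"
  by (simp add: grad_def inner_sum_left inner_Basis if_distrib cong: if_cong)

lemma test_C_k: "\<phi> \<in> test_functions \<Omega> \<Longrightarrow> C_k k \<phi>"
  by (simp add: test_functions_def)

lemma test_continuous: "\<phi> \<in> test_functions \<Omega> \<Longrightarrow> continuous_on UNIV \<phi>"
  using C_k_continuous[OF test_C_k[of _ _ 0]] .

lemma C_1_has_grad:
  assumes "C_k (Suc 0) \<phi>"
  shows "(\<phi> has_derivative (\<lambda>h. grad \<phi> x \<bullet> h)) (at x)"
proof -
  have d: "(\<phi> has_derivative frechet_derivative \<phi> (at x)) (at x)" by (rule C_k_SucD(1)[OF assms])
  then have "linear (frechet_derivative \<phi> (at x))" by (rule has_derivative_linear)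
  then have lin: "linear (frechet_derivative \<phi> (at x))" .
  have "frechet_derivative \<phi> (at x) h = grad \<phi> x \<bullet> h" for h
  proof -
    have "frechet_derivative \<phi> (at x) h = frechet_derivative \<phi> (at x) (\<Sum>i\<in>Basis. (h \<bullet> i) *\<^sub>R i)"
      by (simp add: euclidean_representation)
    also have "\<dots> = (\<Sum>i\<in>Basis. frechet_derivative \<phi> (at x) ((h \<bullet> i) *\<^sub>R i))"
      by (rule linear_sum[OF lin])
    also have "\<dots> = grad \<phi> x \<bullet> h"
      by (simp add: linear_scale[OF lin] grad_def inner_sum_left mult.commute inner_commute[of h])
    finally show ?thesis .
  qed
  then have "frechet_derivative \<phi> (at x) = (\<lambda>h. grad \<phi> x \<bullet> h)" by blast
  then show ?thesis using d by simp
qed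

lemma C_1_grad_continuous: "C_k (Suc 0) \<phi> \<Longrightarrow> continuous_on UNIV (grad \<phi>)"
  unfolding grad_def[abs_def] by (intro continuous_on_sum continuous_on_scaleR continuous_on_const) auto

lemma grad_unique:
  assumes "(\<phi> has_derivative (\<lambda>h. g \<bullet> h)) (at x)"
  shows "grad \<phi> x = g"
proof -
  have "frechet_derivative \<phi> (at x) = (\<lambda>h. g \<bullet> h)" using frechet_derivative_at[OF assms] by simp
  then show ?thesis by (simp add: grad_def euclidean_representation)
qed

lemma grad_support:
  assumes "x \<notin> closure {x. \<phi> x \<noteq> 0}"
  shows "grad \<phi> x = 0"
proof (rule grad_unique)
  have "((\<lambda>_. 0) has_derivative (\<lambda>h. 0 \<bullet> h)) (at x)" by simp
  then show "(\<phi> has_derivative (\<lambda>h. 0 \<bullet> h)) (at x)"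
    by (rule has_derivative_transform_within_open[where s = "- closure {x. \<phi> x \<noteq> 0}"])
      (use assms closure_subset[of "{x. \<phi> x \<noteq> 0}"] in auto)
qed

lemma test_grad_continuous: "\<phi> \<in> test_functions \<Omega> \<Longrightarrow> continuous_on UNIV (grad \<phi>)"
  by (rule C_1_grad_continuous[OF test_C_k])

lemma test_has_grad: "\<phi> \<in> test_functions \<Omega> \<Longrightarrow> (\<phi> has_derivative (\<lambda>h. grad \<phi> x \<bullet> h)) (at x)"
  by (rule C_1_has_grad[OF test_C_k])

lemma test_zero_outside:
  assumes "\<phi> \<in> test_functions \<Omega>" "x \<notin> \<Omega>"
  shows "\<phi> x = 0" "grad \<phi> x = 0"
  using assms grad_support[of x \<phi>] closure_subset[of "{x. \<phi> x \<noteq> 0}"] by (auto simp: test_functions_def)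

lemma bounded_of_compact_support:
  fixes f :: "'a::euclidean_space \<Rightarrow> 'b::real_normed_vector"
  assumes "continuous_on UNIV f" "compact K" "\<And>x. x \<notin> K \<Longrightarrow> f x = 0"
  shows "\<exists>M\<ge>0. \<forall>x. norm (f x) \<le> M"
proof -
  have "bounded (f ` K)" using assms by (intro compact_imp_bounded compact_continuous_image
      continuous_on_subset[OF assms(1)]) auto
  then obtain M where "0 < M" "\<And>x. x \<in> K \<Longrightarrow> norm (f x) \<le> M" by (auto simp: bounded_pos)
  then have "norm (f x) \<le> M" for x using assms(3)[of x] by (cases "x \<in> K") auto
  then show ?thesis using \<open>0 < M\<close> by (intro exI[of _ M]) auto
qed

lemma test_bounded:
  assumes "\<phi> \<in> test_functions \<Omega>"
  shows "\<exists>M\<ge>0. \<forall>x. \<bar>\<phi> x\<bar> \<le> M" "\<exists>M\<ge>0. \<forall>x. norm (grad \<phi> x) \<le> M"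
proof -
  let ?K = "closure {x. \<phi> x \<noteq> 0}"
  have K: "compact ?K" using assms by (simp add: test_functions_def)
  have "x \<notin> ?K \<Longrightarrow> \<phi> x = 0" for x using closure_subset[of "{x. \<phi> x \<noteq> 0}"] by auto
  then show "\<exists>M\<ge>0. \<forall>x. \<bar>\<phi> x\<bar> \<le> M"
    by (rule bounded_of_compact_support[OF test_continuous[OF assms] K, unfolded real_norm_def])
  show "\<exists>M\<ge>0. \<forall>x. norm (grad \<phi> x) \<le> M"
    by (rule bounded_of_compact_support[OF test_grad_continuous[OF assms] K grad_support])
qed

section \<open>Weak gradients\<close>

lemma borel_measurable_of_continuous_UNIV:
  "continuous_on UNIV f \<Longrightarrow> f \<in> borel_measurable borel"
  by (rule borel_measurable_continuous_onI)

lemma zero_outside_support: "x \<notin> closure {x. F x \<noteq> 0} \<Longrightarrow> F x = 0"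
  using closure_subset[of "{x. F x \<noteq> 0}"] by (metis (mono_tags, lifting) mem_Collect_eq subsetD)

lemma compact_support_in_cball:
  fixes F :: "'a::euclidean_space \<Rightarrow> real"
  assumes "compact (closure {x. F x \<noteq> 0})"
  obtains r where "0 < r" "\<And>x. r < norm x \<Longrightarrow> x \<notin> closure {x. F x \<noteq> 0}"
proof -
  obtain r where "0 < r" "\<And>x. x \<in> closure {x. F x \<noteq> 0} \<Longrightarrow> norm x \<le> r"
    using compact_imp_bounded[OF assms] unfolding bounded_pos by blast
  then show ?thesis using that[of r] by (meson not_le)
qed

lemma integrable_indicator_cball: "integrable lborel (indicator (cball (0::'a::euclidean_space) r) :: 'a
    \<Rightarrow> real)"
  by (rule integrable_real_indicator[OF _ emeasure_lborel_cball_finite]) simp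

lemma integrable_lborel_of_bounded_support:
  fixes f :: "'a::euclidean_space \<Rightarrow> real"
  assumes "f \<in> borel_measurable borel" "\<And>x. \<bar>f x\<bar> \<le> M" "\<And>x. x \<notin> cball 0 r \<Longrightarrow> f x = 0"
  shows "integrable lborel f"
proof (rule Bochner_Integration.integrable_bound)
  show "integrable lborel (\<lambda>x::'a. M * indicator (cball 0 r) x)"
    by (intro integrable_mult_right integrable_indicator_cball)
  show "AE x in lborel. norm (f x) \<le> norm (M * indicator (cball 0 r) x)"
  proof (rule AE_I2)
    fix x :: 'a
    show "norm (f x) \<le> norm (M * indicator (cball 0 r) x)"
      using assms(2)[of x] assms(3)[of x] by (cases "x \<in> cball 0 r") auto
  qed
qed (use assms(1) in simp)

lemma lborel_integral_translate:
  fixes f :: "'a::euclidean_space \<Rightarrow> real"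
  assumes "f \<in> borel_measurable borel"
  shows "(LINT x|lborel. f (x + c)) = (LINT x|lborel. f x)"
proof -
  have "(LINT x|lborel. f x) = integral\<^sup>L (distr lborel borel ((+) c)) f"
      by (simp add: lborel_distr_plus)
  also have "\<dots> = (LINT x|lborel. f (c + x))" using assms by (intro integral_distr) auto
  finally show ?thesis by (simp add: add.commute)
qed

lemma grad_Lipschitz:
  fixes F :: "'a::euclidean_space \<Rightarrow> real"
  assumes "\<And>x. (F has_derivative (\<lambda>h. grad F x \<bullet> h)) (at x)" "\<And>x. norm (grad F x) \<le> M"
  shows "\<bar>F y - F x\<bar> \<le> M * norm (y - x)"
proof -
  have "norm (F y - F x) \<le> M * norm (y - x)"
  proof (rule differentiable_bound[of UNIV F "\<lambda>x h. grad F x \<bullet> h"])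
    fix x :: 'a
    show "onorm (\<lambda>h. grad F x \<bullet> h) \<le> M"
    proof (rule onorm_le)
      fix h
      have "norm (grad F x \<bullet> h) \<le> norm (grad F x) * norm h" by (simp add: Cauchy_Schwarz_ineq2)
      also have "\<dots> \<le> M * norm h" using assms(2) by (intro mult_right_mono) auto
      finally show "norm (grad F x \<bullet> h) \<le> M * norm h" .
    qed
  qed (use assms(1) in auto)
  then show ?thesis by simp
qed

lemma has_derivative_along_line:
  fixes F :: "'a::euclidean_space \<Rightarrow> real"
  assumes "\<And>x. (F has_derivative (\<lambda>h. grad F x \<bullet> h)) (at x)"
  shows "((\<lambda>t. F (x + t *\<^sub>R v)) has_real_derivative grad F (x + t *\<^sub>R v) \<bullet> v) (at t)"
proof -
  have 1: "((\<lambda>t. x + t *\<^sub>R v) has_derivative (\<lambda>h. h *\<^sub>R v)) (at t)"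
    by (auto intro!: derivative_eq_intros)
  have "((\<lambda>t. F (x + t *\<^sub>R v)) has_derivative (\<lambda>h. grad F (x + t *\<^sub>R v) \<bullet> (h *\<^sub>R v))) (at t)"
    by (rule has_derivative_compose[OF 1 assms])
  moreover have "(\<lambda>h. grad F (x + t *\<^sub>R v) \<bullet> (h *\<^sub>R v)) = (*) (grad F (x + t *\<^sub>R v) \<bullet> v)"
    by (simp add: fun_eq_iff mult.commute)
  ultimately show ?thesis by (simp only: has_field_derivative_def)
qed

text \<open>Difference quotients have integral zero by translation invariance; they converge to the
  directional derivative and are dominated, because \<open>F\<close> is Lipschitz with compact support.\<close>

lemma integral_partial_derivative_eq_0:
  fixes F :: "'a::euclidean_space \<Rightarrow> real"
  assumes F: "C_k (Suc 0) F" and K: "compact (closure {x. F x \<noteq> 0})"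
  shows "(LINT x|lborel. grad F x \<bullet> v) = 0"
proof -
  let ?K = "closure {x. F x \<noteq> 0}"
  note F0 = zero_outside_support[of _ F]
  have der: "(F has_derivative (\<lambda>h. grad F x \<bullet> h)) (at x)" for x by (rule C_1_has_grad[OF F])
  have cont: "continuous_on UNIV F" by (rule C_k_continuous[OF F])
  obtain M0 where M0: "0 \<le> M0" "\<And>x. norm (F x) \<le> M0" using bounded_of_compact_support[OF cont K F0]
      by blast
  obtain M where M: "0 \<le> M" "\<And>x. norm (grad F x) \<le> M"
    using bounded_of_compact_support[OF C_1_grad_continuous[OF F] K grad_support] by blast
  obtain r where r: "0 < r" "\<And>x. r < norm x \<Longrightarrow> x \<notin> ?K" using compact_support_in_cball[OF K] by blast
  define t where "t n = 1 / real (Suc n)" for n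
  have t: "0 < t n" "t n \<le> 1" for n by (auto simp: t_def)
  define s where "s n x = (F (x + t n *\<^sub>R v) - F x) / t n" for n x
  define w where "w x = M * norm v * indicator (cball 0 (r + norm v)) x" for x :: 'a
  have Fm: "F \<in> borel_measurable borel" by (rule borel_measurable_of_continuous_UNIV[OF cont])
  have Fi: "integrable lborel F"
  proof (rule integrable_lborel_of_bounded_support[OF Fm, of M0 r])
    show "\<bar>F x\<bar> \<le> M0" for x using M0(2)[of x] by simp
    show "F x = 0" if "x \<notin> cball 0 r" for x using that by (intro F0 r(2)) (simp add: not_le)
  qed
  have lim: "(\<lambda>n. s n x) \<longlonglongrightarrow> grad F x \<bullet> v" for x
  proof -
    have "(\<lambda>h. (F (x + (0 + h) *\<^sub>R v) - F (x + 0 *\<^sub>R v)) / h) \<midarrow>0\<rightarrow> grad F (x + 0 *\<^sub>R v) \<bullet> v"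
      using has_derivative_along_line[OF der, of x v 0] by (simp only: DERIV_def)
    moreover have "filterlim t (at 0) sequentially"
      unfolding filterlim_at using t LIMSEQ_Suc[OF lim_inverse_n']
          by (auto simp: t_def[abs_def] less_imp_neq[symmetric])
    ultimately have "((\<lambda>n. (F (x + (0 + t n) *\<^sub>R v) - F (x + 0 *\<^sub>R v)) / t n) \<longlongrightarrow> grad F (x +
        0 *\<^sub>R v) \<bullet> v) sequentially"
      by (rule filterlim_compose)
    then show ?thesis by (simp add: s_def)
  qed
  have bound: "norm (s n x) \<le> w x" for n x
  proof (cases "x \<in> cball 0 (r + norm v)")
    case True
    have "\<bar>F (x + t n *\<^sub>R v) - F x\<bar> \<le> M * norm (x + t n *\<^sub>R v - x)"
        by (rule grad_Lipschitz[OF der M(2)])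
    also have "\<dots> = M * norm v * t n" using t[of n] by simp
    finally show ?thesis using True t[of n] by (simp add: s_def w_def divide_le_eq)
  next
    case False
    then have x: "r + norm v < norm x" by (simp add: not_le)
    then have "r < norm x" using norm_ge_zero[of v] by linarith
    then have 1: "F x = 0" by (intro F0 r(2))
    have "norm (t n *\<^sub>R v) \<le> norm v" using t[of n] by (simp add: mult_left_le_one_le)
    then have "r < norm (x + t n *\<^sub>R v)"
      using norm_triangle_ineq4[of "x + t n *\<^sub>R v" "t n *\<^sub>R v"] x by simp
    then have "F (x + t n *\<^sub>R v) = 0" by (intro F0 r(2))
    then show ?thesis using 1 False by (simp add: s_def w_def)
  qed
  have wi: "integrable lborel w"
    unfolding w_def[abs_def] by (intro integrable_mult_right integrable_indicator_cball)
  have sm: "s n \<in> borel_measurable borel" for n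
    unfolding s_def[abs_def] using Fm by measurable
  have gm: "(\<lambda>x. grad F x \<bullet> v) \<in> borel_measurable borel"
    by (intro borel_measurable_of_continuous_UNIV continuous_on_inner C_1_grad_continuous F
        continuous_on_const)
  have "(\<lambda>n. LINT x|lborel. s n x) \<longlonglongrightarrow> (LINT x|lborel. grad F x \<bullet> v)"
    by (rule integral_dominated_convergence[OF _ _ wi]) (use sm gm lim bound in \<open>simp_all add:
        measurable_lborel1\<close>)
  moreover have "(LINT x|lborel. s n x) = 0" for n
  proof -
    have Ft: "integrable lborel (\<lambda>x. F (x + t n *\<^sub>R v))"
    proof (rule integrable_lborel_of_bounded_support[of _ M0 "r + norm v"])
      fix x :: 'a assume x: "x \<notin> cball 0 (r + norm v)"
      then have "r < norm x" using norm_ge_zero[of v] unfolding mem_cball_0 not_le by linarith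
      then have "F x = 0" by (intro F0 r(2))
      moreover have "s n x = 0" using bound[of n x] x by (simp add: w_def)
      ultimately show "F (x + t n *\<^sub>R v) = 0" using t[of n] by (simp add: s_def)
    qed (use Fm M0 in auto)
    have "(LINT x|lborel. s n x) = ((LINT x|lborel. F (x + t n *\<^sub>R v)) - (LINT x|lborel. F x)) / t n"
      unfolding s_def by (simp add: Bochner_Integration.integral_diff[OF Ft Fi])
    then show ?thesis by (simp add: lborel_integral_translate[OF Fm])
  qed
  ultimately show ?thesis using LIMSEQ_unique[of "\<lambda>n. 0::real"] by force
qed

lemma integral_lebesgue_on_eq_lborel:
  fixes f :: "'a::euclidean_space \<Rightarrow> real"
  assumes "\<Omega> \<in> sets lebesgue" "f \<in> borel_measurable borel" "\<And>x. x \<notin> \<Omega> \<Longrightarrow> f x = 0"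
  shows "(LINT x|lebesgue_on \<Omega>. f x) = (LINT x|lborel. f x)"
proof -
  have "(LINT x|lebesgue_on \<Omega>. f x) = (LINT x|lebesgue. indicator \<Omega> x *\<^sub>R f x)"
    using assms by (intro integral_restrict_space) auto
  also have "\<dots> = (LINT x|lebesgue. f x)"
    using assms(3) by (intro Bochner_Integration.integral_cong) (auto simp: indicator_def)
  also have "\<dots> = (LINT x|lborel. f x)" using assms by (intro integral_completion) auto
  finally show ?thesis .
qed

lemma nn_integral_lebesgue_on_eq_lborel:
  assumes "\<Omega> \<in> sets lebesgue" "\<And>x. x \<notin> \<Omega> \<Longrightarrow> f x = (0::ennreal)"
  shows "(\<integral>\<^sup>+x. f x \<partial>lebesgue_on \<Omega>) = (\<integral>\<^sup>+x. f x \<partial>lborel)"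
proof -
  have "(\<integral>\<^sup>+x. f x \<partial>lebesgue_on \<Omega>) = (\<integral>\<^sup>+x. f x * indicator \<Omega> x \<partial>lebesgue)"
    using assms by (intro nn_integral_restrict_space) auto
  also have "\<dots> = (\<integral>\<^sup>+x. f x \<partial>lebesgue)" using assms(2)
      by (intro nn_integral_cong) (auto simp: indicator_def)
  finally show ?thesis by (simp add: nn_integral_completion)
qed

lemma lebesgue_on_borel_measurable: "f \<in> borel_measurable borel \<Longrightarrow> f \<in> borel_measurable (lebesgue_on S)"
  by (intro measurable_restrict_space1) (simp add: measurable_completion)

lemma test_integration_by_parts:
  assumes \<phi>: "\<phi> \<in> test_functions \<Omega>" and \<psi>: "\<psi> \<in> test_functions \<Omega>" and i: "i \<in> Basis"
      and \<Omega>: "\<Omega> \<in> sets lebesgue"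
  shows "(LINT x|lebesgue_on \<Omega>. \<phi> x * frechet_derivative \<psi> (at x) i) = - (LINT x|lebesgue_on \<Omega>.
      (grad \<phi> x \<bullet> i) * \<psi> x)"
proof -
  have c: "continuous_on UNIV \<phi>" "continuous_on UNIV \<psi>" "continuous_on UNIV (grad \<phi>)" "continuous_on
      UNIV (grad \<psi>)"
    using \<phi> \<psi> test_continuous test_grad_continuous by blast+
  define F where "F x = \<phi> x * \<psi> x" for x
  have F1: "C_k (Suc 0) F" unfolding F_def[abs_def] by (intro C_k_mult test_C_k[OF \<phi>] test_C_k[OF \<psi>])
  have "closure {x. F x \<noteq> 0} \<subseteq> closure {x. \<phi> x \<noteq> 0}" by (intro closure_mono) (auto simp: F_def)
  moreover have "compact (closure {x. \<phi> x \<noteq> 0})" using \<phi> by (simp add: test_functions_def)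
  ultimately have K: "compact (closure {x. F x \<noteq> 0})"
    by (meson bounded_subset closed_closure compact_eq_bounded_closed)
  have gF: "grad F x = \<phi> x *\<^sub>R grad \<psi> x + \<psi> x *\<^sub>R grad \<phi> x" for x
  proof (rule grad_unique)
    have "(F has_derivative (\<lambda>h. \<phi> x * (grad \<psi> x \<bullet> h) + (grad \<phi> x \<bullet> h) * \<psi> x)) (at x)"
      unfolding F_def[abs_def] by (intro has_derivative_mult test_has_grad[OF \<phi>] test_has_grad[OF \<psi>])
    then show "(F has_derivative (\<lambda>h. (\<phi> x *\<^sub>R grad \<psi> x + \<psi> x *\<^sub>R grad \<phi> x) \<bullet> h)) (at x)"
      by (simp add: inner_add_left mult.commute)
  qed
  obtain Mp Mg where M: "\<And>x. \<bar>\<phi> x\<bar> \<le> Mp" "0 \<le> Mp" "\<And>x. norm (grad \<phi> x) \<le> Mg" "0 \<le> Mg"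
      using test_bounded[OF \<phi>] by blast
  obtain Np Ng where N: "\<And>x. \<bar>\<psi> x\<bar> \<le> Np" "0 \<le> Np" "\<And>x. norm (grad \<psi> x) \<le> Ng" "0 \<le> Ng"
      using test_bounded[OF \<psi>] by blast
  obtain r where r: "0 < r" "\<And>x. r < norm x \<Longrightarrow> x \<notin> closure {x. \<phi> x \<noteq> 0}"
    using compact_support_in_cball[OF \<open>compact (closure {x. \<phi> x \<noteq> 0})\<close>] by blast
  have out: "\<phi> x = 0" "grad \<phi> x = 0" if "x \<notin> cball 0 r" for x
    using that zero_outside_support[of x \<phi>] r(2)[of x] grad_support[of x \<phi>] by (simp_all add: not_le)
  have i1: "integrable lborel (\<lambda>x. \<phi> x * (grad \<psi> x \<bullet> i))"
  proof (rule integrable_lborel_of_bounded_support[of _ "Mp * Ng" r])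
    fix x
    have "\<bar>grad \<psi> x \<bullet> i\<bar> \<le> Ng" using N(3)[of x] norm_bound_Basis_le[OF i N(3)] by simp
    then show "\<bar>\<phi> x * (grad \<psi> x \<bullet> i)\<bar> \<le> Mp * Ng" using M(1)[of x] M(2) by (simp add: abs_mult mult_mono)
  qed (use c out in \<open>auto intro!: borel_measurable_of_continuous_UNIV continuous_intros\<close>)
  have i2: "integrable lborel (\<lambda>x. (grad \<phi> x \<bullet> i) * \<psi> x)"
  proof (rule integrable_lborel_of_bounded_support[of _ "Mg * Np" r])
    fix x
    have "\<bar>grad \<phi> x \<bullet> i\<bar> \<le> Mg" using norm_bound_Basis_le[OF i M(3)] by simp
    then show "\<bar>(grad \<phi> x \<bullet> i) * \<psi> x\<bar> \<le> Mg * Np" using N(1)[of x] M(4) by (simp add: abs_mult mult_mono)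
  qed (use c out in \<open>auto intro!: borel_measurable_of_continuous_UNIV continuous_intros\<close>)
  have "0 = (LINT x|lborel. grad F x \<bullet> i)"
      by (rule integral_partial_derivative_eq_0[OF F1 K, symmetric])
  also have "\<dots> = (LINT x|lborel. \<phi> x * (grad \<psi> x \<bullet> i) + (grad \<phi> x \<bullet> i) * \<psi> x)"
    by (simp add: gF inner_add_left mult.commute)
  also have "\<dots> = (LINT x|lborel. \<phi> x * (grad \<psi> x \<bullet> i)) + (LINT x|lborel. (grad \<phi> x \<bullet> i) * \<psi> x)"
    by (rule Bochner_Integration.integral_add[OF i1 i2])
  also have "(LINT x|lborel. \<phi> x * (grad \<psi> x \<bullet> i)) = (LINT x|lebesgue_on \<Omega>. \<phi> x * (grad \<psi> x \<bullet> i))"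
    using test_zero_outside[OF \<phi>] c i1 \<Omega> by (intro integral_lebesgue_on_eq_lborel[symmetric]) auto
  also have "(LINT x|lborel. (grad \<phi> x \<bullet> i) * \<psi> x) = (LINT x|lebesgue_on \<Omega>. (grad \<phi> x \<bullet> i) * \<psi> x)"
    using test_zero_outside[OF \<phi>] c i2 \<Omega> by (intro integral_lebesgue_on_eq_lborel[symmetric]) auto
  finally show ?thesis by (simp add: grad_inner_Basis[OF i])
qed

lemma integrable_lebesgue_on_compact:
  fixes f :: "'a::euclidean_space \<Rightarrow> 'b::euclidean_space"
  assumes "continuous_on UNIV f" "compact K"
  shows "integrable (lebesgue_on K) f"
proof -
  have i: "integrable lborel (\<lambda>x. indicator K x *\<^sub>R f x)"
    using assms by (intro borel_integrable_compact) (auto intro: continuous_on_subset)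
  then have "integrable lebesgue (\<lambda>x. indicator K x *\<^sub>R f x)"
    using integrable_completion[of "\<lambda>x. indicator K x *\<^sub>R f x" lborel] borel_measurable_integrable[OF i]
        by simp
  moreover have "K \<in> sets lebesgue" using borel_compact[OF assms(2)] by simp
  ultimately show ?thesis by (simp add: integrable_restrict_space)
qed

lemma test_has_weak_gradient:
  assumes "\<phi> \<in> test_functions \<Omega>" "\<Omega> \<in> sets lebesgue"
  shows "has_weak_gradient \<Omega> \<phi> (grad \<phi>)"
  unfolding has_weak_gradient_def
  using test_integration_by_parts[OF assms(1) _ _ assms(2)]
    integrable_lebesgue_on_compact[OF test_continuous[OF assms(1)]]
    integrable_lebesgue_on_compact[OF test_grad_continuous[OF assms(1)]] by blast

text \<open>By Lebesgue differentiation along cubes, almost every value of \<open>g\<close> is a limit of means over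
  cubes with corner \<open>x\<close>.\<close>

lemma vanishing_integrals_imp_zero_on_box:
  fixes g :: "'a::euclidean_space \<Rightarrow> real"
  assumes int: "integrable (lebesgue_on (cbox a b)) g"
    and zero: "\<And>c d. cbox c d \<subseteq> cbox a b \<Longrightarrow> integral (cbox c d) g = 0"
  shows "\<exists>N. negligible N \<and> (\<forall>x\<in>box a b - N. g x = 0)"
proof -
  define f where "f x = (if x \<in> cbox a b then g x else 0)" for x
  have gi: "g absolutely_integrable_on cbox a b" using int
      by (simp add: integrable_restrict_space set_integrable_def)
  then have "g integrable_on cbox a b" using absolutely_integrable_on_def by blast
  then have "f integrable_on UNIV" unfolding f_def[abs_def] by (simp only: integrable_restrict_UNIV)
  then have "f integrable_on cbox c d" for c d by (rule integrable_on_subcbox) auto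
  then obtain N where N: "negligible N" "\<And>x e. x \<notin> N \<Longrightarrow> 0 < e \<Longrightarrow>
      \<exists>d>0. \<forall>h. 0 < h \<and> h < d \<longrightarrow> norm (integral (cbox x (x + h *\<^sub>R One)) f /\<^sub>R h ^ DIM('a) - f x) < e"
    by (rule integrable_ccontinuous_explicit) blast
  have "g x = 0" if x: "x \<in> box a b" "x \<notin> N" for x
  proof (rule ccontr)
    assume ne: "g x \<noteq> 0"
    have fx: "f x = g x" using x box_subset_cbox by (auto simp: f_def)
    obtain d where d: "0 < d" "\<And>h. 0 < h \<Longrightarrow> h < d \<Longrightarrow>
        norm (integral (cbox x (x + h *\<^sub>R One)) f /\<^sub>R h ^ DIM('a) - f x) < \<bar>g x\<bar>"
      using N(2)[OF x(2), of "\<bar>g x\<bar>"] ne by auto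
    obtain e where e: "0 < e" "ball x e \<subseteq> box a b" using open_box x(1) open_contains_ball by metis
    define L where "L = norm (One::'a) + 1"
    have L: "1 \<le> L" "norm (One::'a) \<le> L" using norm_ge_zero[of "One::'a"] unfolding L_def by linarith+
    define h where "h = min (d / 2) (e / (2 * L))"
    have h: "0 < h" "h < d" "h \<le> e / (2 * L)" using d e L by (auto simp: h_def)
    have sub: "cbox x (x + h *\<^sub>R One) \<subseteq> cbox a b"
    proof -
      have "x + h *\<^sub>R One \<in> ball x e"
      proof -
        have "norm (h *\<^sub>R (One::'a)) = h * norm (One::'a)" using h by simp
        also have "\<dots> \<le> e / (2 * L) * L" using h L by (intro mult_mono) auto
        also have "\<dots> = e / 2" using L by simp
        finally show ?thesis using e by (simp add: dist_norm)
      qed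
      then have "x + h *\<^sub>R One \<in> cbox a b" using e box_subset_cbox by blast
      moreover have "x \<in> cbox a b" using x box_subset_cbox by blast
      ultimately show ?thesis unfolding subset_box(1) mem_box by blast
    qed
    have "integral (cbox x (x + h *\<^sub>R One)) f = integral (cbox x (x + h *\<^sub>R One)) g"
      using sub by (intro integral_cong) (auto simp: f_def)
    then show False using d(2)[OF h(1,2)] zero[OF sub] fx by simp
  qed
  then show ?thesis using N(1) by blast
qed

lemma integral_lebesgue_on_restrict:
  fixes f :: "'a::euclidean_space \<Rightarrow> real"
  assumes "S \<in> sets lebesgue" "T \<in> sets lebesgue" "S \<subseteq> T" "\<And>x. x \<in> T \<Longrightarrow> x \<notin> S \<Longrightarrow> f x = 0"
  shows "(LINT x|lebesgue_on T. f x) = (LINT x|lebesgue_on S. f x)"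
proof -
  have "(LINT x|lebesgue_on T. f x) = (LINT x|lebesgue. indicator T x *\<^sub>R f x)"
    using assms by (intro integral_restrict_space) auto
  also have "\<dots> = (LINT x|lebesgue. indicator S x *\<^sub>R f x)"
    using assms by (intro Bochner_Integration.integral_cong) (auto simp: indicator_def)
  also have "\<dots> = (LINT x|lebesgue_on S. f x)"
    using assms by (intro integral_restrict_space[symmetric]) auto
  finally show ?thesis .
qed

text \<open>Box-shaped bumps approximate indicators of boxes boundedly, so all integrals of \<open>g\<close> over
  closed boxes in \<open>\<Omega>\<close> vanish; countably many such boxes cover \<open>\<Omega>\<close>.\<close>

lemma fundamental_lemma:
  fixes g :: "'a::euclidean_space \<Rightarrow> real"
  assumes \<Omega>: "open \<Omega>"
    and int: "\<And>K. compact K \<Longrightarrow> K \<subseteq> \<Omega> \<Longrightarrow> integrable (lebesgue_on K) g"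
    and zero: "\<And>\<phi>. \<phi> \<in> test_functions \<Omega> \<Longrightarrow> (LINT x|lebesgue_on \<Omega>. g x * \<phi> x) = 0"
  shows "AE x in lebesgue_on \<Omega>. g x = 0"
proof -
  have \<Omega>s: "\<Omega> \<in> sets lebesgue" using \<Omega> by auto
  have box0: "integral (cbox c d) g = 0" if sub: "cbox c d \<subseteq> \<Omega>" for c d
  proof -
    let ?M = "lebesgue_on (cbox c d)"
    have gi: "integrable ?M g" by (rule int[OF compact_cbox sub])
    have bm: "box_bump c d (real (Suc n)) \<in> borel_measurable ?M" for n
      by (intro lebesgue_on_borel_measurable borel_measurable_of_continuous_UNIV
          test_continuous[OF box_bump_test[OF _ sub]]) simp
    have "(\<lambda>n. LINT x|?M. g x * box_bump c d (real (Suc n)) x) \<longlonglongrightarrow> (LINT x|?M.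
        g x * indicator (box c d) x)"
    proof (rule integral_dominated_convergence[where w = "\<lambda>x. \<bar>g x\<bar>"])
      show "integrable ?M (\<lambda>x. \<bar>g x\<bar>)" using gi by simp
      show "AE x in ?M. (\<lambda>n. g x * box_bump c d (real (Suc n)) x) \<longlonglongrightarrow> g x * indicator (box c d) x"
        by (intro AE_I2 tendsto_mult tendsto_const box_bump_tendsto)
      have "indicator (box c d) \<in> borel_measurable ?M"
        by (intro lebesgue_on_borel_measurable) simp
      then show "(\<lambda>x. g x * indicator (box c d) x) \<in> borel_measurable ?M"
        using borel_measurable_integrable[OF gi] by (intro borel_measurable_times)
      fix n
      show "(\<lambda>x. g x * box_bump c d (real (Suc n)) x) \<in> borel_measurable ?M"
        using borel_measurable_integrable[OF gi] bm by (intro borel_measurable_times)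
      show "AE x in ?M. norm (g x * box_bump c d (real (Suc n)) x) \<le> \<bar>g x\<bar>"
        using box_bump_nonneg box_bump_le_1
            by (intro AE_I2) (simp only: real_norm_def abs_mult abs_of_nonneg[OF box_bump_nonneg]
            mult_left_le[OF box_bump_le_1] abs_ge_zero)
    qed
    moreover have "(LINT x|?M. g x * box_bump c d (real (Suc n)) x) = 0" for n
    proof -
      have "(LINT x|lebesgue_on \<Omega>. g x * box_bump c d (real (Suc n)) x) = (LINT x|?M.
          g x * box_bump c d (real (Suc n)) x)"
      proof (rule integral_lebesgue_on_restrict[OF _ \<Omega>s sub])
        fix x assume "x \<notin> cbox c d"
        then have "x \<notin> box c d" using box_subset_cbox by blast
        then show "g x * box_bump c d (real (Suc n)) x = 0"
            using box_bump_outside[of "real (Suc n)" x c d] by (simp del: of_nat_Suc)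
      qed simp
      then show ?thesis using zero[OF box_bump_test[OF _ sub, of "real (Suc n)"]] by simp
    qed
    ultimately have z: "(LINT x|?M. g x * indicator (box c d) x) = 0"
      using LIMSEQ_unique[of "\<lambda>n. 0::real"] by force
    have "integrable ?M (\<lambda>x. g x * indicator (box c d) x)"
      using gi by (rule Bochner_Integration.integrable_bound)
        (rule borel_measurable_times[OF borel_measurable_integrable[OF gi]
            lebesgue_on_borel_measurable], auto simp: indicator_def)
    then have "integral (cbox c d) (\<lambda>x. g x * indicator (box c d) x) = 0"
      using z lebesgue_integral_eq_integral[of "cbox c d" "\<lambda>x. g x * indicator (box c d) x"] by simp
    moreover have "integral (cbox c d) (\<lambda>x. g x * indicator (box c d) x) = integral (cbox c d) g"
      by (rule integral_spike[of "cbox c d - box c d"]) (auto simp: negligible_frontier_interval)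
    ultimately show ?thesis by simp
  qed
  obtain D where D: "countable D" "D \<subseteq> Pow \<Omega>" "\<And>X. X \<in> D \<Longrightarrow> \<exists>a b. X = cbox a b" "\<Union>D = \<Omega>"
    using open_countable_Union_open_cbox[OF \<Omega>] by metis
  have "\<exists>N. negligible N \<and> (\<forall>x\<in>X - N. g x = 0)" if X: "X \<in> D" for X
  proof -
    obtain a b where ab: "X = cbox a b" "cbox a b \<subseteq> \<Omega>" using D(2,3) X by blast
    then obtain N where "negligible N" "\<And>x. x \<in> box a b - N \<Longrightarrow> g x = 0"
      using vanishing_integrals_imp_zero_on_box[OF int[OF compact_cbox ab(2)]] box0
          by (metis order_trans)
    then show ?thesis unfolding ab(1)
      by (intro exI[of _ "N \<union> (cbox a b - box a b)"]) (auto simp: negligible_frontier_interval)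
  qed
  then obtain N where N: "\<And>X. X \<in> D \<Longrightarrow> negligible (N X)" "\<And>X x. X \<in> D \<Longrightarrow> x \<in> X \<Longrightarrow> x \<notin> N X \<Longrightarrow> g x = 0"
      by (metis DiffI)
  have "negligible (\<Union>X\<in>D. N X)" using N(1) D(1) by (intro negligible_countable_Union) auto
  then have "(\<Union>X\<in>D. N X) \<in> null_sets lebesgue" by (simp add: negligible_iff_null_sets)
  then have "AE x in lebesgue. x \<notin> (\<Union>X\<in>D. N X)" by (rule AE_not_in)
  then have "AE x in lebesgue. x \<in> \<Omega> \<longrightarrow> g x = 0"
    by eventually_elim (use N(2) D(4) in blast)
  then show ?thesis using \<Omega>s by (subst AE_restrict_space_iff) auto
qed

lemma compact_sets_lebesgue: "compact K \<Longrightarrow> K \<in> sets lebesgue"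
  using borel_compact[of K] by simp

lemma integrable_mult_compact_support:
  fixes g \<phi> :: "'a::euclidean_space \<Rightarrow> real"
  assumes int: "integrable (lebesgue_on K) g" and K: "compact K" "K \<subseteq> \<Omega>" and \<Omega>: "\<Omega> \<in> sets lebesgue"
    and \<phi>: "continuous_on UNIV \<phi>" "\<And>x. x \<notin> K \<Longrightarrow> \<phi> x = 0"
  shows "integrable (lebesgue_on \<Omega>) (\<lambda>x. g x * \<phi> x)"
proof -
  have Ks: "K \<in> sets lebesgue" by (rule compact_sets_lebesgue[OF K(1)])
  obtain C where C: "0 \<le> C" "\<And>x. \<bar>\<phi> x\<bar> \<le> C" using bounded_of_compact_support[OF \<phi>(1) K(1) \<phi>(2)] by auto
  have "integrable (lebesgue_on K) (\<lambda>x. g x * \<phi> x)"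
  proof (rule Bochner_Integration.integrable_bound)
    show "integrable (lebesgue_on K) (\<lambda>x. C * g x)" using int by simp
    show "(\<lambda>x. g x * \<phi> x) \<in> borel_measurable (lebesgue_on K)"
      by (intro borel_measurable_times[OF borel_measurable_integrable[OF int]]
          lebesgue_on_borel_measurable
          borel_measurable_of_continuous_UNIV \<phi>(1))
    show "AE x in lebesgue_on K. norm (g x * \<phi> x) \<le> norm (C * g x)"
      using C by (intro AE_I2) (simp add: abs_mult mult.commute mult_right_mono)
  qed
  then have "integrable lebesgue (\<lambda>x. indicator K x *\<^sub>R (g x * \<phi> x))"
    using Ks by (subst (asm) integrable_restrict_space) auto
  moreover have "(\<lambda>x. indicator K x *\<^sub>R (g x * \<phi> x)) = (\<lambda>x. indicator \<Omega> x *\<^sub>R (g x * \<phi> x))"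
  proof
    fix x show "indicator K x *\<^sub>R (g x * \<phi> x) = indicator \<Omega> x *\<^sub>R (g x * \<phi> x)"
      using K(2) \<phi>(2)[of x] by (cases "x \<in> K") (simp_all add: subset_iff)
  qed
  ultimately show ?thesis using \<Omega> by (subst integrable_restrict_space) simp_all
qed

lemma test_derivative_continuous:
  "\<phi> \<in> test_functions \<Omega> \<Longrightarrow> i \<in> Basis \<Longrightarrow> continuous_on UNIV (\<lambda>x. frechet_derivative \<phi> (at x) i)"
  using C_k_SucD(2)[OF test_C_k[of \<phi> \<Omega> "Suc 0"]] by simp

lemma test_derivative_support:
  fixes \<phi> :: "'a::euclidean_space \<Rightarrow> real"
  shows "i \<in> Basis \<Longrightarrow> x \<notin> closure {x. \<phi> x \<noteq> 0} \<Longrightarrow> frechet_derivative \<phi> (at x) i = 0"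
  using grad_support[of x \<phi>] grad_inner_Basis[of i \<phi> x] by simp

lemma weak_gradient_integrable:
  assumes G: "has_weak_gradient \<Omega> u G" and \<phi>: "\<phi> \<in> test_functions \<Omega>" and i: "i \<in> Basis"
      and \<Omega>: "\<Omega> \<in> sets lebesgue"
  shows "integrable (lebesgue_on \<Omega>) (\<lambda>x. u x * frechet_derivative \<phi> (at x) i)"
    and "integrable (lebesgue_on \<Omega>) (\<lambda>x. (G x \<bullet> i) * \<phi> x)"
proof -
  have K: "compact (closure {x. \<phi> x \<noteq> 0})" "closure {x. \<phi> x \<noteq> 0} \<subseteq> \<Omega>" using \<phi>
      by (auto simp: test_functions_def)
  show "integrable (lebesgue_on \<Omega>) (\<lambda>x. u x * frechet_derivative \<phi> (at x) i)"
    using G K by (intro integrable_mult_compact_support[OF _ K \<Omega> test_derivative_continuous[OF \<phi> i]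
        test_derivative_support[OF i]])
      (auto simp: has_weak_gradient_def)
  show "integrable (lebesgue_on \<Omega>) (\<lambda>x. (G x \<bullet> i) * \<phi> x)"
    using G K by (intro integrable_mult_compact_support[OF _ K \<Omega> test_continuous[OF \<phi>]
        zero_outside_support[of _ \<phi>]])
      (auto simp: has_weak_gradient_def)
qed

lemma weak_gradient_unique:
  assumes \<Omega>: "open \<Omega>" and G: "has_weak_gradient \<Omega> u G" and G': "has_weak_gradient \<Omega> u G'"
  shows "AE x in lebesgue_on \<Omega>. G x = G' x"
proof -
  have "AE x in lebesgue_on \<Omega>. (G x - G' x) \<bullet> i = 0" if i: "i \<in> Basis" for i
  proof (rule fundamental_lemma[OF \<Omega>])
    fix K assume "compact K" "K \<subseteq> \<Omega>"
    then show "integrable (lebesgue_on K) (\<lambda>x. (G x - G' x) \<bullet> i)"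
      using G G' by (auto simp: has_weak_gradient_def)
  next
    fix \<phi> assume \<phi>: "\<phi> \<in> test_functions \<Omega>"
    have "\<Omega> \<in> sets lebesgue" using \<Omega> by auto
    note int = weak_gradient_integrable(2)[OF _ \<phi> i this]
    have "(LINT x|lebesgue_on \<Omega>. ((G x - G' x) \<bullet> i) * \<phi> x) =
        (LINT x|lebesgue_on \<Omega>. (G x \<bullet> i) * \<phi> x) - (LINT x|lebesgue_on \<Omega>. (G' x \<bullet> i) * \<phi> x)"
      using Bochner_Integration.integral_diff[OF int[OF G] int[OF G']]
          by (simp add: inner_diff_left left_diff_distrib)
    also have "\<dots> = 0"
    proof -
      have "(LINT x|lebesgue_on \<Omega>. u x * frechet_derivative \<phi> (at x) i) = - (LINT x|lebesgue_on \<Omega>.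
          (G x \<bullet> i) * \<phi> x)"
        using G \<phi> i unfolding has_weak_gradient_def by blast
      moreover have "(LINT x|lebesgue_on \<Omega>. u x * frechet_derivative \<phi> (at x) i) =
          - (LINT x|lebesgue_on \<Omega>. (G' x \<bullet> i) * \<phi> x)"
        using G' \<phi> i unfolding has_weak_gradient_def by blast
      ultimately show ?thesis by simp
    qed
    finally show "(LINT x|lebesgue_on \<Omega>. ((G x - G' x) \<bullet> i) * \<phi> x) = 0" .
  qed
  then have "AE x in lebesgue_on \<Omega>. \<forall>i\<in>Basis. (G x - G' x) \<bullet> i = 0" by (intro AE_finite_allI) auto
  then show ?thesis
  proof eventually_elim
    case (elim x) then show ?case using euclidean_eqI[of "G x" "G' x"] by (simp add: inner_diff_left)
  qed
qed

section \<open>Inequalities of Poincare and Sobolev type\<close>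

lemma pred_in_cball [measurable (raw)]:
  "f \<in> M \<rightarrow>\<^sub>M borel \<Longrightarrow> Measurable.pred M (\<lambda>x. f x \<in> cball (c::'a::euclidean_space) d)"
  unfolding mem_cball by measurable

lemma pred_in_ball [measurable (raw)]:
  "f \<in> M \<rightarrow>\<^sub>M borel \<Longrightarrow> Measurable.pred M (\<lambda>x. f x \<in> ball (c::'a::euclidean_space) d)"
  unfolding mem_ball by measurable

lemma nn_integral_translate:
  fixes f :: "'a::euclidean_space \<Rightarrow> ennreal"
  assumes "f \<in> borel_measurable borel"
  shows "(\<integral>\<^sup>+x. f (x + c) \<partial>lborel) = (\<integral>\<^sup>+x. f x \<partial>lborel)"
proof -
  have "(\<integral>\<^sup>+x. f x \<partial>lborel) = (\<integral>\<^sup>+x. f x \<partial>distr lborel borel ((+) c))" by (simp add: lborel_distr_plus)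
  also have "\<dots> = (\<integral>\<^sup>+x. f (c + x) \<partial>lborel)" using assms by (intro nn_integral_distr) auto
  finally show ?thesis by (simp add: add.commute)
qed

lemma nn_integral_scale:
  fixes f :: "'a::euclidean_space \<Rightarrow> ennreal"
  assumes f: "f \<in> borel_measurable borel" and c: "0 < c"
  shows "(\<integral>\<^sup>+x. f x \<partial>lborel) = ennreal (c ^ DIM('a)) * (\<integral>\<^sup>+h. f (x + c *\<^sub>R h) \<partial>lborel)"
proof -
  have "(\<integral>\<^sup>+x. f x \<partial>lborel) = (\<integral>\<^sup>+z. f z \<partial>density (distr lborel borel (\<lambda>h. x + c *\<^sub>R h)) (\<lambda>_.
      \<bar>c\<bar> ^ DIM('a)))"
    using lborel_affine[of c x] c by simp
  also have "\<dots> = (\<integral>\<^sup>+z. ennreal (\<bar>c\<bar> ^ DIM('a)) * f z \<partial>distr lborel borel (\<lambda>h. x + c *\<^sub>R h))"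
    using f by (subst nn_integral_density) auto
  also have "\<dots> = (\<integral>\<^sup>+h. ennreal (\<bar>c\<bar> ^ DIM('a)) * f (x + c *\<^sub>R h) \<partial>lborel)"
    using f by (intro nn_integral_distr) auto
  also have "\<dots> = ennreal (c ^ DIM('a)) * (\<integral>\<^sup>+h. f (x + c *\<^sub>R h) \<partial>lborel)"
    using f c by (subst nn_integral_cmult) auto
  finally show ?thesis .
qed

lemma nn_integral_powr_unit_interval:
  assumes "-1 < (\<beta>::real)"
  shows "(\<integral>\<^sup>+t. ennreal (t powr \<beta>) * indicator {0..1} t \<partial>lborel) = ennreal (1 / (\<beta> + 1))"
proof -
  have "((\<lambda>t::real. if t \<in> {0..1} then t powr \<beta> else 0) has_integral (1 / (\<beta> + 1))) UNIV"
    using has_integral_powr_from_0[OF assms, of 1] by (simp only: has_integral_restrict_UNIV) simp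
  moreover have "(\<lambda>t::real. if t \<in> {0..1} then t powr \<beta> else 0) = (\<lambda>t. t powr \<beta> * indicator {0..1} t)"
    by (auto simp: indicator_def)
  ultimately have "((\<lambda>t::real. t powr \<beta> * indicator {0..1} t) has_integral (1 / (\<beta> + 1))) UNIV" by simp
  then have "(\<integral>\<^sup>+t. ennreal (t powr \<beta> * indicator {0..1} t) \<partial>lborel) = ennreal (1 / (\<beta> + 1))"
    by (intro nn_integral_has_integral_lborel) auto
  moreover have "ennreal (t powr \<beta> * indicator {0..1} t) = ennreal (t powr \<beta>) * indicator {0..1} t"
      for t :: real
    by (auto simp: indicator_def)
  ultimately show ?thesis by simp
qed

lemma increment_le_line_integral:
  fixes \<phi> :: "'a::euclidean_space \<Rightarrow> real"
  assumes \<phi>: "C_k (Suc 0) \<phi>" and T: "0 \<le> T"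
  shows "ennreal \<bar>\<phi> (x + T *\<^sub>R h) - \<phi> x\<bar> \<le>
    (\<integral>\<^sup>+t. ennreal (norm (grad \<phi> (x + t *\<^sub>R h)) * norm h) * indicator {0..T} t \<partial>lborel)"
proof -
  let ?d = "\<lambda>t. grad \<phi> (x + t *\<^sub>R h) \<bullet> h"
  let ?g = "\<lambda>t. norm (grad \<phi> (x + t *\<^sub>R h)) * norm h"
  have gc: "continuous_on UNIV (grad \<phi>)" by (rule C_1_grad_continuous[OF \<phi>])
  have gcomp: "continuous_on UNIV (\<lambda>t. grad \<phi> (x + t *\<^sub>R h))"
    by (rule continuous_on_compose2[OF gc]) (auto intro!: continuous_intros)
  have der: "((\<lambda>t. \<phi> (x + t *\<^sub>R h)) has_real_derivative ?d t) (at t)" for t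
    by (rule has_derivative_along_line[OF C_1_has_grad[OF \<phi>]])
  have FTC: "(?d has_integral (\<phi> (x + T *\<^sub>R h) - \<phi> (x + 0 *\<^sub>R h))) {0..T}"
    using T der by (intro fundamental_theorem_of_calculus)
      (auto simp: has_real_derivative_iff_has_vector_derivative[symmetric] intro:
          has_field_derivative_at_within)
  have gint: "?g integrable_on {0..T}"
    using gcomp by (intro integrable_continuous_real continuous_intros) (auto intro:
        continuous_on_subset)
  have "\<bar>integral {0..T} ?d\<bar> \<le> integral {0..T} ?g"
    using integral_norm_bound_integral[OF has_integral_integrable[OF FTC] gint] Cauchy_Schwarz_ineq2
        by fastforce
  then have "\<bar>\<phi> (x + T *\<^sub>R h) - \<phi> x\<bar> \<le> integral {0..T} ?g" using integral_unique[OF FTC] by simp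
  also have "ennreal (integral {0..T} ?g) = (\<integral>\<^sup>+t. ennreal (?g t) * indicator {0..T} t \<partial>lborel)"
  proof -
    have "((\<lambda>t. if t \<in> {0..T} then ?g t else 0) has_integral integral {0..T} ?g) UNIV"
      using integrable_integral[OF gint] by (simp only: has_integral_restrict_UNIV)
    moreover have "(\<lambda>t. if t \<in> {0..T} then ?g t else 0) = (\<lambda>t. ?g t * indicator {0..T} t)"
      by (auto simp: indicator_def)
    ultimately have "((\<lambda>t. ?g t * indicator {0..T} t) has_integral integral {0..T} ?g) UNIV" by simp
    moreover have "(\<lambda>t. ?g t * indicator {0..T} t) \<in> borel_measurable borel"
      using borel_measurable_of_continuous_UNIV[OF gcomp] by measurable
    ultimately have "(\<integral>\<^sup>+t. ennreal (?g t * indicator {0..T} t) \<partial>lborel) = ennreal (integral {0..T} ?g)"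
      by (intro nn_integral_has_integral_lborel) auto
    moreover have "ennreal (?g t * indicator {0..T} t) = ennreal (?g t) * indicator {0..T} t" for t
      by (auto simp: indicator_def)
    ultimately show ?thesis by simp
  qed
  finally show ?thesis by (simp add: ennreal_leI)
qed

lemma grad_norm_measurable:
  "C_k (Suc 0) \<phi> \<Longrightarrow> (\<lambda>x. norm (grad \<phi> x)) \<in> borel_measurable borel"
  by (intro borel_measurable_of_continuous_UNIV continuous_on_norm C_1_grad_continuous)

text \<open>Moving from \<open>x\<close> by the fixed vector \<open>T e\<close> leaves \<open>\<Omega>\<close>, so \<open>|\<phi>(x)|\<close> is at most the integral of
  \<open>|\<nabla>\<phi>|\<close> over a segment of length \<open>T\<close>; integrating over \<open>x\<close> and using translation invariance gives
  the factor \<open>T\<close>.\<close>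

lemma poincare_L1:
  fixes \<Omega> :: "'a::euclidean_space set"
  assumes "bounded \<Omega>"
  shows "\<exists>T>0. \<forall>\<phi>\<in>test_functions \<Omega>.
    (\<integral>\<^sup>+x. ennreal \<bar>\<phi> x\<bar> \<partial>lborel) \<le> ennreal T * (\<integral>\<^sup>+x. ennreal (norm (grad \<phi> x)) \<partial>lborel)"
proof -
  obtain b where b: "0 < b" "\<And>x. x \<in> \<Omega> \<Longrightarrow> norm x \<le> b" using assms unfolding bounded_pos by blast
  obtain e :: 'a where e: "e \<in> Basis" using nonempty_Basis by blast
  define T where "T = 2 * b + 1"
  have T: "0 < T" using b by (simp add: T_def)
  have "(\<integral>\<^sup>+x. ennreal \<bar>\<phi> x\<bar> \<partial>lborel) \<le> ennreal T * (\<integral>\<^sup>+x. ennreal (norm (grad \<phi> x)) \<partial>lborel)"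
    if \<phi>: "\<phi> \<in> test_functions \<Omega>" for \<phi>
  proof -
    define g where "g x = ennreal (norm (grad \<phi> x))" for x
    have gm[measurable]: "g \<in> borel_measurable borel"
      unfolding g_def[abs_def] using grad_norm_measurable[OF test_C_k[OF \<phi>]] by measurable
    have "ennreal \<bar>\<phi> x\<bar> \<le> (\<integral>\<^sup>+t. g (x + t *\<^sub>R e) * indicator {0..T} t \<partial>lborel)" for x
    proof (cases "x \<in> \<Omega>")
      case True
      have "norm (T *\<^sub>R e) \<le> norm (x + T *\<^sub>R e) + norm x" using norm_triangle_ineq4[of "x + T *\<^sub>R e" x]
          by simp
      then have "x + T *\<^sub>R e \<notin> \<Omega>" using b(2)[OF True] b(2)[of "x + T *\<^sub>R e"] T e unfolding T_def by auto
      then have "\<phi> (x + T *\<^sub>R e) = 0" by (rule test_zero_outside[OF \<phi>])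
      then show ?thesis using increment_le_line_integral[OF test_C_k[OF \<phi>], of T x e] T e
          by (simp add: g_def)
    next
      case False then show ?thesis using test_zero_outside[OF \<phi>] by simp
    qed
    then have "(\<integral>\<^sup>+x. ennreal \<bar>\<phi> x\<bar> \<partial>lborel) \<le> (\<integral>\<^sup>+x. (\<integral>\<^sup>+t. g (x + t *\<^sub>R e) * indicator {0..T} t
        \<partial>lborel) \<partial>lborel)"
      by (intro nn_integral_mono)
    also have "\<dots> = (\<integral>\<^sup>+t. (\<integral>\<^sup>+x. g (x + t *\<^sub>R e) * indicator {0..T} t \<partial>lborel) \<partial>lborel)"
      by (rule lborel_pair.Fubini') measurable
    also have "\<dots> = (\<integral>\<^sup>+t. (\<integral>\<^sup>+x. g x \<partial>lborel) * indicator {0..T} t \<partial>lborel)"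
      by (intro nn_integral_cong) (simp add: nn_integral_multc nn_integral_translate[OF gm])
    also have "\<dots> = (\<integral>\<^sup>+x. g x \<partial>lborel) * ennreal T"
      using T by (subst nn_integral_cmult_indicator) auto
    finally show ?thesis by (simp add: g_def mult.commute)
  qed
  then show ?thesis using T by blast
qed

text \<open>The integral of \<open>g\<close> over all segments from \<open>x\<close> to the points \<open>x + h\<close> of a ball around \<open>x\<close>,
  each segment being parametrised by \<open>t\<close> with density \<open>w\<close>. After the substitution \<open>y = x + t h\<close>
  this is a Riesz-type potential; keeping \<open>t\<close> and \<open>h\<close> apart avoids polar coordinates.\<close>

definition segment_average :: "('a::euclidean_space \<Rightarrow> ennreal) \<Rightarrow> (real \<Rightarrow> real) \<Rightarrow> real \<Rightarrow> 'a \<Rightarrow> ennreal"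
    where
  "segment_average g w \<delta> x = (\<integral>\<^sup>+t. (\<integral>\<^sup>+h. g (x + t *\<^sub>R h) * (ennreal (w t) * indicator {0..1} t *
      indicator (cball 0 \<delta>) h) \<partial>lborel) \<partial>lborel)"

lemma segment_average_measurable:
  assumes [measurable]: "g \<in> borel_measurable borel" "w \<in> borel_measurable borel"
  shows "segment_average g w \<delta> \<in> borel_measurable borel"
  unfolding segment_average_def[abs_def] by measurable

text \<open>Integrate \<open>|\<phi>(x)| \<le> |\<phi>(x + h)| + |\<phi>(x + h) - \<phi>(x)|\<close> over \<open>h\<close> in the ball.\<close>

lemma deviation_le_segment_average:
  fixes \<phi> :: "'a::euclidean_space \<Rightarrow> real"
  assumes \<phi>: "C_k (Suc 0) \<phi>" and \<delta>: "0 < \<delta>"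
  shows "emeasure lborel (cball (0::'a) \<delta>) * ennreal \<bar>\<phi> x\<bar> \<le>
    (\<integral>\<^sup>+x. ennreal \<bar>\<phi> x\<bar> \<partial>lborel) + ennreal \<delta> * segment_average (\<lambda>y. ennreal (norm (grad \<phi> y))) (\<lambda>_.
        1) \<delta> x"
proof -
  define g where "g x = ennreal (norm (grad \<phi> x))" for x
  have gm[measurable]: "g \<in> borel_measurable borel"
    unfolding g_def[abs_def] using grad_norm_measurable[OF \<phi>] by measurable
  have \<phi>m[measurable]: "\<phi> \<in> borel_measurable borel"
    by (intro borel_measurable_of_continuous_UNIV C_k_continuous[OF \<phi>])
  let ?B = "cball (0::'a) \<delta>"
  have pt: "ennreal \<bar>\<phi> x\<bar> * indicator ?B h \<le> ennreal \<bar>\<phi> (h + x)\<bar> +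
      ennreal \<delta> * (\<integral>\<^sup>+t. g (x + t *\<^sub>R h) * (ennreal 1 * indicator {0..1} t * indicator ?B h) \<partial>lborel)"
          for h
  proof (cases "h \<in> ?B")
    case True
    have "ennreal \<bar>\<phi> x\<bar> \<le> ennreal (\<bar>\<phi> (h + x)\<bar> + \<bar>\<phi> (x + 1 *\<^sub>R h) - \<phi> x\<bar>)"
      by (intro ennreal_leI) (simp add: add.commute)
    also have "\<dots> = ennreal \<bar>\<phi> (h + x)\<bar> + ennreal \<bar>\<phi> (x + 1 *\<^sub>R h) - \<phi> x\<bar>" by (rule ennreal_plus) auto
    also have "ennreal \<bar>\<phi> (x + 1 *\<^sub>R h) - \<phi> x\<bar> \<le> (\<integral>\<^sup>+t. ennreal (norm (grad \<phi> (x + t *\<^sub>R h)) * norm h) *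
        indicator {0..1} t \<partial>lborel)"
      by (rule increment_le_line_integral[OF \<phi>]) simp
    also have "\<dots> \<le> (\<integral>\<^sup>+t. ennreal \<delta> * (g (x + t *\<^sub>R h) * indicator {0..1} t) \<partial>lborel)"
      using True \<delta> unfolding g_def
      by (intro nn_integral_mono) (auto simp: ennreal_mult[symmetric] mult.commute intro!: ennreal_leI
          mult_right_mono split: split_indicator)
    also have "\<dots> = ennreal \<delta> * (\<integral>\<^sup>+t. g (x + t *\<^sub>R h) * indicator {0..1} t \<partial>lborel)"
      by (rule nn_integral_cmult) measurable
    finally show ?thesis using True by (simp add: add_left_mono)
  qed simp
  have "emeasure lborel ?B * ennreal \<bar>\<phi> x\<bar> = (\<integral>\<^sup>+h. ennreal \<bar>\<phi> x\<bar> * indicator ?B h \<partial>lborel)"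
    by (subst nn_integral_cmult_indicator) (auto simp: mult.commute)
  also have "\<dots> \<le> (\<integral>\<^sup>+h. (ennreal \<bar>\<phi> (h + x)\<bar> +
      ennreal \<delta> * (\<integral>\<^sup>+t. g (x + t *\<^sub>R h) * (ennreal 1 * indicator {0..1} t * indicator ?B h) \<partial>lborel))
          \<partial>lborel)"
    by (intro nn_integral_mono pt)
  also have "\<dots> = (\<integral>\<^sup>+h. ennreal \<bar>\<phi> (h + x)\<bar> \<partial>lborel) +
      ennreal \<delta> * (\<integral>\<^sup>+h. (\<integral>\<^sup>+t. g (x + t *\<^sub>R h) * (ennreal 1 * indicator {0..1} t * indicator ?B h)
          \<partial>lborel) \<partial>lborel)"
    by (subst nn_integral_add, measurable, subst nn_integral_cmult, measurable)
  also have "(\<integral>\<^sup>+h. ennreal \<bar>\<phi> (h + x)\<bar> \<partial>lborel) = (\<integral>\<^sup>+h. ennreal \<bar>\<phi> h\<bar> \<partial>lborel)"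
    by (rule nn_integral_translate) measurable
  also have "(\<integral>\<^sup>+h. (\<integral>\<^sup>+t. g (x + t *\<^sub>R h) * (ennreal 1 * indicator {0..1} t * indicator ?B h) \<partial>lborel)
      \<partial>lborel) =
      segment_average g (\<lambda>_. 1) \<delta> x" unfolding segment_average_def
    by (rule lborel_pair.Fubini') measurable
  finally show ?thesis unfolding g_def[abs_def] .
qed

text \<open>Young's inequality for three factors with the conjugate exponents \<open>r\<close>, \<open>1 / (1/s - 1/r)\<close> and
  \<open>s / (s - 1)\<close>, applied to \<open>g = (g\<^sup>s\<^sup>/\<^sup>r t\<^sup>a) (g\<^sup>1\<^sup>-\<^sup>s\<^sup>/\<^sup>r t\<^sup>b) t\<^sup>-\<^sup>a\<^sup>-\<^sup>b\<close>. A free parameter \<open>l\<close>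
  weighs the first term against the others. The weights \<open>1/r\<close>, \<open>1/s - 1/r\<close> and \<open>1 - 1/s\<close> of the
  logarithms add up to 1, so the largest of the three terms dominates \<open>g\<close>.\<close>

lemma three_term_young:
  fixes g l t :: real
  assumes g: "0 \<le> g" and l: "0 < l" and t: "0 < t" and s: "1 < s" and r: "s < r"
  shows "g \<le> l powr (1 - r) * (t powr (r * a) * g powr s) +
     l * (t powr (b / (1/s - 1/r)) * g powr s + t powr (- (a + b) / (1 - 1/s)))"
proof (cases "g = 0")
  case True then show ?thesis using l t by simp
next
  case False
  then have gp: "0 < g" using g by simp
  define A where "A = l powr (1 - r) * (t powr (r * a) * g powr s)"
  define B where "B = l * (t powr (b / (1/s - 1/r)) * g powr s)"
  define C where "C = l * t powr (- (a + b) / (1 - 1/s))"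
  have pos: "0 < A" "0 < B" "0 < C" using gp l t by (auto simp: A_def B_def C_def)
  define m where "m = max A (max B C)"
  define u where "u = 1/s - 1/r"
  have u: "0 < u" using s r by (simp add: u_def field_simps)
  have v: "0 < 1 - 1/s" using s by simp
  have lA: "ln A = (1 - r) * ln l + r * a * ln t + s * ln g"
    using gp l t by (simp add: A_def ln_mult)
  have lB: "ln B = ln l + b / u * ln t + s * ln g"
    using gp l t by (simp add: B_def ln_mult u_def)
  have lC: "ln C = ln l + (- (a + b) / (1 - 1/s)) * ln t"
    using gp l t by (simp add: C_def ln_mult)
  have "ln g = 1/r * ln A + u * ln B + (1 - 1/s) * ln C"
  proof -
    have 1: "1/r * ln A = (1/r - 1) * ln l + a * ln t + s / r * ln g" unfolding lA using s r
        by (simp add: field_simps)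
    have 2: "u * ln B = u * ln l + b * ln t + u * s * ln g" unfolding lB using u
        by (simp add: field_simps)
    have 3: "(1 - 1/s) * ln C = (1 - 1/s) * ln l - (a + b) * ln t" unfolding lC using v
      by (simp only: distrib_left mult.assoc[symmetric] times_divide_eq_right
          nonzero_mult_div_cancel_left)
    have 4: "u * s = 1 - s / r" using s r by (simp add: u_def field_simps)
    show ?thesis unfolding 1 2 3 4 by (simp add: u_def algebra_simps)
  qed
  also have "\<dots> \<le> 1/r * ln m + u * ln m + (1 - 1/s) * ln m"
    using pos u v s r by (intro add_mono mult_left_mono ln_mono) (auto simp: m_def)
  also have "\<dots> = ln m" by (simp add: u_def algebra_simps)
  finally have "g \<le> m" using gp pos by (subst (asm) ln_le_cancel_iff) (auto simp: m_def)
  also have "m \<le> A + (B + C)" using pos by (auto simp: m_def)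
  finally show ?thesis by (simp add: A_def B_def C_def distrib_left)
qed

lemma segment_average_le_powers:
  fixes g :: "'a::euclidean_space \<Rightarrow> real"
  assumes gm[measurable]: "g \<in> borel_measurable borel" and g: "\<And>y. 0 \<le> g y"
    and l: "0 < l" and s: "1 < s" and r: "s < r" and \<delta>: "0 < \<delta>" and x: "x \<in> ball x0 \<delta>"
  defines "gs \<equiv> \<lambda>y. ennreal (g y powr s) * indicator (cball x0 (2 * \<delta>)) y"
  shows "segment_average (\<lambda>y. ennreal (g y)) (\<lambda>_. 1) \<delta> x \<le>
    ennreal (l powr (1 - r)) * segment_average gs (\<lambda>t. t powr (r * a)) \<delta> x +
    ennreal l * (segment_average gs (\<lambda>t. t powr (b / (1/s - 1/r))) \<delta> x +
       segment_average (\<lambda>_. 1) (\<lambda>t. t powr (- (a + b) / (1 - 1/s))) \<delta> x)"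
proof -
  have gsm[measurable]: "gs \<in> borel_measurable borel" unfolding gs_def by measurable
  define c where "c t h = indicator {0..1} t * (indicator (cball (0::'a) \<delta>) h :: ennreal)" for t :: real
      and h
  define w1 where "w1 t = t powr (r * a)" for t :: real
  define w2 where "w2 t = t powr (b / (1/s - 1/r))" for t :: real
  define w3 where "w3 t = t powr (- (a + b) / (1 - 1/s))" for t :: real
  have wm[measurable]: "w1 \<in> borel_measurable borel" "w2 \<in> borel_measurable borel" "w3 \<in>
      borel_measurable borel"
    unfolding w1_def[abs_def] w2_def[abs_def] w3_def[abs_def] by measurable
  have cm[measurable]: "(\<lambda>(t, h). c t h) \<in> borel_measurable (borel \<Otimes>\<^sub>M borel)" unfolding c_def
      by measurable
  have pt: "ennreal (g (x + t *\<^sub>R h)) * (ennreal 1 * indicator {0..1} t * indicator (cball 0 \<delta>) h) \<le>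
    ennreal (l powr (1 - r)) * (gs (x + t *\<^sub>R h) * (ennreal (w1 t) * indicator {0..1} t * indicator
        (cball 0 \<delta>) h)) +
    ennreal l * (gs (x + t *\<^sub>R h) * (ennreal (w2 t) * indicator {0..1} t * indicator (cball 0 \<delta>) h) +
       1 * (ennreal (w3 t) * indicator {0..1} t * indicator (cball 0 \<delta>) h))" (is "?L \<le> ?R")
           if t0: "t \<noteq> 0" for t h
  proof (cases "t \<in> {0..1} \<and> h \<in> cball 0 \<delta>")
    case True
    then have t: "0 < t" "t \<le> 1" and h: "norm h \<le> \<delta>" using t0 by auto
    have "dist x0 (x + t *\<^sub>R h) \<le> dist x0 x + norm (t *\<^sub>R h)"
      using dist_triangle[of x0 "x + t *\<^sub>R h" x] by (simp add: dist_norm)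
    moreover have "norm (t *\<^sub>R h) \<le> 1 * norm h" unfolding norm_scaleR using t
        by (intro mult_right_mono) auto
    ultimately have in2: "x + t *\<^sub>R h \<in> cball x0 (2 * \<delta>)" using x h by simp
    define y where "y = g (x + t *\<^sub>R h)"
    have y: "0 \<le> y" using g by (simp add: y_def)
    have "y \<le> l powr (1 - r) * (w1 t * y powr s) + l * (w2 t * y powr s + w3 t)"
      unfolding w1_def w2_def w3_def by (rule three_term_young[OF y l t(1) s r])
    then have "ennreal y \<le> ennreal (l powr (1 - r) * (w1 t * y powr s) + l * (w2 t * y powr s + w3 t))"
        by (rule ennreal_leI)
    also have "\<dots> = ennreal (l powr (1 - r)) * (ennreal (y powr s) * ennreal (w1 t)) +
        ennreal l * (ennreal (y powr s) * ennreal (w2 t) + ennreal (w3 t))"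
      using l by (simp add: ennreal_plus ennreal_mult w1_def w2_def w3_def mult.commute)
    finally show ?thesis using True in2 by (simp add: gs_def y_def)
  next
    case False then show ?thesis by auto
  qed
  have "segment_average (\<lambda>y. ennreal (g y)) (\<lambda>_. 1) \<delta> x \<le> (\<integral>\<^sup>+t. (\<integral>\<^sup>+h.
    ennreal (l powr (1 - r)) * (gs (x + t *\<^sub>R h) * (ennreal (w1 t) * indicator {0..1} t * indicator
        (cball 0 \<delta>) h)) +
    ennreal l * (gs (x + t *\<^sub>R h) * (ennreal (w2 t) * indicator {0..1} t * indicator (cball 0 \<delta>) h) +
       1 * (ennreal (w3 t) * indicator {0..1} t * indicator (cball 0 \<delta>) h)) \<partial>lborel) \<partial>lborel)"
    unfolding segment_average_def
  proof (rule nn_integral_mono_AE)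
    have "AE t in lborel. t \<noteq> (0::real)" by (rule AE_lborel_singleton)
    then show "AE t in lborel. (\<integral>\<^sup>+h. ennreal (g (x + t *\<^sub>R h)) * (ennreal 1 * indicator {0..1} t *
        indicator (cball 0 \<delta>) h) \<partial>lborel)
      \<le> (\<integral>\<^sup>+h. ennreal (l powr (1 - r)) * (gs (x + t *\<^sub>R h) * (ennreal (w1 t) * indicator {0..1} t *
          indicator (cball 0 \<delta>) h)) +
    ennreal l * (gs (x + t *\<^sub>R h) * (ennreal (w2 t) * indicator {0..1} t * indicator (cball 0 \<delta>) h) +
       1 * (ennreal (w3 t) * indicator {0..1} t * indicator (cball 0 \<delta>) h)) \<partial>lborel)"
      by eventually_elim (intro nn_integral_mono pt)
  qed
  also have "\<dots> = ennreal (l powr (1 - r)) * segment_average gs w1 \<delta> x +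
    ennreal l * (segment_average gs w2 \<delta> x + segment_average (\<lambda>_. 1) w3 \<delta> x)"
    unfolding segment_average_def by (simp add: nn_integral_add nn_integral_cmult)
  finally show ?thesis unfolding w1_def[abs_def] w2_def[abs_def] w3_def[abs_def] .
qed

text \<open>For fixed \<open>t\<close> the substitution \<open>y = x + t h\<close> costs the factor \<open>t\<close> to the power minus the
  dimension, which \<open>t\<^sup>\<beta>\<close> has to compensate.\<close>

lemma segment_average_bound:
  fixes gs :: "'a::euclidean_space \<Rightarrow> ennreal"
  assumes [measurable]: "gs \<in> borel_measurable borel" and S: "(\<integral>\<^sup>+y. gs y \<partial>lborel) \<le> ennreal S" "0 \<le> S"
    and \<beta>: "-1 < \<beta> - real DIM('a)"
  shows "segment_average gs (\<lambda>t. t powr \<beta>) \<delta> x \<le> ennreal (S / (\<beta> - real DIM('a) + 1))"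
proof -
  have inner: "(\<integral>\<^sup>+h. gs (x + t *\<^sub>R h) * (ennreal (t powr \<beta>) * indicator {0..1} t * indicator (cball 0
      \<delta>) h) \<partial>lborel)
      \<le> ennreal (t powr (\<beta> - real DIM('a))) * indicator {0..1} t * ennreal S" if "t \<noteq> 0" for t
  proof (cases "t \<in> {0..1}")
    case True
    then have t: "0 < t" using that by auto
    have "(\<integral>\<^sup>+h. gs (x + t *\<^sub>R h) * (ennreal (t powr \<beta>) * indicator {0..1} t * indicator (cball 0 \<delta>) h)
        \<partial>lborel)
        \<le> (\<integral>\<^sup>+h. ennreal (t powr \<beta>) * gs (x + t *\<^sub>R h) \<partial>lborel)"
      using True by (intro nn_integral_mono) (auto simp: mult.commute split: split_indicator)
    also have "\<dots> = ennreal (t powr \<beta>) * (\<integral>\<^sup>+h. gs (x + t *\<^sub>R h) \<partial>lborel)"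
      by (rule nn_integral_cmult) measurable
    also have "\<dots> = ennreal (t powr (\<beta> - real DIM('a))) * (\<integral>\<^sup>+y. gs y \<partial>lborel)"
    proof -
      have "t powr \<beta> = t powr (\<beta> - real DIM('a)) * t ^ DIM('a)"
        using t by (simp add: powr_diff powr_realpow)
      then show ?thesis using t nn_integral_scale[of gs t x] by (simp add: ennreal_mult mult.assoc)
    qed
    also have "\<dots> \<le> ennreal (t powr (\<beta> - real DIM('a))) * ennreal S" using S
        by (intro mult_left_mono) auto
    finally show ?thesis using True by simp
  qed simp
  have "segment_average gs (\<lambda>t. t powr \<beta>) \<delta> x \<le>
      (\<integral>\<^sup>+t. ennreal (t powr (\<beta> - real DIM('a))) * indicator {0..1} t * ennreal S \<partial>lborel)"
    unfolding segment_average_def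
  proof (rule nn_integral_mono_AE)
    have "AE t in lborel. t \<noteq> (0::real)" by (rule AE_lborel_singleton)
    then show "AE t in lborel. (\<integral>\<^sup>+h. gs (x + t *\<^sub>R h) * (ennreal (t powr \<beta>) * indicator {0..1} t *
        indicator (cball 0 \<delta>) h) \<partial>lborel)
      \<le> ennreal (t powr (\<beta> - real DIM('a))) * indicator {0..1} t * ennreal S"
      by eventually_elim (rule inner)
  qed
  also have "\<dots> = ennreal (1 / (\<beta> - real DIM('a) + 1)) * ennreal S"
    by (subst nn_integral_multc) (simp_all add: nn_integral_powr_unit_interval[OF \<beta>])
  also have "\<dots> = ennreal (S / (\<beta> - real DIM('a) + 1))" using S \<beta> by (simp add: ennreal_mult[symmetric])
  finally show ?thesis .
qed

lemma segment_average_const: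
  assumes "-1 < \<beta>"
  shows "segment_average (\<lambda>_. 1) (\<lambda>t. t powr \<beta>) \<delta> (x::'a::euclidean_space) =
    emeasure lborel (cball (0::'a) \<delta>) * ennreal (1 / (\<beta> + 1))"
proof -
  have "segment_average (\<lambda>_. 1) (\<lambda>t. t powr \<beta>) \<delta> x =
      (\<integral>\<^sup>+t. (ennreal (t powr \<beta>) * indicator {0..1} t) * emeasure lborel (cball (0::'a) \<delta>) \<partial>lborel)"
    unfolding segment_average_def by (intro nn_integral_cong) (simp add: nn_integral_cmult_indicator)
  also have "\<dots> = ennreal (1 / (\<beta> + 1)) * emeasure lborel (cball (0::'a) \<delta>)"
    by (subst nn_integral_multc) (simp_all add: nn_integral_powr_unit_interval[OF assms])
  finally show ?thesis by (simp add: mult.commute)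
qed

text \<open>Integrating over \<open>x\<close> first, translation invariance removes the shift, so no power of \<open>t\<close> is
  lost.\<close>

lemma integral_segment_average:
  fixes gs :: "'a::euclidean_space \<Rightarrow> ennreal"
  assumes gsm[measurable]: "gs \<in> borel_measurable borel" and \<beta>: "-1 < \<beta>"
  shows "(\<integral>\<^sup>+x. segment_average gs (\<lambda>t. t powr \<beta>) \<delta> x \<partial>lborel) =
    (\<integral>\<^sup>+y. gs y \<partial>lborel) * (emeasure lborel (cball (0::'a) \<delta>) * ennreal (1 / (\<beta> + 1)))"
proof -
  define c where "c t h = ennreal (t powr \<beta>) * indicator {0..1} t * (indicator (cball (0::'a) \<delta>) h ::
      ennreal)" for t :: real and h
  have cm[measurable]: "(\<lambda>(t, h). c t h) \<in> borel_measurable (borel \<Otimes>\<^sub>M borel)" unfolding c_def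
      by measurable
  have "(\<integral>\<^sup>+x. segment_average gs (\<lambda>t. t powr \<beta>) \<delta> x \<partial>lborel) =
      (\<integral>\<^sup>+x. (\<integral>\<^sup>+t. (\<integral>\<^sup>+h. gs (x + t *\<^sub>R h) * c t h \<partial>lborel) \<partial>lborel) \<partial>lborel)"
    by (simp add: segment_average_def c_def)
  also have "\<dots> = (\<integral>\<^sup>+t. (\<integral>\<^sup>+x. (\<integral>\<^sup>+h. gs (x + t *\<^sub>R h) * c t h \<partial>lborel) \<partial>lborel) \<partial>lborel)"
    by (rule lborel_pair.Fubini') measurable
  also have "\<dots> = (\<integral>\<^sup>+t. (\<integral>\<^sup>+h. (\<integral>\<^sup>+x. gs (x + t *\<^sub>R h) * c t h \<partial>lborel) \<partial>lborel) \<partial>lborel)"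
    by (intro nn_integral_cong lborel_pair.Fubini') measurable
  also have "\<dots> = (\<integral>\<^sup>+t. (\<integral>\<^sup>+h. (\<integral>\<^sup>+y. gs y \<partial>lborel) * c t h \<partial>lborel) \<partial>lborel)"
    by (intro nn_integral_cong) (simp add: nn_integral_multc nn_integral_translate[OF gsm])
  also have "\<dots> = (\<integral>\<^sup>+y. gs y \<partial>lborel) * (\<integral>\<^sup>+t. (\<integral>\<^sup>+h. 1 * c t h \<partial>lborel) \<partial>lborel)"
    by (simp add: nn_integral_cmult)
  also have "(\<integral>\<^sup>+t. (\<integral>\<^sup>+h. 1 * c t h \<partial>lborel) \<partial>lborel) = segment_average (\<lambda>_. 1) (\<lambda>t.
      t powr \<beta>) \<delta> (0::'a)"
    unfolding segment_average_def c_def ..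
  finally show ?thesis by (simp add: segment_average_const[OF \<beta>])
qed

text \<open>Subcritical Sobolev inequality on a ball. By \<open>deviation_le_segment_average\<close> it remains to
  bound the segment average of \<open>|\<nabla>\<phi>|\<close> in \<open>L\<^sup>r\<close>. In \<open>segment_average_le_powers\<close> the second and
  third terms are bounded uniformly in \<open>x\<close>, and the first one is integrable in \<open>x\<close>; choosing \<open>l\<close>
  as the \<open>r\<close>-th root of 1 plus the first average makes the whole bound a multiple of \<open>l\<close>. The
  condition on \<open>s\<close> and \<open>r\<close> is what permits exponents \<open>a\<close> and \<open>b\<close> for which all powers of \<open>t\<close> are
  integrable at \<open>0\<close>.\<close>

lemma local_sobolev:
  fixes s r \<delta> S P :: real
  assumes s: "1 < s" and r: "s < r" and sub: "real DIM('a::euclidean_space) * (1/s - 1/r) < 1"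
    and \<delta>: "0 < \<delta>" and S: "0 \<le> S" and P: "0 \<le> P"
  shows "\<exists>K\<ge>0. \<forall>\<phi>. \<forall>x0::'a. C_k (Suc 0) \<phi> \<longrightarrow> (\<integral>\<^sup>+x. ennreal \<bar>\<phi> x\<bar> \<partial>lborel) \<le> ennreal P \<longrightarrow>
     (\<integral>\<^sup>+x. ennreal (norm (grad \<phi> x) powr s) * indicator (cball x0 (2 * \<delta>)) x \<partial>lborel) \<le> ennreal S \<longrightarrow>
     (\<integral>\<^sup>+x. ennreal (\<bar>\<phi> x\<bar> powr r) * indicator (ball x0 \<delta>) x \<partial>lborel) \<le> ennreal K"
proof -
  define n where "n = real DIM('a)"
  define u where "u = 1/s - 1/r"
  have u: "0 < u" using s r by (simp add: u_def field_simps)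
  define \<eta> where "\<eta> = (1 - n * u) / 4"
  have "n * u < 1" using sub by (simp add: n_def u_def)
  then have "0 < \<eta>" by (simp add: \<eta>_def)
  moreover have "4 * \<eta> = 1 - n * u" by (simp add: \<eta>_def)
  ultimately have \<eta>: "0 < \<eta>" "n * u = 1 - 4 * \<eta>" by simp_all
  \<comment> \<open>The three integrability conditions are \<open>r a > -1\<close>, \<open>b / u - n > -1\<close> and \<open>a + b < 1 - 1/s\<close>;
    the gap \<open>1 - n u = 4 \<eta>\<close> leaves room for all of them.\<close>
  define a b where "a = - 1/r + \<eta>" and "b = (n - 1) * u + \<eta>"
  define \<beta>1 \<beta>2 \<beta>3 where "\<beta>1 = r * a" and "\<beta>2 = b / u" and "\<beta>3 = - (a + b) / (1 - 1/s)"
  have "\<beta>1 = r * \<eta> - 1" using s r by (simp add: \<beta>1_def a_def right_diff_distrib distrib_left)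
  then have \<beta>1: "-1 < \<beta>1" using s r \<eta> by simp
  have "\<beta>2 = n - 1 + \<eta> / u" using u by (simp add: \<beta>2_def b_def add_divide_distrib)
  moreover have "0 < \<eta> / u" using \<eta> u by simp
  ultimately have \<beta>2: "-1 < \<beta>2 - n" by linarith
  have v: "0 < 1 - 1/s" using s by simp
  have "a + b = n * u - 1/s + 2 * \<eta>" 
  proof -
    have "b = n * u - u + \<eta>" by (simp add: b_def left_diff_distrib)
    moreover have "u = 1/s - 1/r" by (rule u_def)
    ultimately show ?thesis unfolding a_def by linarith
  qed
  then have "a + b < 1 - 1/s" using \<eta> by linarith
  then have "(a + b) / (1 - 1/s) < 1" using v by (simp only: divide_less_eq_1_pos)
  then have \<beta>3: "-1 < \<beta>3" unfolding \<beta>3_def minus_divide_left[symmetric] by linarith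
  define \<omega> where "\<omega> = unit_ball_vol n * \<delta> ^ DIM('a)"
  have \<omega>: "0 < \<omega>" using \<delta> by (simp add: \<omega>_def n_def)
  have e\<omega>: "emeasure lborel (cball (0::'a) \<delta>) = ennreal \<omega>" "emeasure lborel (ball (x::'a) \<delta>) =
      ennreal \<omega>" for x
    using \<delta> emeasure_cball[of \<delta> "0::'a"] emeasure_ball[of \<delta> x] by (simp_all add: \<omega>_def n_def)
  define C where "C = S / (\<beta>2 - n + 1) + \<omega> / (\<beta>3 + 1)"
  have C: "0 \<le> C" using \<beta>2 \<beta>3 S \<omega> by (simp add: C_def)
  define K1 where "K1 = (2 / \<omega>) powr r * P powr r"
  define K2 where "K2 = (2 / \<omega>) powr r * (\<delta> * (1 + C)) powr r"
  have K1: "0 \<le> K1" by (simp add: K1_def)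
  have K2: "0 < K2" using \<omega> \<delta> C by (simp add: K2_def)
  define I1 where "I1 = S * (\<omega> * (1 / (\<beta>1 + 1)))"
  have I1: "0 \<le> I1" using S \<omega> \<beta>1 by (simp add: I1_def)
  have "(\<integral>\<^sup>+x. ennreal (\<bar>\<phi> x\<bar> powr r) * indicator (ball x0 \<delta>) x \<partial>lborel) \<le> ennreal ((K1 + K2) * \<omega> +
      K2 * I1)"
    if \<phi>: "C_k (Suc 0) \<phi>" and hP: "(\<integral>\<^sup>+x. ennreal \<bar>\<phi> x\<bar> \<partial>lborel) \<le> ennreal P"
      and hS: "(\<integral>\<^sup>+x. ennreal (norm (grad \<phi> x) powr s) * indicator (cball x0 (2 * \<delta>)) x \<partial>lborel) \<le>
          ennreal S"
    for \<phi> and x0 :: 'a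
  proof -
    define g where "g y = norm (grad \<phi> y)" for y
    have gm[measurable]: "g \<in> borel_measurable borel" unfolding g_def[abs_def]
        by (rule grad_norm_measurable[OF \<phi>])
    define gs where "gs y = ennreal (g y powr s) * indicator (cball x0 (2 * \<delta>)) y" for y
    have gsm[measurable]: "gs \<in> borel_measurable borel" unfolding gs_def[abs_def] by measurable
    have gS: "(\<integral>\<^sup>+y. gs y \<partial>lborel) \<le> ennreal S" using hS by (simp add: gs_def g_def)
    define E where "E = segment_average gs (\<lambda>t. t powr \<beta>1) \<delta>"
    have Em[measurable]: "E \<in> borel_measurable borel" unfolding E_def
        by (rule segment_average_measurable) measurable
    have pt: "ennreal (\<bar>\<phi> x\<bar> powr r) \<le> ennreal (K1 + K2) + ennreal K2 * E x" if x: "x \<in> ball x0 \<delta>" for x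
    proof (cases "E x")
      case top then show ?thesis using K2 by (simp add: ennreal_mult_top)
    next
      case (real e)
      \<comment> \<open>The summand 1 keeps \<open>l\<close> positive when the average vanishes.\<close>
      define l where "l = (e + 1) powr (1 / r)"
      have l: "0 < l" "l powr r = e + 1" using real s r by (simp_all add: l_def powr_powr)
      have le: "l powr (1 - r) * e \<le> l"
      proof -
        have "l powr (1 - r) * e \<le> l powr (1 - r) * l powr r" using l by (intro mult_left_mono) auto
        also have "\<dots> = l powr (1 - r + r)" by (rule powr_add[symmetric])
        also have "\<dots> = l" using l(1) by simp
        finally show ?thesis .
      qed
      have "segment_average (\<lambda>y. ennreal (g y)) (\<lambda>_. 1) \<delta> x \<le>
          ennreal (l powr (1 - r)) * E x +
          ennreal l * (segment_average gs (\<lambda>t. t powr \<beta>2) \<delta> x + segment_average (\<lambda>_. 1) (\<lambda>t.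
              t powr \<beta>3) \<delta> x)"
        unfolding E_def \<beta>1_def \<beta>2_def \<beta>3_def gs_def[abs_def] u_def
        by (rule segment_average_le_powers[OF gm _ l(1) s r \<delta> x]) (simp add: g_def)
      also have "\<dots> \<le> ennreal (l powr (1 - r)) * ennreal e +
          ennreal l * (ennreal (S / (\<beta>2 - n + 1)) + ennreal \<omega> * ennreal (1 / (\<beta>3 + 1)))"
        using segment_average_bound[OF gsm gS S, of \<beta>2 \<delta> x] \<beta>2 segment_average_const[OF \<beta>3, of \<delta> x] real
        by (intro add_mono mult_left_mono) (simp_all add: n_def e\<omega>)
      also have "\<dots> = ennreal (l powr (1 - r) * e + l * C)"
        using real l S \<omega> \<beta>2 \<beta>3 by (simp add: C_def ennreal_mult[symmetric] ennreal_plus[symmetric] del: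
            ennreal_plus)
      also have "\<dots> \<le> ennreal (l * (1 + C))" using le by (intro ennreal_leI) (simp add: distrib_left)
      finally have Y: "segment_average (\<lambda>y. ennreal (g y)) (\<lambda>_. 1) \<delta> x \<le> ennreal (l * (1 + C))" .
      have "ennreal (\<omega> * \<bar>\<phi> x\<bar>) = emeasure lborel (cball (0::'a) \<delta>) * ennreal \<bar>\<phi> x\<bar>"
        using \<omega> by (simp add: e\<omega> ennreal_mult)
      also have "\<dots> \<le> (\<integral>\<^sup>+x. ennreal \<bar>\<phi> x\<bar> \<partial>lborel) + ennreal \<delta> * segment_average (\<lambda>y.
          ennreal (g y)) (\<lambda>_. 1) \<delta> x"
        unfolding g_def by (rule deviation_le_segment_average[OF \<phi> \<delta>])
      also have "\<dots> \<le> ennreal P + ennreal \<delta> * ennreal (l * (1 + C))"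
        using hP Y by (intro add_mono mult_left_mono) auto
      also have "\<dots> = ennreal (P + \<delta> * (1 + C) * l)"
        using P \<delta> l C by (simp add: ennreal_mult[symmetric] ennreal_plus[symmetric] mult_ac del:
            ennreal_plus)
      finally have "\<omega> * \<bar>\<phi> x\<bar> \<le> P + \<delta> * (1 + C) * l" using P \<delta> l C by (subst (asm) ennreal_le_iff) auto
      also have "\<dots> \<le> 2 * max P (\<delta> * (1 + C) * l)" by simp
      finally have "\<bar>\<phi> x\<bar> \<le> 2 / \<omega> * max P (\<delta> * (1 + C) * l)" using \<omega> by (simp add: field_simps)
      then have "\<bar>\<phi> x\<bar> powr r \<le> (2 / \<omega> * max P (\<delta> * (1 + C) * l)) powr r" using s r
          by (intro powr_mono2) auto
      also have "\<dots> = (2 / \<omega>) powr r * (max P (\<delta> * (1 + C) * l)) powr r" by (rule powr_mult)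
      also have "(max P (\<delta> * (1 + C) * l)) powr r \<le> P powr r + (\<delta> * (1 + C) * l) powr r"
        by (simp add: max_def)
      also have "(\<delta> * (1 + C) * l) powr r = (\<delta> * (1 + C)) powr r * (e + 1)"
        using \<delta> C l by (subst powr_mult) auto
      finally have "\<bar>\<phi> x\<bar> powr r \<le> (K1 + K2) + K2 * e"
        using \<omega> by (simp add: K1_def K2_def algebra_simps mult_left_mono)
      then have "ennreal (\<bar>\<phi> x\<bar> powr r) \<le> ennreal ((K1 + K2) + K2 * e)" by (rule ennreal_leI)
      also have "\<dots> = ennreal (K1 + K2) + ennreal K2 * E x"
        using K1 K2 real by (simp add: ennreal_plus ennreal_mult)
      finally show ?thesis .
    qed
    have "(\<integral>\<^sup>+x. ennreal (\<bar>\<phi> x\<bar> powr r) * indicator (ball x0 \<delta>) x \<partial>lborel) \<le>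
        (\<integral>\<^sup>+x. (ennreal (K1 + K2) * indicator (ball x0 \<delta>) x + ennreal K2 * E x) \<partial>lborel)"
    proof (rule nn_integral_mono)
      fix x show "ennreal (\<bar>\<phi> x\<bar> powr r) * indicator (ball x0 \<delta>) x \<le> ennreal (K1 +
          K2) * indicator (ball x0 \<delta>) x + ennreal K2 * E x"
        using pt[of x] by (cases "x \<in> ball x0 \<delta>") auto
    qed
    also have "\<dots> = (\<integral>\<^sup>+x. ennreal (K1 + K2) * indicator (ball x0 \<delta>) x \<partial>lborel) + (\<integral>\<^sup>+x.
        ennreal K2 * E x \<partial>lborel)"
      by (rule nn_integral_add) measurable
    also have "\<dots> = ennreal (K1 + K2) * ennreal \<omega> + ennreal K2 * (\<integral>\<^sup>+x. E x \<partial>lborel)"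
      by (subst nn_integral_cmult_indicator) (simp_all add: e\<omega> nn_integral_cmult)
    also have "(\<integral>\<^sup>+x. E x \<partial>lborel) \<le> ennreal S * (ennreal \<omega> * ennreal (1 / (\<beta>1 + 1)))"
      unfolding E_def integral_segment_average[OF gsm \<beta>1] e\<omega> using gS by (intro mult_right_mono) auto
    also have "ennreal S * (ennreal \<omega> * ennreal (1 / (\<beta>1 + 1))) = ennreal I1"
    proof -
      have "0 \<le> 1 / (\<beta>1 + 1)" using \<beta>1 by simp
      then show ?thesis using S \<omega> by (simp only: I1_def ennreal_mult mult_nonneg_nonneg less_imp_le)
    qed
    finally show ?thesis using K1 K2 I1 \<omega> by (simp add: ennreal_mult ennreal_plus mult_left_mono)
  qed
  moreover have "0 \<le> (K1 + K2) * \<omega> + K2 * I1" using K1 K2 \<omega> I1 by simp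
  ultimately show ?thesis by blast
qed

section \<open>The modular and the duality pairing of vector fields\<close>

text \<open>The standing hypotheses. The subcriticality of \<open>q\<close> and the boundedness of \<open>\<mu>\<close> are assumed
  only in the lemmas on which coercivity depends.\<close>

locale log_double_phase =
  fixes \<Omega> :: "'a::euclidean_space set" and p q \<mu> :: "'a \<Rightarrow> real"
  assumes \<Omega>_open: "open \<Omega>" and \<Omega>_nonempty: "\<Omega> \<noteq> {}" and \<Omega>_bounded: "bounded \<Omega>"
    and p_C_plus: "p \<in> C_plus \<Omega>" and q_C_plus: "q \<in> C_plus \<Omega>"
    and p_le_q: "\<And>x. x \<in> closure \<Omega> \<Longrightarrow> p x \<le> q x"
    and \<mu>_integrable: "integrable (lebesgue_on \<Omega>) \<mu>"
    and \<mu>_nonneg: "AE x in lebesgue_on \<Omega>. 0 \<le> \<mu> x"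
begin

abbreviation "M \<equiv> lebesgue_on \<Omega>"

definition "p_min = (INF x\<in>closure \<Omega>. p x)"

text \<open>Natural, because it serves as the lower exponent in \<open>power_growth\<close>.\<close>

definition "q_bound = (SOME n::nat. \<forall>x\<in>closure \<Omega>. q x \<le> real n)"

lemma compact_closure_\<Omega>: "compact (closure \<Omega>)"
  using \<Omega>_bounded by simp

lemma p_min_gt_1: "1 < p_min"
  using p_C_plus by (simp add: C_plus_def p_min_def)

lemma p_min_le: "x \<in> closure \<Omega> \<Longrightarrow> p_min \<le> p x"
proof -
  assume x: "x \<in> closure \<Omega>"
  have "continuous_on (closure \<Omega>) p" using p_C_plus by (simp add: C_plus_def)
  then have "bounded (p ` closure \<Omega>)" using compact_closure_\<Omega> compact_continuous_image
      compact_imp_bounded by blast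
  then have "bdd_below (p ` closure \<Omega>)" by (rule bounded_imp_bdd_below)
  then show ?thesis unfolding p_min_def using x by (rule cINF_lower)
qed

lemma q_le_bound: "x \<in> closure \<Omega> \<Longrightarrow> q x \<le> real q_bound"
proof -
  assume x: "x \<in> closure \<Omega>"
  have "continuous_on (closure \<Omega>) q" using q_C_plus by (simp add: C_plus_def)
  then have "bounded (q ` closure \<Omega>)" using compact_closure_\<Omega> compact_continuous_image
      compact_imp_bounded by blast
  then have "bdd_above (q ` closure \<Omega>)" by (rule bounded_imp_bdd_above)
  then obtain b where "\<And>x. x \<in> closure \<Omega> \<Longrightarrow> q x \<le> b" by (auto simp: bdd_above_def)
  moreover obtain n where "b \<le> real n" using real_arch_simple by blast
  ultimately have "\<exists>n::nat. \<forall>x\<in>closure \<Omega>. q x \<le> real n" by (meson order_trans)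
  from someI_ex[OF this] show ?thesis using x by (simp add: q_bound_def)
qed

text \<open>The points at which the pointwise inequalities apply; by \<open>AE_regular\<close> they are almost all of
  \<open>\<Omega>\<close>.\<close>

definition regular :: "'a \<Rightarrow> bool" where
  "regular x \<longleftrightarrow> x \<in> \<Omega> \<and> p_min \<le> p x \<and> p x \<le> q x \<and> q x \<le> real q_bound \<and> 0 \<le> \<mu> x"

lemma AE_regular: "AE x in M. regular x"
  using \<mu>_nonneg AE_space
proof eventually_elim
  case (elim x)
  then have "x \<in> \<Omega>" by (simp add: space_restrict_space)
  moreover from this have "x \<in> closure \<Omega>" using closure_subset by blast
  ultimately show ?case using elim p_min_le p_le_q q_le_bound by (simp add: regular_def)
qed

lemma \<Omega>_sets: "\<Omega> \<in> sets lebesgue"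
  using \<Omega>_open by auto

lemma emeasure_\<Omega>_finite: "emeasure M (space M) < \<infinity>"
proof -
  have "emeasure M \<Omega> = emeasure lebesgue \<Omega>" using \<Omega>_sets by (intro emeasure_restrict_space) auto
  also have "\<dots> < \<infinity>" using \<Omega>_bounded \<Omega>_sets bounded_set_imp_lmeasurable fmeasurableD2
      by (metis infinity_ennreal_def less_top)
  finally show ?thesis by (simp add: space_restrict_space)
qed

sublocale finite_measure M
  by standard (use emeasure_\<Omega>_finite in auto)

lemma exponents_measurable [measurable]: "p \<in> borel_measurable M" "q \<in> borel_measurable M" "\<mu> \<in>
    borel_measurable M"
proof -
  have "continuous_on \<Omega> p" "continuous_on \<Omega> q"
    using p_C_plus q_C_plus closure_subset[of \<Omega>] by (auto simp: C_plus_def intro: continuous_on_subset)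
  then show "p \<in> borel_measurable M" "q \<in> borel_measurable M"
    using \<Omega>_sets by (auto intro: continuous_imp_measurable_on_sets_lebesgue)
  show "\<mu> \<in> borel_measurable M" using \<mu>_integrable by (rule borel_measurable_integrable)
qed

abbreviation "h x \<equiv> log_phase (p x) (q x) (\<mu> x)"
abbreviation "f x \<equiv> log_flux (p x) (q x) (\<mu> x)"

lemma regular_growth_h: "regular x \<Longrightarrow> power_growth p_min (Suc q_bound) (h x)"
  using p_min_gt_1 by (auto simp: regular_def intro: power_growth_log_phase)

lemma regular_growth_f: "regular x \<Longrightarrow> power_growth (p_min - 1) q_bound (f x)"
  using p_min_gt_1 by (auto simp: regular_def intro: power_growth_log_flux)

lemma regular_bounds: "regular x \<Longrightarrow> 1 < p x" "regular x \<Longrightarrow> 1 < q x" "regular x \<Longrightarrow> 0 \<le> \<mu> x"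
  using p_min_gt_1 by (auto simp: regular_def)

lemma h_nonneg: "regular x \<Longrightarrow> 0 \<le> t \<Longrightarrow> 0 \<le> h x t"
  by (rule power_growth_nonneg[OF regular_growth_h])

lemma h_mono: "regular x \<Longrightarrow> 0 \<le> s \<Longrightarrow> s \<le> t \<Longrightarrow> h x s \<le> h x t"
  using p_min_gt_1 by (intro power_growth_mono[OF regular_growth_h]) auto

lemma h_le_f: "regular x \<Longrightarrow> 0 \<le> t \<Longrightarrow> h x t \<le> f x t * t"
  and f_le_h: "regular x \<Longrightarrow> 0 \<le> t \<Longrightarrow> f x t * t \<le> 2 * h x t"
  using log_phase_le_flux[of t "q x" "\<mu> x" "p x"] regular_bounds[of x] by auto

text \<open>Stated for fields with values in any Euclidean space, so that functions and gradients are
  treated together.\<close>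

definition fin_modular :: "('a \<Rightarrow> 'b::euclidean_space) \<Rightarrow> bool" where
  "fin_modular F \<longleftrightarrow> F \<in> borel_measurable M \<and> integrable M (\<lambda>x. h x (norm (F x)))"

definition \<rho> :: "('a \<Rightarrow> 'b::euclidean_space) \<Rightarrow> real" where
  "\<rho> F = (LINT x|M. h x (norm (F x)))"

lemma h_norm_measurable:
  assumes [measurable]: "F \<in> borel_measurable M"
  shows "(\<lambda>x. h x (norm (F x))) \<in> borel_measurable M"
  unfolding log_phase_def by measurable

lemma AE_h_nonneg: "AE x in M. 0 \<le> h x (norm (F x))"
  using AE_regular by eventually_elim (simp add: h_nonneg)

lemma \<rho>_nonneg: "0 \<le> \<rho> F"
  unfolding \<rho>_def using AE_h_nonneg by (rule integral_nonneg_AE)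

lemma modular_eq_\<rho>: "fin_modular F \<Longrightarrow> modular_Hlog \<Omega> p q \<mu> (\<lambda>x. norm (F x)) = ennreal (\<rho> F)"
  unfolding modular_Hlog_def Hlog_eq_log_phase \<rho>_def fin_modular_def
  using nn_integral_eq_integral[OF _ AE_h_nonneg, of F] by simp

lemma modular_norm: "modular_Hlog \<Omega> p q \<mu> (\<lambda>x. norm (u x)) = modular_Hlog \<Omega> p q \<mu> u"
  by (simp add: modular_Hlog_def)

lemma fin_modularI: "F \<in> borel_measurable M \<Longrightarrow> modular_Hlog \<Omega> p q \<mu> (\<lambda>x. norm (F x)) < \<infinity> \<Longrightarrow> fin_modular F"
  unfolding fin_modular_def modular_Hlog_def Hlog_eq_log_phase
  using integrableI_nonneg[OF h_norm_measurable AE_h_nonneg, of F] by simp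

lemma fin_modular_measurable: "fin_modular F \<Longrightarrow> F \<in> borel_measurable M"
  and fin_modular_integrable: "fin_modular F \<Longrightarrow> integrable M (\<lambda>x. h x (norm (F x)))"
  by (auto simp: fin_modular_def)

lemma fin_modular_dominated:
  assumes "F \<in> borel_measurable M" "integrable M w" "AE x in M. h x (norm (F x)) \<le> w x"
  shows "fin_modular F" "\<rho> F \<le> (LINT x|M. w x)"
proof -
  have "integrable M (\<lambda>x. h x (norm (F x)))"
    using assms(2) h_norm_measurable[OF assms(1)]
  proof (rule Bochner_Integration.integrable_bound)
    show "AE x in M. norm (h x (norm (F x))) \<le> norm (w x)"
      using assms(3) AE_h_nonneg[of F] by eventually_elim simp
  qed
  then show "fin_modular F" "\<rho> F \<le> (LINT x|M. w x)"
    using assms by (auto simp: fin_modular_def \<rho>_def intro: integral_mono_AE)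
qed

lemma \<rho>_cong_AE:
  assumes "AE x in M. norm (F x) = norm (G x)" "F \<in> borel_measurable M" "G \<in> borel_measurable M"
  shows "\<rho> F = \<rho> G"
  unfolding \<rho>_def using assms(1) by (intro integral_cong_AE h_norm_measurable assms) (auto elim:
      eventually_mono)

lemma fin_modular_cong_AE:
  assumes "AE x in M. norm (F x) = norm (G x)" "F \<in> borel_measurable M" "fin_modular G"
  shows "fin_modular F"
  using assms(1) by (intro fin_modular_dominated(1)[OF assms(2) fin_modular_integrable[OF assms(3)]])
      (auto elim: eventually_mono)

lemma modular_scale:
  assumes F: "fin_modular F"
  shows "fin_modular (\<lambda>x. c *\<^sub>R F x)"
    and "1 \<le> c \<Longrightarrow> \<rho> (\<lambda>x. c *\<^sub>R F x) \<le> c ^ Suc q_bound * \<rho> F"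
    and "1 \<le> c \<Longrightarrow> c powr p_min * \<rho> F \<le> \<rho> (\<lambda>x. c *\<^sub>R F x)"
proof -
  have m[measurable]: "F \<in> borel_measurable M" by (rule fin_modular_measurable[OF F])
  have up: "AE x in M. h x (norm (b *\<^sub>R F x)) \<le> b ^ Suc q_bound * h x (norm (F x))" if "1 \<le> b" for b
    using AE_regular
  proof eventually_elim
    case (elim x) then show ?case using power_growth_scale_up[OF regular_growth_h, of x b "norm (F x)"]
        that by simp
  qed
  show fin: "fin_modular (\<lambda>x. c *\<^sub>R F x)" for c
  proof (rule fin_modular_dominated(1))
    show "AE x in M. h x (norm (c *\<^sub>R F x)) \<le> (max 1 \<bar>c\<bar>) ^ Suc q_bound * h x (norm (F x))"
      using AE_regular up[of "max 1 \<bar>c\<bar>", OF max.cobounded1]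
    proof eventually_elim
      case (elim x)
      have "norm (c *\<^sub>R F x) \<le> norm (max 1 \<bar>c\<bar> *\<^sub>R F x)" by (simp add: mult_right_mono)
      from h_mono[OF elim(1) norm_ge_zero this] elim(2) show ?case by linarith
    qed
  qed (use fin_modular_integrable[OF F] in auto)
  show "1 \<le> c \<Longrightarrow> \<rho> (\<lambda>x. c *\<^sub>R F x) \<le> c ^ Suc q_bound * \<rho> F"
    using fin_modular_dominated(2)[OF _ _ up, of c] fin_modular_integrable[OF F]
    by (simp add: \<rho>_def del: power_Suc)
  assume c: "1 \<le> c"
  have "(LINT x|M. c powr p_min * h x (norm (F x))) \<le> \<rho> (\<lambda>x. c *\<^sub>R F x)"
    unfolding \<rho>_def
  proof (rule integral_mono_AE)
    show "AE x in M. c powr p_min * h x (norm (F x)) \<le> h x (norm (c *\<^sub>R F x))"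
      using AE_regular
    proof eventually_elim
      case (elim x)
      have "h x ((1 / c) * norm (c *\<^sub>R F x)) \<le> (1 / c) powr p_min * h x (norm (c *\<^sub>R F x))"
        using c by (intro power_growth_upper[OF regular_growth_h[OF elim]]) auto
      then show ?case using c by (simp add: powr_divide field_simps)
    qed
  qed (use fin_modular_integrable[OF F] fin_modular_integrable[OF fin] in auto)
  then show "c powr p_min * \<rho> F \<le> \<rho> (\<lambda>x. c *\<^sub>R F x)" by (simp add: \<rho>_def)
qed

lemma modular_add:
  assumes F: "fin_modular F" and G: "fin_modular G"
  shows "fin_modular (\<lambda>x. F x + G x)" "\<rho> (\<lambda>x. F x + G x) \<le> 2 ^ Suc q_bound * (\<rho> F + \<rho> G)"
proof -
  have m[measurable]: "F \<in> borel_measurable M" "G \<in> borel_measurable M" using F G fin_modular_measurable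
      by auto
  have up: "AE x in M. h x (norm (F x + G x)) \<le> 2 ^ Suc q_bound * (h x (norm (F x)) + h x (norm (G x)))"
    using AE_regular
  proof eventually_elim
    case (elim x)
    have "h x (norm (F x + G x)) \<le> h x (norm (F x) + norm (G x))"
        by (rule h_mono[OF elim norm_ge_zero norm_triangle_ineq])
    also have "\<dots> \<le> 2 ^ Suc q_bound * (h x (norm (F x)) + h x (norm (G x)))"
      using p_min_gt_1 by (intro power_growth_add_le[OF regular_growth_h[OF elim]]) auto
    finally show ?case .
  qed
  have i: "integrable M (\<lambda>x. 2 ^ Suc q_bound * (h x (norm (F x)) + h x (norm (G x))))"
    using fin_modular_integrable[OF F] fin_modular_integrable[OF G]
        by (intro integrable_mult_right Bochner_Integration.integrable_add)
  show "fin_modular (\<lambda>x. F x + G x)" by (rule fin_modular_dominated(1)[OF _ i up]) measurable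
  have "\<rho> (\<lambda>x. F x + G x) \<le> (LINT x|M. 2 ^ Suc q_bound * (h x (norm (F x)) + h x (norm (G x))))"
    by (rule fin_modular_dominated(2)[OF _ i up]) measurable
  then show "\<rho> (\<lambda>x. F x + G x) \<le> 2 ^ Suc q_bound * (\<rho> F + \<rho> G)"
    using fin_modular_integrable[OF F] fin_modular_integrable[OF G] by (simp add: \<rho>_def del: power_Suc)
qed

lemma modular_diff:
  assumes F: "fin_modular F" and G: "fin_modular G"
  shows "fin_modular (\<lambda>x. F x - G x)"
  using modular_add(1)[OF F modular_scale(1)[OF G, of "-1"]] by simp

lemma modular_convex:
  assumes F: "fin_modular F" and G: "fin_modular G" and c: "0 \<le> c" "c \<le> 1"
  shows "\<rho> (\<lambda>x. (1 - c) *\<^sub>R F x + c *\<^sub>R G x) \<le> (1 - c) * \<rho> F + c * \<rho> G"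
proof -
  have m[measurable]: "F \<in> borel_measurable M" "G \<in> borel_measurable M" using F G fin_modular_measurable
      by auto
  have i: "integrable M (\<lambda>x. h x (norm (F x)))" "integrable M (\<lambda>x. h x (norm (G x)))"
    using F G fin_modular_integrable by auto
  have "\<rho> (\<lambda>x. (1 - c) *\<^sub>R F x + c *\<^sub>R G x) \<le> (LINT x|M. (1 - c) * h x (norm (F x)) +
      c * h x (norm (G x)))"
  proof (rule fin_modular_dominated(2))
    show "AE x in M. h x (norm ((1 - c) *\<^sub>R F x + c *\<^sub>R G x)) \<le> (1 - c) * h x (norm (F x)) +
        c * h x (norm (G x))"
      using AE_regular
    proof eventually_elim
      case (elim x)
      have "norm ((1 - c) *\<^sub>R F x + c *\<^sub>R G x) \<le> (1 - c) * norm (F x) + c * norm (G x)"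
        using norm_triangle_ineq[of "(1 - c) *\<^sub>R F x" "c *\<^sub>R G x"] c by simp
      from h_mono[OF elim norm_ge_zero this]
      have "h x (norm ((1 - c) *\<^sub>R F x + c *\<^sub>R G x)) \<le> h x ((1 - c) * norm (F x) + c * norm (G x))" .
      also have "\<dots> \<le> (1 - c) * h x (norm (F x)) + c * h x (norm (G x))"
        using regular_bounds[OF elim] c by (intro log_phase_convex) auto
      finally show ?case .
    qed
  qed (use i in auto)
  then show ?thesis using i by (simp add: \<rho>_def)
qed

lemma modular_zero_imp:
  assumes F: "fin_modular F" and 0: "\<rho> F = 0"
  shows "AE x in M. F x = 0"
proof -
  have "AE x in M. h x (norm (F x)) = 0"
    using integral_nonneg_eq_0_iff_AE[OF fin_modular_integrable[OF F] AE_h_nonneg] 0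
        by (simp add: \<rho>_def)
  then show ?thesis using AE_regular
  proof eventually_elim
    case (elim x)
    have "0 \<le> \<mu> x * norm (F x) powr q x * ln (exp 1 + norm (F x))"
      using regular_bounds(3)[OF elim(2)] ln_exp1_plus_ge_1[OF norm_ge_zero, of "F x"] by simp
    then have "norm (F x) powr p x \<le> 0" using elim(1) unfolding log_phase_def by linarith
    then have "norm (F x) powr p x = 0" using powr_ge_zero[of "norm (F x)" "p x"] by linarith
    then show ?case by simp
  qed
qed

text \<open>The bound \<open>t \<le> 1 + H(t)\<close>, applied to \<open>t = |F| / e\<close>. Modular convergence thus implies
  convergence in \<open>L\<^sup>1\<close>.\<close>

lemma L1_le_modular:
  assumes F: "fin_modular F" and e: "0 < e"
  shows "integrable M (\<lambda>x. norm (F x))"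
    and "(LINT x|M. norm (F x)) \<le> e * (measure M (space M) + \<rho> (\<lambda>x. (1 / e) *\<^sub>R F x))"
proof -
  have m[measurable]: "F \<in> borel_measurable M" using F fin_modular_measurable by auto
  have i: "integrable M (\<lambda>x. e * (1 + h x (norm ((1 / e) *\<^sub>R F x))))"
    by (intro integrable_mult_right Bochner_Integration.integrable_add fin_modular_integrable
        modular_scale(1) F integrable_const)
  have le: "AE x in M. norm (F x) \<le> e * (1 + h x (norm ((1 / e) *\<^sub>R F x)))"
    using AE_regular
  proof eventually_elim
    case (elim x)
    have "norm ((1 / e) *\<^sub>R F x) \<le> 1 + h x (norm ((1 / e) *\<^sub>R F x))"
      using regular_bounds[OF elim] by (intro le_1_plus_log_phase) auto
    then show ?case using e by (simp add: field_simps)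
  qed
  show ii: "integrable M (\<lambda>x. norm (F x))"
    using i by (rule Bochner_Integration.integrable_bound) (use le in \<open>auto elim: eventually_mono\<close>)
  have "(LINT x|M. norm (F x)) \<le> (LINT x|M. e * (1 + h x (norm ((1 / e) *\<^sub>R F x))))"
    by (rule integral_mono_AE[OF ii i le])
  also have "\<dots> = e * (measure M (space M) + \<rho> (\<lambda>x. (1 / e) *\<^sub>R F x))"
    using fin_modular_integrable[OF modular_scale(1)[OF F, of "1/e"]] by (simp add: \<rho>_def)
  finally show "(LINT x|M. norm (F x)) \<le> e * (measure M (space M) + \<rho> (\<lambda>x. (1 / e) *\<^sub>R F x))" .
qed

text \<open>The value \<open>\<langle>A u, v\<rangle>\<close> depends on the gradients only; here \<open>F\<close> stands for \<open>\<nabla>u\<close> and \<open>V\<close> for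
  \<open>\<nabla>v\<close>.\<close>

definition duality :: "('a \<Rightarrow> 'a) \<Rightarrow> ('a \<Rightarrow> 'a) \<Rightarrow> real" where
  "duality F V = (LINT x|M. flux (f x) (F x) \<bullet> V x)"

lemma flux_measurable:
  assumes [measurable]: "F \<in> borel_measurable M"
  shows "(\<lambda>x. flux (f x) (F x) :: 'a) \<in> borel_measurable M"
  unfolding flux_def log_flux_def log_bracket_def by measurable

text \<open>A crude Young inequality that follows from monotonicity alone; it replaces Hoelder's
  inequality everywhere below.\<close>

lemma f_mult_le:
  assumes x: "regular x" and st: "0 \<le> s" "0 \<le> t"
  shows "f x s * t \<le> 2 * (h x s + h x t)"
proof (cases "s \<le> t")
  case True
  have "f x s \<le> f x t" using power_growth_mono[OF regular_growth_f[OF x], of s t] p_min_gt_1 st True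
      by simp
  then have "f x s * t \<le> f x t * t" using st by (intro mult_right_mono)
  also have "\<dots> \<le> 2 * h x t" by (rule f_le_h[OF x st(2)])
  finally show ?thesis using h_nonneg[OF x st(1)] by simp
next
  case False
  then have "f x s * t \<le> f x s * s" using power_growth_nonneg[OF regular_growth_f[OF x] st(1)]
      by (intro mult_left_mono) auto
  also have "\<dots> \<le> 2 * h x s" by (rule f_le_h[OF x st(1)])
  finally show ?thesis using h_nonneg[OF x st(2)] by simp
qed

lemma norm_flux_f: "regular x \<Longrightarrow> norm (flux (f x) (\<xi>::'a)) = f x (norm \<xi>)"
  by (rule norm_flux) (auto intro: power_growth_zero[OF regular_growth_f] power_growth_nonneg[OF
      regular_growth_f])

lemma duality_integrable:
  assumes F: "fin_modular F" and V: "fin_modular V"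
  shows "integrable M (\<lambda>x. flux (f x) (F x) \<bullet> V x)" "\<bar>duality F V\<bar> \<le> 2 * (\<rho> F + \<rho> V)"
proof -
  have m[measurable]: "F \<in> borel_measurable M" "V \<in> borel_measurable M" using F V fin_modular_measurable
      by auto
  have i: "integrable M (\<lambda>x. 2 * (h x (norm (F x)) + h x (norm (V x))))"
    using fin_modular_integrable[OF F] fin_modular_integrable[OF V] by auto
  have le: "AE x in M. norm (flux (f x) (F x) \<bullet> V x) \<le> 2 * (h x (norm (F x)) + h x (norm (V x)))"
    using AE_regular
  proof eventually_elim
    case (elim x)
    have "\<bar>flux (f x) (F x) \<bullet> V x\<bar> \<le> f x (norm (F x)) * norm (V x)"
      using Cauchy_Schwarz_ineq2[of "flux (f x) (F x)" "V x"] norm_flux_f[OF elim] by simp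
    then show ?case using f_mult_le[OF elim, of "norm (F x)" "norm (V x)"] by simp
  qed
  have fm: "(\<lambda>x. flux (f x) (F x) \<bullet> V x) \<in> borel_measurable M"
    by (intro borel_measurable_inner flux_measurable m)
  show int: "integrable M (\<lambda>x. flux (f x) (F x) \<bullet> V x)"
    using i fm by (rule Bochner_Integration.integrable_bound) (use le in \<open>auto elim: eventually_mono\<close>)
  have "\<bar>duality F V\<bar> \<le> (LINT x|M. norm (flux (f x) (F x) \<bullet> V x))"
    unfolding duality_def using integral_norm_bound[of M "\<lambda>x. flux (f x) (F x) \<bullet> V x"] by simp
  also have "\<dots> \<le> (LINT x|M. 2 * (h x (norm (F x)) + h x (norm (V x))))"
    by (rule integral_mono_AE[OF _ i le]) (use int in auto)
  also have "\<dots> = 2 * (\<rho> F + \<rho> V)"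
    using fin_modular_integrable[OF F] fin_modular_integrable[OF V] by (simp add: \<rho>_def)
  finally show "\<bar>duality F V\<bar> \<le> 2 * (\<rho> F + \<rho> V)" .
qed

lemma duality_linear:
  assumes F: "fin_modular F" and V: "fin_modular V" and W: "fin_modular W"
  shows "duality F (\<lambda>x. V x + W x) = duality F V + duality F W" "duality F (\<lambda>x. c *\<^sub>R V x) =
      c * duality F V"
    "duality F (\<lambda>x. V x - W x) = duality F V - duality F W"
  using duality_integrable(1)[OF F V] duality_integrable(1)[OF F W]
  by (simp_all add: duality_def inner_add_right inner_diff_right)

lemma duality_monotone:
  assumes F: "fin_modular F" and W: "fin_modular W"
  shows "0 \<le> duality F (\<lambda>x. F x - W x) - duality W (\<lambda>x. F x - W x)"
proof -
  have D: "fin_modular (\<lambda>x. F x - W x)" by (rule modular_diff[OF F W])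
  have "duality F (\<lambda>x. F x - W x) - duality W (\<lambda>x. F x - W x) =
      (LINT x|M. (flux (f x) (F x) - flux (f x) (W x)) \<bullet> (F x - W x))"
    using duality_integrable(1)[OF F D] duality_integrable(1)[OF W D]
        by (simp add: duality_def inner_diff_left)
  also have "0 \<le> \<dots>"
  proof (rule integral_nonneg_AE)
    show "AE x in M. 0 \<le> (flux (f x) (F x) - flux (f x) (W x)) \<bullet> (F x - W x)"
      using AE_regular by eventually_elim (use p_min_gt_1 flux_monotone[OF regular_growth_f] in auto)
  qed
  finally show ?thesis .
qed

lemma duality_monotone_modulus:
  assumes \<epsilon>: "0 < \<epsilon>"
  shows "\<exists>C\<ge>0. \<forall>F W. fin_modular F \<longrightarrow> fin_modular W \<longrightarrow>
    \<rho> (\<lambda>x. F x - W x) \<le> \<epsilon> * \<rho> W + C * (duality F (\<lambda>x. F x - W x) - duality W (\<lambda>x. F x - W x))"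
proof -
  obtain C where C: "0 \<le> C" "\<And>g \<xi> \<eta>. power_growth (p_min - 1) q_bound g \<Longrightarrow>
     g (norm (\<xi> - \<eta> :: 'a)) * norm (\<xi> - \<eta>) \<le> \<epsilon> / 2 * (g (norm \<eta>) * norm \<eta>) +
         C * ((flux g \<xi> - flux g \<eta>) \<bullet> (\<xi> - \<eta>))"
    using flux_monotone_modulus[of "p_min - 1" "\<epsilon> / 2" q_bound, where 'a = 'a] p_min_gt_1 \<epsilon> by auto
  have "\<rho> (\<lambda>x. F x - W x) \<le> \<epsilon> * \<rho> W + C * (duality F (\<lambda>x. F x - W x) - duality W (\<lambda>x. F x - W x))"
    if F: "fin_modular F" and W: "fin_modular W" for F W
  proof -
    have D: "fin_modular (\<lambda>x. F x - W x)" by (rule modular_diff[OF F W])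
    have iD: "integrable M (\<lambda>x. flux (f x) (F x) \<bullet> (F x - W x))" "integrable M (\<lambda>x.
        flux (f x) (W x) \<bullet> (F x - W x))"
      by (rule duality_integrable(1)[OF F D], rule duality_integrable(1)[OF W D])
    have "\<rho> (\<lambda>x. F x - W x) \<le> (LINT x|M. \<epsilon> * h x (norm (W x)) +
        C * (flux (f x) (F x) \<bullet> (F x - W x) - flux (f x) (W x) \<bullet> (F x - W x)))"
    proof (rule fin_modular_dominated(2)[OF fin_modular_measurable[OF D]])
      show "integrable M (\<lambda>x. \<epsilon> * h x (norm (W x)) + C * (flux (f x) (F x) \<bullet> (F x - W x) - flux (f x)
          (W x) \<bullet> (F x - W x)))"
        using fin_modular_integrable[OF W] iD by auto
      show "AE x in M. h x (norm (F x - W x)) \<le> \<epsilon> * h x (norm (W x)) +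
          C * (flux (f x) (F x) \<bullet> (F x - W x) - flux (f x) (W x) \<bullet> (F x - W x))"
        using AE_regular
      proof eventually_elim
        case (elim x)
        have "h x (norm (F x - W x)) \<le> f x (norm (F x - W x)) * norm (F x - W x)"
            by (rule h_le_f[OF elim norm_ge_zero])
        also have "\<dots> \<le> \<epsilon> / 2 * (f x (norm (W x)) * norm (W x)) +
            C * ((flux (f x) (F x) - flux (f x) (W x)) \<bullet> (F x - W x))"
          by (rule C(2)[OF regular_growth_f[OF elim]])
        also have "\<epsilon> / 2 * (f x (norm (W x)) * norm (W x)) \<le> \<epsilon> / 2 * (2 * h x (norm (W x)))"
          using \<epsilon> by (intro mult_left_mono f_le_h[OF elim]) auto
        finally show ?case by (simp add: inner_diff_left)
      qed
    qed
    also have "\<dots> = \<epsilon> * \<rho> W + C * (duality F (\<lambda>x. F x - W x) - duality W (\<lambda>x. F x - W x))"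
      using fin_modular_integrable[OF W] iD by (simp add: \<rho>_def duality_def)
    finally show ?thesis .
  qed
  then show ?thesis using C(1) by blast
qed

lemma duality_modulus:
  assumes \<epsilon>: "0 < \<epsilon>"
  shows "\<exists>C\<ge>0. \<forall>F W V. fin_modular F \<longrightarrow> fin_modular W \<longrightarrow> fin_modular V \<longrightarrow>
    \<bar>duality F V - duality W V\<bar> \<le> \<epsilon> * (\<rho> F + \<rho> W + \<rho> V) + C * \<rho> (\<lambda>x. F x - W x)"
proof -
  obtain C where C: "0 \<le> C" "\<And>g z \<xi> \<eta>. power_growth (p_min - 1) q_bound g \<Longrightarrow> 0 \<le> z \<Longrightarrow>
     norm (flux g \<xi> - flux g (\<eta>::'a)) * z \<le> \<epsilon> / 2 * (g (norm \<xi>) * norm \<xi> + g (norm \<eta>) * norm \<eta> +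
         g z * z) +
       C * (g (norm (\<xi> - \<eta>)) * norm (\<xi> - \<eta>))"
    using flux_modulus[of "p_min - 1" "\<epsilon> / 2" q_bound, where 'a = 'a] p_min_gt_1 \<epsilon> by auto
  have "\<bar>duality F V - duality W V\<bar> \<le> \<epsilon> * (\<rho> F + \<rho> W + \<rho> V) + (2 * C) * \<rho> (\<lambda>x. F x - W x)"
    if F: "fin_modular F" and W: "fin_modular W" and V: "fin_modular V" for F W V
  proof -
    have D: "fin_modular (\<lambda>x. F x - W x)" by (rule modular_diff[OF F W])
    note i = fin_modular_integrable[OF F] fin_modular_integrable[OF W] fin_modular_integrable[OF V]
        fin_modular_integrable[OF D]
    have iD: "integrable M (\<lambda>x. flux (f x) (F x) \<bullet> V x)" "integrable M (\<lambda>x. flux (f x) (W x) \<bullet> V x)"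
      by (rule duality_integrable(1)[OF F V], rule duality_integrable(1)[OF W V])
    have "\<bar>duality F V - duality W V\<bar> = \<bar>LINT x|M. (flux (f x) (F x) \<bullet> V x - flux (f x) (W x) \<bullet> V x)\<bar>"
      using iD by (simp add: duality_def)
    also have "\<dots> \<le> (LINT x|M. norm (flux (f x) (F x) \<bullet> V x - flux (f x) (W x) \<bullet> V x))"
      using integral_norm_bound[of M "\<lambda>x. flux (f x) (F x) \<bullet> V x - flux (f x) (W x) \<bullet> V x"] by simp
    also have "\<dots> \<le> (LINT x|M. \<epsilon> * (h x (norm (F x)) + h x (norm (W x)) + h x (norm (V x))) +
        (2 * C) * h x (norm (F x - W x)))"
    proof (rule integral_mono_AE)
      show "AE x in M. norm (flux (f x) (F x) \<bullet> V x - flux (f x) (W x) \<bullet> V x) \<le>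
          \<epsilon> * (h x (norm (F x)) + h x (norm (W x)) + h x (norm (V x))) +
              (2 * C) * h x (norm (F x - W x))"
        using AE_regular
      proof eventually_elim
        case (elim x)
        have "norm (flux (f x) (F x) \<bullet> V x - flux (f x) (W x) \<bullet> V x) \<le>
            norm (flux (f x) (F x) - flux (f x) (W x)) * norm (V x)"
          using Cauchy_Schwarz_ineq2[of "flux (f x) (F x) - flux (f x) (W x)" "V x"]
              by (simp add: inner_diff_left)
        also have "\<dots> \<le> \<epsilon> / 2 * (f x (norm (F x)) * norm (F x) + f x (norm (W x)) * norm (W x) +
            f x (norm (V x)) * norm (V x)) +
           C * (f x (norm (F x - W x)) * norm (F x - W x))"
          by (rule C(2)[OF regular_growth_f[OF elim] norm_ge_zero])
        also have "\<dots> \<le> \<epsilon> / 2 * (2 * h x (norm (F x)) + 2 * h x (norm (W x)) + 2 * h x (norm (V x))) +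
           C * (2 * h x (norm (F x - W x)))"
          using \<epsilon> C(1) by (intro add_mono mult_left_mono f_le_h[OF elim] norm_ge_zero) auto
        finally show ?case by (simp add: algebra_simps)
      qed
    qed (use i iD in auto)
    also have "\<dots> = \<epsilon> * (\<rho> F + \<rho> W + \<rho> V) + (2 * C) * \<rho> (\<lambda>x. F x - W x)"
      using i by (simp add: \<rho>_def)
    finally show ?thesis .
  qed
  then show ?thesis using C(1) by (intro exI[of _ "2 * C"]) auto
qed

lemma modular_le_duality:
  assumes F: "fin_modular F"
  shows "\<rho> F \<le> duality F F"
  unfolding \<rho>_def duality_def
proof (rule integral_mono_AE[OF fin_modular_integrable[OF F] duality_integrable(1)[OF F F]])
  show "AE x in M. h x (norm (F x)) \<le> flux (f x) (F x) \<bullet> F x"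
    using AE_regular
  proof eventually_elim
    case (elim x)
    then show ?case using h_le_f[OF elim norm_ge_zero, of "F x"] flux_inner_self[of "f x" "F x", OF
        power_growth_zero[OF regular_growth_f[OF elim]]] by simp
  qed
qed

definition energy :: "('a \<Rightarrow> 'a) \<Rightarrow> real" where
  "energy F = (LINT x|M. log_energy (p x) (q x) (\<mu> x) (norm (F x)))"

lemma energy_integrable:
  assumes F: "fin_modular F"
  shows "integrable M (\<lambda>x. log_energy (p x) (q x) (\<mu> x) (norm (F x)))"
  using fin_modular_integrable[OF F]
proof (rule Bochner_Integration.integrable_bound)
  have [measurable]: "F \<in> borel_measurable M" by (rule fin_modular_measurable[OF F])
  show "(\<lambda>x. log_energy (p x) (q x) (\<mu> x) (norm (F x))) \<in> borel_measurable M"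
    unfolding log_energy_def by measurable
  show "AE x in M. norm (log_energy (p x) (q x) (\<mu> x) (norm (F x))) \<le> norm (h x (norm (F x)))"
    using AE_regular
  proof eventually_elim
    case (elim x)
    note b = regular_bounds[OF elim]
    define t where "t = norm (F x)"
    have l: "1 \<le> ln (exp 1 + t)" by (rule ln_exp1_plus_ge_1) (simp add: t_def)
    have "t powr p x / p x \<le> t powr p x / 1" using b by (intro divide_left_mono) auto
    moreover have "\<mu> x * (t powr q x * ln (exp 1 + t) / q x) \<le> \<mu> x * (t powr q x * ln (exp 1 + t) / 1)"
      using b l by (intro mult_left_mono divide_left_mono) auto
    ultimately have "log_energy (p x) (q x) (\<mu> x) t \<le> h x t"
        by (simp add: log_energy_def log_phase_def mult.assoc)
    moreover have "0 \<le> log_energy (p x) (q x) (\<mu> x) t" using b l by (simp add: log_energy_def)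
    ultimately show ?case by (simp add: t_def)
  qed
qed

text \<open>By the Cauchy-Schwarz inequality the tangent inequality for vectors reduces to the scalar
  one for \<open>log_energy\<close>.\<close>

lemma energy_tangent:
  assumes F: "fin_modular F" and W: "fin_modular W"
  shows "energy F + duality F (\<lambda>x. W x - F x) \<le> energy W"
proof -
  have D: "fin_modular (\<lambda>x. W x - F x)" by (rule modular_diff[OF W F])
  note i = energy_integrable[OF F] energy_integrable[OF W] duality_integrable(1)[OF F D]
  have "energy F + duality F (\<lambda>x. W x - F x) =
      (LINT x|M. log_energy (p x) (q x) (\<mu> x) (norm (F x)) + flux (f x) (F x) \<bullet> (W x - F x))"
    using i by (simp add: energy_def duality_def)
  also have "\<dots> \<le> energy W" unfolding energy_def
  proof (rule integral_mono_AE)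
    show "AE x in M. log_energy (p x) (q x) (\<mu> x) (norm (F x)) + flux (f x) (F x) \<bullet> (W x - F x) \<le>
        log_energy (p x) (q x) (\<mu> x) (norm (W x))"
      using AE_regular
    proof eventually_elim
      case (elim x)
      have f0: "f x 0 = 0" by (rule power_growth_zero[OF regular_growth_f[OF elim]])
      have "flux (f x) (F x) \<bullet> W x \<le> f x (norm (F x)) * norm (W x)"
        using norm_cauchy_schwarz[of "flux (f x) (F x)" "W x"] norm_flux_f[OF elim] by simp
      then have "flux (f x) (F x) \<bullet> (W x - F x) \<le> f x (norm (F x)) * (norm (W x) - norm (F x))"
        using flux_inner_self[of "f x" "F x", OF f0] by (simp add: inner_diff_right right_diff_distrib)
      then show ?case using log_energy_above_tangent[of "p x" "q x" "\<mu> x" "norm (F x)" "norm (W x)"]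
          regular_bounds[OF elim] by simp
    qed
  qed (use i in auto)
  finally show ?thesis .
qed

end

section \<open>Equivalence classes and limits of weak gradients\<close>

lemma rep_L0_measurable: "rep_L0 u \<in> borel_measurable lebesgue"
  using Quotient_rep_reflp[OF Quotient_L0, of u] by (simp add: ae_equal_def)

lemma rep_abs_L0: "f \<in> borel_measurable lebesgue \<Longrightarrow> AE x in lebesgue. rep_L0 (abs_L0 f) x = f x"
  using Quotient_rep_abs[OF Quotient_L0, of f] by (simp add: ae_equal_def)

lemma L0_eqI: "AE x in lebesgue. rep_L0 u x = rep_L0 v x \<Longrightarrow> u = v"
  using Quotient_rel_rep[OF Quotient_L0, of u v] rep_L0_measurable[of u] rep_L0_measurable[of v]
      by (simp add: ae_equal_def)

lemma abs_rep_L0: "abs_L0 (rep_L0 u) = u"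
  by (rule Quotient_abs_rep[OF Quotient_L0])

lemma rep_L0_add: "AE x in lebesgue. rep_L0 (u + v) x = rep_L0 u x + rep_L0 v x"
proof -
  have "u + v = abs_L0 (\<lambda>x. rep_L0 u x + rep_L0 v x)"
    using plus_L0.abs_eq[of "rep_L0 u" "rep_L0 v"] rep_L0_measurable[of u] rep_L0_measurable[of v]
        by (simp add: abs_rep_L0 ae_equal_def)
  then show ?thesis using rep_abs_L0[of "\<lambda>x. rep_L0 u x + rep_L0 v x"] rep_L0_measurable[of u]
      rep_L0_measurable[of v] by simp
qed

lemma rep_L0_scale: "AE x in lebesgue. rep_L0 (c *\<^sub>R u) x = c * rep_L0 u x"
proof -
  have "c *\<^sub>R u = abs_L0 (\<lambda>x. c * rep_L0 u x)"
    using scaleR_L0.abs_eq[of "rep_L0 u" c] rep_L0_measurable[of u]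
        by (simp add: abs_rep_L0 ae_equal_def)
  then show ?thesis using rep_abs_L0[of "\<lambda>x. c * rep_L0 u x"] rep_L0_measurable[of u] by simp
qed

lemma rep_L0_zero: "AE x in lebesgue. rep_L0 0 x = 0"
  unfolding zero_L0_def by (rule rep_abs_L0) simp

lemma AE_lebesgue_onI: "AE x in lebesgue. P x \<Longrightarrow> S \<in> sets lebesgue \<Longrightarrow> AE x in lebesgue_on S. P x"
  by (subst AE_restrict_space_iff) auto

lemma measurable_lebesgue_onI: "f \<in> borel_measurable lebesgue \<Longrightarrow> f \<in> borel_measurable (lebesgue_on S)"
  by (rule measurable_restrict_space1)

lemma has_weak_gradient_cong:
  assumes G: "has_weak_gradient \<Omega> u G" and u': "u' \<in> borel_measurable lebesgue"
      and u: "u \<in> borel_measurable lebesgue"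
    and eq: "AE x in lebesgue. u' x = u x" and \<Omega>: "\<Omega> \<in> sets lebesgue"
  shows "has_weak_gradient \<Omega> u' G"
  unfolding has_weak_gradient_def
proof (intro conjI allI impI ballI)
  fix K :: "'a set" assume K: "compact K \<and> K \<subseteq> \<Omega>"
  then have "integrable (lebesgue_on K) u" using G by (auto simp: has_weak_gradient_def)
  then show "integrable (lebesgue_on K) u'"
    using K by (subst integrable_cong_AE[of u' _ u]) (auto intro: measurable_lebesgue_onI u u'
        AE_lebesgue_onI eq compact_sets_lebesgue)
  show "integrable (lebesgue_on K) G" using G K by (auto simp: has_weak_gradient_def)
next
  fix \<phi> and i :: 'a assume \<phi>: "\<phi> \<in> test_functions \<Omega>" and i: "i \<in> Basis"
  have "(LINT x|lebesgue_on \<Omega>. u' x * frechet_derivative \<phi> (at x) i) = (LINT x|lebesgue_on \<Omega>.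
      u x * frechet_derivative \<phi> (at x) i)"
  proof (rule integral_cong_AE)
    show "AE x in lebesgue_on \<Omega>. u' x * frechet_derivative \<phi> (at x) i =
        u x * frechet_derivative \<phi> (at x) i"
      using AE_lebesgue_onI[OF eq \<Omega>] by eventually_elim simp
  qed (intro borel_measurable_times measurable_lebesgue_onI[OF u] measurable_lebesgue_onI[OF u']
      lebesgue_on_borel_measurable
      borel_measurable_of_continuous_UNIV test_derivative_continuous[OF \<phi> i])+
  then show "(LINT x|lebesgue_on \<Omega>. u' x * frechet_derivative \<phi> (at x) i) = - (LINT x|lebesgue_on \<Omega>.
      (G x \<bullet> i) * \<phi> x)"
    using G \<phi> i by (simp add: has_weak_gradient_def)
qed

lemma has_weak_gradient_add:
  assumes G: "has_weak_gradient \<Omega> u G" and H: "has_weak_gradient \<Omega> v H" and \<Omega>: "\<Omega> \<in> sets lebesgue"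
  shows "has_weak_gradient \<Omega> (\<lambda>x. u x + v x) (\<lambda>x. G x + H x)"
  unfolding has_weak_gradient_def
proof (intro conjI allI impI ballI)
  fix \<phi> and i :: 'a assume \<phi>: "\<phi> \<in> test_functions \<Omega>" and i: "i \<in> Basis"
  note I = weak_gradient_integrable[OF G \<phi> i \<Omega>] weak_gradient_integrable[OF H \<phi> i \<Omega>]
  have "(LINT x|lebesgue_on \<Omega>. u x * frechet_derivative \<phi> (at x) i) = - (LINT x|lebesgue_on \<Omega>.
      (G x \<bullet> i) * \<phi> x)"
    "(LINT x|lebesgue_on \<Omega>. v x * frechet_derivative \<phi> (at x) i) = - (LINT x|lebesgue_on \<Omega>.
        (H x \<bullet> i) * \<phi> x)"
    using G H \<phi> i by (auto simp: has_weak_gradient_def)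
  then show "(LINT x|lebesgue_on \<Omega>. (u x + v x) * frechet_derivative \<phi> (at x) i) =
      - (LINT x|lebesgue_on \<Omega>. ((G x + H x) \<bullet> i) * \<phi> x)"
    using I by (simp add: distrib_right inner_add_left)
qed (use G H in \<open>auto simp: has_weak_gradient_def\<close>)

lemma has_weak_gradient_scale:
  assumes G: "has_weak_gradient \<Omega> u G"
  shows "has_weak_gradient \<Omega> (\<lambda>x. c * u x) (\<lambda>x. c *\<^sub>R G x)"
  unfolding has_weak_gradient_def
proof (intro conjI allI impI ballI)
  fix \<phi> and i :: 'a assume \<phi>: "\<phi> \<in> test_functions \<Omega>" and i: "i \<in> Basis"
  have "(LINT x|lebesgue_on \<Omega>. u x * frechet_derivative \<phi> (at x) i) = - (LINT x|lebesgue_on \<Omega>.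
      (G x \<bullet> i) * \<phi> x)"
    using G \<phi> i by (auto simp: has_weak_gradient_def)
  then show "(LINT x|lebesgue_on \<Omega>. (c * u x) * frechet_derivative \<phi> (at x) i) =
      - (LINT x|lebesgue_on \<Omega>. ((c *\<^sub>R G x) \<bullet> i) * \<phi> x)"
    by (simp add: mult.assoc)
qed (use G in \<open>auto simp: has_weak_gradient_def\<close>)

lemma weak_gradient_measurable:
  assumes \<Omega>: "open \<Omega>" and G: "has_weak_gradient \<Omega> u G"
  shows "G \<in> borel_measurable (lebesgue_on \<Omega>)"
proof -
  obtain D where D: "countable D" "D \<subseteq> Pow \<Omega>" "\<And>X. X \<in> D \<Longrightarrow> \<exists>a b. X = cbox a b" "\<Union>D = \<Omega>"
    using open_countable_Union_open_cbox[OF \<Omega>] by metis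
  have Ds: "X \<in> sets lebesgue" if "X \<in> D" for X using D(3)[OF that] by auto
  show ?thesis
  proof (rule measurable_piecewise_restrict[OF D(1)])
    fix X assume X: "X \<in> D"
    then have sub: "X \<subseteq> \<Omega>" using D(2) by auto
    show "X \<inter> space (lebesgue_on \<Omega>) \<in> sets (lebesgue_on \<Omega>)"
      using Ds[OF X] \<Omega> by (auto simp: sets_restrict_space space_restrict_space)
    have "restrict_space (lebesgue_on \<Omega>) X = lebesgue_on X"
      using Ds[OF X] \<Omega> sub by (subst restrict_restrict_space) (auto simp: Int_absorb1)
    moreover have "integrable (lebesgue_on X) G" using G D(3)[OF X] sub
        by (auto simp: has_weak_gradient_def)
    ultimately show "G \<in> borel_measurable (restrict_space (lebesgue_on \<Omega>) X)" by simp
  qed (use D(4) in \<open>simp add: space_restrict_space\<close>)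
qed

text \<open>Weak gradients are closed under convergence in \<open>L\<^sup>1\<close>, since test functions and their
  derivatives are bounded.\<close>

lemma has_weak_gradient_limit:
  fixes u :: "nat \<Rightarrow> 'a::euclidean_space \<Rightarrow> real"
  assumes \<Omega>: "\<Omega> \<in> sets lebesgue"
    and G: "\<And>n. has_weak_gradient \<Omega> (u n) (G n)"
    and iu: "\<And>n. integrable (lebesgue_on \<Omega>) (u n)" "integrable (lebesgue_on \<Omega>) u0"
    and iG: "\<And>n. integrable (lebesgue_on \<Omega>) (G n)" "integrable (lebesgue_on \<Omega>) G0"
    and lu: "(\<lambda>n. LINT x|lebesgue_on \<Omega>. norm (u n x - u0 x)) \<longlonglongrightarrow> 0"
    and lG: "(\<lambda>n. LINT x|lebesgue_on \<Omega>. norm (G n x - G0 x)) \<longlonglongrightarrow> 0"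
  shows "has_weak_gradient \<Omega> u0 G0"
proof -
  have conv: "(\<lambda>n. LINT x|lebesgue_on \<Omega>. v n x * \<psi> x) \<longlonglongrightarrow> (LINT x|lebesgue_on \<Omega>. v0 x * \<psi> x)"
    if iv: "\<And>n. integrable (lebesgue_on \<Omega>) (v n)" "integrable (lebesgue_on \<Omega>) v0"
      and lv: "(\<lambda>n. LINT x|lebesgue_on \<Omega>. \<bar>v n x - v0 x\<bar>) \<longlonglongrightarrow> 0"
      and \<psi>: "\<psi> \<in> borel_measurable borel" "\<And>x. \<bar>\<psi> x\<bar> \<le> C"
    for v :: "nat \<Rightarrow> 'a \<Rightarrow> real" and v0 \<psi> C
  proof -
    have \<psi>m: "\<psi> \<in> borel_measurable (lebesgue_on \<Omega>)" by (rule lebesgue_on_borel_measurable[OF \<psi>(1)])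
    have C0: "0 \<le> C" using order_trans[OF abs_ge_zero \<psi>(2)] .
    have im: "integrable (lebesgue_on \<Omega>) (\<lambda>x. w x * \<psi> x)" if "integrable (lebesgue_on \<Omega>) w"
        for w :: "'a \<Rightarrow> real"
    proof (rule Bochner_Integration.integrable_bound)
      show "integrable (lebesgue_on \<Omega>) (\<lambda>x. C * w x)" using that by simp
      show "AE x in lebesgue_on \<Omega>. norm (w x * \<psi> x) \<le> norm (C * w x)"
        using \<psi>(2) C0 by (intro AE_I2) (simp add: abs_mult mult.commute mult_right_mono)
    qed (use that \<psi>m in auto)
    have bd: "\<bar>(LINT x|lebesgue_on \<Omega>. v n x * \<psi> x) - (LINT x|lebesgue_on \<Omega>. v0 x * \<psi> x)\<bar> \<le>
        C * (LINT x|lebesgue_on \<Omega>. \<bar>v n x - v0 x\<bar>)" for n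
    proof -
      have id: "integrable (lebesgue_on \<Omega>) (\<lambda>x. v n x - v0 x)" using iv by simp
      have "(LINT x|lebesgue_on \<Omega>. v n x * \<psi> x) - (LINT x|lebesgue_on \<Omega>. v0 x * \<psi> x) =
          (LINT x|lebesgue_on \<Omega>. (v n x - v0 x) * \<psi> x)"
        using im[OF iv(1)[of n]] im[OF iv(2)] by (simp add: left_diff_distrib)
      also have "\<bar>\<dots>\<bar> \<le> (LINT x|lebesgue_on \<Omega>. norm ((v n x - v0 x) * \<psi> x))"
        using integral_norm_bound[of "lebesgue_on \<Omega>" "\<lambda>x. (v n x - v0 x) * \<psi> x"] by simp
      also have "\<dots> \<le> (LINT x|lebesgue_on \<Omega>. C * \<bar>v n x - v0 x\<bar>)"
      proof (rule integral_mono_AE)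
        show "AE x in lebesgue_on \<Omega>. norm ((v n x - v0 x) * \<psi> x) \<le> C * \<bar>v n x - v0 x\<bar>"
          using \<psi>(2) by (intro AE_I2) (simp add: abs_mult mult.commute mult_right_mono)
        show "integrable (lebesgue_on \<Omega>) (\<lambda>x. norm ((v n x - v0 x) * \<psi> x))"
            by (rule integrable_norm[OF im[OF id]])
        show "integrable (lebesgue_on \<Omega>) (\<lambda>x. C * \<bar>v n x - v0 x\<bar>)" using id by simp
      qed
      finally show ?thesis by simp
    qed
    have lim0: "(\<lambda>n. C * (LINT x|lebesgue_on \<Omega>. \<bar>v n x - v0 x\<bar>)) \<longlonglongrightarrow> 0"
        using tendsto_mult[OF tendsto_const lv, of C] by simp
    show ?thesis
    proof (rule LIM_zero_cancel, rule Lim_null_comparison[OF _ lim0])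
      show "\<forall>\<^sub>F n in sequentially. norm ((LINT x|lebesgue_on \<Omega>. v n x * \<psi> x) - (LINT x|lebesgue_on \<Omega>.
          v0 x * \<psi> x))
          \<le> C * (LINT x|lebesgue_on \<Omega>. \<bar>v n x - v0 x\<bar>)"
        unfolding real_norm_def using bd by (rule eventuallyI)
    qed
  qed
  show ?thesis unfolding has_weak_gradient_def
  proof (intro conjI allI impI ballI)
    fix K :: "'a set" assume K: "compact K \<and> K \<subseteq> \<Omega>"
    then have Ks: "K \<in> sets lebesgue" using compact_sets_lebesgue[of K] by simp
    have "set_integrable lebesgue \<Omega> u0" using iu(2) \<Omega>
        by (simp add: set_integrable_def integrable_restrict_space)
    then have "set_integrable lebesgue K u0" by (rule set_integrable_subset) (use K Ks in auto)
    then show "integrable (lebesgue_on K) u0" using Ks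
        by (simp add: set_integrable_def integrable_restrict_space)
  next
    fix K :: "'a set" assume K: "compact K \<and> K \<subseteq> \<Omega>"
    then have Ks: "K \<in> sets lebesgue" using compact_sets_lebesgue[of K] by simp
    have "set_integrable lebesgue \<Omega> G0" using iG(2) \<Omega>
        by (simp add: set_integrable_def integrable_restrict_space)
    then have "set_integrable lebesgue K G0" by (rule set_integrable_subset) (use K Ks in auto)
    then show "integrable (lebesgue_on K) G0" using Ks
        by (simp add: set_integrable_def integrable_restrict_space)
  next
    fix \<phi> and i :: 'a assume \<phi>: "\<phi> \<in> test_functions \<Omega>" and i: "i \<in> Basis"
    obtain C1 where C1: "\<And>x. \<bar>\<phi> x\<bar> \<le> C1" using test_bounded(1)[OF \<phi>] by blast
    obtain C2 where C2: "\<And>x. norm (grad \<phi> x) \<le> C2" using test_bounded(2)[OF \<phi>] by blast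
    have fd: "\<bar>frechet_derivative \<phi> (at x) i\<bar> \<le> C2" for x
      using norm_bound_Basis_le[OF i C2, of x] by (simp add: grad_inner_Basis[OF i])
    have 1: "(\<lambda>n. LINT x|lebesgue_on \<Omega>. u n x * frechet_derivative \<phi> (at x) i) \<longlonglongrightarrow> (LINT x|lebesgue_on \<Omega>.
        u0 x * frechet_derivative \<phi> (at x) i)"
      using lu by (intro conv[OF iu _ _ fd] borel_measurable_of_continuous_UNIV
          test_derivative_continuous[OF \<phi> i]) auto
    have 2: "(\<lambda>n. LINT x|lebesgue_on \<Omega>. (G n x \<bullet> i) * \<phi> x) \<longlonglongrightarrow> (LINT x|lebesgue_on \<Omega>. (G0 x \<bullet> i) * \<phi> x)"
    proof (rule conv[OF _ _ _ _ C1])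
      show "(\<lambda>n. LINT x|lebesgue_on \<Omega>. \<bar>G n x \<bullet> i - G0 x \<bullet> i\<bar>) \<longlonglongrightarrow> 0"
      proof (rule tendsto_sandwich[OF _ _ tendsto_const lG])
        show "\<forall>\<^sub>F n in sequentially. (LINT x|lebesgue_on \<Omega>. \<bar>G n x \<bullet> i - G0 x \<bullet> i\<bar>) \<le>
            (LINT x|lebesgue_on \<Omega>. norm (G n x - G0 x))"
        proof (intro always_eventually allI integral_mono_AE AE_I2)
          fix n x show "\<bar>G n x \<bullet> i - G0 x \<bullet> i\<bar> \<le> norm (G n x - G0 x)"
            using norm_bound_Basis_le[OF i order_refl, of "G n x - G0 x"] by (simp add: inner_diff_left)
        qed (use iG in auto)
      qed auto
    qed (use iG in \<open>auto intro: borel_measurable_of_continuous_UNIV test_continuous[OF \<phi>]\<close>)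
    have "(LINT x|lebesgue_on \<Omega>. u n x * frechet_derivative \<phi> (at x) i) = - (LINT x|lebesgue_on \<Omega>.
        (G n x \<bullet> i) * \<phi> x)" for n
      using G \<phi> i by (auto simp: has_weak_gradient_def)
    then have "(\<lambda>n. LINT x|lebesgue_on \<Omega>. u n x * frechet_derivative \<phi> (at x) i) \<longlonglongrightarrow> - (LINT x|lebesgue_on
        \<Omega>. (G0 x \<bullet> i) * \<phi> x)"
      using tendsto_minus[OF 2] by simp
    then show "(LINT x|lebesgue_on \<Omega>. u0 x * frechet_derivative \<phi> (at x) i) = - (LINT x|lebesgue_on \<Omega>.
        (G0 x \<bullet> i) * \<phi> x)"
      using LIMSEQ_unique[OF 1] by blast
  qed
qed

text \<open>The increments are summable in \<open>L\<^sup>1\<close>, hence absolutely summable at almost every point.\<close>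

lemma fast_L1_Cauchy_converges_AE:
  fixes F :: "nat \<Rightarrow> 'a \<Rightarrow> 'b::euclidean_space"
  assumes int: "\<And>k. integrable M (F k)" and c: "0 \<le> c"
    and fast: "\<And>k. (LINT x|M. norm (F (Suc k) x - F k x)) \<le> c * (1/2) ^ k"
  shows "\<exists>G\<in>borel_measurable M. AE x in M. (\<lambda>k. F k x) \<longlonglongrightarrow> G x"
proof -
  have m[measurable]: "F k \<in> borel_measurable M" for k using int by auto
  have "(\<integral>\<^sup>+x. (\<Sum>k. ennreal (norm (F (Suc k) x - F k x))) \<partial>M) = (\<Sum>k. \<integral>\<^sup>+x.
      ennreal (norm (F (Suc k) x - F k x)) \<partial>M)"
    by (rule nn_integral_suminf) measurable
  also have "\<dots> \<le> (\<Sum>k. ennreal (c * (1/2) ^ k))"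
  proof (rule suminf_le)
    fix k
    have "(\<integral>\<^sup>+x. ennreal (norm (F (Suc k) x - F k x)) \<partial>M) = ennreal (LINT x|M.
        norm (F (Suc k) x - F k x))"
      using int by (intro nn_integral_eq_integral) auto
    also have "\<dots> \<le> ennreal (c * (1/2) ^ k)" by (rule ennreal_leI[OF fast])
    finally show "(\<integral>\<^sup>+x. ennreal (norm (F (Suc k) x - F k x)) \<partial>M) \<le> ennreal (c * (1/2) ^ k)" .
  qed auto
  also have "\<dots> = ennreal (\<Sum>k. c * (1/2) ^ k)"
    using c by (intro suminf_ennreal2) (auto intro: summable_mult summable_geometric)
  finally have "(\<integral>\<^sup>+x. (\<Sum>k. ennreal (norm (F (Suc k) x - F k x))) \<partial>M) \<noteq> \<infinity>"
    by (metis ennreal_neq_top infinity_ennreal_def neq_top_trans)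
  then have "AE x in M. (\<Sum>k. ennreal (norm (F (Suc k) x - F k x))) \<noteq> \<infinity>"
    by (intro nn_integral_noteq_infinite) measurable
  then have "AE x in M. (\<lambda>k. F k x) \<longlonglongrightarrow> lim (\<lambda>k. F k x)"
  proof eventually_elim
    case (elim x)
    then have "summable (\<lambda>k. norm (F (Suc k) x - F k x))"
      by (intro summable_suminf_not_top) auto
    then have "summable (\<lambda>k. F (Suc k) x - F k x)" by (rule summable_norm_cancel)
    then have "(\<lambda>n. \<Sum>k<n. F (Suc k) x - F k x) \<longlonglongrightarrow> (\<Sum>k. F (Suc k) x - F k x)" by (rule summable_LIMSEQ)
    moreover have "(\<Sum>k<n. F (Suc k) x - F k x) = F n x - F 0 x" for n by (rule sum_lessThan_telescope)
    ultimately have "(\<lambda>n. F n x - F 0 x) \<longlonglongrightarrow> (\<Sum>k. F (Suc k) x - F k x)" by simp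
    then have "(\<lambda>n. (F n x - F 0 x) + F 0 x) \<longlonglongrightarrow> (\<Sum>k. F (Suc k) x - F k x) + F 0 x"
      by (rule tendsto_add[OF _ tendsto_const])
    then have "convergent (\<lambda>k. F k x)" by (auto simp: convergent_def)
    then show ?case by (simp add: convergent_LIMSEQ_iff)
  qed
  moreover have "(\<lambda>x. lim (\<lambda>k. F k x)) \<in> borel_measurable M"
      by (rule borel_measurable_lim_metric) measurable
  ultimately show ?thesis by (rule bexI[of _ "\<lambda>x. lim (\<lambda>k. F k x)"])
qed

section \<open>The Sobolev spaces\<close>

context log_double_phase
begin

abbreviation "W1 \<equiv> W1_Hlog \<Omega> p q \<mu>"
abbreviation "W10 \<equiv> W10_Hlog \<Omega> p q \<mu>"
abbreviation "D u \<equiv> weak_gradient \<Omega> u"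
abbreviation "sob_norm \<equiv> norm_W1_Hlog \<Omega> p q \<mu>"

definition sob_modular :: "'a L0 \<Rightarrow> real" where
  "sob_modular u = \<rho> (rep_L0 u) + \<rho> (D u)"

lemma W1_zero_outside: "u \<in> W1 \<Longrightarrow> AE x in lebesgue. x \<notin> \<Omega> \<longrightarrow> rep_L0 u x = 0"
  by (simp add: W1_Hlog_def L_Hlog_def)

lemma W1_has_weak_gradient: "u \<in> W1 \<Longrightarrow> has_weak_gradient \<Omega> (rep_L0 u) (D u)"
proof -
  assume "u \<in> W1"
  then obtain G where "has_weak_gradient \<Omega> (rep_L0 u) G" by (auto simp: W1_Hlog_def)
  then show ?thesis unfolding weak_gradient_def by (rule someI[of "has_weak_gradient \<Omega> (rep_L0 u)"])
qed

lemma W1_fin_rep: "u \<in> W1 \<Longrightarrow> fin_modular (rep_L0 u)"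
  by (rule fin_modularI[OF measurable_lebesgue_onI[OF rep_L0_measurable]])
    (simp only: modular_norm, simp add: W1_Hlog_def L_Hlog_def)

lemma W1_fin_grad: "u \<in> W1 \<Longrightarrow> fin_modular (D u)"
  by (rule fin_modularI[OF weak_gradient_measurable[OF \<Omega>_open W1_has_weak_gradient]]) (simp_all add:
      W1_Hlog_def)

text \<open>The space is defined through the representative picked by \<open>weak_gradient\<close>; uniqueness of
  weak gradients allows any other one.\<close>

lemma W1I:
  assumes out: "AE x in lebesgue. x \<notin> \<Omega> \<longrightarrow> rep_L0 u x = 0" and u: "fin_modular (rep_L0 u)"
    and G: "has_weak_gradient \<Omega> (rep_L0 u) G" and fG: "fin_modular G"
  shows "u \<in> W1" "AE x in M. D u x = G x"
proof -
  have D: "has_weak_gradient \<Omega> (rep_L0 u) (D u)" unfolding weak_gradient_def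
      by (rule someI[of "has_weak_gradient \<Omega> (rep_L0 u)" G, OF G])
  show eq: "AE x in M. D u x = G x" by (rule weak_gradient_unique[OF \<Omega>_open D G])
  have fD: "fin_modular (D u)"
    by (rule fin_modular_cong_AE[OF _ weak_gradient_measurable[OF \<Omega>_open D] fG]) (use eq in \<open>auto elim:
        eventually_mono\<close>)
  have "modular_Hlog \<Omega> p q \<mu> (rep_L0 u) < \<infinity>" using modular_eq_\<rho>[OF u] by (simp only: modular_norm) simp
  then show "u \<in> W1" using out G modular_eq_\<rho>[OF fD] unfolding W1_Hlog_def L_Hlog_def by auto
qed

lemma fin_modular_real_scale: "fin_modular (u :: 'a \<Rightarrow> real) \<Longrightarrow> fin_modular (\<lambda>x. c * u x)"
  using modular_scale(1)[of u c] by simp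

lemma rep_measurable_M: "rep_L0 u \<in> borel_measurable M"
  by (rule measurable_lebesgue_onI[OF rep_L0_measurable])

lemma W1_add:
  assumes u: "u \<in> W1" and v: "v \<in> W1"
  shows "u + v \<in> W1" "AE x in M. D (u + v) x = D u x + D v x"
proof -
  have G: "has_weak_gradient \<Omega> (rep_L0 (u + v)) (\<lambda>x. D u x + D v x)"
    using rep_L0_measurable[of u] rep_L0_measurable[of v]
    by (intro has_weak_gradient_cong[OF has_weak_gradient_add[OF W1_has_weak_gradient[OF u]
        W1_has_weak_gradient[OF v] \<Omega>_sets]]
        rep_L0_measurable rep_L0_add \<Omega>_sets) auto
  have out: "AE x in lebesgue. x \<notin> \<Omega> \<longrightarrow> rep_L0 (u + v) x = 0"
    using W1_zero_outside[OF u] W1_zero_outside[OF v] rep_L0_add[of u v] by eventually_elim auto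
  have fin: "fin_modular (rep_L0 (u + v))"
    by (rule fin_modular_cong_AE[OF _ rep_measurable_M modular_add(1)[OF W1_fin_rep[OF u] W1_fin_rep[OF
        v]]])
      (use AE_lebesgue_onI[OF rep_L0_add[of u v] \<Omega>_sets] in \<open>auto elim: eventually_mono\<close>)
  show "u + v \<in> W1" "AE x in M. D (u + v) x = D u x + D v x"
    using W1I[OF out fin G modular_add(1)[OF W1_fin_grad[OF u] W1_fin_grad[OF v]]] by auto
qed

lemma W1_scale:
  assumes u: "u \<in> W1"
  shows "c *\<^sub>R u \<in> W1" "AE x in M. D (c *\<^sub>R u) x = c *\<^sub>R D u x"
proof -
  have G: "has_weak_gradient \<Omega> (rep_L0 (c *\<^sub>R u)) (\<lambda>x. c *\<^sub>R D u x)"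
    using rep_L0_measurable[of u]
    by (intro has_weak_gradient_cong[OF has_weak_gradient_scale[OF W1_has_weak_gradient[OF u]]]
        rep_L0_measurable rep_L0_scale \<Omega>_sets) auto
  have out: "AE x in lebesgue. x \<notin> \<Omega> \<longrightarrow> rep_L0 (c *\<^sub>R u) x = 0"
    using W1_zero_outside[OF u] rep_L0_scale[of c u] by eventually_elim auto
  have fin: "fin_modular (rep_L0 (c *\<^sub>R u))"
    by (rule fin_modular_cong_AE[OF _ rep_measurable_M fin_modular_real_scale[OF W1_fin_rep[OF u]]])
      (use AE_lebesgue_onI[OF rep_L0_scale[of c u] \<Omega>_sets] in \<open>auto elim: eventually_mono\<close>)
  show "c *\<^sub>R u \<in> W1" "AE x in M. D (c *\<^sub>R u) x = c *\<^sub>R D u x"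
    using W1I[OF out fin G modular_scale(1)[OF W1_fin_grad[OF u]]] by auto
qed

lemma W1_diff:
  assumes u: "u \<in> W1" and v: "v \<in> W1"
  shows "u - v \<in> W1" "AE x in M. D (u - v) x = D u x - D v x"
    "AE x in lebesgue. rep_L0 (u - v) x = rep_L0 u x - rep_L0 v x"
proof -
  have eq: "u - v = u + (-1) *\<^sub>R v" by simp
  have v': "(-1) *\<^sub>R v \<in> W1" by (rule W1_scale(1)[OF v])
  show "u - v \<in> W1" unfolding eq by (rule W1_add(1)[OF u v'])
  show "AE x in M. D (u - v) x = D u x - D v x" unfolding eq
    using W1_add(2)[OF u v'] W1_scale(2)[OF v, of "-1"] by eventually_elim simp
  show "AE x in lebesgue. rep_L0 (u - v) x = rep_L0 u x - rep_L0 v x" unfolding eq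
    using rep_L0_add[of u "(-1) *\<^sub>R v"] rep_L0_scale[of "-1" v] by eventually_elim simp
qed

lemma fin_modular_zero: "fin_modular (\<lambda>x. 0 :: 'b::euclidean_space)" "\<rho> (\<lambda>x. 0 :: 'b) = 0"
  by (simp_all add: fin_modular_def \<rho>_def log_phase_def)

lemma W1_zero: "0 \<in> W1" "AE x in M. D 0 x = 0"
proof -
  have G: "has_weak_gradient \<Omega> (rep_L0 0) (\<lambda>x. 0)"
    by (rule has_weak_gradient_cong[OF _ rep_L0_measurable _ rep_L0_zero \<Omega>_sets])
      (auto simp: has_weak_gradient_def)
  have out: "AE x in lebesgue. x \<notin> \<Omega> \<longrightarrow> rep_L0 0 x = 0" using rep_L0_zero by eventually_elim simp
  have fin: "fin_modular (rep_L0 (0 :: 'a L0))"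
    by (rule fin_modular_cong_AE[OF _ rep_measurable_M fin_modular_zero(1)[where 'b = real]])
      (use AE_lebesgue_onI[OF rep_L0_zero \<Omega>_sets] in \<open>auto elim: eventually_mono\<close>)
  show "0 \<in> W1" "AE x in M. D 0 x = 0" using W1I[OF out fin G fin_modular_zero(1)] by auto
qed

lemma subspace_W1: "subspace W1"
  using W1_zero(1) W1_add(1) W1_scale(1) by (auto simp: subspace_def)

lemma D_measurable: "u \<in> W1 \<Longrightarrow> D u \<in> borel_measurable M"
  by (rule fin_modular_measurable[OF W1_fin_grad])

lemma \<rho>_D_scale: "u \<in> W1 \<Longrightarrow> \<rho> (D (c *\<^sub>R u)) = \<rho> (\<lambda>x. c *\<^sub>R D u x)"
  using W1_scale(2)[of u c]
  by (intro \<rho>_cong_AE D_measurable W1_scale(1) fin_modular_measurable[OF modular_scale(1)[OF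
      W1_fin_grad]])
    (auto elim: eventually_mono)

lemma \<rho>_rep_scale: "u \<in> W1 \<Longrightarrow> \<rho> (rep_L0 (c *\<^sub>R u)) = \<rho> (\<lambda>x. c *\<^sub>R rep_L0 u x)"
  using AE_lebesgue_onI[OF rep_L0_scale[of c u] \<Omega>_sets]
  by (intro \<rho>_cong_AE rep_measurable_M fin_modular_measurable[OF modular_scale(1)[OF W1_fin_rep]])
    (auto elim: eventually_mono)

lemma \<rho>_D_diff: "u \<in> W1 \<Longrightarrow> v \<in> W1 \<Longrightarrow> \<rho> (D (u - v)) = \<rho> (\<lambda>x. D u x - D v x)"
  using W1_diff(2)[of u v]
  by (intro \<rho>_cong_AE D_measurable W1_diff(1) fin_modular_measurable[OF modular_diff[OF W1_fin_grad
      W1_fin_grad]])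
    (auto elim: eventually_mono)

lemma \<rho>_lincomb:
  assumes u: "u \<in> W1" and v: "v \<in> W1"
  shows "\<rho> (D (a *\<^sub>R u + b *\<^sub>R v)) = \<rho> (\<lambda>x. a *\<^sub>R D u x + b *\<^sub>R D v x)"
    "\<rho> (rep_L0 (a *\<^sub>R u + b *\<^sub>R v)) = \<rho> (\<lambda>x. a *\<^sub>R rep_L0 u x + b *\<^sub>R rep_L0 v x)"
proof -
  have s: "a *\<^sub>R u \<in> W1" "b *\<^sub>R v \<in> W1" using W1_scale(1) u v by auto
  have "AE x in M. D (a *\<^sub>R u + b *\<^sub>R v) x = a *\<^sub>R D u x + b *\<^sub>R D v x"
    using W1_add(2)[OF s] W1_scale(2)[OF u, of a] W1_scale(2)[OF v, of b] by eventually_elim simp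
  then show "\<rho> (D (a *\<^sub>R u + b *\<^sub>R v)) = \<rho> (\<lambda>x. a *\<^sub>R D u x + b *\<^sub>R D v x)"
    by (intro \<rho>_cong_AE D_measurable W1_add(1)[OF s]
        fin_modular_measurable[OF modular_add(1)[OF modular_scale(1)[OF W1_fin_grad[OF u]]
            modular_scale(1)[OF W1_fin_grad[OF v]]]])
      (auto elim: eventually_mono)
  have "AE x in lebesgue. rep_L0 (a *\<^sub>R u + b *\<^sub>R v) x = a *\<^sub>R rep_L0 u x + b *\<^sub>R rep_L0 v x"
    using rep_L0_add[of "a *\<^sub>R u" "b *\<^sub>R v"] rep_L0_scale[of a u] rep_L0_scale[of b v]
        by eventually_elim simp
  from AE_lebesgue_onI[OF this \<Omega>_sets] show "\<rho> (rep_L0 (a *\<^sub>R u + b *\<^sub>R v)) = \<rho> (\<lambda>x. a *\<^sub>R rep_L0 u x +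
      b *\<^sub>R rep_L0 v x)"
    by (intro \<rho>_cong_AE rep_measurable_M
        fin_modular_measurable[OF modular_add(1)[OF modular_scale(1)[OF W1_fin_rep[OF u]]
            modular_scale(1)[OF W1_fin_rep[OF v]]]])
      (auto elim: eventually_mono)
qed

lemma modular_sum_eq:
  assumes u: "u \<in> W1"
  shows "modular_Hlog \<Omega> p q \<mu> (\<lambda>x. rep_L0 u x / l) + modular_Hlog \<Omega> p q \<mu> (\<lambda>x. norm (D u x) / l) =
      ennreal (sob_modular ((1 / l) *\<^sub>R u))"
proof -
  have "modular_Hlog \<Omega> p q \<mu> (\<lambda>x. rep_L0 u x / l) = modular_Hlog \<Omega> p q \<mu> (\<lambda>x.
      norm ((1 / l) *\<^sub>R rep_L0 u x))"
    unfolding modular_norm by simp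
  also have "\<dots> = ennreal (\<rho> (rep_L0 ((1 / l) *\<^sub>R u)))"
    unfolding \<rho>_rep_scale[OF u] by (rule modular_eq_\<rho>[OF modular_scale(1)[OF W1_fin_rep[OF u]]])
  finally have 1: "modular_Hlog \<Omega> p q \<mu> (\<lambda>x. rep_L0 u x / l) = ennreal (\<rho> (rep_L0 ((1 / l) *\<^sub>R u)))" .
  have "modular_Hlog \<Omega> p q \<mu> (\<lambda>x. norm (D u x) / l) = modular_Hlog \<Omega> p q \<mu> (\<lambda>x.
      norm ((1 / l) *\<^sub>R D u x))"
    by (simp add: modular_Hlog_def)
  also have "\<dots> = ennreal (\<rho> (D ((1 / l) *\<^sub>R u)))"
    unfolding \<rho>_D_scale[OF u] by (rule modular_eq_\<rho>[OF modular_scale(1)[OF W1_fin_grad[OF u]]])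
  finally show ?thesis using 1 by (simp add: sob_modular_def \<rho>_nonneg ennreal_plus)
qed

lemma sob_norm_eq: "u \<in> W1 \<Longrightarrow> sob_norm u = Inf {l. 0 < l \<and> sob_modular ((1 / l) *\<^sub>R u) \<le> 1}"
  by (simp add: norm_W1_Hlog_def modular_sum_eq)

text \<open>A function with vanishing modular vanishes almost everywhere on \<open>\<Omega>\<close>; outside \<open>\<Omega>\<close> it vanishes
  by convention, so that it is zero as an equivalence class on the whole space.\<close>

lemma luxemburg_W1: "luxemburg_norm W1 sob_modular sob_norm (Suc q_bound)"
proof
  show "subspace W1" by (rule subspace_W1)
  show "0 \<le> sob_modular u" for u by (simp add: sob_modular_def \<rho>_nonneg)
  have "\<rho> (rep_L0 (0 :: 'a L0)) = \<rho> (\<lambda>x. 0 :: real)"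
    using AE_lebesgue_onI[OF rep_L0_zero \<Omega>_sets]
    by (intro \<rho>_cong_AE rep_measurable_M) (auto elim: eventually_mono)
  moreover have "\<rho> (D 0) = \<rho> (\<lambda>x. 0 :: 'a)"
    using W1_zero(2) by (intro \<rho>_cong_AE D_measurable W1_zero(1)) (auto elim: eventually_mono)
  ultimately show "sob_modular 0 = 0" by (simp add: sob_modular_def fin_modular_zero(2))
  fix u assume u: "u \<in> W1"
  show "u = 0" if "sob_modular u = 0"
  proof (rule L0_eqI)
    have "\<rho> (rep_L0 u) = 0" using that \<rho>_nonneg[of "rep_L0 u"] \<rho>_nonneg[of "D u"]
        by (simp add: sob_modular_def)
    then have "AE x in M. rep_L0 u x = 0" by (rule modular_zero_imp[OF W1_fin_rep[OF u]])
    then have "AE x in lebesgue. x \<in> \<Omega> \<longrightarrow> rep_L0 u x = 0" using \<Omega>_sets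
        by (subst (asm) AE_restrict_space_iff) auto
    then show "AE x in lebesgue. rep_L0 u x = rep_L0 0 x"
      using W1_zero_outside[OF u] rep_L0_zero by eventually_elim auto
  qed
  show "sob_modular (- u) = sob_modular u"
  proof -
    have "\<rho> (\<lambda>x. (-1) *\<^sub>R D u x) = \<rho> (D u)" "\<rho> (\<lambda>x. (-1) *\<^sub>R rep_L0 u x) = \<rho> (rep_L0 u)"
      by (simp_all add: \<rho>_def)
    then show ?thesis using \<rho>_D_scale[OF u, of "-1"] \<rho>_rep_scale[OF u, of "-1"]
        by (simp add: sob_modular_def)
  qed
  show "sob_modular (c *\<^sub>R u) \<le> c ^ Suc q_bound * sob_modular u" if "1 \<le> c" for c
    using modular_scale(2)[OF W1_fin_grad[OF u] that] modular_scale(2)[OF W1_fin_rep[OF u] that]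
    unfolding sob_modular_def \<rho>_D_scale[OF u] \<rho>_rep_scale[OF u] distrib_left by linarith
  show "sob_norm u = Inf {l. 0 < l \<and> sob_modular ((1 / l) *\<^sub>R u) \<le> 1}" by (rule sob_norm_eq[OF u])
  fix v c assume v: "v \<in> W1" and c: "0 \<le> c" "c \<le> (1::real)"
  show "sob_modular ((1 - c) *\<^sub>R u + c *\<^sub>R v) \<le> (1 - c) * sob_modular u + c * sob_modular v"
    using modular_convex[OF W1_fin_grad[OF u] W1_fin_grad[OF v] c] modular_convex[OF W1_fin_rep[OF u]
        W1_fin_rep[OF v] c]
    unfolding sob_modular_def \<rho>_lincomb[OF u v] distrib_left by linarith
qed

end

sublocale log_double_phase \<subseteq> W1: luxemburg_norm "W1_Hlog \<Omega> p q \<mu>" sob_modular "norm_W1_Hlog \<Omega> p q \<mu>"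
    "Suc q_bound"
  by (rule luxemburg_W1)

context log_double_phase
begin

text \<open>Bounded fields have finite modular because \<open>\<mu>\<close> is integrable.\<close>

lemma test_in_W1:
  assumes \<phi>: "\<phi> \<in> test_functions \<Omega>"
  shows "abs_L0 \<phi> \<in> W1" "AE x in M. D (abs_L0 \<phi>) x = grad \<phi> x" "AE x in lebesgue. rep_L0 (abs_L0 \<phi>) x =
      \<phi> x"
proof -
  have \<phi>m: "\<phi> \<in> borel_measurable borel" by (rule borel_measurable_of_continuous_UNIV[OF
      test_continuous[OF \<phi>]])
  then have \<phi>l: "\<phi> \<in> borel_measurable lebesgue" by (simp add: measurable_completion)
  show eq: "AE x in lebesgue. rep_L0 (abs_L0 \<phi>) x = \<phi> x" by (rule rep_abs_L0[OF \<phi>l])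
  have bounded_fin: "fin_modular F" if F: "F \<in> borel_measurable M" and b: "\<And>x. norm (F x) \<le> C"
      for F :: "'a \<Rightarrow> 'b::euclidean_space" and C
  proof (rule fin_modular_dominated(1)[OF F])
    define B where "B = max 1 C"
    show "integrable M (\<lambda>x. B ^ q_bound + \<mu> x * (B ^ q_bound * ln (exp 1 + B)))"
      using \<mu>_integrable by (intro Bochner_Integration.integrable_add integrable_mult_left
          integrable_const)
    show "AE x in M. h x (norm (F x)) \<le> B ^ q_bound + \<mu> x * (B ^ q_bound * ln (exp 1 + B))"
      using AE_regular
    proof eventually_elim
      case (elim x)
      have B: "1 \<le> B" "norm (F x) \<le> B" using b[of x] by (auto simp: B_def)
      have pw: "B powr r \<le> B ^ q_bound" if "r \<le> real q_bound" for r
      proof -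
        have "B powr r \<le> B powr real q_bound" using B that by (intro powr_mono) auto
        then show ?thesis using B by (simp add: powr_realpow)
      qed
      have "h x (norm (F x)) \<le> h x B" by (rule h_mono[OF elim norm_ge_zero B(2)])
      also have "h x B = B powr p x + \<mu> x * (B powr q x * ln (exp 1 + B))"
          by (simp add: log_phase_def mult.assoc)
      also have "\<dots> \<le> B ^ q_bound + \<mu> x * (B ^ q_bound * ln (exp 1 + B))"
        using elim B ln_exp1_plus_ge_1[of B]
            by (intro add_mono mult_left_mono mult_right_mono pw) (auto simp: regular_def)
      finally show ?case .
    qed
  qed
  obtain C1 where C1: "\<And>x. \<bar>\<phi> x\<bar> \<le> C1" using test_bounded(1)[OF \<phi>] by blast
  obtain C2 where C2: "\<And>x. norm (grad \<phi> x) \<le> C2" using test_bounded(2)[OF \<phi>] by blast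
  have f\<phi>: "fin_modular \<phi>" using C1 by (intro bounded_fin[of _ C1] lebesgue_on_borel_measurable \<phi>m) auto
  have fin: "fin_modular (rep_L0 (abs_L0 \<phi>))"
    by (rule fin_modular_cong_AE[OF _ rep_measurable_M f\<phi>])
      (use AE_lebesgue_onI[OF eq \<Omega>_sets] in \<open>auto elim: eventually_mono\<close>)
  have fg: "fin_modular (grad \<phi>)"
    by (intro bounded_fin[OF _ C2] lebesgue_on_borel_measurable borel_measurable_of_continuous_UNIV
        test_grad_continuous[OF \<phi>])
  have G: "has_weak_gradient \<Omega> (rep_L0 (abs_L0 \<phi>)) (grad \<phi>)"
    by (rule has_weak_gradient_cong[OF test_has_weak_gradient[OF \<phi> \<Omega>_sets] rep_L0_measurable \<phi>l eq
        \<Omega>_sets])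
  have out: "AE x in lebesgue. x \<notin> \<Omega> \<longrightarrow> rep_L0 (abs_L0 \<phi>) x = 0"
    using eq by eventually_elim (use test_zero_outside[OF \<phi>] in auto)
  show "abs_L0 \<phi> \<in> W1" "AE x in M. D (abs_L0 \<phi>) x = grad \<phi> x" using W1I[OF out fin G fg] by auto
qed

lemma test_ae_equal: "\<phi> \<in> test_functions \<Omega> \<Longrightarrow> ae_equal \<phi> \<phi>"
  unfolding ae_equal_def
  by (simp add: measurable_completion borel_measurable_of_continuous_UNIV[OF test_continuous])

lemma test_zero: "(\<lambda>x. 0) \<in> test_functions \<Omega>"
  by (simp add: test_functions_def C_k_const)

lemma W10_subset: "u \<in> W10 \<Longrightarrow> u \<in> W1"
  by (simp add: W10_Hlog_def)

lemma W10_approx: "u \<in> W10 \<Longrightarrow> 0 < e \<Longrightarrow> \<exists>\<phi>\<in>test_functions \<Omega>. sob_norm (u - abs_L0 \<phi>) < e"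
  by (simp add: W10_Hlog_def)

lemma subspace_W10: "subspace W10"
  unfolding subspace_def
proof (intro conjI ballI allI)
  have "sob_norm (0 - abs_L0 (\<lambda>x. 0)) = 0"
    using W1.N_0 by (simp flip: zero_L0_def)
  then show "0 \<in> W10" unfolding W10_Hlog_def using W1_zero(1) test_zero by force
next
  fix u v assume u: "u \<in> W10" and v: "v \<in> W10"
  have "\<exists>\<phi>\<in>test_functions \<Omega>. sob_norm (u + v - abs_L0 \<phi>) < e" if e: "0 < e" for e
  proof -
    obtain \<phi> \<psi> where \<phi>: "\<phi> \<in> test_functions \<Omega>" "sob_norm (u - abs_L0 \<phi>) < e / 2"
      and \<psi>: "\<psi> \<in> test_functions \<Omega>" "sob_norm (v - abs_L0 \<psi>) < e / 2"
      using W10_approx[OF u, of "e/2"] W10_approx[OF v, of "e/2"] e by auto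
    have "abs_L0 (\<lambda>x. \<phi> x + \<psi> x) = abs_L0 \<phi> + abs_L0 \<psi>"
      by (rule plus_L0.abs_eq[symmetric]) (use \<phi> \<psi> test_ae_equal in auto)
    then have "u + v - abs_L0 (\<lambda>x. \<phi> x + \<psi> x) = (u - abs_L0 \<phi>) + (v - abs_L0 \<psi>)" by simp
    also have "sob_norm \<dots> \<le> sob_norm (u - abs_L0 \<phi>) + sob_norm (v - abs_L0 \<psi>)"
      using u v \<phi> \<psi> by (intro W1.N_triangle W1_diff(1) W10_subset test_in_W1(1)) auto
    also have "\<dots> < e" using \<phi> \<psi> by simp
    finally show ?thesis using test_functions_add[OF \<phi>(1) \<psi>(1)] by blast
  qed
  moreover have "u + v \<in> W1" by (intro W1_add(1) W10_subset u v)
  ultimately show "u + v \<in> W10" by (simp add: W10_Hlog_def)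
next
  fix u and c :: real assume u: "u \<in> W10"
  have "\<exists>\<phi>\<in>test_functions \<Omega>. sob_norm (c *\<^sub>R u - abs_L0 \<phi>) < e" if e: "0 < e" for e
  proof -
    have "0 < e / (\<bar>c\<bar> + 1)" using e by simp
    then obtain \<phi> where \<phi>: "\<phi> \<in> test_functions \<Omega>" "sob_norm (u - abs_L0 \<phi>) < e / (\<bar>c\<bar> + 1)"
      using W10_approx[OF u] by blast
    have "abs_L0 (\<lambda>x. c * \<phi> x) = c *\<^sub>R abs_L0 \<phi>"
      by (rule scaleR_L0.abs_eq[symmetric]) (use \<phi> test_ae_equal in auto)
    then have "c *\<^sub>R u - abs_L0 (\<lambda>x. c * \<phi> x) = c *\<^sub>R (u - abs_L0 \<phi>)" by (simp add: scaleR_diff_right)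
    also have "sob_norm \<dots> = \<bar>c\<bar> * sob_norm (u - abs_L0 \<phi>)"
      using u \<phi> by (intro W1.N_scale W1_diff(1) W10_subset test_in_W1(1)) auto
    also have "\<dots> \<le> \<bar>c\<bar> * (e / (\<bar>c\<bar> + 1))" using \<phi> by (intro mult_left_mono) auto
    also have "\<dots> < e" using e by (simp add: field_simps)
    finally show ?thesis using test_functions_cmult[OF \<phi>(1)] by blast
  qed
  moreover have "c *\<^sub>R u \<in> W1" by (intro W1_scale(1) W10_subset u)
  ultimately show "c *\<^sub>R u \<in> W10" by (simp add: W10_Hlog_def)
qed

lemma luxemburg_W10: "luxemburg_norm W10 sob_modular sob_norm (Suc q_bound)"
  by standard (use subspace_W10 W10_subset W1.R_nonneg W1.R_zero W1.R_zero_imp W1.R_minus W1.R_convex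
      W1.R_scale sob_norm_eq in \<open>simp_all del: power_Suc\<close>)

lemma sob_modular_scaled_le_1:
  assumes u: "u \<in> W1" and l: "sob_norm u < l"
  shows "\<rho> (\<lambda>x. (1 / l) *\<^sub>R rep_L0 u x) \<le> 1" "\<rho> (\<lambda>x. (1 / l) *\<^sub>R D u x) \<le> 1"
  using W1.N_less[OF u l] \<rho>_nonneg[of "rep_L0 ((1 / l) *\<^sub>R u)"] \<rho>_nonneg[of "D ((1 / l) *\<^sub>R u)"]
  unfolding sob_modular_def \<rho>_D_scale[OF u, symmetric] \<rho>_rep_scale[OF u, symmetric] by linarith+

lemma L1_le_sob_norm:
  assumes u: "u \<in> W1" and l: "sob_norm u < l"
  shows "(LINT x|M. norm (rep_L0 u x)) \<le> l * (measure M (space M) + 1)" "(LINT x|M. norm (D u x)) \<le>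
      l * (measure M (space M) + 1)"
proof -
  have lp: "0 < l" using W1.N_nonneg[OF u] l by simp
  show "(LINT x|M. norm (rep_L0 u x)) \<le> l * (measure M (space M) + 1)" "(LINT x|M. norm (D u x)) \<le>
      l * (measure M (space M) + 1)"
    using L1_le_modular(2)[OF W1_fin_rep[OF u] lp] L1_le_modular(2)[OF W1_fin_grad[OF u] lp]
      mult_left_mono[OF sob_modular_scaled_le_1(1)[OF u l] less_imp_le[OF lp]]
      mult_left_mono[OF sob_modular_scaled_le_1(2)[OF u l] less_imp_le[OF lp]]
    unfolding distrib_left mult_1_right by linarith+
qed

end

context log_double_phase
begin

lemma h_tendsto:
  assumes x: "regular x" and t: "t \<longlonglongrightarrow> t0" "\<And>j. 0 \<le> t j"
  shows "(\<lambda>j. h x (t j)) \<longlonglongrightarrow> h x t0"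
proof -
  have t0: "0 \<le> t0" using LIMSEQ_le_const[OF t(1)] t(2) by blast
  show ?thesis unfolding log_phase_def
    using regular_bounds[OF x] t exp1_plus_pos[OF t0]
    by (intro tendsto_add tendsto_mult tendsto_const tendsto_powr' tendsto_ln) auto
qed

lemma modular_fatou:
  fixes F :: "nat \<Rightarrow> 'a \<Rightarrow> 'b::euclidean_space"
  assumes F: "\<And>j. fin_modular (F j)" "\<And>j. \<rho> (F j) \<le> 1"
    and lim: "AE x in M. (\<lambda>j. F j x) \<longlonglongrightarrow> F0 x" and F0: "F0 \<in> borel_measurable M"
  shows "fin_modular F0" "\<rho> F0 \<le> 1"
proof -
  have m: "(\<lambda>x. ennreal (h x (norm (F j x)))) \<in> borel_measurable M" for j
    using h_norm_measurable[OF fin_modular_measurable[OF F(1)[of j]]] by measurable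
  have "(\<integral>\<^sup>+x. ennreal (h x (norm (F0 x))) \<partial>M) \<le> (\<integral>\<^sup>+x. liminf (\<lambda>j. ennreal (h x (norm (F j x)))) \<partial>M)"
  proof (rule nn_integral_mono_AE)
    show "AE x in M. ennreal (h x (norm (F0 x))) \<le> liminf (\<lambda>j. ennreal (h x (norm (F j x))))"
      using lim AE_regular
    proof eventually_elim
      case (elim x)
      have "(\<lambda>j. ennreal (h x (norm (F j x)))) \<longlonglongrightarrow> ennreal (h x (norm (F0 x)))"
        by (intro tendsto_ennrealI h_tendsto[OF elim(2)] tendsto_norm elim(1)) simp
      then show ?case by (simp add: lim_imp_Liminf)
    qed
  qed
  also have "\<dots> \<le> liminf (\<lambda>j. \<integral>\<^sup>+x. ennreal (h x (norm (F j x))) \<partial>M)" by (rule nn_integral_liminf[OF m])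
  also have "\<dots> \<le> limsup (\<lambda>j. \<integral>\<^sup>+x. ennreal (h x (norm (F j x))) \<partial>M)" by (rule Liminf_le_Limsup) simp
  also have "\<dots> \<le> 1"
  proof (rule Limsup_bounded, rule always_eventually, rule allI)
    fix j
    have "(\<integral>\<^sup>+x. ennreal (h x (norm (F j x))) \<partial>M) = ennreal (\<rho> (F j))"
      using modular_eq_\<rho>[OF F(1)] by (simp add: modular_Hlog_def Hlog_eq_log_phase)
    then show "(\<integral>\<^sup>+x. ennreal (h x (norm (F j x))) \<partial>M) \<le> 1" using F(2)[of j] by (simp add: ennreal_le_1)
  qed
  finally have le: "modular_Hlog \<Omega> p q \<mu> (\<lambda>x. norm (F0 x)) \<le> 1"
      by (simp add: modular_Hlog_def Hlog_eq_log_phase)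
  then have "modular_Hlog \<Omega> p q \<mu> (\<lambda>x. norm (F0 x)) < \<infinity>" using ennreal_one_less_top order_le_less_trans
      by fastforce
  then show fin: "fin_modular F0" by (rule fin_modularI[OF F0])
  show "\<rho> F0 \<le> 1" using le modular_eq_\<rho>[OF fin] by (simp add: ennreal_le_1)
qed

lemma \<rho>_rep_diff_scaled:
  assumes u: "u \<in> W1" and v: "v \<in> W1"
  shows "\<rho> (\<lambda>x. c *\<^sub>R (rep_L0 u x - rep_L0 v x)) = \<rho> (\<lambda>x. c *\<^sub>R rep_L0 (u - v) x)"
    "\<rho> (\<lambda>x. c *\<^sub>R (D u x - D v x)) = \<rho> (\<lambda>x. c *\<^sub>R D (u - v) x)"
proof -
  have "AE x in M. norm (c *\<^sub>R (rep_L0 u x - rep_L0 v x)) = norm (c *\<^sub>R rep_L0 (u - v) x)"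
    using AE_lebesgue_onI[OF W1_diff(3)[OF u v] \<Omega>_sets] by eventually_elim simp
  then show "\<rho> (\<lambda>x. c *\<^sub>R (rep_L0 u x - rep_L0 v x)) = \<rho> (\<lambda>x. c *\<^sub>R rep_L0 (u - v) x)"
    by (rule \<rho>_cong_AE) (intro borel_measurable_scaleR borel_measurable_diff borel_measurable_const
        rep_measurable_M)+
  have "AE x in M. norm (c *\<^sub>R (D u x - D v x)) = norm (c *\<^sub>R D (u - v) x)"
    using W1_diff(2)[OF u v] by eventually_elim simp
  then show "\<rho> (\<lambda>x. c *\<^sub>R (D u x - D v x)) = \<rho> (\<lambda>x. c *\<^sub>R D (u - v) x)"
    by (rule \<rho>_cong_AE) (intro borel_measurable_scaleR borel_measurable_diff borel_measurable_const
        D_measurable u v W1_diff(1))+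
qed

text \<open>Fatou's lemma along the almost everywhere convergent subsequence transfers the Cauchy
  estimate to the limit.\<close>

lemma modular_limit_of_Cauchy:
  fixes s :: "nat \<Rightarrow> 'a \<Rightarrow> 'b::euclidean_space"
  assumes s: "\<And>i. fin_modular (s i)"
    and cauchy: "\<And>i j. I \<le> i \<Longrightarrow> I \<le> j \<Longrightarrow> \<rho> (\<lambda>x. (1 / l) *\<^sub>R (s i x - s j x)) \<le> 1"
    and l: "0 < l" and r: "\<And>k. k \<le> r k"
    and lim: "AE x in M. (\<lambda>k. s (r k) x) \<longlonglongrightarrow> u x" and u: "u \<in> borel_measurable M" and i: "I \<le> i"
  shows "fin_modular (\<lambda>x. s i x - u x)" "\<rho> (\<lambda>x. (1 / l) *\<^sub>R (s i x - u x)) \<le> 1"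
    "(LINT x|M. norm (s i x - u x)) \<le> l * (measure M (space M) + 1)"
proof -
  have m[measurable]: "s i \<in> borel_measurable M" for i by (rule fin_modular_measurable[OF s])
  note u[measurable]
  define F where "F j x = (1 / l) *\<^sub>R (s i x - s (r (j + I)) x)" for j x
  have F: "fin_modular (F j)" for j unfolding F_def by (intro modular_scale(1) modular_diff s)
  have F1: "\<rho> (F j) \<le> 1" for j unfolding F_def using i r[of "j + I"] by (intro cauchy) auto
  have "AE x in M. (\<lambda>j. F j x) \<longlonglongrightarrow> (1 / l) *\<^sub>R (s i x - u x)"
    using lim
  proof eventually_elim
    case (elim x)
    then show ?case unfolding F_def by (intro tendsto_scaleR tendsto_diff tendsto_const
        LIMSEQ_ignore_initial_segment)
  qed
  from modular_fatou[OF F F1 this]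
  have fin: "fin_modular (\<lambda>x. (1 / l) *\<^sub>R (s i x - u x))" and le: "\<rho> (\<lambda>x. (1 / l) *\<^sub>R (s i x - u x)) \<le>
      1" by measurable
  show "\<rho> (\<lambda>x. (1 / l) *\<^sub>R (s i x - u x)) \<le> 1" by (rule le)
  show fin': "fin_modular (\<lambda>x. s i x - u x)" using modular_scale(1)[OF fin, of l] l by simp
  have "(LINT x|M. norm (s i x - u x)) \<le> l * (measure M (space M) + \<rho> (\<lambda>x. (1 / l) *\<^sub>R (s i x - u x)))"
    by (rule L1_le_modular(2)[OF fin' l])
  also have "\<dots> \<le> l * (measure M (space M) + 1)" using le l by (intro mult_left_mono) auto
  finally show "(LINT x|M. norm (s i x - u x)) \<le> l * (measure M (space M) + 1)" .
qed

lemma fin_modular_L1: "fin_modular F \<Longrightarrow> integrable M (F :: 'a \<Rightarrow> 'b::euclidean_space)"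
  using L1_le_modular(1)[of F 1] fin_modular_measurable[of F] integrable_norm_iff[of F M] by simp

lemma norm_measurable: "F \<in> borel_measurable N \<Longrightarrow> (\<lambda>x. norm (F x :: 'b::euclidean_space)) \<in>
    borel_measurable N"
  by measurable

text \<open>A subsequence with geometrically decreasing increments converges almost everywhere, together
  with its gradients. By Fatou's lemma the whole sequence converges in the modular; this implies
  convergence in \<open>L\<^sup>1\<close>, hence the limit has a weak gradient.\<close>

lemma W10_complete:
  assumes s: "range s \<subseteq> W10" and cauchy: "\<And>e. 0 < e \<Longrightarrow> \<exists>I. \<forall>i\<ge>I. \<forall>j\<ge>I. sob_norm (s i - s j) < e"
  shows "\<exists>w\<in>W10. (\<lambda>i. sob_norm (s i - w)) \<longlonglongrightarrow> 0"
proof -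
  have s1: "s i \<in> W1" for i using s W10_subset by auto
  obtain m where m: "\<And>e i j. 0 < e \<Longrightarrow> m e \<le> i \<Longrightarrow> m e \<le> j \<Longrightarrow> sob_norm (s i - s j) < e" using cauchy by metis
  \<comment> \<open>Monotone in \<open>k\<close> and beyond each threshold \<open>m (1 / 2\<^sup>k)\<close>; the summand \<open>k\<close> makes it unbounded.\<close>
  define r where "r k = (\<Sum>i\<le>k. m ((1/2) ^ i)) + k" for k
  have r: "k \<le> r k" "m ((1/2) ^ k) \<le> r k" "r k \<le> r (Suc k)" for k
    by (auto simp: r_def intro: trans_le_add1 member_le_sum)
  have fast: "sob_norm (s (r (Suc k)) - s (r k)) < (1/2) ^ k" for k
    using r(2)[of k] r(3)[of k] by (intro m) auto
  define c where "c = measure M (space M) + 1"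
  have c: "0 \<le> c" by (simp add: c_def)
  note fr = W1_fin_rep[OF s1] and fD = W1_fin_grad[OF s1]
  have fr1: "(LINT x|M. norm (rep_L0 (s (r (Suc k))) x - rep_L0 (s (r k)) x)) \<le> c * (1/2) ^ k" for k
  proof -
    have "(LINT x|M. norm (rep_L0 (s (r (Suc k))) x - rep_L0 (s (r k)) x)) = (LINT x|M.
        norm (rep_L0 (s (r (Suc k)) - s (r k)) x))"
    proof (rule integral_cong_AE)
      show "AE x in M. norm (rep_L0 (s (r (Suc k))) x - rep_L0 (s (r k)) x) =
          norm (rep_L0 (s (r (Suc k)) - s (r k)) x)"
        using AE_lebesgue_onI[OF W1_diff(3)[OF s1 s1, of "r (Suc k)" "r k"] \<Omega>_sets]
            by eventually_elim simp
    qed (intro norm_measurable borel_measurable_diff rep_measurable_M)+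
    then show ?thesis using L1_le_sob_norm(1)[OF W1_diff(1)[OF s1 s1] fast, of k]
        by (simp add: c_def mult.commute)
  qed
  have fD1: "(LINT x|M. norm (D (s (r (Suc k))) x - D (s (r k)) x)) \<le> c * (1/2) ^ k" for k
  proof -
    have "(LINT x|M. norm (D (s (r (Suc k))) x - D (s (r k)) x)) = (LINT x|M.
        norm (D (s (r (Suc k)) - s (r k)) x))"
    proof (rule integral_cong_AE)
      show "AE x in M. norm (D (s (r (Suc k))) x - D (s (r k)) x) =
          norm (D (s (r (Suc k)) - s (r k)) x)"
        using W1_diff(2)[OF s1 s1, of "r (Suc k)" "r k"] by eventually_elim simp
    qed (intro norm_measurable borel_measurable_diff D_measurable s1 W1_diff(1))+
    then show ?thesis using L1_le_sob_norm(2)[OF W1_diff(1)[OF s1 s1] fast, of k]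
        by (simp add: c_def mult.commute)
  qed
  obtain u where u: "u \<in> borel_measurable M" "AE x in M. (\<lambda>k. rep_L0 (s (r k)) x) \<longlonglongrightarrow> u x"
    using fast_L1_Cauchy_converges_AE[OF fin_modular_L1[OF fr] c fr1] by blast
  obtain G where G: "G \<in> borel_measurable M" "AE x in M. (\<lambda>k. D (s (r k)) x) \<longlonglongrightarrow> G x"
    using fast_L1_Cauchy_converges_AE[OF fin_modular_L1[OF fD] c fD1] by blast
  \<comment> \<open>The limit is measurable on \<open>\<Omega>\<close> only; its extension by zero is measurable on the whole space.\<close>
  define u0 where "u0 x = (if x \<in> \<Omega> then u x else 0)" for x
  have u0l: "u0 \<in> borel_measurable lebesgue"
    unfolding u0_def[abs_def] using u(1) \<Omega>_sets by (simp add: borel_measurable_if)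
  have u0m: "u0 \<in> borel_measurable M" by (rule measurable_lebesgue_onI[OF u0l])
  have u0: "AE x in M. (\<lambda>k. rep_L0 (s (r k)) x) \<longlonglongrightarrow> u0 x"
    using u(2) AE_regular by eventually_elim (simp add: u0_def regular_def)
  have close: "\<rho> (\<lambda>x. (1 / l) *\<^sub>R (rep_L0 (s i) x - rep_L0 (s j) x)) \<le> 1" "\<rho> (\<lambda>x.
      (1 / l) *\<^sub>R (D (s i) x - D (s j) x)) \<le> 1"
    if "0 < l" "m l \<le> i" "m l \<le> j" for l i j
    unfolding \<rho>_rep_diff_scaled[OF s1 s1]
    by (rule sob_modular_scaled_le_1[OF W1_diff(1)[OF s1 s1] m[OF that]])+
  have U: "fin_modular (\<lambda>x. rep_L0 (s i) x - u0 x)" "\<rho> (\<lambda>x. (1 / l) *\<^sub>R (rep_L0 (s i) x - u0 x)) \<le> 1"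
    "(LINT x|M. norm (rep_L0 (s i) x - u0 x)) \<le> l * c" if "0 < l" "m l \<le> i" for l i
    unfolding c_def
    by (rule modular_limit_of_Cauchy[OF fr close(1) that(1) r(1) u0 u0m that(2)], rule that(1),
        assumption+)+
  have V: "fin_modular (\<lambda>x. D (s i) x - G x)" "\<rho> (\<lambda>x. (1 / l) *\<^sub>R (D (s i) x - G x)) \<le> 1"
    "(LINT x|M. norm (D (s i) x - G x)) \<le> l * c" if "0 < l" "m l \<le> i" for l i
    unfolding c_def
    by (rule modular_limit_of_Cauchy[OF fD close(2) that(1) r(1) G(2) G(1) that(2)], rule that(1),
        assumption+)+
  have fu0: "fin_modular u0" using modular_diff[OF fr U(1)[of 1 "m 1"], of "m 1"] by simp
  have fG: "fin_modular G" using modular_diff[OF fD V(1)[of 1 "m 1"], of "m 1"] by simp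
  have small: "v \<longlonglongrightarrow> 0" if v: "\<And>l i. 0 < l \<Longrightarrow> m l \<le> i \<Longrightarrow> v i \<le> l * c" "\<And>i. 0 \<le> v i" for v :: "nat \<Rightarrow> real"
  proof (rule LIMSEQ_I)
    fix e :: real assume e: "0 < e"
    have l: "0 < e / (c + 1)" using e c by simp
    have "norm (v i - 0) < e" if "m (e / (c + 1)) \<le> i" for i
    proof -
      have "v i \<le> e / (c + 1) * c" by (rule v(1)[OF l that])
      also have "\<dots> < e" using e c by (simp add: field_simps)
      finally show ?thesis using v(2)[of i] by simp
    qed
    then show "\<exists>no. \<forall>n\<ge>no. norm (v n - 0) < e" by blast
  qed
  have wg: "has_weak_gradient \<Omega> u0 G"
    by (rule has_weak_gradient_limit[OF \<Omega>_sets W1_has_weak_gradient[OF s1] fin_modular_L1[OF fr]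
        fin_modular_L1[OF fu0]
          fin_modular_L1[OF fD] fin_modular_L1[OF fG] small[OF U(3)] small[OF V(3)]]) (auto intro:
              integral_nonneg_AE)
  define w where "w = abs_L0 u0"
  have wr: "AE x in lebesgue. rep_L0 w x = u0 x" unfolding w_def by (rule rep_abs_L0[OF u0l])
  have out: "AE x in lebesgue. x \<notin> \<Omega> \<longrightarrow> rep_L0 w x = 0" using wr by eventually_elim (simp add: u0_def)
  have finw: "fin_modular (rep_L0 w)"
    by (rule fin_modular_cong_AE[OF _ rep_measurable_M fu0]) (use AE_lebesgue_onI[OF wr \<Omega>_sets] in \<open>auto
        elim: eventually_mono\<close>)
  have gw: "has_weak_gradient \<Omega> (rep_L0 w) G"
      by (rule has_weak_gradient_cong[OF wg rep_L0_measurable u0l wr \<Omega>_sets])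
  have w1: "w \<in> W1" and Dw: "AE x in M. D w x = G x" using W1I[OF out finw gw fG] by auto
  have near: "sob_norm (s i - w) \<le> 2 * l" if l: "0 < l" and i: "m l \<le> i" for l i
  proof -
    have d: "s i - w \<in> W1" by (rule W1_diff(1)[OF s1 w1])
    have "\<rho> (\<lambda>x. (1 / l) *\<^sub>R (rep_L0 (s i) x - rep_L0 w x)) = \<rho> (\<lambda>x.
        (1 / l) *\<^sub>R (rep_L0 (s i) x - u0 x))"
    proof (rule \<rho>_cong_AE)
      show "AE x in M. norm ((1 / l) *\<^sub>R (rep_L0 (s i) x - rep_L0 w x)) =
          norm ((1 / l) *\<^sub>R (rep_L0 (s i) x - u0 x))"
        using AE_lebesgue_onI[OF wr \<Omega>_sets] by eventually_elim simp
    qed (intro borel_measurable_scaleR borel_measurable_diff borel_measurable_const rep_measurable_M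
        u0m)+
    moreover have "\<rho> (\<lambda>x. (1 / l) *\<^sub>R (D (s i) x - D w x)) = \<rho> (\<lambda>x. (1 / l) *\<^sub>R (D (s i) x - G x))"
    proof (rule \<rho>_cong_AE)
      show "AE x in M. norm ((1 / l) *\<^sub>R (D (s i) x - D w x)) = norm ((1 / l) *\<^sub>R (D (s i) x - G x))"
        using Dw by eventually_elim simp
    qed (intro borel_measurable_scaleR borel_measurable_diff borel_measurable_const D_measurable s1 w1
        G(1))+
    ultimately have "sob_modular ((1 / l) *\<^sub>R (s i - w)) \<le> 2"
      using U(2)[OF l i] V(2)[OF l i] unfolding sob_modular_def \<rho>_D_scale[OF d] \<rho>_rep_scale[OF d]
          \<rho>_rep_diff_scaled[OF s1 w1, symmetric]
      by linarith
    then have "sob_modular ((1/2) *\<^sub>R ((1 / l) *\<^sub>R (s i - w))) \<le> 1"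
      using W1.R_contract[OF W1.scaleX[OF d, of "1/l"], of "1/2"] by simp
    then show ?thesis using l by (intro W1.N_le[OF d]) simp_all
  qed
  have "w \<in> W10"
  proof -
    have "\<exists>\<phi>\<in>test_functions \<Omega>. sob_norm (w - abs_L0 \<phi>) < e" if e: "0 < e" for e
    proof -
      have e4: "0 < e / 4" using e by simp
      define i where "i = m (e / 4)"
      have a: "sob_norm (s i - w) \<le> 2 * (e / 4)" by (rule near[OF e4]) (simp add: i_def)
      obtain \<phi> where \<phi>: "\<phi> \<in> test_functions \<Omega>" "sob_norm (s i - abs_L0 \<phi>) < e / 2"
        using W10_approx[of "s i" "e / 2"] s e by auto
      have "sob_norm (w - abs_L0 \<phi>) \<le> sob_norm (w - s i) + sob_norm (s i - abs_L0 \<phi>)"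
        by (rule W1.N_triangle_diff[OF w1 s1 test_in_W1(1)[OF \<phi>(1)]])
      also have "\<dots> < e" using a \<phi>(2) W1.N_minus_commute[OF w1 s1, of i] by simp
      finally show ?thesis using \<phi>(1) by blast
    qed
    then show ?thesis using w1 by (simp add: W10_Hlog_def)
  qed
  moreover have "(\<lambda>i. sob_norm (s i - w)) \<longlonglongrightarrow> 0"
  proof (rule LIMSEQ_I)
    fix e :: real assume e: "0 < e"
    have e4: "0 < e / 4" using e by simp
    have "norm (sob_norm (s i - w) - 0) < e" if "m (e / 4) \<le> i" for i
      using near[OF e4 that] W1.N_nonneg[OF W1_diff(1)[OF s1 w1], of i] e by simp
    then show "\<exists>no. \<forall>n\<ge>no. norm (sob_norm (s n - w) - 0) < e" by blast
  qed
  ultimately show ?thesis by blast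
qed

lemma nn_integral_M_eq_lborel:
  assumes "F \<in> borel_measurable borel" "\<And>x. x \<notin> \<Omega> \<Longrightarrow> F x = (0::real)" "\<And>x. 0 \<le> F x"
  shows "(\<integral>\<^sup>+x. ennreal (F x) \<partial>M) = (\<integral>\<^sup>+x. ennreal (F x) \<partial>lborel)"
  using assms by (intro nn_integral_lebesgue_on_eq_lborel \<Omega>_sets) simp

text \<open>If \<open>\<nabla>u = 0\<close>, then approximating test functions have gradients that are small in \<open>L\<^sup>1\<close>, so
  the Poincare inequality in \<open>L\<^sup>1\<close> makes them, and therefore \<open>u\<close>, small in \<open>L\<^sup>1\<close>.\<close>

lemma W10_zero_of_grad_zero:
  assumes u: "u \<in> W10" and 0: "\<rho> (D u) = 0"
  shows "u = 0"
proof -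
  have u1: "u \<in> W1" by (rule W10_subset[OF u])
  obtain T where T: "0 < T" "\<And>\<phi>. \<phi> \<in> test_functions \<Omega> \<Longrightarrow>
    (\<integral>\<^sup>+x. ennreal \<bar>\<phi> x\<bar> \<partial>lborel) \<le> ennreal T * (\<integral>\<^sup>+x. ennreal (norm (grad \<phi> x)) \<partial>lborel)"
    using poincare_L1[OF \<Omega>_bounded] by blast
  have Du0: "AE x in M. D u x = 0" by (rule modular_zero_imp[OF W1_fin_grad[OF u1] 0])
  define c where "c = measure M (space M) + 1"
  have c: "0 \<le> c" by (simp add: c_def)
  have ie: "integrable M (\<lambda>x. norm (rep_L0 u x))"
      by (rule L1_le_modular(1)[OF W1_fin_rep[OF u1], of 1]) simp
  have bound: "(LINT x|M. norm (rep_L0 u x)) \<le> (1 + T) * (e * c)" if e: "0 < e" for e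
  proof -
    obtain \<phi> where \<phi>: "\<phi> \<in> test_functions \<Omega>" "sob_norm (u - abs_L0 \<phi>) < e" using W10_approx[OF u e]
        by blast
    note p1 = test_in_W1[OF \<phi>(1)]
    define v where "v = u - abs_L0 \<phi>"
    have v: "v \<in> W1" unfolding v_def by (rule W1_diff(1)[OF u1 p1(1)])
    note L1 = L1_le_sob_norm[OF v \<phi>(2)[folded v_def], folded c_def]
    have iv: "integrable M (\<lambda>x. norm (rep_L0 v x))" "integrable M (\<lambda>x. norm (D v x))"
      using L1_le_modular(1)[OF W1_fin_rep[OF v], of 1] L1_le_modular(1)[OF W1_fin_grad[OF v], of 1]
          by auto
    have "(\<integral>\<^sup>+x. ennreal (norm (grad \<phi> x)) \<partial>M) = (\<integral>\<^sup>+x. ennreal (norm (D v x)) \<partial>M)"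
    proof (rule nn_integral_cong_AE)
      show "AE x in M. ennreal (norm (grad \<phi> x)) = ennreal (norm (D v x))"
        using W1_diff(2)[OF u1 p1(1)] p1(2) Du0 unfolding v_def by eventually_elim simp
    qed
    also have "\<dots> = ennreal (LINT x|M. norm (D v x))" by (rule nn_integral_eq_integral[OF iv(2)]) simp
    also have "\<dots> \<le> ennreal (e * c)" by (rule ennreal_leI[OF L1(2)])
    finally have g: "(\<integral>\<^sup>+x. ennreal (norm (grad \<phi> x)) \<partial>M) \<le> ennreal (e * c)" .
    have "(\<integral>\<^sup>+x. ennreal \<bar>\<phi> x\<bar> \<partial>M) = (\<integral>\<^sup>+x. ennreal \<bar>\<phi> x\<bar> \<partial>lborel)"
      using test_zero_outside[OF \<phi>(1)] borel_measurable_of_continuous_UNIV[OF test_continuous[OF \<phi>(1)]]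
      by (intro nn_integral_M_eq_lborel) auto
    also have "\<dots> \<le> ennreal T * (\<integral>\<^sup>+x. ennreal (norm (grad \<phi> x)) \<partial>lborel)" by (rule T(2)[OF \<phi>(1)])
    also have "(\<integral>\<^sup>+x. ennreal (norm (grad \<phi> x)) \<partial>lborel) = (\<integral>\<^sup>+x. ennreal (norm (grad \<phi> x)) \<partial>M)"
      using test_zero_outside[OF \<phi>(1)] grad_norm_measurable[OF test_C_k[OF \<phi>(1)]]
      by (intro nn_integral_M_eq_lborel[symmetric]) auto
    also have "ennreal T * \<dots> \<le> ennreal T * ennreal (e * c)" using g by (rule mult_left_mono) simp
    also have "\<dots> = ennreal (T * (e * c))" using T e c by (simp add: ennreal_mult)
    finally have f: "(\<integral>\<^sup>+x. ennreal \<bar>\<phi> x\<bar> \<partial>M) \<le> ennreal (T * (e * c))" .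
    have "ennreal (LINT x|M. norm (rep_L0 u x)) = (\<integral>\<^sup>+x. ennreal (norm (rep_L0 u x)) \<partial>M)"
      by (rule nn_integral_eq_integral[OF ie, symmetric]) simp
    also have "\<dots> \<le> (\<integral>\<^sup>+x. (ennreal (norm (rep_L0 v x)) + ennreal \<bar>\<phi> x\<bar>) \<partial>M)"
    proof (rule nn_integral_mono_AE)
      show "AE x in M. ennreal (norm (rep_L0 u x)) \<le> ennreal (norm (rep_L0 v x)) + ennreal \<bar>\<phi> x\<bar>"
        using AE_lebesgue_onI[OF W1_diff(3)[OF u1 p1(1)] \<Omega>_sets] AE_lebesgue_onI[OF p1(3) \<Omega>_sets]
            unfolding v_def
      proof eventually_elim
        case (elim x)
        then have "norm (rep_L0 u x) \<le> norm (rep_L0 (u - abs_L0 \<phi>) x) + \<bar>\<phi> x\<bar>" by simp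
        then show ?case by (simp add: ennreal_leI flip: ennreal_plus)
      qed
    qed
    also have "\<dots> = (\<integral>\<^sup>+x. ennreal (norm (rep_L0 v x)) \<partial>M) + (\<integral>\<^sup>+x. ennreal \<bar>\<phi> x\<bar> \<partial>M)"
    proof -
      note [measurable] = rep_measurable_M[of v] lebesgue_on_borel_measurable[OF
          borel_measurable_of_continuous_UNIV[OF test_continuous[OF \<phi>(1)]], of \<Omega>]
      show ?thesis by (rule nn_integral_add) measurable
    qed
    also have "(\<integral>\<^sup>+x. ennreal (norm (rep_L0 v x)) \<partial>M) = ennreal (LINT x|M. norm (rep_L0 v x))"
        by (rule nn_integral_eq_integral[OF iv(1)]) simp
    also have "\<dots> + (\<integral>\<^sup>+x. ennreal \<bar>\<phi> x\<bar> \<partial>M) \<le> ennreal (e * c) + ennreal (T * (e * c))"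
      by (intro add_mono f ennreal_leI L1(1))
    also have "\<dots> = ennreal ((1 + T) * (e * c))" using T e c
        by (simp add: ennreal_plus[symmetric] distrib_right del: ennreal_plus)
    finally show ?thesis using T e c by (subst (asm) ennreal_le_iff) auto
  qed
  have "(LINT x|M. norm (rep_L0 u x)) \<le> 0"
  proof (rule field_le_epsilon)
    fix e :: real assume e: "0 < e"
    have pos: "0 < (1 + T) * (c + 1)" using T c by (intro mult_pos_pos) auto
    have "(LINT x|M. norm (rep_L0 u x)) \<le> (1 + T) * (e / ((1 + T) * (c + 1)) * c)" using e pos
        by (intro bound divide_pos_pos)
    also have "\<dots> \<le> (1 + T) * (e / ((1 + T) * (c + 1)) * (c + 1))" using e pos T c
        by (intro mult_left_mono) auto
    also have "\<dots> = e" using pos T c by (simp add: field_simps)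
    finally show "(LINT x|M. norm (rep_L0 u x)) \<le> 0 + e" by simp
  qed
  moreover have "0 \<le> (LINT x|M. norm (rep_L0 u x))" by (rule integral_nonneg_AE) simp
  ultimately have "(LINT x|M. norm (rep_L0 u x)) = 0" by (rule order_antisym)
  then have "AE x in M. norm (rep_L0 u x) = 0" using integral_nonneg_eq_0_iff_AE[OF ie] by simp
  then have "AE x in lebesgue. x \<in> \<Omega> \<longrightarrow> norm (rep_L0 u x) = 0" using \<Omega>_sets
      by (subst (asm) AE_restrict_space_iff) auto
  then have "AE x in lebesgue. rep_L0 u x = rep_L0 0 x"
    using W1_zero_outside[OF u1] rep_L0_zero by eventually_elim auto
  then show ?thesis by (rule L0_eqI)
qed

end

section \<open>A Poincare inequality for the modular\<close>

text \<open>A strict inequality between exponents survives a small decrease of \<open>p\<close> and a small increase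
  of \<open>q\<close>.\<close>

lemma subcritical_exponent_gap:
  assumes n: "0 < n" and p0: "1 < p0" and q0: "p0 \<le> q0" and sub: "n / p0 - n / q0 < (1::real)"
  shows "\<exists>\<eta>>0. 1 < p0 - \<eta> \<and> n * (1 / (p0 - \<eta>) - 1 / (q0 + 2 * \<eta>)) < 1"
proof -
  have "((\<lambda>\<eta>. n * (1 / (p0 - \<eta>) - 1 / (q0 + 2 * \<eta>))) \<longlongrightarrow> n * (1 / (p0 - 0) - 1 / (q0 + 2 * 0))) (at_right
      0)"
    using p0 q0 by (intro tendsto_intros) auto
  then have "\<forall>\<^sub>F \<eta> in at_right 0. n * (1 / (p0 - \<eta>) - 1 / (q0 + 2 * \<eta>)) < 1"
    using sub by (intro order_tendstoD(2)) (simp_all add: right_diff_distrib)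
  moreover have "\<forall>\<^sub>F \<eta> in at_right 0. \<eta> < p0 - 1"
    using p0 by (intro eventually_at_right_less[THEN eventually_mono] order_tendstoD(2)[OF
        tendsto_ident_at]) auto
  moreover have "\<forall>\<^sub>F \<eta> in at_right 0. (0::real) < \<eta>" by (rule eventually_at_right_less)
  ultimately have "\<forall>\<^sub>F \<eta> in at_right 0. 0 < \<eta> \<and> 1 < p0 - \<eta> \<and> n * (1 / (p0 - \<eta>) - 1 / (q0 + 2 * \<eta>)) < 1"
    by eventually_elim auto
  then show ?thesis using eventually_happens'[of "at_right (0::real)"] by auto
qed

text \<open>Any margin \<open>e\<close> above the exponent \<open>q\<close> absorbs the logarithm.\<close>

lemma log_phase_le_power:
  assumes p: "0 < p" "p \<le> q" and e: "0 < e" "q + e \<le> r" and m: "0 \<le> m" "m \<le> C" and t: "0 \<le> t"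
  shows "log_phase p q m t \<le> (1 + C * (2 + 4 powr e / e)) * (1 + t powr r)"
proof -
  define B where "B = 2 + 4 powr e / e"
  have B: "0 \<le> B" using e by (simp add: B_def)
  have r: "0 < r" using p e by simp
  have 1: "t powr p \<le> 1 + t powr r"
  proof (cases "t \<le> 1")
    case True
    then have "t powr p \<le> 1" using p t by (intro powr_le1) auto
    then show ?thesis by (simp add: add_increasing2)
  next
    case False
    then have "t powr p \<le> t powr r" using p e by (intro powr_mono) auto
    then show ?thesis by simp
  qed
  have 2: "t powr q * ln (exp 1 + t) \<le> B * (1 + t powr r)"
  proof (cases "t \<le> 1")
    case True
    have "exp 1 + t \<le> exp (1::real) * exp 1" 
    proof -
      have e2: "2 \<le> exp (1::real)" using exp_ge_add_one_self[of "1::real"] by simp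
      then have "2 * exp 1 \<le> exp (1::real) * exp 1" by (rule mult_right_mono) simp
      then show ?thesis using True e2 by linarith
    qed
    then have "ln (exp 1 + t) \<le> ln (exp (1::real) * exp 1)" using exp1_plus_pos[OF t]
        by (intro ln_mono) auto
    then have "ln (exp 1 + t) \<le> 2" by (simp add: ln_mult)
    then have "t powr q * ln (exp 1 + t) \<le> 1 * 2"
      using True p t ln_exp1_plus_ge_1[OF t] by (intro mult_mono powr_le1) auto
    also have "\<dots> \<le> B * (1 + t powr r)" using e by (simp add: B_def algebra_simps add_increasing2)
    finally show ?thesis .
  next
    case False
    then have t1: "1 < t" by simp
    have "exp 1 + t \<le> 4 * t" using exp_le t1 by simp
    then have "ln (exp 1 + t) \<le> ln (4 * t)" using exp1_plus_pos[OF t] by (intro ln_mono) auto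
    also have "\<dots> \<le> (4 * t) powr e / e" using t1 e by (intro ln_powr_bound) auto
    finally have "t powr q * ln (exp 1 + t) \<le> t powr q * ((4 * t) powr e / e)"
        by (intro mult_left_mono) auto
    also have "\<dots> = 4 powr e / e * t powr (q + e)" using t1 by (simp add: powr_mult powr_add)
    also have "\<dots> \<le> 4 powr e / e * t powr r" using t1 e by (intro mult_left_mono powr_mono) auto
    also have "\<dots> \<le> B * (1 + t powr r)" using e by (intro mult_mono) (auto simp: B_def)
    finally show ?thesis .
  qed
  have "m * (t powr q * ln (exp 1 + t)) \<le> C * (B * (1 + t powr r))"
    using m t ln_exp1_plus_ge_1[OF t] by (intro mult_mono[OF m(2) 2]) auto
  then show ?thesis using 1 unfolding log_phase_def B_def by (simp add: distrib_right mult.assoc)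
qed

context log_double_phase
begin

text \<open>For \<open>p(z) < n\<close> the condition \<open>q(z) < p\<^sup>*(z)\<close> says that \<open>n / p(z) - n / q(z) < 1\<close>, and for
  \<open>p(z) \<ge> n\<close> that inequality always holds. By continuity it persists for constant exponents \<open>s <
  p\<close> and \<open>r > q\<close> near \<open>z\<close>.\<close>

lemma local_exponents:
  assumes z: "z \<in> closure \<Omega>" and sub: "ereal (q z) < critical_exponent p z"
  shows "\<exists>\<delta> s r e. 0 < \<delta> \<and> 1 < s \<and> s < r \<and> real DIM('a) * (1/s - 1/r) < 1 \<and> 0 < e \<and>
    (\<forall>x\<in>closure \<Omega> \<inter> cball z (2 * \<delta>). s \<le> p x \<and> q x + e \<le> r)"
proof -
  have p0: "1 < p z" using p_min_le[OF z] p_min_gt_1 by simp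
  have q0: "p z \<le> q z" by (rule p_le_q[OF z])
  define n where "n = real DIM('a)"
  have n: "0 < n" by (simp add: n_def)
  have gap: "n / p z - n / q z < 1"
  proof (cases "p z < n")
    case True
    then have "q z < n * p z / (n - p z)" using sub by (simp add: critical_exponent_def n_def)
    then have "q z * (n - p z) < n * p z" using True by (simp add: less_divide_eq)
    then have "n * (q z - p z) < p z * q z" by (simp add: algebra_simps)
    then have "n * (q z - p z) / (p z * q z) < 1" using p0 q0 by simp
    moreover have "n / p z - n / q z = n * (q z - p z) / (p z * q z)" using p0 q0
        by (simp add: field_simps)
    ultimately show ?thesis by simp
  next
    case False
    then have "n / p z \<le> 1" using p0 by simp
    moreover have "0 < n / q z" using n p0 q0 by simp
    ultimately show ?thesis by linarith
  qed
  obtain \<eta> where \<eta>: "0 < \<eta>" "1 < p z - \<eta>" "n * (1 / (p z - \<eta>) - 1 / (q z + 2 * \<eta>)) < 1"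
    using subcritical_exponent_gap[OF n p0 q0 gap] by blast
  have "continuous_on (closure \<Omega>) p" "continuous_on (closure \<Omega>) q" using p_C_plus q_C_plus
      by (auto simp: C_plus_def)
  then obtain d1 d2 where d: "0 < d1" "\<And>x. x \<in> closure \<Omega> \<Longrightarrow> dist x z < d1 \<Longrightarrow> dist (p x) (p z) < \<eta>"
     "0 < d2" "\<And>x. x \<in> closure \<Omega> \<Longrightarrow> dist x z < d2 \<Longrightarrow> dist (q x) (q z) < \<eta>"
    using z \<eta>(1) unfolding continuous_on_iff by metis
  define \<delta> where "\<delta> = min d1 d2 / 3"
  have \<delta>: "0 < \<delta>" using d by (simp add: \<delta>_def)
  have "p z - \<eta> \<le> p x \<and> q x + \<eta> \<le> q z + 2 * \<eta>" if "x \<in> closure \<Omega> \<inter> cball z (2 * \<delta>)" for x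
  proof -
    have "dist x z \<le> 2 * \<delta>" using that by (simp add: dist_commute)
    moreover have "2 * \<delta> < d1" "2 * \<delta> < d2" using d unfolding \<delta>_def by linarith+
    ultimately have "dist x z < d1" "dist x z < d2" by linarith+
    then have "\<bar>p x - p z\<bar> < \<eta>" "\<bar>q x - q z\<bar> < \<eta>" using d(2,4) that by (auto simp: dist_real_def)
    then show ?thesis by linarith
  qed
  then show ?thesis using \<delta> \<eta> q0 unfolding n_def
    by (intro exI[of _ \<delta>] exI[of _ "p z - \<eta>"] exI[of _ "q z + 2 * \<eta>"] exI[of _ \<eta>]) auto
qed

lemma test_gradient_modular:
  assumes \<phi>: "\<phi> \<in> test_functions \<Omega>"
  shows "fin_modular (grad \<phi>)" "\<rho> (grad \<phi>) = \<rho> (D (abs_L0 \<phi>))" "fin_modular \<phi>" "\<rho> \<phi> =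
      \<rho> (rep_L0 (abs_L0 \<phi>))"
proof -
  note t = test_in_W1[OF \<phi>]
  have gm: "grad \<phi> \<in> borel_measurable M"
    by (intro lebesgue_on_borel_measurable borel_measurable_of_continuous_UNIV test_grad_continuous[OF
        \<phi>])
  have \<phi>m: "\<phi> \<in> borel_measurable M"
    by (intro lebesgue_on_borel_measurable borel_measurable_of_continuous_UNIV test_continuous[OF \<phi>])
  have e1: "AE x in M. norm (grad \<phi> x) = norm (D (abs_L0 \<phi>) x)" using t(2) by eventually_elim simp
  have e2: "AE x in M. norm (\<phi> x) = norm (rep_L0 (abs_L0 \<phi>) x)"
    using AE_lebesgue_onI[OF t(3) \<Omega>_sets] by eventually_elim simp
  show "fin_modular (grad \<phi>)" by (rule fin_modular_cong_AE[OF e1 gm W1_fin_grad[OF t(1)]])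
  show "\<rho> (grad \<phi>) = \<rho> (D (abs_L0 \<phi>))" by (rule \<rho>_cong_AE[OF e1 gm D_measurable[OF t(1)]])
  show "fin_modular \<phi>" by (rule fin_modular_cong_AE[OF e2 \<phi>m W1_fin_rep[OF t(1)]])
  show "\<rho> \<phi> = \<rho> (rep_L0 (abs_L0 \<phi>))" by (rule \<rho>_cong_AE[OF e2 \<phi>m rep_measurable_M])
qed

text \<open>On the ball, \<open>|\<nabla>\<phi>|\<^sup>s \<le> 1 + H(|\<nabla>\<phi>|)\<close> and \<open>H(|\<phi>|)\<close> is at most a multiple of \<open>1 + |\<phi>|\<^sup>r\<close>, so
  \<open>local_sobolev\<close> applies. The bound on \<open>\<phi>\<close> in \<open>L\<^sup>1\<close> that it needs is the Poincare inequality in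
  \<open>L\<^sup>1\<close>.\<close>

lemma local_modular_bound:
  assumes z: "z \<in> closure \<Omega>" and sub: "ereal (q z) < critical_exponent p z"
    and C: "AE x in M. \<mu> x \<le> C" "0 \<le> C" and B: "0 \<le> B"
  shows "\<exists>\<delta>>0. \<exists>K\<ge>0. \<forall>\<phi>\<in>test_functions \<Omega>. \<rho> (grad \<phi>) \<le> B \<longrightarrow>
    (\<integral>\<^sup>+x. ennreal (h x (norm (\<phi> x))) * indicator (ball z \<delta>) x \<partial>M) \<le> ennreal K"
proof -
  obtain \<delta> s r e where \<delta>: "0 < \<delta>" and s: "1 < s" and r: "s < r"
      and gap: "real DIM('a) * (1/s - 1/r) < 1" and e: "0 < e"
    and loc: "\<And>x. x \<in> closure \<Omega> \<Longrightarrow> x \<in> cball z (2 * \<delta>) \<Longrightarrow> s \<le> p x \<and> q x + e \<le> r"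
    using local_exponents[OF z sub] by blast
  obtain T where T: "0 < T" "\<And>\<phi>. \<phi> \<in> test_functions \<Omega> \<Longrightarrow>
    (\<integral>\<^sup>+x. ennreal \<bar>\<phi> x\<bar> \<partial>lborel) \<le> ennreal T * (\<integral>\<^sup>+x. ennreal (norm (grad \<phi> x)) \<partial>lborel)"
    using poincare_L1[OF \<Omega>_bounded] by blast
  define S where "S = measure M (space M) + B"
  have S: "0 \<le> S" using B by (simp add: S_def)
  obtain K0 where K0: "0 \<le> K0" "\<And>\<phi> x0. C_k (Suc 0) \<phi> \<Longrightarrow> (\<integral>\<^sup>+x. ennreal \<bar>\<phi> x\<bar> \<partial>lborel) \<le> ennreal (T * S) \<Longrightarrow>
     (\<integral>\<^sup>+x. ennreal (norm (grad \<phi> (x::'a)) powr s) * indicator (cball x0 (2 * \<delta>)) x \<partial>lborel) \<le>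
         ennreal S \<Longrightarrow>
     (\<integral>\<^sup>+x. ennreal (\<bar>\<phi> x\<bar> powr r) * indicator (ball x0 \<delta>) x \<partial>lborel) \<le> ennreal K0"
    using local_sobolev[OF s r gap \<delta> S, of "T * S"] T S by auto
  define A where "A = 1 + C * (2 + 4 powr e / e)"
  have A: "0 \<le> A" using C e by (simp add: A_def)
  define K where "K = A * (measure M (space M) + K0)"
  have "(\<integral>\<^sup>+x. ennreal (h x (norm (\<phi> x))) * indicator (ball z \<delta>) x \<partial>M) \<le> ennreal K"
    if \<phi>: "\<phi> \<in> test_functions \<Omega>" and \<rho>B: "\<rho> (grad \<phi>) \<le> B" for \<phi>
  proof -
    note fg = test_gradient_modular(1)[OF \<phi>]
    note z0 = test_zero_outside[OF \<phi>]
    have gm[measurable]: "(\<lambda>x. norm (grad \<phi> x)) \<in> borel_measurable borel"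
        by (rule grad_norm_measurable[OF test_C_k[OF \<phi>]])
    have \<phi>m[measurable]: "\<phi> \<in> borel_measurable borel"
        by (rule borel_measurable_of_continuous_UNIV[OF test_continuous[OF \<phi>]])
    have i1: "integrable M (\<lambda>x. 1 + h x (norm (grad \<phi> x)))"
      by (intro Bochner_Integration.integrable_add integrable_const fin_modular_integrable[OF fg])
    have S1: "(\<integral>\<^sup>+x. ennreal (1 + h x (norm (grad \<phi> x))) \<partial>M) \<le> ennreal S"
    proof -
      have "(\<integral>\<^sup>+x. ennreal (1 + h x (norm (grad \<phi> x))) \<partial>M) = ennreal (LINT x|M. 1 +
          h x (norm (grad \<phi> x)))"
        using AE_h_nonneg[of "grad \<phi>"] by (intro nn_integral_eq_integral i1) (auto elim:
            eventually_mono)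
      also have "(LINT x|M. 1 + h x (norm (grad \<phi> x))) = measure M (space M) + \<rho> (grad \<phi>)"
        using fin_modular_integrable[OF fg] by (simp add: \<rho>_def)
      finally show ?thesis using \<rho>B by (simp add: S_def ennreal_leI)
    qed
    have "(\<integral>\<^sup>+x. ennreal (norm (grad \<phi> x)) \<partial>lborel) = (\<integral>\<^sup>+x. ennreal (norm (grad \<phi> x)) \<partial>M)"
      using z0 by (intro nn_integral_M_eq_lborel[symmetric] gm) auto
    also have "\<dots> \<le> (\<integral>\<^sup>+x. ennreal (1 + h x (norm (grad \<phi> x))) \<partial>M)"
    proof (rule nn_integral_mono_AE)
      show "AE x in M. ennreal (norm (grad \<phi> x)) \<le> ennreal (1 + h x (norm (grad \<phi> x)))"
        using AE_regular
      proof eventually_elim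
        case (elim x)
        show ?case using regular_bounds[OF elim] by (intro ennreal_leI le_1_plus_log_phase) auto
      qed
    qed
    finally have "ennreal T * (\<integral>\<^sup>+x. ennreal (norm (grad \<phi> x)) \<partial>lborel) \<le> ennreal T * ennreal S"
      using S1 by (intro mult_left_mono) auto
    then have P: "(\<integral>\<^sup>+x. ennreal \<bar>\<phi> x\<bar> \<partial>lborel) \<le> ennreal (T * S)"
      using T(2)[OF \<phi>] T(1) S by (simp add: ennreal_mult)
    have "(\<integral>\<^sup>+x. ennreal (norm (grad \<phi> x) powr s) * indicator (cball z (2 * \<delta>)) x \<partial>lborel) =
        (\<integral>\<^sup>+x. ennreal (norm (grad \<phi> x) powr s) * indicator (cball z (2 * \<delta>)) x \<partial>M)"
      using z0 by (intro nn_integral_lebesgue_on_eq_lborel[symmetric] \<Omega>_sets) auto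
    also have "\<dots> \<le> (\<integral>\<^sup>+x. ennreal (1 + h x (norm (grad \<phi> x))) \<partial>M)"
    proof (rule nn_integral_mono_AE)
      show "AE x in M. ennreal (norm (grad \<phi> x) powr s) * indicator (cball z (2 * \<delta>)) x \<le> ennreal (1 +
          h x (norm (grad \<phi> x)))"
        using AE_regular
      proof eventually_elim
        case (elim x)
        show ?case
        proof (cases "x \<in> cball z (2 * \<delta>)")
          case True
          have "x \<in> closure \<Omega>" using elim closure_subset by (auto simp: regular_def)
          then have sp: "s \<le> p x" using loc True by blast
          define t where "t = norm (grad \<phi> x)"
          have "t powr s \<le> 1 + t powr p x"
          proof (cases "t \<le> 1")
            case True
            then have "t powr s \<le> 1" using s by (intro powr_le1) (auto simp: t_def)
            then show ?thesis by (simp add: add_increasing2)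
          next
            case False
            then have "t powr s \<le> t powr p x" using sp by (intro powr_mono) auto
            then show ?thesis by simp
          qed
          also have "t powr p x \<le> h x t"
            using regular_bounds(3)[OF elim] ln_exp1_plus_ge_1[of t] by (simp add: log_phase_def t_def)
          finally show ?thesis using True by (simp add: t_def ennreal_leI)
        qed simp
      qed
    qed
    also note S1
    finally have "(\<integral>\<^sup>+x. ennreal (norm (grad \<phi> x) powr s) * indicator (cball z (2 * \<delta>)) x \<partial>lborel) \<le>
        ennreal S" .
    from K0(2)[OF test_C_k[OF \<phi>] P this]
    have K1: "(\<integral>\<^sup>+x. ennreal (\<bar>\<phi> x\<bar> powr r) * indicator (ball z \<delta>) x \<partial>lborel) \<le> ennreal K0" .
    have "(\<integral>\<^sup>+x. ennreal (h x (norm (\<phi> x))) * indicator (ball z \<delta>) x \<partial>M) \<le>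
        (\<integral>\<^sup>+x. ennreal A * (1 + ennreal (\<bar>\<phi> x\<bar> powr r) * indicator (ball z \<delta>) x) \<partial>M)"
    proof (rule nn_integral_mono_AE)
      show "AE x in M. ennreal (h x (norm (\<phi> x))) * indicator (ball z \<delta>) x \<le> ennreal A * (1 +
          ennreal (\<bar>\<phi> x\<bar> powr r) * indicator (ball z \<delta>) x)"
        using AE_regular C(1)
      proof eventually_elim
        case (elim x)
        show ?case
        proof (cases "x \<in> ball z \<delta>")
          case True
          then have "x \<in> cball z (2 * \<delta>)" using \<delta> by simp
          moreover have "x \<in> closure \<Omega>" using elim(1) closure_subset by (auto simp: regular_def)
          ultimately have qe: "q x + e \<le> r" using loc by blast
          have "h x (norm (\<phi> x)) \<le> A * (1 + norm (\<phi> x) powr r)"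
            unfolding A_def using regular_bounds[OF elim(1)] elim qe e
                by (intro log_phase_le_power) (auto simp: regular_def)
          then have "ennreal (h x (norm (\<phi> x))) \<le> ennreal (A * (1 + norm (\<phi> x) powr r))"
              by (rule ennreal_leI)
          also have "\<dots> = ennreal A * (1 + ennreal (\<bar>\<phi> x\<bar> powr r))" using A
              by (simp add: ennreal_mult ennreal_plus)
          finally show ?thesis using True by simp
        qed simp
      qed
    qed
    also have "\<dots> = ennreal A * (emeasure M (space M) + (\<integral>\<^sup>+x. ennreal (\<bar>\<phi> x\<bar> powr r) * indicator (ball z
        \<delta>) x \<partial>M))"
    proof -
      note [measurable] = lebesgue_on_borel_measurable[OF \<phi>m, of \<Omega>]
      have bm[measurable]: "(\<lambda>x. ennreal (\<bar>\<phi> x\<bar> powr r) * indicator (ball z \<delta>) x) \<in> borel_measurable M"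
        using \<phi>m by (intro lebesgue_on_borel_measurable) measurable
      show ?thesis by (subst nn_integral_cmult, measurable, subst nn_integral_add, measurable)
    qed
    also have "(\<integral>\<^sup>+x. ennreal (\<bar>\<phi> x\<bar> powr r) * indicator (ball z \<delta>) x \<partial>M) = (\<integral>\<^sup>+x.
        ennreal (\<bar>\<phi> x\<bar> powr r) * indicator (ball z \<delta>) x \<partial>lborel)"
      using z0 by (intro nn_integral_lebesgue_on_eq_lborel \<Omega>_sets) auto
    also have "ennreal A * (emeasure M (space M) + \<dots>) \<le> ennreal A * (emeasure M (space M) + ennreal K0)"
      using K1 by (intro mult_left_mono add_mono) auto
    also have "\<dots> = ennreal K" using A K0
        by (simp add: K_def emeasure_eq_measure ennreal_mult ennreal_plus)
    finally show ?thesis .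
  qed
  moreover have "0 \<le> K" using A K0 by (simp add: K_def)
  ultimately show ?thesis using \<delta> by blast
qed

lemma test_modular_poincare:
  assumes sub: "\<And>x. x \<in> closure \<Omega> \<Longrightarrow> ereal (q x) < critical_exponent p x"
    and C: "AE x in M. \<mu> x \<le> C" "0 \<le> C" and B: "0 \<le> B"
  shows "\<exists>K\<ge>0. \<forall>\<phi>\<in>test_functions \<Omega>. \<rho> (grad \<phi>) \<le> B \<longrightarrow> \<rho> \<phi> \<le> K"
proof -
  define P where "P z \<delta> K \<longleftrightarrow> 0 < \<delta> \<and> 0 \<le> K \<and> (\<forall>\<phi>\<in>test_functions \<Omega>. \<rho> (grad \<phi>) \<le> B \<longrightarrow>
      (\<integral>\<^sup>+x. ennreal (h x (norm (\<phi> x))) * indicator (ball z \<delta>) x \<partial>M) \<le> ennreal K)" for z \<delta> K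
  have "\<exists>\<delta> K. P z \<delta> K" if "z \<in> closure \<Omega>" for z
    unfolding P_def using local_modular_bound[OF that sub[OF that] C B] by blast
  then obtain \<delta> K where P: "\<And>z. z \<in> closure \<Omega> \<Longrightarrow> P z (\<delta> z) (K z)" by metis
  have \<delta>: "\<And>z. z \<in> closure \<Omega> \<Longrightarrow> 0 < \<delta> z" and K: "\<And>z. z \<in> closure \<Omega> \<Longrightarrow> 0 \<le> K z"
    and loc: "\<And>z \<phi>. z \<in> closure \<Omega> \<Longrightarrow> \<phi> \<in> test_functions \<Omega> \<Longrightarrow> \<rho> (grad \<phi>) \<le> B \<Longrightarrow>
      (\<integral>\<^sup>+x. ennreal (h x (norm (\<phi> x))) * indicator (ball z (\<delta> z)) x \<partial>M) \<le> ennreal (K z)"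
    using P unfolding P_def by blast+
  have "closure \<Omega> \<subseteq> (\<Union>z\<in>closure \<Omega>. ball z (\<delta> z))" using \<delta> by force
  then obtain F where F: "F \<subseteq> closure \<Omega>" "finite F" "closure \<Omega> \<subseteq> (\<Union>z\<in>F. ball z (\<delta> z))"
    using compactE_image[OF compact_closure_\<Omega>, of "closure \<Omega>" "\<lambda>z. ball z (\<delta> z)"] by blast
  have "\<rho> \<phi> \<le> (\<Sum>z\<in>F. K z)" if \<phi>: "\<phi> \<in> test_functions \<Omega>" and \<rho>B: "\<rho> (grad \<phi>) \<le> B" for \<phi>
  proof -
    have fin: "fin_modular \<phi>" by (rule test_gradient_modular(3)[OF \<phi>])
    have hm: "(\<lambda>x. ennreal (h x (norm (\<phi> x)))) \<in> borel_measurable M"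
      using h_norm_measurable[OF fin_modular_measurable[OF fin]] by measurable
    have "ennreal (\<rho> \<phi>) = (\<integral>\<^sup>+x. ennreal (h x (norm (\<phi> x))) \<partial>M)"
      using modular_eq_\<rho>[OF fin] by (simp add: modular_Hlog_def Hlog_eq_log_phase)
    also have "\<dots> \<le> (\<integral>\<^sup>+x. (\<Sum>z\<in>F. ennreal (h x (norm (\<phi> x))) * indicator (ball z (\<delta> z)) x) \<partial>M)"
    proof (rule nn_integral_mono_AE)
      show "AE x in M. ennreal (h x (norm (\<phi> x))) \<le> (\<Sum>z\<in>F. ennreal (h x (norm (\<phi> x))) * indicator
          (ball z (\<delta> z)) x)"
        using AE_regular
      proof eventually_elim
        case (elim x)
        then have "x \<in> closure \<Omega>" using closure_subset by (auto simp: regular_def)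
        then obtain z where z: "z \<in> F" "x \<in> ball z (\<delta> z)" using F(3) by blast
        have "ennreal (h x (norm (\<phi> x))) = ennreal (h x (norm (\<phi> x))) * indicator (ball z (\<delta> z)) x"
            using z by simp
        also have "\<dots> \<le> (\<Sum>z\<in>F. ennreal (h x (norm (\<phi> x))) * indicator (ball z (\<delta> z)) x)"
          by (rule member_le_sum[OF z(1) _ F(2)]) simp
        finally show ?case .
      qed
    qed
    also have "\<dots> = (\<Sum>z\<in>F. \<integral>\<^sup>+x. ennreal (h x (norm (\<phi> x))) * indicator (ball z (\<delta> z)) x \<partial>M)"
    proof (rule nn_integral_sum)
      fix z
      have "indicator (ball z (\<delta> z)) \<in> borel_measurable M" by (rule lebesgue_on_borel_measurable) simp
      then show "(\<lambda>x. ennreal (h x (norm (\<phi> x))) * indicator (ball z (\<delta> z)) x) \<in> borel_measurable M"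
        using hm by (intro borel_measurable_times_ennreal)
    qed
    also have "\<dots> \<le> (\<Sum>z\<in>F. ennreal (K z))" using F(1) by (intro sum_mono loc \<phi> \<rho>B) auto
    also have "\<dots> = ennreal (\<Sum>z\<in>F. K z)" using F(1) K by (intro sum_ennreal) auto
    finally show ?thesis using F(1) K by (subst (asm) ennreal_le_iff) (auto intro: sum_nonneg)
  qed
  then show ?thesis using F(1) K by (intro exI[of _ "\<Sum>z\<in>F. K z"]) (auto intro: sum_nonneg)
qed

text \<open>Passes from test functions to \<open>u\<close> by a single test function at distance less than 1, up to
  the constant of the quasi-triangle inequality for the modular.\<close>

lemma W10_modular_poincare:
  assumes sub: "\<And>x. x \<in> closure \<Omega> \<Longrightarrow> ereal (q x) < critical_exponent p x"
    and C: "AE x in M. \<mu> x \<le> C" "0 \<le> C"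
  shows "\<exists>K. \<forall>u\<in>W10. \<rho> (D u) \<le> 1 \<longrightarrow> sob_modular u \<le> K"
proof -
  \<comment> \<open>The modular of the gradient of a test function at distance less than 1 is at most \<open>B\<close>.\<close>
  define B where "B = 2 ^ Suc q_bound * (2::real)"
  obtain K where K: "0 \<le> K" "\<And>\<phi>. \<phi> \<in> test_functions \<Omega> \<Longrightarrow> \<rho> (grad \<phi>) \<le> B \<Longrightarrow> \<rho> \<phi> \<le> K"
    using test_modular_poincare[OF sub C, of B] by (auto simp: B_def)
  have "sob_modular u \<le> 2 ^ Suc q_bound * (1 + K) + 1" if u: "u \<in> W10" and Du: "\<rho> (D u) \<le> 1" for u
  proof -
    have u1: "u \<in> W1" by (rule W10_subset[OF u])
    obtain \<phi> where \<phi>: "\<phi> \<in> test_functions \<Omega>" "sob_norm (u - abs_L0 \<phi>) < 1" using W10_approx[OF u, of 1]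
        by auto
    note t = test_in_W1(1)[OF \<phi>(1)] and g = test_gradient_modular[OF \<phi>(1)]
    define v where "v = u - abs_L0 \<phi>"
    have v: "v \<in> W1" unfolding v_def by (rule W1_diff(1)[OF u1 t])
    have "sob_modular v \<le> 1" using W1.R_le_of_N_small[OF v, of 1] \<phi>(2) by (simp add: v_def)
    then have v1: "\<rho> (D v) \<le> 1" "\<rho> (rep_L0 v) \<le> 1" using \<rho>_nonneg[of "D v"] \<rho>_nonneg[of "rep_L0 v"]
        by (auto simp: sob_modular_def)
    have eq1: "abs_L0 \<phi> = 1 *\<^sub>R u + (-1) *\<^sub>R v" and eq2: "u = 1 *\<^sub>R v + 1 *\<^sub>R abs_L0 \<phi>"
        by (simp_all add: v_def)
    have neg: "\<rho> (\<lambda>x. (-1) *\<^sub>R D v x) = \<rho> (D v)" by (simp add: \<rho>_def)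
    have "\<rho> (grad \<phi>) = \<rho> (\<lambda>x. D u x + (-1) *\<^sub>R D v x)"
      unfolding g(2) by (subst eq1, subst \<rho>_lincomb(1)[OF u1 v]) simp
    also have "\<dots> \<le> 2 ^ Suc q_bound * (\<rho> (D u) + \<rho> (\<lambda>x. (-1) *\<^sub>R D v x))"
      by (rule modular_add(2)[OF W1_fin_grad[OF u1] modular_scale(1)[OF W1_fin_grad[OF v]]])
    also have "\<dots> \<le> 2 ^ Suc q_bound * 2" using Du v1 unfolding neg by (intro mult_left_mono) auto
    finally have "\<rho> (grad \<phi>) \<le> B" by (simp only: B_def)
    then have K1: "\<rho> (rep_L0 (abs_L0 \<phi>)) \<le> K" using K(2)[OF \<phi>(1)] g(4) by simp
    have "\<rho> (rep_L0 u) = \<rho> (\<lambda>x. rep_L0 v x + rep_L0 (abs_L0 \<phi>) x)"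
      by (subst eq2, subst \<rho>_lincomb(2)[OF v t]) simp
    also have "\<dots> \<le> 2 ^ Suc q_bound * (\<rho> (rep_L0 v) + \<rho> (rep_L0 (abs_L0 \<phi>)))"
      by (rule modular_add(2)[OF W1_fin_rep[OF v] W1_fin_rep[OF t]])
    also have "\<dots> \<le> 2 ^ Suc q_bound * (1 + K)" using K1 v1 by (intro mult_left_mono add_mono) auto
    finally show ?thesis using Du by (simp only: sob_modular_def)
  qed
  then show ?thesis by blast
qed

end

section \<open>The logarithmic double phase operator\<close>

context log_double_phase
begin

abbreviation "A \<equiv> log_double_phase_op \<Omega> p q \<mu>"

lemma integrands_eq_flux: "p_integrand \<Omega> p u v x + q_integrand \<Omega> q \<mu> u v x = flux (f x) (D u x) \<bullet> D v x"
proof (cases "D u x = 0")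
  case True then show ?thesis by (simp add: p_integrand_def q_integrand_def flux_def)
next
  case False
  define t where "t = norm (D u x)"
  have t: "0 < t" using False by (simp add: t_def)
  have "f x t / t = t powr (p x - 2) + \<mu> x * log_bracket (q x) t * t powr (q x - 2)"
  proof -
    have "t powr (p x - 1) / t = t powr (p x - 2)" "t powr (q x - 1) / t = t powr (q x - 2)"
      using t by (simp_all add: powr_diff power2_eq_square)
    then show ?thesis by (simp only: log_flux_def add_divide_distrib times_divide_eq_right[symmetric])
  qed
  then show ?thesis unfolding p_integrand_def q_integrand_def flux_def Let_def t_def[symmetric]
    by (simp add: log_bracket_def distrib_right)
qed

text \<open>The two parts of the operator are separately dominated by \<open>f(|\<nabla>u|) |\<nabla>v|\<close>.\<close>

lemma integrands_integrable:
  assumes u: "u \<in> W1" and v: "v \<in> W1"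
  shows "integrable M (p_integrand \<Omega> p u v)" "integrable M (q_integrand \<Omega> q \<mu> u v)"
proof -
  note [measurable] = D_measurable[OF u] D_measurable[OF v]
  have i: "integrable M (\<lambda>x. 2 * (h x (norm (D u x)) + h x (norm (D v x))))"
    using fin_modular_integrable[OF W1_fin_grad[OF u]] fin_modular_integrable[OF W1_fin_grad[OF v]]
        by auto
  have le: "AE x in M. \<bar>p_integrand \<Omega> p u v x\<bar> \<le> 2 * (h x (norm (D u x)) + h x (norm (D v x))) \<and>
      \<bar>q_integrand \<Omega> q \<mu> u v x\<bar> \<le> 2 * (h x (norm (D u x)) + h x (norm (D v x)))"
    using AE_regular
  proof eventually_elim
    case (elim x)
    define t where "t = norm (D u x)"
    have t: "0 \<le> t" by (simp add: t_def)
    have lb: "0 \<le> log_bracket (q x) t" using log_bracket_ge_1[of "q x" t] regular_bounds[OF elim] t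
        by simp
    have tp: "t powr (a - 2) * t = t powr (a - 1)" for a
      using t by (cases "t = 0") (simp_all add: powr_diff power2_eq_square)
    have in_le: "\<bar>(t powr (a - 2) *\<^sub>R D u x) \<bullet> D v x\<bar> \<le> t powr (a - 1) * norm (D v x)" for a
    proof -
      have "\<bar>(t powr (a - 2) *\<^sub>R D u x) \<bullet> D v x\<bar> \<le> norm (t powr (a - 2) *\<^sub>R D u x) * norm (D v x)"
          by (rule Cauchy_Schwarz_ineq2)
      also have "norm (t powr (a - 2) *\<^sub>R D u x) = t powr (a - 1)" using tp[of a] by (simp add: t_def)
      finally show ?thesis .
    qed
    have fm: "f x t * norm (D v x) \<le> 2 * (h x t + h x (norm (D v x)))"
        by (rule f_mult_le[OF elim t]) simp
    have split: "f x t * norm (D v x) = t powr (p x - 1) * norm (D v x) +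
        \<mu> x * log_bracket (q x) t * (t powr (q x - 1) * norm (D v x))"
      by (simp add: log_flux_def distrib_right mult.assoc)
    have nn: "0 \<le> t powr (p x - 1) * norm (D v x)" "0 \<le> \<mu> x * log_bracket (q x) t * (t powr (q x - 1) *
        norm (D v x))"
      using lb regular_bounds[OF elim] by auto
    have "\<bar>p_integrand \<Omega> p u v x\<bar> \<le> t powr (p x - 1) * norm (D v x)"
      using in_le[of "p x"] by (simp add: p_integrand_def Let_def t_def)
    moreover have "\<bar>q_integrand \<Omega> q \<mu> u v x\<bar> = \<mu> x * log_bracket (q x) t * \<bar>(t powr (q x - 2) *\<^sub>R D u x)
        \<bullet> D v x\<bar>"
      using lb regular_bounds(3)[OF elim]
          unfolding q_integrand_def Let_def t_def[symmetric] log_bracket_def[symmetric]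
      by (simp only: abs_mult abs_of_nonneg)
    moreover have "\<dots> \<le> \<mu> x * log_bracket (q x) t * (t powr (q x - 1) * norm (D v x))"
      using in_le[of "q x"] lb regular_bounds(3)[OF elim] by (intro mult_left_mono) auto
    ultimately show ?case using fm nn unfolding split t_def[symmetric] by linarith
  qed
  have pm: "p_integrand \<Omega> p u v \<in> borel_measurable M" unfolding p_integrand_def[abs_def] Let_def
      by measurable
  have qm: "q_integrand \<Omega> q \<mu> u v \<in> borel_measurable M" unfolding q_integrand_def[abs_def] Let_def
      by measurable
  show "integrable M (p_integrand \<Omega> p u v)"
    by (rule Bochner_Integration.integrable_bound[OF i pm]) (use le in \<open>auto elim: eventually_mono\<close>)
  show "integrable M (q_integrand \<Omega> q \<mu> u v)"
    by (rule Bochner_Integration.integrable_bound[OF i qm]) (use le in \<open>auto elim: eventually_mono\<close>)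
qed

lemma A_eq_duality:
  assumes u: "u \<in> W10" and v: "v \<in> W10"
  shows "A u v = duality (D u) (D v)"
proof -
  have "A u v = (LINT x|M. p_integrand \<Omega> p u v x) + (LINT x|M. q_integrand \<Omega> q \<mu> u v x)"
    using v by (simp add: log_double_phase_op_def)
  also have "\<dots> = (LINT x|M. p_integrand \<Omega> p u v x + q_integrand \<Omega> q \<mu> u v x)"
    by (rule Bochner_Integration.integral_add[OF integrands_integrable[OF W10_subset[OF u] W10_subset[OF
        v]], symmetric])
  finally show ?thesis by (simp add: integrands_eq_flux duality_def)
qed

lemma duality_cong_AE:
  assumes "AE x in M. V x = W x" "F \<in> borel_measurable M" "V \<in> borel_measurable M" "W \<in> borel_measurable
      M"
  shows "duality F V = duality F W"
  unfolding duality_def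
proof (rule integral_cong_AE)
  show "AE x in M. flux (f x) (F x) \<bullet> V x = flux (f x) (F x) \<bullet> W x" using assms(1)
      by eventually_elim simp
qed (intro borel_measurable_inner flux_measurable assms)+

lemma duality_D_diff:
  assumes "fin_modular F" "u \<in> W1" "v \<in> W1"
  shows "duality F (D (u - v)) = duality F (\<lambda>x. D u x - D v x)"
  by (rule duality_cong_AE[OF W1_diff(2)[OF assms(2,3)] fin_modular_measurable[OF assms(1)]
      D_measurable[OF W1_diff(1)[OF assms(2,3)]]
        fin_modular_measurable[OF modular_diff[OF W1_fin_grad[OF assms(2)] W1_fin_grad[OF assms(3)]]]])

text \<open>Each assumption of the abstract locale is the corresponding fact on vector fields; gradients
  of linear combinations agree with linear combinations of gradients almost everywhere.\<close>

lemma modular_operator_A: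
  "modular_operator W10 sob_modular sob_norm (Suc q_bound) (\<lambda>u. \<rho> (D u)) (\<lambda>u. energy (D u)) A p_min 2"
proof -
  interpret W10: luxemburg_norm W10 sob_modular sob_norm "Suc q_bound" by (rule luxemburg_W10)
  note G = W1_fin_grad[OF W10_subset]
  note Ad = A_eq_duality
  show ?thesis
  proof
    fix u assume u: "u \<in> W10"
    note u1 = W10_subset[OF u]
    show "0 \<le> \<rho> (D u)" by (rule \<rho>_nonneg)
    show "\<rho> (D u) \<le> sob_modular u" by (simp add: sob_modular_def \<rho>_nonneg)
    show "u = 0" if "\<rho> (D u) = 0" by (rule W10_zero_of_grad_zero[OF u that])
    show "c powr p_min * \<rho> (D u) \<le> \<rho> (D (c *\<^sub>R u))" if "1 \<le> c" for c
      unfolding \<rho>_D_scale[OF u1] by (rule modular_scale(3)[OF G[OF u] that])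
    show "\<rho> (D (c *\<^sub>R u)) \<le> c ^ Suc q_bound * \<rho> (D u)" if "1 \<le> c" for c
      unfolding \<rho>_D_scale[OF u1] by (rule modular_scale(2)[OF G[OF u] that])
    show "\<rho> (D u) \<le> A u u" unfolding Ad[OF u u] by (rule modular_le_duality[OF G[OF u]])
    fix v assume v: "v \<in> W10"
    note v1 = W10_subset[OF v]
    have uv: "u - v \<in> W10" by (rule W10.X_diff[OF u v])
    show "\<bar>A u v\<bar> \<le> 2 * (\<rho> (D u) + \<rho> (D v))" unfolding Ad[OF u v]
        by (rule duality_integrable(2)[OF G[OF u] G[OF v]])
    show "A u (c *\<^sub>R v) = c * A u v" for c
    proof -
      have "duality (D u) (D (c *\<^sub>R v)) = duality (D u) (\<lambda>x. c *\<^sub>R D v x)"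
        by (rule duality_cong_AE[OF W1_scale(2)[OF v1] D_measurable[OF u1] D_measurable[OF
            W1_scale(1)[OF v1]]
              fin_modular_measurable[OF modular_scale(1)[OF G[OF v]]]])
      then show ?thesis unfolding Ad[OF u v] Ad[OF u W10.X_scale[OF v]]
          using duality_linear(2)[OF G[OF u] G[OF v] G[OF v]] by simp
    qed
    show "A u (v + w) = A u v + A u w" if w: "w \<in> W10" for w
    proof -
      note w1 = W10_subset[OF w]
      have "duality (D u) (D (v + w)) = duality (D u) (\<lambda>x. D v x + D w x)"
        by (rule duality_cong_AE[OF W1_add(2)[OF v1 w1] D_measurable[OF u1] D_measurable[OF W1_add(1)[OF
            v1 w1]]
              fin_modular_measurable[OF modular_add(1)[OF G[OF v] G[OF w]]]])
      then show ?thesis unfolding Ad[OF u v] Ad[OF u w] Ad[OF u W10.X_add[OF v w]]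
          using duality_linear(1)[OF G[OF u] G[OF v] G[OF w]] by simp
    qed
    show "0 \<le> A u (u - v) - A v (u - v)"
      unfolding Ad[OF u uv] Ad[OF v uv] duality_D_diff[OF G[OF u] u1 v1] duality_D_diff[OF G[OF v] u1
          v1]
      by (rule duality_monotone[OF G[OF u] G[OF v]])
    show "energy (D u) + A u (v - u) \<le> energy (D v)"
      unfolding Ad[OF u W10.X_diff[OF v u]] duality_D_diff[OF G[OF u] v1 u1]
          by (rule energy_tangent[OF G[OF u] G[OF v]])
  next
    show "1 < p_min" by (rule p_min_gt_1)
    show "A u v = 0" if "v \<notin> W10" for u v using that by (simp add: log_double_phase_op_def)
  next
    fix \<epsilon> :: real assume \<epsilon>: "0 < \<epsilon>"
    obtain C where C: "0 \<le> C" "\<And>F W V. fin_modular F \<Longrightarrow> fin_modular W \<Longrightarrow> fin_modular V \<Longrightarrow>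
      \<bar>duality F V - duality W V\<bar> \<le> \<epsilon> * (\<rho> F + \<rho> W + \<rho> V) + C * \<rho> (\<lambda>x. F x - W x)"
          using duality_modulus[OF \<epsilon>] by blast
    have "\<bar>A u v - A w v\<bar> \<le> \<epsilon> * (\<rho> (D u) + \<rho> (D w) + \<rho> (D v)) + C * \<rho> (D (u - w))"
      if u: "u \<in> W10" and w: "w \<in> W10" and v: "v \<in> W10" for u w v
      unfolding Ad[OF u v] Ad[OF w v] \<rho>_D_diff[OF W10_subset[OF u] W10_subset[OF w]]
          by (rule C(2)[OF G[OF u] G[OF w] G[OF v]])
    then show "\<exists>C\<ge>0. \<forall>u\<in>W10. \<forall>w\<in>W10. \<forall>v\<in>W10. \<bar>A u v - A w v\<bar> \<le> \<epsilon> * (\<rho> (D u) + \<rho> (D w) + \<rho> (D v)) +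
        C * \<rho> (D (u - w))"
      using C(1) by blast
    obtain C where C: "0 \<le> C" "\<And>F W. fin_modular F \<Longrightarrow> fin_modular W \<Longrightarrow>
      \<rho> (\<lambda>x. F x - W x) \<le> \<epsilon> * \<rho> W + C * (duality F (\<lambda>x. F x - W x) - duality W (\<lambda>x. F x - W x))"
      using duality_monotone_modulus[OF \<epsilon>] by blast
    have "\<rho> (D (u - w)) \<le> \<epsilon> * \<rho> (D w) + C * (A u (u - w) - A w (u - w))" if u: "u \<in> W10"
        and w: "w \<in> W10" for u w
      unfolding Ad[OF u W10.X_diff[OF u w]] Ad[OF w W10.X_diff[OF u w]] \<rho>_D_diff[OF W10_subset[OF u]
          W10_subset[OF w]]
        duality_D_diff[OF G[OF u] W10_subset[OF u] W10_subset[OF w]] duality_D_diff[OF G[OF w]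
            W10_subset[OF u] W10_subset[OF w]]
      by (rule C(2)[OF G[OF u] G[OF w]])
    then show "\<exists>C\<ge>0. \<forall>u\<in>W10. \<forall>w\<in>W10. \<rho> (D (u - w)) \<le> \<epsilon> * \<rho> (D w) + C * (A u (u - w) - A w (u - w))"
      using C(1) by blast
  qed simp
qed

lemma coercive_modular_operator_A:
  assumes sub: "\<forall>x\<in>closure \<Omega>. ereal (q x) < critical_exponent p x" and C: "\<exists>C. AE x in M. \<bar>\<mu> x\<bar> \<le> C"
  shows "\<exists>K. coercive_modular_operator W10 sob_modular sob_norm (Suc q_bound) (\<lambda>u. \<rho> (D u)) (\<lambda>u.
      energy (D u)) A p_min 2 K"
proof -
  obtain C where "AE x in M. \<bar>\<mu> x\<bar> \<le> C" using C by blast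
  then have "AE x in M. \<mu> x \<le> \<bar>C\<bar>" by eventually_elim linarith
  then obtain K where K: "\<forall>u\<in>W10. \<rho> (D u) \<le> 1 \<longrightarrow> sob_modular u \<le> K"
      using W10_modular_poincare[of "\<bar>C\<bar>"] sub by auto
  interpret modular_operator W10 sob_modular sob_norm "Suc q_bound" "\<lambda>u. \<rho> (D u)" "\<lambda>u.
      energy (D u)" A p_min 2
    by (rule modular_operator_A)
  have "coercive_modular_operator W10 sob_modular sob_norm (Suc q_bound) (\<lambda>u. \<rho> (D u)) (\<lambda>u.
      energy (D u)) A p_min 2 K"
    by unfold_locales (use K W10_complete in blast)+
  then show ?thesis by blast
qed

end

theorem theorem4p4:
  fixes \<Omega> :: "'a::euclidean_space set"
    and p q \<mu> :: "'a \<Rightarrow> real"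
  defines "X \<equiv> W10_Hlog \<Omega> p q \<mu>"
    and "N \<equiv> norm_W1_Hlog \<Omega> p q \<mu>"
    and "A \<equiv> log_double_phase_op \<Omega> p q \<mu>"
  assumes dim: "2 \<le> DIM('a)"
    and domain: "open \<Omega>" "connected \<Omega>" "\<Omega> \<noteq> {}" "bounded \<Omega>" "lipschitz_boundary \<Omega>"
    and exponents: "p \<in> C_plus \<Omega>" "q \<in> C_plus \<Omega>" "\<forall>x\<in>closure \<Omega>. p x \<le> q x"
    and weight: "integrable (lebesgue_on \<Omega>) \<mu>" "AE x in lebesgue_on \<Omega>. 0 \<le> \<mu> x"
  shows "(\<forall>u\<in>X. \<forall>v\<in>X. integrable (lebesgue_on \<Omega>) (p_integrand \<Omega> p u v) \<and>
                       integrable (lebesgue_on \<Omega>) (q_integrand \<Omega> q \<mu> u v)) \<and>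
         A ` X \<subseteq> dual_space X N \<and>
         bounded_operator X N A \<and>
         continuous_map (norm_topology X N) (dual_topology X N) A \<and>
         strictly_monotone_operator X A \<and>
         ((\<forall>x\<in>closure \<Omega>. ereal (q x) < critical_exponent p x) \<and>
          (\<exists>C. AE x in lebesgue_on \<Omega>. \<bar>\<mu> x\<bar> \<le> C) \<longrightarrow>
            S_plus_operator X N A \<and>
            coercive_operator X N A \<and>
            homeomorphic_map (norm_topology X N) (dual_topology X N) A)"
proof -
  interpret L: log_double_phase \<Omega> p q \<mu>
    by standard (use domain exponents weight in auto)
  interpret O: modular_operator "W10_Hlog \<Omega> p q \<mu>" L.sob_modular "norm_W1_Hlog \<Omega> p q \<mu>" "Suc L.q_bound"
    "\<lambda>u. L.\<rho> (weak_gradient \<Omega> u)" "\<lambda>u. L.energy (weak_gradient \<Omega> u)" "log_double_phase_op \<Omega> p q \<mu>"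
        L.p_min 2
    by (rule L.modular_operator_A)
  have integrable: "\<forall>u\<in>X. \<forall>v\<in>X. integrable (lebesgue_on \<Omega>) (p_integrand \<Omega> p u v) \<and>
      integrable (lebesgue_on \<Omega>) (q_integrand \<Omega> q \<mu> u v)"
    using L.integrands_integrable L.W10_subset by (simp add: X_def)
  have basic: "A ` X \<subseteq> dual_space X N" "bounded_operator X N A"
    "continuous_map (norm_topology X N) (dual_topology X N) A" "strictly_monotone_operator X A"
    unfolding X_def N_def A_def using O.A_in_dual O.A_bounded O.A_continuous O.A_strictly_monotone
        by auto
  have "S_plus_operator X N A \<and> coercive_operator X N A \<and> homeomorphic_map (norm_topology X N)
      (dual_topology X N) A"
    if sub: "\<forall>x\<in>closure \<Omega>. ereal (q x) < critical_exponent p x" and C: "\<exists>C. AE x in lebesgue_on \<Omega>.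
        \<bar>\<mu> x\<bar> \<le> C"
  proof -
    obtain K where "coercive_modular_operator (W10_Hlog \<Omega> p q \<mu>) L.sob_modular (norm_W1_Hlog \<Omega> p q \<mu>)
        (Suc L.q_bound)
      (\<lambda>u. L.\<rho> (weak_gradient \<Omega> u)) (\<lambda>u. L.energy (weak_gradient \<Omega> u)) (log_double_phase_op \<Omega> p q \<mu>)
          L.p_min 2 K"
      using L.coercive_modular_operator_A[OF sub C] by blast
    then interpret P: coercive_modular_operator "W10_Hlog \<Omega> p q \<mu>" L.sob_modular "norm_W1_Hlog \<Omega> p q \<mu>"
        "Suc L.q_bound"
      "\<lambda>u. L.\<rho> (weak_gradient \<Omega> u)" "\<lambda>u. L.energy (weak_gradient \<Omega> u)" "log_double_phase_op \<Omega> p q \<mu>"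
          L.p_min 2 K .
    show ?thesis unfolding X_def N_def A_def using P.A_S_plus P.A_coercive P.A_homeomorphic by blast
  qed
  then show ?thesis using integrable basic by blast
qed

end
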